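(* Let $B=\bigoplus_{i\ge0}B_{(i)}$ be a graded bialgebra over a field $\mathbb{K}$. Then: (1) There is a bijection between $iso\,\mathcal{E}^1(B)$ and $\hat h^2_b(B)_{(-1)}$. (2) If $\hat h^2_b(B)_{(-l)}=0$ for each $l\ge 1$, then the graded bialgebra $B$ is graded-rigid. (3) The obstruction to extend an element of $\mathcal{E}^l(B)$ to $\mathcal{E}^{l+1}(B)$ lies in $\hat h^3_b(B)_{(-l-1)}$, $l\ge 1$. In particular, if $\hat h^3_b(B)_{(-l-1)}=0$, one can extend any element of $\mathcal{E}^l(B)$ to $\mathcal{E}^{l+1}(B)$.
   Context: $B=\bigoplus_{i\ge0}B_{(i)}$ is a graded bialgebra over $\mathbb{K}$ with identity $1_B$, multiplication $m$, counit $\varepsilon$, comultiplication $\Delta$ (all homogeneous of degree $0$). Tensor products are over $\mathbb{K}$ unless indicated. Sweedler notation: $\Delta(a)=a_{(1)}\otimes a_{(2)}$, with iterates $a_{(1)}\otimes\cdots\otimes a_{(p)}$. A map $f:V\to W$ of graded spaces is homogeneous of degree $d$ if $f(V_{(n)})\subseteq W_{(n+d)}$ for all $n$. Deformations. Let $l\in\mathbb{N}\cup\{+\infty\}$; for $l=+\infty$, $B[t]/(t^{l+1})$ means $B[t]$ and $\mathbb{K}[t]/(t^{l+1})$ means $\mathbb{K}[t]$. View $B[t]/(t^{l+1})$ as a free $\mathbb{K}[t]/(t^{l+1})$-module and a graded $\mathbb{K}$-space with $\deg t=1$, $\deg b=n$ for $b\in B_{(n)}$. An $l$-deformation (an $l$-th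 level graded bialgebra deformation) of $B$ consists of $\mathbb{K}[t]/(t^{l+1})$-linear maps, homogeneous of degree zero, $m_t^l:(B\otimes B)[t]/(t^{l+1})\to B[t]/(t^{l+1})$ and $\Delta_t^l:B[t]/(t^{l+1})\to(B\otimes B)[t]/(t^{l+1})\cong B[t]/(t^{l+1})\otimes_{\mathbb{K}[t]/(t^{l+1})}B[t]/(t^{l+1})$ such that (i) $B[t]/(t^{l+1})$ is a bialgebra over $\mathbb{K}[t]/(t^{l+1})$ with identity $1_B$, multiplication $m_t^l$, counit $\varepsilon_t^l$ given by $\varepsilon_t^l(bt^j)=\varepsilon(b)t^j$, and comultiplication $\Delta_t^l$; (ii) $m_t^l\equiv m\otimes\mathrm{Id}$ and $\Delta_t^l\equiv\Delta\otimes\mathrm{Id}$ mod $(t)$. $\mathcal{E}^l(B)$ is the set of $l$-deformations of $B$. Two $l$-deformations are isomorphic if there is an isomorphism $\phi$ of $\mathbb{K}[t]/(t^{l+1})$-bialgebras between them, homogeneous of degree zero, with $\phi\equiv\mathrm{Id}_B\otimes\mathrm{Id}$ mod $(t)$; $iso\,\mathcal{E}^l(B)$ is the set of isomorphism classes. $B$ is graded-rigid if $iso\,\mathcal{E}^{+\infty}(B)$ has only one element, i.e. any $(+\infty)$-deformation of $B$ is isomorphic to the trivial one. For an $l$-deformation write $m_t^l(a\otimes b)=\sum_{0\le s\le l}m_s(a\otimes b)t^s$, $\Delta_t^l(c)=\sum_{0\le s\le l}\Delta_s(c)t^s$ for $a,b,c\in B$, with $m_s:B\otimes B\to B$ and $\Delta_s:B\to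 B\otimes B$ homogeneous of degree $-s$, $m_0=m$, $\Delta_0=\Delta$. Extending an element of $\mathcal{E}^l(B)$ ($l\in\mathbb{N}$) to $\mathcal{E}^{l+1}(B)$ means finding an $(l+1)$-deformation with the same $m_s,\Delta_s$ for $0\le s\le l$. Cohomology. For $p,q\ge1$ let $C^{p,q}=\mathrm{Hom}_{\mathbb{K}}(B^{\otimes q},B^{\otimes p})$ and, for $f\in C^{p,q}$, $$\delta_h^{p,q}(f)=\lambda^p\circ(\mathrm{Id}\otimes f)+\sum_{i=1}^q(-1)^if\circ\mu_i^q+(-1)^{q+1}\rho^p\circ(f\otimes\mathrm{Id})\in C^{p,q+1},$$ $$\delta_c^{p,q}(f)=(\mathrm{Id}\otimes f)\circ\sigma^q+\sum_{j=1}^p(-1)^j\Delta_j^p\circ f+(-1)^{p+1}(f\otimes\mathrm{Id})\circ\tau^q\in C^{p+1,q},$$ where $\lambda^p(b^1\otimes\cdots\otimes b^{p+1})=b^1_{(1)}b^2\otimes\cdots\otimes b^1_{(p)}b^{p+1}$; $\rho^p(b^1\otimes\cdots\otimes b^{p+1})=b^1b^{p+1}_{(1)}\otimes\cdots\otimes b^pb^{p+1}_{(p)}$; $\sigma^q(b^1\otimes\cdots\otimes b^q)=(b^1_{(1)}\cdots b^q_{(1)})\otimes b^1_{(2)}\otimes\cdots\otimes b^q_{(2)}$; $\tau^q(b^1\otimes\cdots\otimes b^q)=b^1_{(1)}\otimes\cdots\otimes b^q_{(1)}\otimes(b^1_{(2)}\cdots b^q_{(2)})$; $\Delta_j^p:B^{\otimes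 p}\to B^{\otimes p+1}$ applies $\Delta$ to the $j$-th factor; $\mu_i^q:B^{\otimes q+1}\to B^{\otimes q}$ multiplies the $i$-th and $(i+1)$-st factors. Let $\mathsf{m}=\mathrm{Ker}\,\varepsilon$ (a graded subspace of $B$), $\mathsf{i}:\mathsf{m}\to B$ the inclusion, and $\pi:B\to\mathsf{m}$, $\pi(b)=b-\varepsilon(b)1_B$. Let $D^{p,q}=\mathrm{Hom}_{\mathbb{K}}(\mathsf{m}^{\otimes q},\mathsf{m}^{\otimes p})$, embedded in $C^{p,q}$ by $f\mapsto\mathsf{i}^{\otimes p}\circ f\circ\pi^{\otimes q}$, and for $d\in\mathbb{Z}$ let $D^{p,q}_{(d)}\subseteq D^{p,q}$ be the subspace of maps homogeneous of degree $d$. The maps $\delta_h^{p,q},\delta_c^{p,q}$ restrict to make $(D^{p,q}_{(d)})_{p,q\ge1}$ a bicomplex (with commuting differentials). Put $\hat D^n_{(d)}=\bigoplus_{p+q=n+1,\,p,q\ge1}D^{p,q}_{(d)}$ for $n\ge1$, and define $\partial^n_{(d)}:\hat D^n_{(d)}\to\hat D^{n+1}_{(d)}$ by $\partial^n_{(d)}|_{D^{p,q}_{(d)}}=\delta_h^{p,q}+(-1)^q\delta_c^{p,q}$ for $p+q=n+1$. The $n$-th cohomology group of the complex $0\to\hat D^1_{(d)}\to\hat D^2_{(d)}\to\hat D^3_{(d)}\to\cdots$ is the $n$-th graded "hat" bialgebra cohomology of degree $d$ of $B$, denoted $\hat h^n_b(B)_{(d)}$. *)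

theory Defs
  imports Complex_Main "HOL-Library.Extended_Nat" "HOL-Library.Function_Algebras"
begin

section \<open>Tensor powers of a vector space\<close>

text \<open>
  The tensor power of a vector space \<open>S\<close> is realised inside the dual of the space of multilinear
  forms: the pure tensor of a list of vectors is evaluation of multilinear forms at that list, and
  the tensor power is the linear span of the pure tensors.  Over a field this is a model of the
  tensor power; its universal property is \<open>tpow_universal\<close> below.  Addition of tensors is the
  pointwise one of \<open>HOL-Library.Function_Algebras\<close>.
\<close>

type_synonym ('b, 'k) tensor = "('b list \<Rightarrow> 'k) \<Rightarrow> 'k"

text \<open>Only the values on lists of length \<open>n\<close> with entries in the subspace \<open>S\<close> matter.\<close>

definition multilinear ::
  "('k::field \<Rightarrow> 'b::ab_group_add \<Rightarrow> 'b) \<Rightarrow> ('k \<Rightarrow> 'w::ab_group_add \<Rightarrow> 'w) \<Rightarrow> 'b set \<Rightarrow> nat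
    \<Rightarrow> ('b list \<Rightarrow> 'w) \<Rightarrow> bool"
  where "multilinear s s' S n F \<longleftrightarrow>
    (\<forall>bs i x y c. length bs = n \<and> set bs \<subseteq> S \<and> i < n \<and> x \<in> S \<and> y \<in> S \<longrightarrow>
       F (bs[i := x + y]) = F (bs[i := x]) + F (bs[i := y]) \<and>
       F (bs[i := s c x]) = s' c (F (bs[i := x])))"

definition tscale :: "'k::field \<Rightarrow> ('b, 'k) tensor \<Rightarrow> ('b, 'k) tensor"
  where "tscale c x = (\<lambda>f. c * x f)"

definition tens :: "('k::field \<Rightarrow> 'b::ab_group_add \<Rightarrow> 'b) \<Rightarrow> 'b list \<Rightarrow> ('b, 'k) tensor"
  where "tens s bs = (\<lambda>f. if multilinear s (*) UNIV (length bs) f then f bs else 0)"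

text \<open>
  For a subspace \<open>S\<close>, the space \<open>tpow s n S\<close> is \<open>S\<^sup>\<otimes>\<^sup>n\<close>, regarded as a subspace of \<open>tpow s n UNIV\<close>
  (which is harmless over a field).
\<close>

definition tpow :: "('k::field \<Rightarrow> 'b::ab_group_add \<Rightarrow> 'b) \<Rightarrow> nat \<Rightarrow> 'b set \<Rightarrow> ('b, 'k) tensor set"
  where "tpow s n S = module.span tscale (tens s ` {bs. length bs = n \<and> set bs \<subseteq> S})"

text \<open>
  If \<open>F\<close> is multilinear on lists of length \<open>n\<close>, then \<open>\<lambda>x. tlift x F\<close> is the linear map on the
  \<open>n\<close>-th tensor power sending \<open>tens s bs\<close> to \<open>F bs\<close>.
\<close>

definition tlift :: "('b, 'k::field) tensor \<Rightarrow> ('b list \<Rightarrow> ('b, 'k) tensor) \<Rightarrow> ('b, 'k) tensor"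
  where "tlift x F = (\<lambda>f. x (\<lambda>bs. F bs f))"

definition tprod :: "('k::field \<Rightarrow> 'b::ab_group_add \<Rightarrow> 'b) \<Rightarrow> ('b, 'k) tensor \<Rightarrow> ('b, 'k) tensor
    \<Rightarrow> ('b, 'k) tensor"
  where "tprod s x y = tlift x (\<lambda>as. tlift y (\<lambda>bs. tens s (as @ bs)))"

text \<open>\<open>tmap s p f g\<close> is \<open>f \<otimes> g\<close>, where \<open>f\<close> is defined on the \<open>p\<close>-th tensor power.\<close>

definition tmap :: "('k::field \<Rightarrow> 'b::ab_group_add \<Rightarrow> 'b) \<Rightarrow> nat
    \<Rightarrow> (('b, 'k) tensor \<Rightarrow> ('b, 'k) tensor) \<Rightarrow> (('b, 'k) tensor \<Rightarrow> ('b, 'k) tensor)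
    \<Rightarrow> ('b, 'k) tensor \<Rightarrow> ('b, 'k) tensor"
  where "tmap s p f g x =
    tlift x (\<lambda>bs. tprod s (f (tens s (take p bs))) (g (tens s (drop p bs))))"

lemma vector_space_tscale: "vector_space (tscale :: 'k::field \<Rightarrow> ('b, 'k) tensor \<Rightarrow> _)"
  by unfold_locales (auto simp: tscale_def algebra_simps fun_eq_iff)

lemma tlift_tens:
  assumes "multilinear s tscale UNIV (length bs) F"
  shows "tlift (tens s bs) F = F bs"
proof
  fix f
  have "multilinear s (*) UNIV (length bs) (\<lambda>cs. F cs f)"
    using assms by (auto simp: multilinear_def tscale_def)
  then show "tlift (tens s bs) F f = F bs f"
    by (simp add: tlift_def tens_def)
qed

lemma tens_multilinear: "multilinear s tscale UNIV n (tens s)"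
  by (auto simp: multilinear_def tens_def tscale_def fun_eq_iff)

lemma functionals_separate:
  fixes s :: "'k::field \<Rightarrow> 'w::ab_group_add \<Rightarrow> 'w"
  assumes "vector_space s" and "\<And>\<phi>. Vector_Spaces.linear s (*) \<phi> \<Longrightarrow> \<phi> w = 0"
  shows "w = 0"
proof (rule ccontr)
  assume "w \<noteq> 0"
  interpret W: vector_space s by fact
  interpret K: vector_space "(*) :: 'k \<Rightarrow> 'k \<Rightarrow> 'k" by unfold_locales (auto simp: algebra_simps)
  interpret P: vector_space_pair s "(*) :: 'k \<Rightarrow> 'k \<Rightarrow> 'k" ..
  have "W.independent {w}" using \<open>w \<noteq> 0\<close> by simp
  from P.linear_independent_extend[OF this, of "\<lambda>_. 1"]
  obtain g where "Vector_Spaces.linear s (*) g" "g w = 1" by auto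
  with assms(2)[of g] show False by simp
qed

lemma tpow_universal:
  fixes s :: "'k::field \<Rightarrow> 'b::ab_group_add \<Rightarrow> 'b" and s' :: "'k \<Rightarrow> 'w::ab_group_add \<Rightarrow> 'w"
  assumes vs: "vector_space s" and vs': "vector_space s'" and S: "module.subspace s S"
    and F: "multilinear s s' S n F"
  shows "\<exists>g. Vector_Spaces.linear tscale s' g \<and>
    (\<forall>bs. length bs = n \<and> set bs \<subseteq> S \<longrightarrow> g (tens s bs) = F bs)"
proof -
  interpret V: vector_space s by fact
  interpret W: vector_space s' by fact
  interpret T: vector_space "tscale :: 'k \<Rightarrow> ('b, 'k) tensor \<Rightarrow> _" by (rule vector_space_tscale)
  interpret K: vector_space "(*) :: 'k \<Rightarrow> 'k \<Rightarrow> 'k" by unfold_locales (auto simp: algebra_simps)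
  interpret VV: vector_space_pair s s ..
  interpret TW: vector_space_pair "tscale :: 'k \<Rightarrow> ('b, 'k) tensor \<Rightarrow> _" s' ..
  interpret TK: vector_space_pair "tscale :: 'k \<Rightarrow> ('b, 'k) tensor \<Rightarrow> _" "(*) :: 'k \<Rightarrow> 'k \<Rightarrow> 'k" ..
  obtain p where p: "range p \<subseteq> S" "Vector_Spaces.linear s s p" "\<And>v. v \<in> S \<Longrightarrow> p v = v"
    using VV.linear_exists_left_inverse_on[of id S] S V.linear_id by auto
  interpret p: Vector_Spaces.linear s s p by fact
  define A where "A = {bs. length bs = n \<and> set bs \<subseteq> S}"
  define F' where "F' = (\<lambda>bs. F (map p bs))"
  have F': "F' bs = F bs" if "bs \<in> A" for bs
    using that p(3) by (auto simp: A_def F'_def intro!: arg_cong[of _ _ F] map_idI)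
  have ml: "multilinear s (*) UNIV n (\<lambda>bs. \<phi> (F' bs))" if "Vector_Spaces.linear s' (*) \<phi>" for \<phi>
  proof -
    interpret phi: Vector_Spaces.linear s' "(*)" \<phi> by fact
    show ?thesis
      unfolding multilinear_def
    proof (intro allI impI)
      fix bs :: "'b list" and i and x y :: 'b and c :: 'k
      assume a: "length bs = n \<and> set bs \<subseteq> UNIV \<and> i < n \<and> x \<in> UNIV \<and> y \<in> UNIV"
      then have "length (map p bs) = n \<and> set (map p bs) \<subseteq> S \<and> i < n \<and> p x \<in> S \<and> p y \<in> S"
        using p(1) by auto
      from F[unfolded multilinear_def, rule_format, OF this, of c]
      show "\<phi> (F' (bs[i := x + y])) = \<phi> (F' (bs[i := x])) + \<phi> (F' (bs[i := y])) \<and>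
        \<phi> (F' (bs[i := s c x])) = c * \<phi> (F' (bs[i := x]))"
        by (simp add: F'_def map_update p.add p.scale phi.add phi.scale)
    qed
  qed
  obtain Bs where Bs: "Bs \<subseteq> tens s ` A" "T.independent Bs" "tens s ` A \<subseteq> T.span Bs"
    using T.maximal_independent_subset by blast
  define pick where "pick x = (SOME a. a \<in> A \<and> tens s a = x)" for x :: "('b, 'k) tensor"
  have pick: "pick x \<in> A" "tens s (pick x) = x" if "x \<in> Bs" for x
    using someI_ex[of "\<lambda>a. a \<in> A \<and> tens s a = x"] Bs(1) that by (auto simp: pick_def)
  define g where "g = TW.construct Bs (F' \<circ> pick)"
  have lg: "Vector_Spaces.linear tscale s' g"
    unfolding g_def by (rule TW.linear_construct[OF Bs(2)])
  have "g (tens s a) = F' a" if a: "a \<in> A" for a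
  proof -
    have "g (tens s a) - F' a = 0"
    proof (rule functionals_separate[OF vs'])
      fix \<phi> assume phi: "Vector_Spaces.linear s' (*) \<phi>"
      interpret phi: Vector_Spaces.linear s' "(*)" \<phi> by fact
      have 1: "Vector_Spaces.linear tscale (*) (\<lambda>x. \<phi> (g x))"
        using Vector_Spaces.linear_compose[OF lg phi] by (simp add: o_def)
      have 2: "Vector_Spaces.linear tscale (*) (\<lambda>x. x (\<lambda>bs. \<phi> (F' bs)))"
        by unfold_locales (auto simp: tscale_def)
      have "\<phi> (g x) = x (\<lambda>bs. \<phi> (F' bs))" if "x \<in> Bs" for x
      proof -
        have "g x = F' (pick x)"
          unfolding g_def using TW.construct_basis[OF Bs(2) that] by simp
        moreover have "tens s (pick x) (\<lambda>bs. \<phi> (F' bs)) = \<phi> (F' (pick x))"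
          using pick(1)[OF that] ml[OF phi] by (simp add: tens_def A_def)
        ultimately show ?thesis using pick(2)[OF that] by simp
      qed
      moreover have "tens s a \<in> T.span Bs" using a Bs(3) by auto
      ultimately have "\<phi> (g (tens s a)) = tens s a (\<lambda>bs. \<phi> (F' bs))"
        using TK.linear_eq_on[OF 1 2] by blast
      also have "\<dots> = \<phi> (F' a)"
        using a ml[OF phi] by (simp add: tens_def A_def)
      finally show "\<phi> (g (tens s a) - F' a) = 0" by (simp add: phi.diff)
    qed
    then show ?thesis by simp
  qed
  then show ?thesis using lg F' by (auto simp: A_def)
qed


section \<open>Graded bialgebras\<close>

text \<open>
  The underlying ring (multiplication and identity) of the bialgebra is the type \<open>'b\<close>.
  The assumption \<open>1 \<noteq> 0\<close> of class \<^class>\<open>ring_1\<close> is automatic, because the counit maps 1 to 1.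
\<close>

record ('k, 'b) bialg =
  smult :: "'k \<Rightarrow> 'b \<Rightarrow> 'b"
  comult :: "'b \<Rightarrow> ('b, 'k) tensor"
  counit :: "'b \<Rightarrow> 'k"
  grade :: "nat \<Rightarrow> 'b set"

abbreviation T :: "('k::field, 'b::ring_1) bialg \<Rightarrow> nat \<Rightarrow> ('b, 'k) tensor set"
  where "T B n \<equiv> tpow (smult B) n UNIV"

text \<open>
  The degree \<open>d\<close> part of \<open>S\<^sup>\<otimes>\<^sup>n\<close> for a graded subspace \<open>S\<close>; it is \<open>{0}\<close> for negative \<open>d\<close>.
\<close>

definition tgrade :: "('k::field, 'b::ring_1) bialg \<Rightarrow> nat \<Rightarrow> 'b set \<Rightarrow> int \<Rightarrow> ('b, 'k) tensor set"
  where "tgrade B n S d = module.span tscale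
    {tens (smult B) bs | bs ns. length bs = n \<and> length ns = n \<and>
       (\<forall>i<n. bs ! i \<in> S \<inter> grade B (ns ! i)) \<and> int (sum_list ns) = d}"

text \<open>The structure maps between tensor powers, with \<open>B\<close> identified with \<open>T B 1\<close> and the field
  with \<open>T B 0\<close>.\<close>

definition mu :: "('k::field, 'b::ring_1) bialg \<Rightarrow> nat \<Rightarrow> ('b, 'k) tensor \<Rightarrow> ('b, 'k) tensor"
  where "mu B i x =
    tlift x (\<lambda>bs. tens (smult B) (take (i - 1) bs @ [bs ! (i - 1) * bs ! i] @ drop (i + 1) bs))"

definition delta :: "('k::field, 'b::ring_1) bialg \<Rightarrow> nat \<Rightarrow> ('b, 'k) tensor \<Rightarrow> ('b, 'k) tensor"
  where "delta B j x = tlift x (\<lambda>bs.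
    tprod (smult B) (tens (smult B) (take (j - 1) bs))
      (tprod (smult B) (comult B (bs ! (j - 1))) (tens (smult B) (drop j bs))))"

definition eps :: "('k::field, 'b::ring_1) bialg \<Rightarrow> ('b, 'k) tensor \<Rightarrow> ('b, 'k) tensor"
  where "eps B x = tlift x (\<lambda>bs. tscale (counit B (hd bs)) (tens (smult B) []))"

text \<open>The factorwise product on a tensor power.\<close>

definition tmult :: "('k::field, 'b::ring_1) bialg \<Rightarrow> ('b, 'k) tensor \<Rightarrow> ('b, 'k) tensor
    \<Rightarrow> ('b, 'k) tensor"
  where "tmult B x y = tlift x (\<lambda>as. tlift y (\<lambda>bs. tens (smult B) (map2 (*) as bs)))"

locale graded_bialgebra =
  fixes B :: "('k::field, 'b::ring_1) bialg"
  assumes vector_space: "vector_space (smult B)"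
    and mult_smult_left: "smult B c a * b = smult B c (a * b)"
    and mult_smult_right: "a * smult B c b = smult B c (a * b)"
    and comult_in: "comult B a \<in> T B 2"
    and comult_linear: "Vector_Spaces.linear (smult B) tscale (comult B)"
    and counit_linear: "Vector_Spaces.linear (smult B) (*) (counit B)"
    and coassoc: "tmap (smult B) 1 (delta B 1) id (comult B a) =
                  tmap (smult B) 1 id (delta B 1) (comult B a)"
    and counit_left: "tmap (smult B) 1 (eps B) id (comult B a) = tens (smult B) [a]"
    and counit_right: "tmap (smult B) 1 id (eps B) (comult B a) = tens (smult B) [a]"
    and comult_mult: "comult B (a * b) = tmult B (comult B a) (comult B b)"
    and comult_one: "comult B 1 = tens (smult B) [1, 1]"
    and counit_mult: "counit B (a * b) = counit B a * counit B b"
    and counit_one: "counit B 1 = 1"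
    and grade_subspace: "module.subspace (smult B) (grade B i)"
    and grade_direct_sum: "\<exists>!c. (\<forall>i. c i \<in> grade B i) \<and> finite {i. c i \<noteq> 0} \<and>
                             a = (\<Sum>i | c i \<noteq> 0. c i)"
    and grade_mult: "a \<in> grade B i \<Longrightarrow> b \<in> grade B j \<Longrightarrow> a * b \<in> grade B (i + j)"
    and grade_one: "1 \<in> grade B 0"
    and grade_comult: "a \<in> grade B i \<Longrightarrow> comult B a \<in> tgrade B 2 UNIV (int i)"
    and grade_counit: "a \<in> grade B i \<Longrightarrow> i \<noteq> 0 \<Longrightarrow> counit B a = 0"


section \<open>Hat cohomology\<close>

text \<open>Linear maps between subspaces are normalised to vanish outside their domain, so that
  equality of maps is equality of functions.\<close>

definition restrict0 :: "'x set \<Rightarrow> ('x \<Rightarrow> 'y::zero) \<Rightarrow> 'x \<Rightarrow> 'y"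
  where "restrict0 X f = (\<lambda>x. if x \<in> X then f x else 0)"

definition Hom :: "('b, 'k::field) tensor set \<Rightarrow> ('b, 'k) tensor set
    \<Rightarrow> (('b, 'k) tensor \<Rightarrow> ('b, 'k) tensor) set"
  where "Hom X Y = {f. (\<forall>x\<in>X. \<forall>y\<in>X. f (x + y) = f x + f y) \<and>
    (\<forall>c. \<forall>x\<in>X. f (tscale c x) = tscale c (f x)) \<and> f ` X \<subseteq> Y \<and> (\<forall>x. x \<notin> X \<longrightarrow> f x = 0)}"

text \<open>Iterated comultiplication \<open>a \<mapsto> a\<^sub>(\<^sub>1\<^sub>) \<otimes> \<dots> \<otimes> a\<^sub>(\<^sub>p\<^sub>)\<close>.\<close>

fun copow :: "('k::field, 'b::ring_1) bialg \<Rightarrow> nat \<Rightarrow> 'b \<Rightarrow> ('b, 'k) tensor"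
  where "copow B 0 a = tscale (counit B a) (tens (smult B) [])"
  | "copow B (Suc 0) a = tens (smult B) [a]"
  | "copow B (Suc (Suc p)) a = delta B 1 (copow B (Suc p) a)"

definition lam :: "('k::field, 'b::ring_1) bialg \<Rightarrow> nat \<Rightarrow> ('b, 'k) tensor \<Rightarrow> ('b, 'k) tensor"
  where "lam B p x = tlift x (\<lambda>bs. tmult B (copow B p (hd bs)) (tens (smult B) (tl bs)))"

definition rho :: "('k::field, 'b::ring_1) bialg \<Rightarrow> nat \<Rightarrow> ('b, 'k) tensor \<Rightarrow> ('b, 'k) tensor"
  where "rho B p x = tlift x (\<lambda>bs. tmult B (tens (smult B) (butlast bs)) (copow B p (last bs)))"

text \<open>\<open>comult_all B [b\<^sub>1, \<dots>, b\<^sub>q]\<close> is the tensor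
  \<open>b\<^sub>1\<^sub>(\<^sub>1\<^sub>) \<otimes> b\<^sub>1\<^sub>(\<^sub>2\<^sub>) \<otimes> \<dots> \<otimes> b\<^sub>q\<^sub>(\<^sub>1\<^sub>) \<otimes> b\<^sub>q\<^sub>(\<^sub>2\<^sub>)\<close>; its first and second Sweedler legs sit at the
  even and odd positions (counted from 0).\<close>

definition comult_all :: "('k::field, 'b::ring_1) bialg \<Rightarrow> 'b list \<Rightarrow> ('b, 'k) tensor"
  where "comult_all B bs = foldr (\<lambda>b. tprod (smult B) (comult B b)) bs (tens (smult B) [])"

definition leg1 :: "nat \<Rightarrow> 'b list \<Rightarrow> 'b list"
  where "leg1 q cs = map (\<lambda>i. cs ! (2 * i)) [0..<q]"

definition leg2 :: "nat \<Rightarrow> 'b list \<Rightarrow> 'b list"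
  where "leg2 q cs = map (\<lambda>i. cs ! (2 * i + 1)) [0..<q]"

definition sigma :: "('k::field, 'b::ring_1) bialg \<Rightarrow> nat \<Rightarrow> ('b, 'k) tensor \<Rightarrow> ('b, 'k) tensor"
  where "sigma B q x = tlift x (\<lambda>bs. tlift (comult_all B bs)
    (\<lambda>cs. tens (smult B) (prod_list (leg1 q cs) # leg2 q cs)))"

definition tau :: "('k::field, 'b::ring_1) bialg \<Rightarrow> nat \<Rightarrow> ('b, 'k) tensor \<Rightarrow> ('b, 'k) tensor"
  where "tau B q x = tlift x (\<lambda>bs. tlift (comult_all B bs)
    (\<lambda>cs. tens (smult B) (leg1 q cs @ [prod_list (leg2 q cs)])))"

definition dh :: "('k::field, 'b::ring_1) bialg \<Rightarrow> nat \<Rightarrow> nat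
    \<Rightarrow> (('b, 'k) tensor \<Rightarrow> ('b, 'k) tensor) \<Rightarrow> ('b, 'k) tensor \<Rightarrow> ('b, 'k) tensor"
  where "dh B p q f = restrict0 (T B (q + 1)) (\<lambda>x.
    lam B p (tmap (smult B) 1 id f x)
    + (\<Sum>i=1..q. tscale ((-1) ^ i) (f (mu B i x)))
    + tscale ((-1) ^ (q + 1)) (rho B p (tmap (smult B) q f id x)))"

definition dc :: "('k::field, 'b::ring_1) bialg \<Rightarrow> nat \<Rightarrow> nat
    \<Rightarrow> (('b, 'k) tensor \<Rightarrow> ('b, 'k) tensor) \<Rightarrow> ('b, 'k) tensor \<Rightarrow> ('b, 'k) tensor"
  where "dc B p q f = restrict0 (T B q) (\<lambda>x.
    tmap (smult B) 1 id f (sigma B q x)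
    + (\<Sum>j=1..p. tscale ((-1) ^ j) (delta B j (f x)))
    + tscale ((-1) ^ (p + 1)) (tmap (smult B) q f id (tau B q x)))"

definition aug :: "('k::field, 'b::ring_1) bialg \<Rightarrow> 'b set"
  where "aug B = {b. counit B b = 0}"

definition proj_aug :: "('k::field, 'b::ring_1) bialg \<Rightarrow> 'b \<Rightarrow> 'b"
  where "proj_aug B b = b - smult B (counit B b) 1"

text \<open>
  The space of homogeneous maps of degree \<open>d\<close> from \<open>\<mm>\<^sup>\<otimes>\<^sup>q\<close> to \<open>\<mm>\<^sup>\<otimes>\<^sup>p\<close>, where \<open>\<mm> = aug B\<close>, and its
  image under the embedding \<open>f \<mapsto> \<ii>\<^sup>\<otimes>\<^sup>p \<circ> f \<circ> \<pi>\<^sup>\<otimes>\<^sup>q\<close> into \<open>Hom (T B q) (T B p)\<close>.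
\<close>

definition Hom_aug :: "('k::field, 'b::ring_1) bialg \<Rightarrow> nat \<Rightarrow> nat \<Rightarrow> int
    \<Rightarrow> (('b, 'k) tensor \<Rightarrow> ('b, 'k) tensor) set"
  where "Hom_aug B p q d = {f \<in> Hom (tpow (smult B) q (aug B)) (tpow (smult B) p (aug B)).
    \<forall>n. f ` tgrade B q (aug B) n \<subseteq> tgrade B p (aug B) (n + d)}"

definition D :: "('k::field, 'b::ring_1) bialg \<Rightarrow> nat \<Rightarrow> nat \<Rightarrow> int
    \<Rightarrow> (('b, 'k) tensor \<Rightarrow> ('b, 'k) tensor) set"
  where "D B p q d =
    (\<lambda>f. restrict0 (T B q) (\<lambda>x. f (tlift x (\<lambda>bs. tens (smult B) (map (proj_aug B) bs)))))
      ` Hom_aug B p q d"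

text \<open>A cochain is the family of its components, indexed by \<open>p\<close> and \<open>q\<close>.\<close>

type_synonym ('b, 'k) cochain = "nat \<Rightarrow> nat \<Rightarrow> ('b, 'k) tensor \<Rightarrow> ('b, 'k) tensor"

definition Dhat :: "('k::field, 'b::ring_1) bialg \<Rightarrow> nat \<Rightarrow> int \<Rightarrow> ('b, 'k) cochain set"
  where "Dhat B n d = {c. \<forall>p q. if 1 \<le> p \<and> 1 \<le> q \<and> p + q = n + 1 then c p q \<in> D B p q d
                              else c p q = 0}"

text \<open>The \<open>(p, q)\<close> component receives \<open>\<delta>\<^sub>h\<close> from \<open>(p, q - 1)\<close> and \<open>(-1)\<^sup>q \<delta>\<^sub>c\<close> from \<open>(p - 1, q)\<close>.\<close>

definition bd :: "('k::field, 'b::ring_1) bialg \<Rightarrow> nat \<Rightarrow> ('b, 'k) cochain \<Rightarrow> ('b, 'k) cochain"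
  where "bd B n c = (\<lambda>p q. if 1 \<le> p \<and> 1 \<le> q \<and> p + q = n + 2 then
      (if 2 \<le> q then dh B p (q - 1) (c p (q - 1)) else 0)
      + (if 2 \<le> p then (\<lambda>x. tscale ((-1) ^ q) (dc B (p - 1) q (c (p - 1) q) x)) else 0)
    else 0)"

definition cocycles :: "('k::field, 'b::ring_1) bialg \<Rightarrow> nat \<Rightarrow> int \<Rightarrow> ('b, 'k) cochain set"
  where "cocycles B n d = {c \<in> Dhat B n d. bd B n c = 0}"

text \<open>For \<open>n = 1\<close> this is \<open>{0}\<close>, since \<open>Dhat B 0 d = {0}\<close>.\<close>

definition coboundaries :: "('k::field, 'b::ring_1) bialg \<Rightarrow> nat \<Rightarrow> int \<Rightarrow> ('b, 'k) cochain set"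
  where "coboundaries B n d = bd B (n - 1) ` Dhat B (n - 1) d"

definition cohomologous :: "('k::field, 'b::ring_1) bialg \<Rightarrow> nat \<Rightarrow> int
    \<Rightarrow> (('b, 'k) cochain \<times> ('b, 'k) cochain) set"
  where "cohomologous B n d =
    {(c, c') \<in> cocycles B n d \<times> cocycles B n d. c - c' \<in> coboundaries B n d}"

definition hclass :: "('k::field, 'b::ring_1) bialg \<Rightarrow> nat \<Rightarrow> int \<Rightarrow> ('b, 'k) cochain
    \<Rightarrow> ('b, 'k) cochain set"
  where "hclass B n d c = cohomologous B n d `` {c}"

definition hat_h :: "('k::field, 'b::ring_1) bialg \<Rightarrow> nat \<Rightarrow> int \<Rightarrow> ('b, 'k) cochain set set"
  where "hat_h B n d = cocycles B n d // cohomologous B n d"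

definition hat_h_vanishes :: "('k::field, 'b::ring_1) bialg \<Rightarrow> nat \<Rightarrow> int \<Rightarrow> bool"
  where "hat_h_vanishes B n d \<longleftrightarrow> hat_h B n d = {hclass B n d 0}"


section \<open>Deformations\<close>

text \<open>
  \<open>V[t]/(t\<^sup>l\<^sup>+\<^sup>1)\<close>, with \<open>V[t]\<close> for \<open>l = \<infinity>\<close>: finitely supported coefficient sequences that vanish
  above \<open>l\<close>.
\<close>

definition tpoly :: "enat \<Rightarrow> 'v::zero set \<Rightarrow> (nat \<Rightarrow> 'v) set"
  where "tpoly l V = {X. (\<forall>n. X n \<in> V) \<and> finite {n. X n \<noteq> 0} \<and> (\<forall>n. X n \<noteq> 0 \<longrightarrow> enat n \<le> l)}"

definition const :: "'v::zero \<Rightarrow> nat \<Rightarrow> 'v"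
  where "const v = (\<lambda>n. if n = 0 then v else 0)"

text \<open>The action of the ring \<open>\<K>[t]/(t\<^sup>l\<^sup>+\<^sup>1)\<close>, whose elements are those of \<open>tpoly l UNIV\<close>.\<close>

definition tact :: "enat \<Rightarrow> (nat \<Rightarrow> 'k::field) \<Rightarrow> (nat \<Rightarrow> ('b, 'k) tensor) \<Rightarrow> nat \<Rightarrow> ('b, 'k) tensor"
  where "tact l c X = (\<lambda>n. if enat n \<le> l then \<Sum>i\<le>n. tscale (c i) (X (n - i)) else 0)"

type_synonym ('b, 'k) tlinmap = "(nat \<Rightarrow> ('b, 'k) tensor) \<Rightarrow> nat \<Rightarrow> ('b, 'k) tensor"

text \<open>Homogeneous \<open>\<K>[t]/(t\<^sup>l\<^sup>+\<^sup>1)\<close>-linear maps of degree zero from \<open>(B\<^sup>\<otimes>\<^sup>p)[t]/(t\<^sup>l\<^sup>+\<^sup>1)\<close> to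
  \<open>(B\<^sup>\<otimes>\<^sup>q)[t]/(t\<^sup>l\<^sup>+\<^sup>1)\<close>, where \<open>t\<close> has degree 1.\<close>

definition tpoly_grade :: "('k::field, 'b::ring_1) bialg \<Rightarrow> enat \<Rightarrow> nat \<Rightarrow> int
    \<Rightarrow> (nat \<Rightarrow> ('b, 'k) tensor) set"
  where "tpoly_grade B l p d = {X \<in> tpoly l (T B p). \<forall>j. X j \<in> tgrade B p UNIV (d - int j)}"

definition tHom :: "('k::field, 'b::ring_1) bialg \<Rightarrow> enat \<Rightarrow> nat \<Rightarrow> nat \<Rightarrow> ('b, 'k) tlinmap set"
  where "tHom B l p q = {F.
    (\<forall>X\<in>tpoly l (T B p). \<forall>Y\<in>tpoly l (T B p). F (X + Y) = F X + F Y) \<and>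
    (\<forall>c\<in>tpoly l UNIV. \<forall>X\<in>tpoly l (T B p). F (tact l c X) = tact l c (F X)) \<and>
    F ` tpoly l (T B p) \<subseteq> tpoly l (T B q) \<and>
    (\<forall>d. F ` tpoly_grade B l p d \<subseteq> tpoly_grade B l q d) \<and>
    (\<forall>X. X \<notin> tpoly l (T B p) \<longrightarrow> F X = 0)}"

text \<open>The components \<open>F\<^sub>s\<close> with \<open>F (x) = \<Sum>\<^sub>s F\<^sub>s(x) t\<^sup>s\<close> for \<open>x\<close> constant in \<open>t\<close>.\<close>

definition tcoeff :: "('b, 'k::field) tlinmap \<Rightarrow> nat \<Rightarrow> ('b, 'k) tensor \<Rightarrow> ('b, 'k) tensor"
  where "tcoeff F s x = F (const x) s"

text \<open>
  Tensor products over \<open>\<K>[t]/(t\<^sup>l\<^sup>+\<^sup>1)\<close> of elements and of linear maps, transported along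
  \<open>V[t]/(t\<^sup>l\<^sup>+\<^sup>1) \<otimes> W[t]/(t\<^sup>l\<^sup>+\<^sup>1) \<cong> (V \<otimes> W)[t]/(t\<^sup>l\<^sup>+\<^sup>1)\<close>.  By linearity, the coefficients of \<open>F \<otimes> G\<close> are
  \<open>(F \<otimes> G)\<^sub>n = \<Sum>\<^sub>i\<^sub>+\<^sub>j\<^sub>=\<^sub>n F\<^sub>i \<otimes> G\<^sub>j\<close>.
\<close>

definition tprod_t :: "('k::field, 'b::ring_1) bialg \<Rightarrow> enat \<Rightarrow> (nat \<Rightarrow> ('b, 'k) tensor)
    \<Rightarrow> (nat \<Rightarrow> ('b, 'k) tensor) \<Rightarrow> nat \<Rightarrow> ('b, 'k) tensor"
  where "tprod_t B l X Y = (\<lambda>n. if enat n \<le> l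
    then \<Sum>i\<le>n. tprod (smult B) (X i) (Y (n - i)) else 0)"

definition tmap_t :: "('k::field, 'b::ring_1) bialg \<Rightarrow> enat \<Rightarrow> nat \<Rightarrow> ('b, 'k) tlinmap
    \<Rightarrow> ('b, 'k) tlinmap \<Rightarrow> ('b, 'k) tlinmap"
  where "tmap_t B l p F G X = (\<lambda>n. if enat n \<le> l
    then \<Sum>i\<le>n. \<Sum>j\<le>n - i. tmap (smult B) p (tcoeff F i) (tcoeff G j) (X (n - i - j)) else 0)"

definition mid_swap :: "('k::field, 'b::ring_1) bialg \<Rightarrow> ('b, 'k) tensor \<Rightarrow> ('b, 'k) tensor"
  where "mid_swap B x = tlift x (\<lambda>bs. tens (smult B) [bs ! 0, bs ! 2, bs ! 1, bs ! 3])"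

definition one_t :: "('k::field, 'b::ring_1) bialg \<Rightarrow> nat \<Rightarrow> ('b, 'k) tensor"
  where "one_t B = const (tens (smult B) [1])"

definition eps_t :: "('k::field, 'b::ring_1) bialg \<Rightarrow> ('b, 'k) tlinmap"
  where "eps_t B X = (\<lambda>n. eps B (X n))"

text \<open>
  \<open>B[t]/(t\<^sup>l\<^sup>+\<^sup>1)\<close> is a bialgebra with identity 1, multiplication \<open>m\<close>, counit \<open>eps_t B\<close> and
  comultiplication \<open>\<Delta>\<close>.
\<close>

definition bialgebra_t :: "('k::field, 'b::ring_1) bialg \<Rightarrow> enat \<Rightarrow> ('b, 'k) tlinmap
    \<Rightarrow> ('b, 'k) tlinmap \<Rightarrow> bool"
  where "bialgebra_t B l m \<Delta> \<longleftrightarrow>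
    (\<forall>X\<in>tpoly l (T B 3). m (tmap_t B l 2 m id X) = m (tmap_t B l 1 id m X)) \<and>
    (\<forall>X\<in>tpoly l (T B 1). m (tprod_t B l (one_t B) X) = X \<and> m (tprod_t B l X (one_t B)) = X) \<and>
    (\<forall>X\<in>tpoly l (T B 1). tmap_t B l 1 \<Delta> id (\<Delta> X) = tmap_t B l 1 id \<Delta> (\<Delta> X)) \<and>
    (\<forall>X\<in>tpoly l (T B 1). tmap_t B l 1 (eps_t B) id (\<Delta> X) = X \<and>
                         tmap_t B l 1 id (eps_t B) (\<Delta> X) = X) \<and>
    (\<forall>X\<in>tpoly l (T B 2). \<Delta> (m X) =
       tmap_t B l 2 m m (\<lambda>n. mid_swap B (tmap_t B l 1 \<Delta> \<Delta> X n))) \<and>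
    \<Delta> (one_t B) = tprod_t B l (one_t B) (one_t B) \<and>
    (\<forall>X\<in>tpoly l (T B 2). eps_t B (m X) = tmap_t B l 1 (eps_t B) (eps_t B) X) \<and>
    eps_t B (one_t B) = const (tens (smult B) [])"

definition deformations :: "('k::field, 'b::ring_1) bialg \<Rightarrow> enat
    \<Rightarrow> (('b, 'k) tlinmap \<times> ('b, 'k) tlinmap) set"
  where "deformations B l = {(m, \<Delta>). m \<in> tHom B l 2 1 \<and> \<Delta> \<in> tHom B l 1 2 \<and>
    bialgebra_t B l m \<Delta> \<and>
    (\<forall>X\<in>tpoly l (T B 2). m X 0 = mu B 1 (X 0)) \<and>
    (\<forall>X\<in>tpoly l (T B 1). \<Delta> X 0 = delta B 1 (X 0))}"

definition deformation_iso :: "('k::field, 'b::ring_1) bialg \<Rightarrow> enat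
    \<Rightarrow> ('b, 'k) tlinmap \<times> ('b, 'k) tlinmap \<Rightarrow> ('b, 'k) tlinmap \<times> ('b, 'k) tlinmap
    \<Rightarrow> ('b, 'k) tlinmap \<Rightarrow> bool"
  where "deformation_iso B l \<xi> \<xi>' \<phi> \<longleftrightarrow>
    \<phi> \<in> tHom B l 1 1 \<and> bij_betw \<phi> (tpoly l (T B 1)) (tpoly l (T B 1)) \<and>
    (\<forall>X\<in>tpoly l (T B 2). \<phi> (fst \<xi> X) = fst \<xi>' (tmap_t B l 1 \<phi> \<phi> X)) \<and>
    \<phi> (one_t B) = one_t B \<and>
    (\<forall>X\<in>tpoly l (T B 1). tmap_t B l 1 \<phi> \<phi> (snd \<xi> X) = snd \<xi>' (\<phi> X)) \<and>
    (\<forall>X\<in>tpoly l (T B 1). eps_t B (\<phi> X) = eps_t B X) \<and>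
    (\<forall>X\<in>tpoly l (T B 1). \<phi> X 0 = X 0)"

definition iso_rel :: "('k::field, 'b::ring_1) bialg \<Rightarrow> enat
    \<Rightarrow> ((('b, 'k) tlinmap \<times> ('b, 'k) tlinmap) \<times> (('b, 'k) tlinmap \<times> ('b, 'k) tlinmap)) set"
  where "iso_rel B l =
    {(\<xi>, \<xi>') \<in> deformations B l \<times> deformations B l. \<exists>\<phi>. deformation_iso B l \<xi> \<xi>' \<phi>}"

definition iso_deformations :: "('k::field, 'b::ring_1) bialg \<Rightarrow> enat
    \<Rightarrow> (('b, 'k) tlinmap \<times> ('b, 'k) tlinmap) set set"
  where "iso_deformations B l = deformations B l // iso_rel B l"

definition graded_rigid :: "('k::field, 'b::ring_1) bialg \<Rightarrow> bool"
  where "graded_rigid B \<longleftrightarrow> (\<exists>x. iso_deformations B \<infinity> = {x})"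

definition extends :: "('k::field, 'b::ring_1) bialg \<Rightarrow> nat
    \<Rightarrow> ('b, 'k) tlinmap \<times> ('b, 'k) tlinmap \<Rightarrow> ('b, 'k) tlinmap \<times> ('b, 'k) tlinmap \<Rightarrow> bool"
  where "extends B l \<xi>' \<xi> \<longleftrightarrow> (\<forall>s\<le>l.
    (\<forall>x\<in>T B 2. tcoeff (fst \<xi>') s x = tcoeff (fst \<xi>) s x) \<and>
    (\<forall>x\<in>T B 1. tcoeff (snd \<xi>') s x = tcoeff (snd \<xi>) s x))"

text \<open>The 2-cochain formed by the coefficients of \<open>t\<close> in multiplication and comultiplication.\<close>

definition infinitesimal :: "('b, 'k::field) tlinmap \<times> ('b, 'k) tlinmap \<Rightarrow> ('b, 'k) cochain"
  where "infinitesimal \<xi> = (\<lambda>p q.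
    if p = 1 \<and> q = 2 then tcoeff (fst \<xi>) 1
    else if p = 2 \<and> q = 1 then tcoeff (snd \<xi>) 1
    else 0)"

text \<open>
  The obstruction of an \<open>l\<close>-deformation \<open>(\<Sum>m\<^sub>st\<^sup>s, \<Sum>\<Delta>\<^sub>st\<^sup>s)\<close>: those terms of the coefficient of
  \<open>t\<^sup>l\<^sup>+\<^sup>1\<close> in

  \<^item> \<open>m (m \<otimes> Id) - m (Id \<otimes> m)\<close>,
  \<^item> \<open>\<Delta> m - (m \<otimes> m) (Id \<otimes> swap \<otimes> Id) (\<Delta> \<otimes> \<Delta>)\<close>,
  \<^item> \<open>(Id \<otimes> \<Delta>) \<Delta> - (\<Delta> \<otimes> Id) \<Delta>\<close>

  that involve only \<open>m\<^sub>s\<close> and \<open>\<Delta>\<^sub>s\<close> with \<open>s \<le> l\<close>.  The remaining terms add up to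
  \<open>-\<partial>(m\<^sub>l\<^sub>+\<^sub>1, \<Delta>\<^sub>l\<^sub>+\<^sub>1)\<close>, so an extension exists if and only if this cochain is a coboundary.
\<close>

definition obstruction :: "('k::field, 'b::ring_1) bialg \<Rightarrow> nat
    \<Rightarrow> ('b, 'k) tlinmap \<times> ('b, 'k) tlinmap \<Rightarrow> ('b, 'k) cochain"
  where "obstruction B l \<xi> = (let m = tcoeff (fst \<xi>); \<Delta> = tcoeff (snd \<xi>); s = smult B in
    (\<lambda>p q.
      if p = 1 \<and> q = 3 then restrict0 (T B 3) (\<lambda>x.
        \<Sum>i=1..l. m i (tmap s 2 (m (l + 1 - i)) id x) - m i (tmap s 1 id (m (l + 1 - i)) x))
      else if p = 2 \<and> q = 2 then restrict0 (T B 2) (\<lambda>x.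
        (\<Sum>i=1..l. \<Delta> i (m (l + 1 - i) x))
        - (\<Sum>(i, j, k, r) \<in> {(i, j, k, r). i \<le> l \<and> j \<le> l \<and> k \<le> l \<and> r \<le> l \<and> i + j + k + r = l + 1}.
             tmap s 2 (m i) (m j) (mid_swap B (tmap s 1 (\<Delta> k) (\<Delta> r) x))))
      else if p = 3 \<and> q = 1 then restrict0 (T B 1) (\<lambda>x.
        \<Sum>i=1..l. tmap s 1 id (\<Delta> i) (\<Delta> (l + 1 - i) x) - tmap s 1 (\<Delta> i) id (\<Delta> (l + 1 - i) x))
      else 0))"

end

theory Submission
  imports Defs
begin

text \<open>
  The structure maps of a deformation are power series in \<open>t\<close> of linear maps between tensor powers of
  \<open>B\<close>.  They live in a symmetric monoidal category, and taking the first coefficient in which two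
  series may differ is a derivation for composition and for the tensor product.  The coefficient of
  \<open>t\<^sup>n\<close> lowers degrees by \<open>n\<close>, so such a series acts on polynomials even for \<open>l = \<infinity>\<close>.

  If the axioms of a bialgebra hold up to \<open>t\<^sup>n\<close>, the coefficients of \<open>t\<^sup>n\<close> in which they fail form a
  3-cochain.  Along a closed loop of diagrams, such as the pentagon for associativity, the
  differences between consecutive diagrams add up to zero; this is the cocycle condition.  Changing
  the coefficients of \<open>t\<^sup>n\<close> in multiplication and comultiplication changes the 3-cochain by a
  coboundary, whence the obstruction theory.  In the same way the failure of a series \<open>\<phi>\<close> to be an
  isomorphism of two deformations is a 2-cocycle, which changes by the coboundary of the change of
  \<open>\<phi>\<close>.  For \<open>n = 1\<close> this classifies the deformations of first order; if all classes vanish, \<open>\<phi>\<close> can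
  be corrected coefficient by coefficient, and the limit of the corrections proves rigidity.
\<close>

section \<open>Linear maps between tensor powers\<close>

text \<open>The hat complex is normalised: its cochains are maps between tensor powers of Ker
  \<epsilon>. This fits because 1 and \<epsilon> are not deformed. \<open>unital\<close> isolates
  the axioms about them, which hold exactly and turn every difference that occurs into a normalised
  cochain; associativity, coassociativity and multiplicativity of the comultiplication are the
  axioms that may fail. Composition and tensor product of series never truncate: for finite l a
  deformation is a series that is zero above t^l and satisfies the axioms modulo t^(l+1). Its defect
  at t^(l+1) is then the explicit \<open>obstruction\<close>, and to extend it means to replace the
  zero coefficients there. The differentials are given by formulas on lists; in the low bidegrees
  that matter they are rewritten through the t^0 coefficients of the composites that occur in the
  loops. The change formulas for defects also show, when applied to changes of the trivial
  deformation or of the identity, that coboundaries are closed under differences, so that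
  \<open>cohomologous\<close> is an equivalence relation.\<close>

interpretation ts: vector_space "tscale :: 'k::field \<Rightarrow> ('b, 'k) tensor \<Rightarrow> ('b, 'k) tensor"
  by (rule vector_space_tscale)

lemmas fun_apply_simps = plus_fun_apply zero_fun_apply minus_apply uminus_apply

text \<open>Unification eta-expands tensors, which are functions; these rules would then rewrite inside.\<close>

declare fun_apply_simps [simp del]

lemma subspace_tpow: "ts.subspace (tpow s n S)"
  by (simp add: tpow_def)

lemma tpow_zero [simp]: "0 \<in> tpow s n S"
  by (rule ts.subspace_0[OF subspace_tpow])

lemma tpow_add [simp]: "x \<in> tpow s n S \<Longrightarrow> y \<in> tpow s n S \<Longrightarrow> x + y \<in> tpow s n S"
  by (rule ts.subspace_add[OF subspace_tpow])

lemma tpow_diff [simp]: "x \<in> tpow s n S \<Longrightarrow> y \<in> tpow s n S \<Longrightarrow> x - y \<in> tpow s n S"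
  by (rule ts.subspace_diff[OF subspace_tpow])

lemma tpow_scale [simp]: "x \<in> tpow s n S \<Longrightarrow> tscale c x \<in> tpow s n S"
  by (rule ts.subspace_scale[OF subspace_tpow])

lemma tpow_sum: "(\<And>i. i \<in> A \<Longrightarrow> f i \<in> tpow s n S) \<Longrightarrow> sum f A \<in> tpow s n S"
  by (rule ts.subspace_sum[OF subspace_tpow])

lemma tens_in_tpow: "length bs = n \<Longrightarrow> set bs \<subseteq> S \<Longrightarrow> tens s bs \<in> tpow s n S"
  unfolding tpow_def by (rule ts.span_base) auto

lemma tens_in [simp]: "length bs = n \<Longrightarrow> tens s bs \<in> tpow s n UNIV"
  by (rule tens_in_tpow) auto

text \<open>The cases for sums and multiples also provide membership: maps between tensor powers are
  additive only on the tensor power itself, and an induction step needs this to split their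
  values.\<close>

lemma tpow_induct [consumes 1, case_names tens zero add scale]:
  assumes "x \<in> tpow s n S"
    and "\<And>bs. length bs = n \<Longrightarrow> set bs \<subseteq> S \<Longrightarrow> P (tens s bs)"
    and "P 0"
    and "\<And>x y. x \<in> tpow s n S \<Longrightarrow> y \<in> tpow s n S \<Longrightarrow> P x \<Longrightarrow> P y \<Longrightarrow> P (x + y)"
    and "\<And>c x. x \<in> tpow s n S \<Longrightarrow> P x \<Longrightarrow> P (tscale c x)"
  shows "P x"
proof -
  have "x \<in> tpow s n S \<and> P x"
    using assms(1) unfolding tpow_def
  proof (induction rule: ts.span_induct_alt)
    case base
    show ?case using assms(3) by (simp add: ts.span_zero)
  next
    case (step c y z)
    then obtain bs where bs: "y = tens s bs" "length bs = n" "set bs \<subseteq> S" by auto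
    then have y: "y \<in> tpow s n S" "P y" using tens_in_tpow[OF bs(2,3)] assms(2) by auto
    have z: "z \<in> tpow s n S" "P z" using step by (auto simp: tpow_def)
    have "P (tscale c y + z)" using y z assms(4,5) by simp
    moreover have "tscale c y + z \<in> tpow s n S" using y z by simp
    ultimately show ?case by (simp add: tpow_def)
  qed
  then show ?thesis by simp
qed

lemma tlift_add: "tlift (x + y) F = tlift x F + tlift y F"
  by (simp add: tlift_def fun_eq_iff fun_apply_simps)

lemma tlift_scale: "tlift (tscale c x) F = tscale c (tlift x F)"
  by (simp add: tlift_def tscale_def fun_eq_iff fun_apply_simps)

lemma tlift_zero [simp]: "tlift 0 F = 0"
  by (simp add: tlift_def fun_eq_iff fun_apply_simps)

lemma tlift_in:
  assumes "x \<in> tpow s n UNIV" "multilinear s tscale UNIV n F"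
    and "\<And>bs. length bs = n \<Longrightarrow> F bs \<in> tpow s q UNIV"
  shows "tlift x F \<in> tpow s q UNIV"
  using assms(1)
  by (induction rule: tpow_induct) (use assms(2,3) in \<open>auto simp: tlift_tens tlift_add tlift_scale\<close>)

text \<open>\<open>lin s p q f\<close>: linear on the \<open>p\<close>-th tensor power with values in the \<open>q\<close>-th one; the values
  of \<open>f\<close> elsewhere are arbitrary.\<close>

definition lin where "lin s p q f \<longleftrightarrow> (\<forall>x\<in>tpow s p UNIV. f x \<in> tpow s q UNIV) \<and>
  (\<forall>x\<in>tpow s p UNIV. \<forall>y\<in>tpow s p UNIV. f (x + y) = f x + f y) \<and>
  (\<forall>c. \<forall>x\<in>tpow s p UNIV. f (tscale c x) = tscale c (f x))"

lemma linI:
  assumes "\<And>x. x \<in> tpow s p UNIV \<Longrightarrow> f x \<in> tpow s q UNIV"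
    and "\<And>x y. x \<in> tpow s p UNIV \<Longrightarrow> y \<in> tpow s p UNIV \<Longrightarrow> f (x + y) = f x + f y"
    and "\<And>c x. x \<in> tpow s p UNIV \<Longrightarrow> f (tscale c x) = tscale c (f x)"
  shows "lin s p q f"
  using assms by (auto simp: lin_def)

lemma lin_in: "lin s p q f \<Longrightarrow> x \<in> tpow s p UNIV \<Longrightarrow> f x \<in> tpow s q UNIV"
  and lin_add: "lin s p q f \<Longrightarrow> x \<in> tpow s p UNIV \<Longrightarrow> y \<in> tpow s p UNIV \<Longrightarrow> f (x + y) = f x + f y"
  and lin_scale: "lin s p q f \<Longrightarrow> x \<in> tpow s p UNIV \<Longrightarrow> f (tscale c x) = tscale c (f x)"
  by (auto simp: lin_def)

lemma lin_zero: "lin s p q f \<Longrightarrow> f 0 = 0"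
  using lin_scale[of s p q f 0 0] by simp

lemma lin_diff:
  "lin s p q f \<Longrightarrow> x \<in> tpow s p UNIV \<Longrightarrow> y \<in> tpow s p UNIV \<Longrightarrow> f (x - y) = f x - f y"
  using lin_add[of s p q f "x - y" y] by (simp add: eq_diff_eq)

lemma lin_sum:
  assumes "lin s p q f" "\<And>i. i \<in> A \<Longrightarrow> g i \<in> tpow s p UNIV"
  shows "f (sum g A) = (\<Sum>i\<in>A. f (g i))"
  using assms(2)
  by (induction A rule: infinite_finite_induct)
    (auto simp: lin_zero[OF assms(1)] lin_add[OF assms(1)] tpow_sum)

lemma lin_id: "lin s p p id" "lin s p p (\<lambda>x. x)"
  by (auto simp: lin_def)

lemma lin_zero_map: "lin s p q 0" "lin s p q (\<lambda>x. 0)"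
  by (auto simp: lin_def fun_apply_simps)

lemma lin_comp: "lin s p q f \<Longrightarrow> lin s q r g \<Longrightarrow> lin s p r (\<lambda>x. g (f x))"
  by (auto simp: lin_def)

lemma lin_plus: "lin s p q f \<Longrightarrow> lin s p q g \<Longrightarrow> lin s p q (\<lambda>x. f x + g x)"
  by (auto simp: lin_def ts.scale_right_distrib)

lemma lin_minus: "lin s p q f \<Longrightarrow> lin s p q g \<Longrightarrow> lin s p q (\<lambda>x. f x - g x)"
  by (auto simp: lin_def ts.scale_right_diff_distrib)

lemma lin_summed: "(\<And>i. i \<in> A \<Longrightarrow> lin s p q (f i)) \<Longrightarrow> lin s p q (\<lambda>x. \<Sum>i\<in>A. f i x)"
  by (induction A rule: infinite_finite_induct) (auto simp: lin_zero_map lin_plus)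

lemma lin_restrict0: "lin s p q (restrict0 (tpow s p UNIV) f) \<longleftrightarrow> lin s p q f"
  by (auto simp: lin_def restrict0_def)

lemma lin_eqI:
  assumes "lin s p q f" "lin s p r g" "\<And>bs. length bs = p \<Longrightarrow> f (tens s bs) = g (tens s bs)"
    and "x \<in> tpow s p UNIV"
  shows "f x = g x"
  using assms(4)
  by (induction rule: tpow_induct)
    (auto simp: assms(3) lin_add[OF assms(1)] lin_add[OF assms(2)] lin_scale[OF assms(1)]
      lin_scale[OF assms(2)] lin_zero[OF assms(1)] lin_zero[OF assms(2)])

lemma lin_tlift:
  assumes "multilinear s tscale UNIV p F" "\<And>bs. length bs = p \<Longrightarrow> F bs \<in> tpow s q UNIV"
  shows "lin s p q (\<lambda>x. tlift x F)"
  by (rule linI) (simp_all add: tlift_in[OF _ assms] tlift_add tlift_scale)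

lemma multilinear_add:
  assumes "multilinear s s' S n F" "length bs = n" "set bs \<subseteq> S" "i < n" "x \<in> S" "y \<in> S"
  shows "F (bs[i := x + y]) = F (bs[i := x]) + F (bs[i := y])"
  using assms unfolding multilinear_def by blast

lemma multilinear_scale:
  assumes "multilinear s s' S n F" "length bs = n" "set bs \<subseteq> S" "i < n" "x \<in> S"
  shows "F (bs[i := s c x]) = s' c (F (bs[i := x]))"
  using assms unfolding multilinear_def by blast

lemma multilinearI:
  assumes "\<And>bs i x y. length bs = n \<Longrightarrow> i < n \<Longrightarrow> F (bs[i := x + y]) = F (bs[i := x]) + F (bs[i := y])"
    and "\<And>bs i x c. length bs = n \<Longrightarrow> i < n \<Longrightarrow> F (bs[i := s c x]) = s' c (F (bs[i := x]))"
  shows "multilinear s s' UNIV n F"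
  using assms unfolding multilinear_def by blast

lemma tens_update_add:
  "length bs = n \<Longrightarrow> i < n \<Longrightarrow> tens s (bs[i := x + y]) = tens s (bs[i := x]) + tens s (bs[i := y])"
  by (rule multilinear_add[OF tens_multilinear]) auto

lemma tens_update_scale:
  "length bs = n \<Longrightarrow> i < n \<Longrightarrow> tens s (bs[i := s c x]) = tscale c (tens s (bs[i := x]))"
  by (rule multilinear_scale[OF tens_multilinear]) auto

lemma multilinear_tens_append_left: "multilinear s tscale UNIV n (\<lambda>as. tens s (as @ bs))"
  by (rule multilinearI)
    (simp_all add: list_update_append1[symmetric] tens_update_add[OF refl] tens_update_scale[OF refl])

lemma multilinear_tens_append_right:
  fixes s :: "'k::field \<Rightarrow> 'b::ab_group_add \<Rightarrow> 'b"
  shows "multilinear s tscale UNIV n (\<lambda>bs. tens s (as @ bs))"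
proof (rule multilinearI)
  fix bs :: "'b list" and i x y c assume a: "length bs = n" "i < n"
  have u: "as @ bs[i := z] = (as @ bs)[length as + i := z]" for z by (simp add: list_update_append)
  show "tens s (as @ bs[i := x + y]) = tens s (as @ bs[i := x]) + tens s (as @ bs[i := y])"
    unfolding u by (rule tens_update_add[OF refl]) (use a in auto)
  show "tens s (as @ bs[i := s c x]) = tscale c (tens s (as @ bs[i := x]))"
    unfolding u by (rule tens_update_scale[OF refl]) (use a in auto)
qed

text \<open>\<open>tprod\<close> nests two lifts, and the outer one evaluates on a pure tensor only
  if its argument is multilinear. For pure y this is multilinearity of \<open>tens\<close> in a
  block of entries, and both equations are linear in y.\<close>

lemma multilinear_tlift_append:
  fixes s :: "'k::field \<Rightarrow> 'b::ab_group_add \<Rightarrow> 'b"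
  assumes "y \<in> tpow s q UNIV"
  shows "multilinear s tscale UNIV p (\<lambda>as. tlift y (\<lambda>bs. tens s (as @ bs)))"
proof (rule multilinearI)
  fix as :: "'b list" and i x x' c assume a: "length as = p" "i < p"
  note ml = multilinear_tens_append_left[of s p, THEN multilinear_add, OF a(1) subset_UNIV a(2) UNIV_I UNIV_I]
    multilinear_tens_append_left[of s p, THEN multilinear_scale, OF a(1) subset_UNIV a(2) UNIV_I]
  have e: "length bs = q \<Longrightarrow> tlift (tens s bs) (\<lambda>bs. tens s (as @ bs)) = tens s (as @ bs)" for as bs
    by (simp add: tlift_tens multilinear_tens_append_right)
  show "tlift y (\<lambda>bs. tens s (as[i := x + x'] @ bs)) =
    tlift y (\<lambda>bs. tens s (as[i := x] @ bs)) + tlift y (\<lambda>bs. tens s (as[i := x'] @ bs))"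
    using assms
  proof (induction rule: tpow_induct)
    case (tens bs)
    show ?case unfolding e[OF tens(1)] by (rule ml)
  qed (simp_all add: tlift_add tlift_scale ts.scale_right_distrib)
  show "tlift y (\<lambda>bs. tens s (as[i := s c x] @ bs)) =
    tscale c (tlift y (\<lambda>bs. tens s (as[i := x] @ bs)))"
    using assms
  proof (induction rule: tpow_induct)
    case (tens bs)
    show ?case unfolding e[OF tens(1)] by (rule ml)
  qed (simp_all add: tlift_add tlift_scale ts.scale_right_distrib mult.commute)
qed

lemma tprod_tens_left:
  "y \<in> tpow s q UNIV \<Longrightarrow> tprod s (tens s as) y = tlift y (\<lambda>bs. tens s (as @ bs))"
  unfolding tprod_def by (rule tlift_tens) (rule multilinear_tlift_append)

lemma tprod_tens [simp]: "tprod s (tens s as) (tens s bs) = tens s (as @ bs)"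
  by (subst tprod_tens_left[OF tens_in[OF refl]]) (simp add: tlift_tens multilinear_tens_append_right)

lemma tprod_add_left: "tprod s (x + y) z = tprod s x z + tprod s y z"
  and tprod_scale_left: "tprod s (tscale c x) z = tscale c (tprod s x z)"
  and tprod_zero_left [simp]: "tprod s 0 z = 0"
  by (simp_all add: tprod_def tlift_add tlift_scale)

lemma tprod_add_right:
  assumes "x \<in> tpow s p UNIV" "y \<in> tpow s q UNIV" "z \<in> tpow s q UNIV"
  shows "tprod s x (y + z) = tprod s x y + tprod s x z"
  using assms(1)
proof (induction rule: tpow_induct)
  case (tens bs)
  then show ?case using assms by (simp add: tprod_tens_left[of _ s q] tlift_add)
qed (auto simp: tprod_add_left tprod_scale_left ts.scale_right_distrib)

lemma tprod_scale_right:
  assumes "x \<in> tpow s p UNIV" "y \<in> tpow s q UNIV"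
  shows "tprod s x (tscale c y) = tscale c (tprod s x y)"
  using assms(1)
proof (induction rule: tpow_induct)
  case (tens bs)
  then show ?case using assms by (simp add: tprod_tens_left[of _ s q] tlift_scale)
qed (auto simp: tprod_add_left tprod_scale_left ts.scale_right_distrib mult.commute)

lemma tprod_zero_right [simp]: "x \<in> tpow s p UNIV \<Longrightarrow> tprod s x 0 = 0"
  using tprod_scale_right[of x s p 0 0 0] by simp

lemma tprod_in [simp]:
  assumes "x \<in> tpow s p UNIV" "y \<in> tpow s q UNIV" "n = p + q"
  shows "tprod s x y \<in> tpow s n UNIV"
  using assms(1)
proof (induction rule: tpow_induct)
  case (tens bs)
  have "tlift y (\<lambda>cs. tens s (bs @ cs)) \<in> tpow s n UNIV"
    by (rule tlift_in[OF assms(2)]) (use tens assms(3) in \<open>auto simp: multilinear_tens_append_right\<close>)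
  then show ?case using assms by (simp add: tprod_tens_left[of _ s q])
qed (auto simp: tprod_add_left tprod_scale_left)

lemma lin_tprod_right: "x \<in> tpow s p UNIV \<Longrightarrow> n = p + q \<Longrightarrow> lin s q n (\<lambda>y. tprod s x y)"
  by (rule linI) (simp_all add: tprod_add_right tprod_scale_right)

lemma lin_tprod_left: "y \<in> tpow s q UNIV \<Longrightarrow> n = p + q \<Longrightarrow> lin s p n (\<lambda>x. tprod s x y)"
  by (rule linI) (simp_all add: tprod_add_left tprod_scale_left)

lemma tprod_nil_left [simp]: "y \<in> tpow s q UNIV \<Longrightarrow> tprod s (tens s []) y = y"
  by (rule lin_eqI[of s q "0 + q" _ q "\<lambda>y. y"]) (simp_all add: lin_tprod_right[where p = 0] lin_id)

lemma tprod_nil_right [simp]: "x \<in> tpow s p UNIV \<Longrightarrow> tprod s x (tens s []) = x"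
  by (rule lin_eqI[of s p "p + 0" _ p "\<lambda>y. y"]) (simp_all add: lin_tprod_left[where q = 0] lin_id)

lemma tprod_assoc:
  fixes s :: "'k::field \<Rightarrow> 'b::ab_group_add \<Rightarrow> 'b"
  assumes x: "x \<in> tpow s p UNIV" and y: "y \<in> tpow s q UNIV" and z: "z \<in> tpow s r UNIV"
  shows "tprod s (tprod s x y) z = tprod s x (tprod s y z)"
proof (rule lin_eqI[OF _ _ _ x, of "p + q + r" _ "p + (q + r)"])
  show "lin s p (p + q + r) (\<lambda>x. tprod s (tprod s x y) z)"
    by (rule lin_comp[OF lin_tprod_left[OF y refl] lin_tprod_left[OF z refl]])
  show "lin s p (p + (q + r)) (\<lambda>x. tprod s x (tprod s y z))"
    by (rule lin_tprod_left[OF tprod_in[OF y z refl] refl])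
  fix as :: "'b list" assume as: "length as = p"
  show "tprod s (tprod s (tens s as) y) z = tprod s (tens s as) (tprod s y z)"
  proof (rule lin_eqI[OF _ _ _ y, of "p + q + r" _ "p + (q + r)"])
    show "lin s q (p + q + r) (\<lambda>y. tprod s (tprod s (tens s as) y) z)"
      by (rule lin_comp[OF lin_tprod_right[OF tens_in[OF as] refl] lin_tprod_left[OF z refl]])
    show "lin s q (p + (q + r)) (\<lambda>y. tprod s (tens s as) (tprod s y z))"
      by (rule lin_comp[OF lin_tprod_left[OF z refl] lin_tprod_right[OF tens_in[OF as] refl]])
    fix bs :: "'b list" assume bs: "length bs = q"
    show "tprod s (tprod s (tens s as) (tens s bs)) z = tprod s (tens s as) (tprod s (tens s bs) z)"
    proof (rule lin_eqI[OF _ _ _ z, of "p + q + r" _ "p + (q + r)"])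
      show "lin s r (p + q + r) (\<lambda>z. tprod s (tprod s (tens s as) (tens s bs)) z)"
        by (rule lin_tprod_right[OF _ refl]) (simp add: as bs)
      show "lin s r (p + (q + r)) (\<lambda>z. tprod s (tens s as) (tprod s (tens s bs) z))"
        by (rule lin_comp[OF lin_tprod_right[OF tens_in[OF bs] refl] lin_tprod_right[OF tens_in[OF as] refl]])
    qed simp
  qed
qed

lemma multilinear_tprod_split:
  fixes s :: "'k::field \<Rightarrow> 'b::ab_group_add \<Rightarrow> 'b"
  assumes f: "lin s p p' f" and g: "lin s q q' g"
  shows "multilinear s tscale UNIV (p + q)
    (\<lambda>bs. tprod s (f (tens s (take p bs))) (g (tens s (drop p bs))))"
proof (rule multilinearI)
  fix bs :: "'b list" and i x y c assume a: "length bs = p + q" "i < p + q"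
  let ?l = "take p bs" and ?r = "drop p bs"
  have len: "length ?l = p" "length ?r = q" using a by auto
  have *: "take p (bs[i := z]) = (if i < p then ?l[i := z] else ?l)"
    "drop p (bs[i := z]) = (if i < p then ?r else ?r[i - p := z])" for z
    by (auto simp: take_update_swap drop_update_swap list_update_beyond)
  note [simp] = lin_in[OF f] lin_in[OF g] len lin_add[OF f] lin_add[OF g] lin_scale[OF f] lin_scale[OF g]
    tprod_add_left tprod_scale_left
  show "tprod s (f (tens s (take p (bs[i := x + y])))) (g (tens s (drop p (bs[i := x + y])))) =
    tprod s (f (tens s (take p (bs[i := x])))) (g (tens s (drop p (bs[i := x])))) +
    tprod s (f (tens s (take p (bs[i := y])))) (g (tens s (drop p (bs[i := y]))))"
    unfolding * using a
    by (auto simp: tens_update_add[OF len(1)] tens_update_add[OF len(2)] tprod_add_right[of _ s p' _ q'])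
  show "tprod s (f (tens s (take p (bs[i := s c x])))) (g (tens s (drop p (bs[i := s c x])))) =
    tscale c (tprod s (f (tens s (take p (bs[i := x])))) (g (tens s (drop p (bs[i := x])))))"
    unfolding * using a
    by (auto simp: tens_update_scale[OF len(1)] tens_update_scale[OF len(2)] tprod_scale_right[of _ s p' _ q'])
qed

lemma tmap_tens:
  assumes "lin s p p' f" "lin s q q' g" "length bs = p + q"
  shows "tmap s p f g (tens s bs) = tprod s (f (tens s (take p bs))) (g (tens s (drop p bs)))"
  unfolding tmap_def
  by (rule tlift_tens) (use multilinear_tprod_split[OF assms(1,2)] assms(3) in simp)

lemma lin_tmap:
  assumes "lin s p p' f" "lin s q q' g" "n = p + q" "n' = p' + q'"
  shows "lin s n n' (tmap s p f g)"
  unfolding tmap_def[abs_def] assms(3)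
  by (rule lin_tlift[OF multilinear_tprod_split[OF assms(1,2)]])
    (use assms in \<open>auto intro!: tprod_in[of _ s p' _ q'] lin_in[OF assms(1)] lin_in[OF assms(2)]\<close>)

lemma tmap_tprod:
  fixes s :: "'k::field \<Rightarrow> 'b::ab_group_add \<Rightarrow> 'b"
  assumes f: "lin s p p' f" and g: "lin s q q' g" and x: "x \<in> tpow s p UNIV" and y: "y \<in> tpow s q UNIV"
  shows "tmap s p f g (tprod s x y) = tprod s (f x) (g y)"
proof (rule lin_eqI[OF _ _ _ x, of "p' + q'" _ "p' + q'"])
  show "lin s p (p' + q') (\<lambda>x. tmap s p f g (tprod s x y))"
    by (rule lin_comp[OF lin_tprod_left[OF y refl] lin_tmap[OF f g refl refl]])
  show "lin s p (p' + q') (\<lambda>x. tprod s (f x) (g y))"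
    by (rule lin_comp[OF f lin_tprod_left[OF lin_in[OF g y] refl]])
  fix as :: "'b list" assume as: "length as = p"
  then have asT: "tens s as \<in> tpow s p UNIV" by simp
  show "tmap s p f g (tprod s (tens s as) y) = tprod s (f (tens s as)) (g y)"
  proof (rule lin_eqI[OF _ _ _ y, of "p' + q'" _ "p' + q'"])
    show "lin s q (p' + q') (\<lambda>y. tmap s p f g (tprod s (tens s as) y))"
      by (rule lin_comp[OF lin_tprod_right[OF asT refl] lin_tmap[OF f g refl refl]])
    show "lin s q (p' + q') (\<lambda>y. tprod s (f (tens s as)) (g y))"
      by (rule lin_comp[OF g lin_tprod_right[OF lin_in[OF f asT] refl]])
  qed (simp add: tmap_tens[OF f g] as)
qed

text \<open>A pure tensor of length p + q is the product of two pure tensors. Testing on products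
  instead of lists keeps positions and lengths out of the laws for tensor products of maps.\<close>

lemma lin_eqI_tprod:
  fixes s :: "'k::field \<Rightarrow> 'b::ab_group_add \<Rightarrow> 'b"
  assumes "lin s n r f" "lin s n r' g" "n = p + q"
    and "\<And>y z. y \<in> tpow s p UNIV \<Longrightarrow> z \<in> tpow s q UNIV \<Longrightarrow> f (tprod s y z) = g (tprod s y z)"
    and "x \<in> tpow s n UNIV"
  shows "f x = g x"
proof (rule lin_eqI[OF assms(1,2) _ assms(5)])
  fix bs :: "'b list" assume "length bs = n"
  then show "f (tens s bs) = g (tens s bs)"
    using assms(4)[of "tens s (take p bs)" "tens s (drop p bs)"] assms(3) by simp
qed

lemma tprod_diff_left:
  "x \<in> tpow s p UNIV \<Longrightarrow> x' \<in> tpow s p UNIV \<Longrightarrow> y \<in> tpow s q UNIV \<Longrightarrow>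
    tprod s (x - x') y = tprod s x y - tprod s x' y"
  by (rule lin_diff[OF lin_tprod_left]) auto

lemma tprod_diff_right:
  "x \<in> tpow s p UNIV \<Longrightarrow> y \<in> tpow s q UNIV \<Longrightarrow> y' \<in> tpow s q UNIV \<Longrightarrow>
    tprod s x (y - y') = tprod s x y - tprod s x y'"
  by (rule lin_diff[OF lin_tprod_right]) auto

section \<open>Homogeneous parts of tensor powers\<close>

lemma subspace_tgrade: "ts.subspace (tgrade B n S d)"
  by (simp add: tgrade_def)

lemma tgrade_zero [simp]: "0 \<in> tgrade B n S d"
  by (rule ts.subspace_0[OF subspace_tgrade])

lemma tgrade_add: "x \<in> tgrade B n S d \<Longrightarrow> y \<in> tgrade B n S d \<Longrightarrow> x + y \<in> tgrade B n S d"
  by (rule ts.subspace_add[OF subspace_tgrade])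

lemma tgrade_diff: "x \<in> tgrade B n S d \<Longrightarrow> y \<in> tgrade B n S d \<Longrightarrow> x - y \<in> tgrade B n S d"
  by (rule ts.subspace_diff[OF subspace_tgrade])

lemma tgrade_scale: "x \<in> tgrade B n S d \<Longrightarrow> tscale c x \<in> tgrade B n S d"
  by (rule ts.subspace_scale[OF subspace_tgrade])

lemma tgrade_sum: "(\<And>i. i \<in> A \<Longrightarrow> f i \<in> tgrade B n S d) \<Longrightarrow> sum f A \<in> tgrade B n S d"
  by (rule ts.subspace_sum[OF subspace_tgrade])

lemma tgrade_tens:
  assumes "length bs = n" "length ns = n" "\<And>i. i < n \<Longrightarrow> bs ! i \<in> S" "\<And>i. i < n \<Longrightarrow> bs ! i \<in> grade B (ns ! i)"
    "int (sum_list ns) = d"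
  shows "tens (smult B) bs \<in> tgrade B n S d"
  unfolding tgrade_def by (rule ts.span_base) (use assms in blast)

lemma tgrade_induct [consumes 1, case_names tens zero add scale]:
  assumes "x \<in> tgrade B n S d"
    and "\<And>bs ns. length bs = n \<Longrightarrow> length ns = n \<Longrightarrow> (\<And>i. i < n \<Longrightarrow> bs ! i \<in> S) \<Longrightarrow>
      (\<And>i. i < n \<Longrightarrow> bs ! i \<in> grade B (ns ! i)) \<Longrightarrow> int (sum_list ns) = d \<Longrightarrow> P (tens (smult B) bs)"
    and "P 0"
    and "\<And>x y. x \<in> tgrade B n S d \<Longrightarrow> y \<in> tgrade B n S d \<Longrightarrow> P x \<Longrightarrow> P y \<Longrightarrow> P (x + y)"
    and "\<And>c x. x \<in> tgrade B n S d \<Longrightarrow> P x \<Longrightarrow> P (tscale c x)"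
  shows "P x"
proof -
  have "x \<in> tgrade B n S d \<and> P x"
    using assms(1) unfolding tgrade_def
  proof (induction rule: ts.span_induct_alt)
    case base
    show ?case using assms(3) by (simp add: ts.span_zero)
  next
    case (step c y z)
    then obtain bs ns where bs: "y = tens (smult B) bs" "length bs = n" "length ns = n"
      "\<And>i. i < n \<Longrightarrow> bs ! i \<in> S" "\<And>i. i < n \<Longrightarrow> bs ! i \<in> grade B (ns ! i)" "int (sum_list ns) = d"
      by auto
    then have y: "y \<in> tgrade B n S d" "P y" using tgrade_tens[OF bs(2-6)] assms(2)[OF bs(2-6)] by auto
    have z: "z \<in> tgrade B n S d" "P z" using step by (auto simp: tgrade_def)
    have "P (tscale c y + z)" using y z assms(4,5) by (simp add: tgrade_scale)
    moreover have "tscale c y + z \<in> tgrade B n S d" using y z by (simp add: tgrade_scale tgrade_add)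
    ultimately show ?case by (simp add: tgrade_def)
  qed
  then show ?thesis by simp
qed

lemma tgrade_in_tpow: "x \<in> tgrade B n S d \<Longrightarrow> x \<in> tpow (smult B) n S"
  by (induction rule: tgrade_induct)
    (auto simp: set_conv_nth intro!: tens_in_tpow)

lemma tgrade_mono: "x \<in> tgrade B n S d \<Longrightarrow> x \<in> tgrade B n UNIV d"
  by (induction rule: tgrade_induct) (auto intro: tgrade_tens tgrade_add tgrade_scale)

lemma tgrade_T: "x \<in> tgrade B n UNIV d \<Longrightarrow> x \<in> T B n"
  by (rule tgrade_in_tpow)

text \<open>Degrees of factors are natural numbers, so a negative degree has no generators. This is
  what makes a series of maps of decreasing degree stop on a given tensor.\<close>

lemma tgrade_negative: "x \<in> tgrade B n S d \<Longrightarrow> d < 0 \<Longrightarrow> x = 0"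
  by (induction rule: tgrade_induct) auto

lemma tgrade_tprod:
  assumes x: "x \<in> tgrade B p UNIV d" and y: "y \<in> tgrade B q UNIV e" and n: "n = p + q" and f: "f = d + e"
  shows "tprod (smult B) x y \<in> tgrade B n UNIV f"
  using x
proof (induction rule: tgrade_induct)
  case (tens as ms)
  note as = this
  show ?case using y
  proof (induction rule: tgrade_induct)
    case (tens bs ns)
    show ?case
      unfolding tprod_tens using as tens n f by (intro tgrade_tens[of _ _ "ms @ ns"]) (auto simp: nth_append)
  qed (use as in \<open>auto simp: tprod_add_right[of _ _ p _ q] tprod_scale_right[of _ _ p _ q] tgrade_T
      tprod_zero_right[of _ _ p] intro: tgrade_add tgrade_scale\<close>)
qed (auto simp: tprod_add_left tprod_scale_left intro: tgrade_add tgrade_scale)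

context graded_bialgebra
begin

abbreviation s where "s \<equiv> smult B"

lemma tens1_add: "tens s [x + y] = tens s [x] + tens s [y]"
  using tens_update_add[of "[0]" 1 0 s x y] by simp

lemma tens1_scale: "tens s [s c x] = tscale c (tens s [x])"
  using tens_update_scale[of "[0]" 1 0 s c x] by simp

lemma tens1_zero [simp]: "tens s [0] = 0"
  using tens1_add[of 0 0] by simp

lemma tens1_sum: "tens s [sum f A] = (\<Sum>i\<in>A. tens s [f i])"
  by (induction A rule: infinite_finite_induct) (auto simp: tens1_add)

text \<open>The span of the homogeneous parts is closed under \<open>tprod\<close> and contains
  every single vector, hence every pure tensor. Multiples of homogeneous tensors are homogeneous, so
  sums are the only closure case.\<close>

lemma T_homogeneous_induct [consumes 1, case_names homogeneous add]:
  assumes "x \<in> T B n" and hom: "\<And>y d. y \<in> tgrade B n UNIV d \<Longrightarrow> P y"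
    and add: "\<And>x y. x \<in> T B n \<Longrightarrow> y \<in> T B n \<Longrightarrow> P x \<Longrightarrow> P y \<Longrightarrow> P (x + y)"
  shows "P x"
proof -
  let ?U = "\<lambda>n. ts.span (\<Union>d. tgrade B n UNIV d)"
  have tp: "tprod s x y \<in> ?U (p + q)" if x: "x \<in> ?U p" and y: "y \<in> ?U q" for x y p q
    using x
  proof (induction rule: ts.span_induct_alt)
    case base
    show ?case by (simp add: ts.span_zero)
  next
    case (step c x x')
    then obtain d where x: "x \<in> tgrade B p UNIV d" by auto
    have "tprod s x y \<in> ?U (p + q) \<and> y \<in> T B q" using y
    proof (induction rule: ts.span_induct_alt)
      case base
      show ?case using tgrade_T[OF x] by (simp add: ts.span_zero)
    next
      case (step c y y')
      then obtain e where y: "y \<in> tgrade B q UNIV e" by auto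
      have "tprod s x (tscale c y + y') = tscale c (tprod s x y) + tprod s x y'"
        using tgrade_T[OF x] tgrade_T[OF y] step by (simp add: tprod_add_right[of _ _ p _ q] tprod_scale_right[of _ _ p _ q])
      moreover have "tprod s x y \<in> ?U (p + q)"
        using tgrade_tprod[OF x y refl refl] by (intro ts.span_base) blast
      ultimately show ?case using step tgrade_T[OF y] by (simp add: ts.span_add ts.span_scale)
    qed
    then show ?case using step by (simp add: tprod_add_left tprod_scale_left ts.span_add ts.span_scale)
  qed
  have one: "tens s [b] \<in> ?U 1" for b
  proof -
    obtain c where c: "\<forall>i. c i \<in> grade B i" "b = (\<Sum>i | c i \<noteq> 0. c i)"
      using grade_direct_sum[of b] by blast
    have "tens s [c i] \<in> ?U 1" for i
      using c(1) by (intro ts.span_base UN_I[of "int i"]) (auto intro!: tgrade_tens[of _ _ "[i]"])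
    then show ?thesis by (subst c(2)) (simp add: tens1_sum ts.span_sum)
  qed
  have "tens s bs \<in> ?U (length bs)" for bs
  proof (induction bs)
    case Nil
    show ?case by (intro ts.span_base UN_I[of 0]) (auto intro!: tgrade_tens[of _ _ "[]"])
  next
    case (Cons b bs)
    show ?case using tp[OF one[of b] Cons] by simp
  qed
  note tens_in_U = this
  have "x \<in> ?U n" using assms(1)
    by (induction rule: tpow_induct) (use tens_in_U in \<open>auto intro: ts.span_add ts.span_scale ts.span_zero\<close>)
  then have "P x \<and> x \<in> T B n"
  proof (induction rule: ts.span_induct_alt)
    case base
    show ?case using hom[OF tgrade_zero] by simp
  next
    case (step c y z)
    then obtain d where "y \<in> tgrade B n UNIV d" by auto
    then have "tscale c y \<in> tgrade B n UNIV d" by (rule tgrade_scale)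
    then show ?case using hom[of "tscale c y" d] step add[of "tscale c y" z] tgrade_T[of "tscale c y" B n d] by simp
  qed
  then show ?thesis by simp
qed

section \<open>Homogeneous linear maps and their tensor products\<close>

definition hlin where "hlin p q d f \<longleftrightarrow> lin s p q f \<and>
  (\<forall>e. \<forall>x\<in>tgrade B p UNIV e. f x \<in> tgrade B q UNIV (e + d))"

lemma hlin_lin [simp]: "hlin p q d f \<Longrightarrow> lin s p q f"
  by (simp add: hlin_def)

lemma hlin_grade: "hlin p q d f \<Longrightarrow> x \<in> tgrade B p UNIV e \<Longrightarrow> e' = e + d \<Longrightarrow> f x \<in> tgrade B q UNIV e'"
  by (simp add: hlin_def)

lemma hlinI:
  assumes l: "lin s p q f"
    and "\<And>bs ns e. length bs = p \<Longrightarrow> length ns = p \<Longrightarrow> (\<And>i. i < p \<Longrightarrow> bs ! i \<in> grade B (ns ! i)) \<Longrightarrow>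
      int (sum_list ns) = e \<Longrightarrow> f (tens s bs) \<in> tgrade B q UNIV (e + d)"
  shows "hlin p q d f"
  unfolding hlin_def
proof (intro conjI allI ballI)
  fix e x assume "x \<in> tgrade B p UNIV e"
  then show "f x \<in> tgrade B q UNIV (e + d)"
  proof (induction rule: tgrade_induct)
    case (tens bs ns)
    show ?case by (rule assms(2)[of bs ns]) (use tens in auto)
  qed (simp_all add: lin_add[OF l] lin_scale[OF l] lin_zero[OF l] tgrade_T tgrade_add tgrade_scale)
qed fact

lemma hlin_id: "hlin p p 0 (\<lambda>x. x)" "hlin p p 0 id"
  by (auto simp: hlin_def lin_id)

lemma hlin_zero: "hlin p q d (\<lambda>x. 0)" "hlin p q d 0"
  by (auto simp: hlin_def lin_zero_map fun_apply_simps)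

lemma hlin_comp: "hlin p q d f \<Longrightarrow> hlin q r e g \<Longrightarrow> d' = d + e \<Longrightarrow> hlin p r d' (\<lambda>x. g (f x))"
  using lin_comp[of s p q f r g] by (simp add: hlin_def add.assoc[symmetric])

lemma hlin_plus: "hlin p q d f \<Longrightarrow> hlin p q d g \<Longrightarrow> hlin p q d (\<lambda>x. f x + g x)"
  by (auto simp: hlin_def intro: lin_plus tgrade_add)

lemma hlin_minus: "hlin p q d f \<Longrightarrow> hlin p q d g \<Longrightarrow> hlin p q d (\<lambda>x. f x - g x)"
  by (auto simp: hlin_def intro: lin_minus tgrade_diff)

lemma hlin_summed: "(\<And>i. i \<in> A \<Longrightarrow> hlin p q d (f i)) \<Longrightarrow> hlin p q d (\<lambda>x. \<Sum>i\<in>A. f i x)"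
  by (auto simp: hlin_def intro: lin_summed tgrade_sum)

lemma hlin_restrict0: "hlin p q d (restrict0 (T B p) f) \<longleftrightarrow> hlin p q d f"
  unfolding hlin_def lin_restrict0 by (simp add: restrict0_def tgrade_T cong: ball_cong)

lemma hlin_tmap:
  assumes f: "hlin p p' d f" and g: "hlin q q' e g" and n: "n = p + q" "n' = p' + q'" "d' = d + e"
  shows "hlin n n' d' (tmap s p f g)"
proof (rule hlinI)
  show "lin s n n' (tmap s p f g)"
    by (rule lin_tmap[of s p p' f q q' g]) (use assms in auto)
  fix bs ns k assume a: "length bs = n" "length ns = n" "\<And>i. i < n \<Longrightarrow> bs ! i \<in> grade B (ns ! i)"
    "int (sum_list ns) = k"
  have 1: "tens s (take p bs) \<in> tgrade B p UNIV (int (sum_list (take p ns)))"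
    by (rule tgrade_tens[of _ _ "take p ns"]) (use a n in auto)
  have 2: "tens s (drop p bs) \<in> tgrade B q UNIV (int (sum_list (drop p ns)))"
    by (rule tgrade_tens[of _ _ "drop p ns"]) (use a n in auto)
  have k: "k = int (sum_list (take p ns)) + int (sum_list (drop p ns))"
    using a(4) by (metis append_take_drop_id of_nat_add sum_list_append)
  have "tmap s p f g (tens s bs) = tprod s (f (tens s (take p bs))) (g (tens s (drop p bs)))"
    by (rule tmap_tens[OF hlin_lin[OF f] hlin_lin[OF g]]) (use a n in simp)
  also have "\<dots> \<in> tgrade B n' UNIV (k + d')"
    by (rule tgrade_tprod[OF hlin_grade[OF f 1 refl] hlin_grade[OF g 2 refl] n(2)]) (simp add: k n)
  finally show "tmap s p f g (tens s bs) \<in> tgrade B n' UNIV (k + d')" .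
qed

text \<open>\<open>tmap\<close> is meaningful only on the tensor power of order p + q. Cutting it
  off there makes equality of maps an equality of functions, in the same normal form as
  \<open>Hom\<close>; this needs q besides p.\<close>

definition tm where "tm p q f g = restrict0 (T B (p + q)) (tmap s p f g)"

lemma hlin_tm:
  "hlin p p' d f \<Longrightarrow> hlin q q' e g \<Longrightarrow> n = p + q \<Longrightarrow> n' = p' + q' \<Longrightarrow> d' = d + e \<Longrightarrow> hlin n n' d' (tm p q f g)"
  unfolding tm_def by (simp add: hlin_restrict0 hlin_tmap)

lemma lin_tm: "lin s p p' f \<Longrightarrow> lin s q q' g \<Longrightarrow> n = p + q \<Longrightarrow> n' = p' + q' \<Longrightarrow> lin s n n' (tm p q f g)"
  unfolding tm_def by (simp add: lin_restrict0 lin_tmap)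

lemma tm_outside: "x \<notin> T B (p + q) \<Longrightarrow> tm p q f g x = 0"
  by (simp add: tm_def restrict0_def)

lemma tm_tprod:
  "lin s p p' f \<Longrightarrow> lin s q q' g \<Longrightarrow> x \<in> T B p \<Longrightarrow> y \<in> T B q \<Longrightarrow>
    tm p q f g (tprod s x y) = tprod s (f x) (g y)"
  using tprod_in[of x s p y q "p + q"] by (simp add: tm_def restrict0_def tmap_tprod)

text \<open>Uniqueness of the linear map with prescribed values on products. The laws for
  composites, associativity, sums and differences of \<open>tm\<close> all reduce to it.\<close>

lemma tm_eqI:
  assumes "lin s (p + q) n' h" "\<And>x. x \<notin> T B (p + q) \<Longrightarrow> h x = 0" "lin s p p' f" "lin s q q' g"
    and "\<And>x y. x \<in> T B p \<Longrightarrow> y \<in> T B q \<Longrightarrow> h (tprod s x y) = tprod s (f x) (g y)"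
  shows "h = tm p q f g"
proof
  fix x show "h x = tm p q f g x"
  proof (cases "x \<in> T B (p + q)")
    case True
    show ?thesis
      by (rule lin_eqI_tprod[OF assms(1) lin_tm[OF assms(3,4) refl refl] refl _ True])
        (simp add: assms(5) tm_tprod[OF assms(3,4)])
  qed (simp add: assms(2) tm_outside)
qed

text \<open>The two families under the lift agree on lists of length p + q, and
  \<open>multilinear\<close> looks only at those. So on a pure tensor both lifts evaluate, or both
  take the default value 0.\<close>

lemma tm_cong:
  assumes "\<And>x. x \<in> T B p \<Longrightarrow> f x = f' x" "\<And>x. x \<in> T B q \<Longrightarrow> g x = g' x"
  shows "tm p q f g = tm p q f' g'"
proof
  fix x
  have "tlift x (\<lambda>bs. tprod s (f (tens s (take p bs))) (g (tens s (drop p bs)))) =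
    tlift x (\<lambda>bs. tprod s (f' (tens s (take p bs))) (g' (tens s (drop p bs))))" if "x \<in> T B (p + q)"
    using that
  proof (induction rule: tpow_induct)
    case (tens bs)
    let ?F = "\<lambda>bs. tprod s (f (tens s (take p bs))) (g (tens s (drop p bs)))"
    let ?G = "\<lambda>bs. tprod s (f' (tens s (take p bs))) (g' (tens s (drop p bs)))"
    have e: "length cs = p + q \<Longrightarrow> ?F cs = ?G cs" for cs using assms by simp
    have m: "multilinear s (*) UNIV (p + q) (\<lambda>cs. ?F cs h) = multilinear s (*) UNIV (p + q) (\<lambda>cs. ?G cs h)" for h
      unfolding multilinear_def using e by (metis (no_types, lifting) length_list_update)
    show ?case using tens m e[OF tens(1)] by (simp add: tlift_def tens_def fun_eq_iff)
  qed (simp_all add: tlift_add tlift_scale)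
  then show "tm p q f g x = tm p q f' g' x" by (simp add: tm_def tmap_def restrict0_def)
qed

lemma tm_comp:
  assumes "lin s p p' f" "lin s q q' g" "lin s p' p'' f'" "lin s q' q'' g'"
  shows "tm p' q' f' g' (tm p q f g x) = tm p q (\<lambda>x. f' (f x)) (\<lambda>x. g' (g x)) x"
proof -
  have "(\<lambda>x. tm p' q' f' g' (tm p q f g x)) = tm p q (\<lambda>x. f' (f x)) (\<lambda>x. g' (g x))"
    by (rule tm_eqI[OF lin_comp[OF lin_tm[OF assms(1,2) refl refl] lin_tm[OF assms(3,4) refl refl]]])
      (auto simp: tm_outside lin_zero[OF lin_tm[OF assms(3,4) refl refl]] tm_tprod[OF assms(1,2)]
        tm_tprod[OF assms(3,4)] lin_in[OF assms(1)] lin_in[OF assms(2)]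
        intro: lin_comp[OF assms(1,3)] lin_comp[OF assms(2,4)])
  then show ?thesis by (simp add: fun_eq_iff)
qed

lemma tm_assoc:
  assumes f: "lin s p p' f" and g: "lin s q q' g" and h: "lin s r r' h"
  shows "tm (p + q) r (tm p q f g) h = tm p (q + r) f (tm q r g h)"
proof (rule tm_eqI)
  note fg = lin_tm[OF f g refl refl] and gh = lin_tm[OF g h refl refl]
  show l: "lin s (p + (q + r)) (p' + q' + r') (tm (p + q) r (tm p q f g) h)"
    by (rule lin_tm[OF fg h]) auto
  show "\<And>x. x \<notin> T B (p + (q + r)) \<Longrightarrow> tm (p + q) r (tm p q f g) h x = 0"
    by (rule tm_outside) (simp add: add.assoc)
  show "lin s p p' f" "lin s (q + r) (q' + r') (tm q r g h)" by fact+
  fix x y assume x: "x \<in> T B p" and y: "y \<in> T B (q + r)"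
  show "tm (p + q) r (tm p q f g) h (tprod s x y) = tprod s (f x) (tm q r g h y)"
  proof (rule lin_eqI_tprod[OF _ _ refl _ y])
    show "lin s (q + r) (p' + q' + r') (\<lambda>y. tm (p + q) r (tm p q f g) h (tprod s x y))"
      by (rule lin_comp[OF lin_tprod_right[OF x refl] l])
    show "lin s (q + r) (p' + (q' + r')) (\<lambda>y. tprod s (f x) (tm q r g h y))"
      by (rule lin_comp[OF gh lin_tprod_right[OF lin_in[OF f x] refl]])
    fix y z assume yz: "y \<in> T B q" "z \<in> T B r"
    have "tm (p + q) r (tm p q f g) h (tprod s (tprod s x y) z) = tprod s (tprod s (f x) (g y)) (h z)"
      using x yz by (simp add: tm_tprod[OF fg h] tm_tprod[OF f g] tprod_in[OF _ _ refl])
    then show "tm (p + q) r (tm p q f g) h (tprod s x (tprod s y z)) = tprod s (f x) (tm q r g h (tprod s y z))"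
      using x yz by (simp add: tm_tprod[OF g h] tprod_assoc[of _ s p _ q _ r]
         tprod_assoc[of _ s p' _ q' _ r'] lin_in[OF f] lin_in[OF g] lin_in[OF h])
  qed
qed

lemma tm_sum_left:
  assumes "\<And>i. i \<in> A \<Longrightarrow> lin s p p' (f i)" "lin s q q' g"
  shows "tm p q (\<lambda>x. \<Sum>i\<in>A. f i x) g x = (\<Sum>i\<in>A. tm p q (f i) g x)"
proof -
  have f: "lin s p p' (\<lambda>x. \<Sum>i\<in>A. f i x)" by (rule lin_summed) (rule assms(1))
  have "(\<lambda>x. \<Sum>i\<in>A. tm p q (f i) g x) = tm p q (\<lambda>x. \<Sum>i\<in>A. f i x) g"
  proof (rule tm_eqI[OF _ _ f assms(2)])
    show "lin s (p + q) (p' + q') (\<lambda>x. \<Sum>i\<in>A. tm p q (f i) g x)"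
      by (rule lin_summed) (rule lin_tm[OF assms refl refl])
    fix x y assume xy: "x \<in> T B p" "y \<in> T B q"
    have "(\<Sum>i\<in>A. tm p q (f i) g (tprod s x y)) = (\<Sum>i\<in>A. tprod s (f i x) (g y))"
      by (rule sum.cong) (auto simp: tm_tprod[OF assms(1) assms(2)] xy)
    also have "\<dots> = tprod s (\<Sum>i\<in>A. f i x) (g y)"
      by (rule lin_sum[OF lin_tprod_left[OF lin_in[OF assms(2) xy(2)] refl], symmetric])
        (rule lin_in[OF assms(1) xy(1)])
    finally show "(\<Sum>i\<in>A. tm p q (f i) g (tprod s x y)) = tprod s (\<Sum>i\<in>A. f i x) (g y)" .
  qed (simp add: tm_outside)
  then show ?thesis by (simp add: fun_eq_iff)
qed

lemma tm_sum_right: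
  assumes "lin s p p' f" "\<And>i. i \<in> A \<Longrightarrow> lin s q q' (g i)"
  shows "tm p q f (\<lambda>x. \<Sum>i\<in>A. g i x) x = (\<Sum>i\<in>A. tm p q f (g i) x)"
proof -
  have g: "lin s q q' (\<lambda>x. \<Sum>i\<in>A. g i x)" by (rule lin_summed) (rule assms)
  have "(\<lambda>x. \<Sum>i\<in>A. tm p q f (g i) x) = tm p q f (\<lambda>x. \<Sum>i\<in>A. g i x)"
  proof (rule tm_eqI[OF _ _ assms(1) g])
    show "lin s (p + q) (p' + q') (\<lambda>x. \<Sum>i\<in>A. tm p q f (g i) x)"
      by (rule lin_summed) (rule lin_tm[OF assms refl refl])
    fix x y assume xy: "x \<in> T B p" "y \<in> T B q"
    have "(\<Sum>i\<in>A. tm p q f (g i) (tprod s x y)) = (\<Sum>i\<in>A. tprod s (f x) (g i y))"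
      by (rule sum.cong) (auto simp: tm_tprod[OF assms(1) assms(2)] xy)
    also have "\<dots> = tprod s (f x) (\<Sum>i\<in>A. g i y)"
      by (rule lin_sum[OF lin_tprod_right[OF lin_in[OF assms(1) xy(1)] refl], symmetric])
        (rule lin_in[OF assms(2) xy(2)])
    finally show "(\<Sum>i\<in>A. tm p q f (g i) (tprod s x y)) = tprod s (f x) (\<Sum>i\<in>A. g i y)" .
  qed (simp add: tm_outside)
  then show ?thesis by (simp add: fun_eq_iff)
qed

lemma tm_minus_left:
  assumes f: "lin s p p' f" "lin s p p' f'" and g: "lin s q q' g"
  shows "tm p q (\<lambda>x. f x - f' x) g x = tm p q f g x - tm p q f' g x"
proof -
  have "(\<lambda>x. tm p q f g x - tm p q f' g x) = tm p q (\<lambda>x. f x - f' x) g"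
    by (rule tm_eqI[OF lin_minus[OF lin_tm[OF f(1) g refl refl] lin_tm[OF f(2) g refl refl]] _ lin_minus[OF f] g])
      (auto simp: tm_outside tm_tprod[OF f(1) g] tm_tprod[OF f(2) g]
        tprod_diff_left[of _ _ p' _ _ q'] lin_in[OF f(1)] lin_in[OF f(2)] lin_in[OF g])
  then show ?thesis by (simp add: fun_eq_iff)
qed

lemma tm_minus_right:
  assumes f: "lin s p p' f" and g: "lin s q q' g" "lin s q q' g'"
  shows "tm p q f (\<lambda>x. g x - g' x) x = tm p q f g x - tm p q f g' x"
proof -
  have "(\<lambda>x. tm p q f g x - tm p q f g' x) = tm p q f (\<lambda>x. g x - g' x)"
    by (rule tm_eqI[OF lin_minus[OF lin_tm[OF f g(1) refl refl] lin_tm[OF f g(2) refl refl]] _ f lin_minus[OF g]])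
      (auto simp: tm_outside tm_tprod[OF f g(1)] tm_tprod[OF f g(2)]
        tprod_diff_right[of _ _ p' _ q'] lin_in[OF f] lin_in[OF g(1)] lin_in[OF g(2)])
  then show ?thesis by (simp add: fun_eq_iff)
qed

end

text \<open>Both sides sum h a b c over a + b + c = n: the left one first fixes a + b, the right one
  first fixes a. This is the index bookkeeping behind associativity of Cauchy products.\<close>

lemma sum_triangle:
  fixes h :: "nat \<Rightarrow> nat \<Rightarrow> nat \<Rightarrow> 'a::comm_monoid_add"
  shows "(\<Sum>i\<le>n. \<Sum>j\<le>i. h j (i - j) (n - i)) = (\<Sum>i\<le>n. \<Sum>j\<le>n - i. h i j (n - i - j))"
proof -
  have "(\<Sum>i\<le>n. \<Sum>j\<le>i. h j (i - j) (n - i)) =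
    (\<Sum>(i, j)\<in>Sigma {..n} (\<lambda>i. {..i}). h j (i - j) (n - i))"
    by (rule sum.Sigma) auto
  also have "\<dots> = (\<Sum>(i, j)\<in>Sigma {..n} (\<lambda>i. {..n - i}). h i j (n - i - j))"
    by (rule sum.reindex_bij_witness[of _ "\<lambda>(i, j). (i + j, i)" "\<lambda>(i, j). (j, i - j)"]) auto
  also have "\<dots> = (\<Sum>i\<le>n. \<Sum>j\<le>n - i. h i j (n - i - j))"
    by (rule sum.Sigma[symmetric]) auto
  finally show ?thesis .
qed

lemma sum_quad:
  fixes h :: "nat \<Rightarrow> nat \<Rightarrow> nat \<Rightarrow> nat \<Rightarrow> 'a::comm_monoid_add"
  shows "(\<Sum>i\<le>n. \<Sum>a\<le>i. \<Sum>b\<le>n - i. h a (i - a) b (n - i - b)) =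
    (\<Sum>(a, b, c, d)\<in>{(a, b, c, d). a + b + c + d = n}. h a b c d)"
proof -
  have "(\<Sum>i\<le>n. \<Sum>a\<le>i. \<Sum>b\<le>n - i. h a (i - a) b (n - i - b)) =
    (\<Sum>i\<le>n. \<Sum>(a, b)\<in>{..i} \<times> {..n - i}. h a (i - a) b (n - i - b))"
    by (simp add: sum.cartesian_product)
  also have "\<dots> = (\<Sum>(i, a, b)\<in>Sigma {..n} (\<lambda>i. {..i} \<times> {..n - i}). h a (i - a) b (n - i - b))"
    by (subst sum.Sigma) (auto intro!: sum.cong simp: split_def)
  also have "\<dots> = (\<Sum>(a, b, c, d)\<in>{(a, b, c, d). a + b + c + d = n}. h a b c d)"
    by (rule sum.reindex_bij_witness[of _ "\<lambda>(a, b, c, d). (a + b, a, c)"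
      "\<lambda>(i, a, b). (a, i - a, b, n - i - b)"]) auto
  finally show ?thesis .
qed

text \<open>Both sides run over all quadruples with sum n and differ by an exchange of the two
  middle entries, which preserves the sum.\<close>

lemma sum_quad_swap:
  fixes h :: "nat \<Rightarrow> nat \<Rightarrow> nat \<Rightarrow> nat \<Rightarrow> 'a::comm_monoid_add"
  shows "(\<Sum>i\<le>n. \<Sum>a\<le>i. \<Sum>b\<le>n - i. h a (i - a) b (n - i - b)) =
    (\<Sum>i\<le>n. \<Sum>a\<le>i. \<Sum>b\<le>n - i. h a b (i - a) (n - i - b))"
  unfolding sum_quad[of h] sum_quad[of "\<lambda>a b c d. h a c b d"]
  by (rule sum.reindex_bij_witness[of _ "\<lambda>(a, b, c, d). (a, c, b, d)" "\<lambda>(a, b, c, d). (a, c, b, d)"]) auto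

section \<open>Power series of linear maps\<close>

text \<open>Power series \<open>\<Sum>\<^sub>n cf F n t\<^sup>n\<close> of linear maps from the \<open>src F\<close>-th to the \<open>tgt F\<close>-th tensor power.
  They form a strict symmetric monoidal category in which both structure maps of a deformation
  live, with truncation of series replaced by agreement of their first coefficients.\<close>

datatype ('b, 'k) mor = Mor (src: nat) (tgt: nat) (cf: "nat \<Rightarrow> ('b, 'k) tensor \<Rightarrow> ('b, 'k) tensor")

context graded_bialgebra
begin

definition arr :: "('b, 'k) mor \<Rightarrow> bool" where
  "arr F \<longleftrightarrow> (\<forall>n. hlin (src F) (tgt F) (- int n) (cf F n) \<and> (\<forall>x. x \<notin> T B (src F) \<longrightarrow> cf F n x = 0))"

definition comp :: "('b, 'k) mor \<Rightarrow> ('b, 'k) mor \<Rightarrow> ('b, 'k) mor" (infixr "\<cdot>" 70) where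
  "F \<cdot> G = Mor (src G) (tgt F) (\<lambda>n x. \<Sum>i\<le>n. cf F i (cf G (n - i) x))"

definition ten :: "('b, 'k) mor \<Rightarrow> ('b, 'k) mor \<Rightarrow> ('b, 'k) mor" (infixr "\<otimes>" 75) where
  "F \<otimes> G = Mor (src F + src G) (tgt F + tgt G)
    (\<lambda>n x. \<Sum>i\<le>n. tm (src F) (src G) (cf F i) (cf G (n - i)) x)"

definition ord0 where
  "ord0 p q f = Mor p q (\<lambda>n. if n = 0 then restrict0 (T B p) f else (\<lambda>x. 0))"

definition I where "I n = ord0 n n (\<lambda>x. x)"

definition swp where
  "swp p q = ord0 (p + q) (q + p) (\<lambda>x. tlift x (\<lambda>bs. tens s (drop p bs @ take p bs)))"

lemma arr_hlin: "arr F \<Longrightarrow> hlin (src F) (tgt F) (- int n) (cf F n)"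
  by (simp add: arr_def)

lemma arr_lin: "arr F \<Longrightarrow> lin s (src F) (tgt F) (cf F n)"
  using hlin_lin[OF arr_hlin] .

lemma arr_lin': "arr F \<Longrightarrow> p = src F \<Longrightarrow> q = tgt F \<Longrightarrow> lin s p q (cf F n)"
  by (simp add: arr_lin)

lemma arr_outside: "arr F \<Longrightarrow> x \<notin> T B (src F) \<Longrightarrow> cf F n x = 0"
  by (simp add: arr_def)

lemma arr_in: "arr F \<Longrightarrow> x \<in> T B (src F) \<Longrightarrow> p = tgt F \<Longrightarrow> cf F n x \<in> T B p"
  using lin_in[OF arr_lin] by blast

lemma arr_zero [simp]: "arr F \<Longrightarrow> cf F n 0 = 0"
  using lin_zero[OF arr_lin] .

lemma src_comp [simp]: "src (F \<cdot> G) = src G"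
  and tgt_comp [simp]: "tgt (F \<cdot> G) = tgt F"
  and src_ten [simp]: "src (F \<otimes> G) = src F + src G"
  and tgt_ten [simp]: "tgt (F \<otimes> G) = tgt F + tgt G"
  and src_ord0 [simp]: "src (ord0 p q f) = p"
  and tgt_ord0 [simp]: "tgt (ord0 p q f) = q"
  and src_I [simp]: "src (I p) = p"
  and tgt_I [simp]: "tgt (I p) = p"
  and src_swp [simp]: "src (swp p q) = p + q"
  and tgt_swp [simp]: "tgt (swp p q) = q + p"
  by (auto simp: comp_def ten_def ord0_def I_def swp_def)

lemma cf_comp: "cf (F \<cdot> G) n x = (\<Sum>i\<le>n. cf F i (cf G (n - i) x))"
  by (simp add: comp_def)

lemma cf_ten: "cf (F \<otimes> G) n x = (\<Sum>i\<le>n. tm (src F) (src G) (cf F i) (cf G (n - i)) x)"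
  by (simp add: ten_def)

lemma cf_ord0: "cf (ord0 p q f) n x = (if n = 0 \<and> x \<in> T B p then f x else 0)"
  by (simp add: ord0_def restrict0_def)

lemma cf_I: "cf (I p) n x = (if n = 0 \<and> x \<in> T B p then x else 0)"
  by (simp add: I_def cf_ord0)

lemma arr_comp [simp]: "arr F \<Longrightarrow> arr G \<Longrightarrow> tgt G = src F \<Longrightarrow> arr (F \<cdot> G)"
  unfolding arr_def[of "F \<cdot> G"]
proof (intro allI conjI impI)
  fix n assume a: "arr F" "arr G" "tgt G = src F"
  show "hlin (src (F \<cdot> G)) (tgt (F \<cdot> G)) (- int n) (cf (F \<cdot> G) n)"
    unfolding cf_comp[abs_def] src_comp tgt_comp
  proof (rule hlin_summed)
    fix i assume "i \<in> {..n}"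
    then show "hlin (src G) (tgt F) (- int n) (\<lambda>x. cf F i (cf G (n - i) x))"
      using hlin_comp[OF arr_hlin[OF a(2), of "n - i", unfolded a(3)] arr_hlin[OF a(1), of i]] by auto
  qed
next
  fix n x assume a: "arr F" "arr G" "tgt G = src F" "x \<notin> T B (src (F \<cdot> G))"
  then show "cf (F \<cdot> G) n x = 0" by (simp add: cf_comp arr_outside)
qed

lemma arr_ten [simp]: "arr F \<Longrightarrow> arr G \<Longrightarrow> arr (F \<otimes> G)"
  unfolding arr_def[of "F \<otimes> G"]
proof (intro allI conjI impI)
  fix n assume a: "arr F" "arr G"
  show "hlin (src (F \<otimes> G)) (tgt (F \<otimes> G)) (- int n) (cf (F \<otimes> G) n)"
    unfolding cf_ten[abs_def] src_ten tgt_ten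
    by (rule hlin_summed) (rule hlin_tm[OF arr_hlin[OF a(1)] arr_hlin[OF a(2)] refl refl], auto)
next
  fix n x assume a: "arr F" "arr G" "x \<notin> T B (src (F \<otimes> G))"
  then show "cf (F \<otimes> G) n x = 0" by (simp add: cf_ten tm_outside)
qed

lemma arr_ord0 [simp]: "hlin p q 0 f \<Longrightarrow> arr (ord0 p q f)"
  by (auto simp: arr_def ord0_def hlin_restrict0 hlin_zero) (simp add: restrict0_def)

lemma arr_I [simp]: "arr (I p)"
  by (simp add: I_def hlin_id)

lemma mor_eqI:
  assumes "arr F" "arr G" "src F = src G" "tgt F = tgt G"
    and "\<And>n x. x \<in> T B (src G) \<Longrightarrow> cf F n x = cf G n x"
  shows "F = G"
proof (rule mor.expand, intro conjI)
  show "cf F = cf G"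
    by (intro ext) (metis assms(1-3,5) arr_outside)
qed fact+

text \<open>As simp rules, this and \<open>ten_assoc\<close> bracket to the right. Proofs that need
  another grouping, for example to apply \<open>interchange\<close> to a block, delete one of
  them.\<close>

lemma comp_assoc [simp]:
  assumes "arr F" "arr G" "arr H" "tgt G = src F" "tgt H = src G"
  shows "(F \<cdot> G) \<cdot> H = F \<cdot> G \<cdot> H"
proof (rule mor_eqI)
  fix n x assume x: "x \<in> T B (src (F \<cdot> G \<cdot> H))"
  have "cf (F \<cdot> G \<cdot> H) n x = (\<Sum>i\<le>n. cf F i (\<Sum>j\<le>n - i. cf G j (cf H (n - i - j) x)))"
    by (simp add: cf_comp)
  also have "\<dots> = (\<Sum>i\<le>n. \<Sum>j\<le>n - i. cf F i (cf G j (cf H (n - i - j) x)))"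
    by (rule sum.cong[OF refl], rule lin_sum[OF arr_lin[OF assms(1)]])
      (use x assms in \<open>auto intro!: arr_in\<close>)
  also have "\<dots> = cf ((F \<cdot> G) \<cdot> H) n x"
    unfolding cf_comp
    by (rule sum_triangle[of "\<lambda>i j k. cf F i (cf G j (cf H k x))", symmetric])
  finally show "cf ((F \<cdot> G) \<cdot> H) n x = cf (F \<cdot> G \<cdot> H) n x" ..
qed (use assms in auto)

lemma ten_assoc [simp]:
  assumes "arr F" "arr G" "arr H"
  shows "(F \<otimes> G) \<otimes> H = F \<otimes> G \<otimes> H"
proof (rule mor_eqI)
  fix n x assume x: "x \<in> T B (src (F \<otimes> G \<otimes> H))"
  note l = assms[THEN arr_lin]
  note fg = lin_tm[OF l(1,2) refl refl] and gh = lin_tm[OF l(2,3) refl refl]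
  let ?p = "src F" and ?q = "src G" and ?r = "src H"
  have "cf ((F \<otimes> G) \<otimes> H) n x =
    (\<Sum>i\<le>n. tm (?p + ?q) ?r (\<lambda>x. \<Sum>j\<le>i. tm ?p ?q (cf F j) (cf G (i - j)) x) (cf H (n - i)) x)"
    by (simp add: cf_ten cf_ten[abs_def])
  also have "\<dots> = (\<Sum>i\<le>n. \<Sum>j\<le>i. tm (?p + ?q) ?r (tm ?p ?q (cf F j) (cf G (i - j))) (cf H (n - i)) x)"
    by (intro sum.cong refl tm_sum_left[OF fg l(3)])
  also have "\<dots> = (\<Sum>i\<le>n. \<Sum>j\<le>n - i. tm (?p + ?q) ?r (tm ?p ?q (cf F i) (cf G j)) (cf H (n - i - j)) x)"
    by (rule sum_triangle[of "\<lambda>i j k. tm (?p + ?q) ?r (tm ?p ?q (cf F i) (cf G j)) (cf H k) x"])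
  also have "\<dots> = (\<Sum>i\<le>n. \<Sum>j\<le>n - i. tm ?p (?q + ?r) (cf F i) (tm ?q ?r (cf G j) (cf H (n - i - j))) x)"
    by (simp add: tm_assoc[OF l])
  also have "\<dots> = (\<Sum>i\<le>n. tm ?p (?q + ?r) (cf F i) (\<lambda>x. \<Sum>j\<le>n - i. tm ?q ?r (cf G j) (cf H (n - i - j)) x) x)"
    by (intro sum.cong refl tm_sum_right[OF l(1) gh, symmetric])
  also have "\<dots> = cf (F \<otimes> G \<otimes> H) n x"
    by (simp add: cf_ten cf_ten[abs_def])
  finally show "cf ((F \<otimes> G) \<otimes> H) n x = cf (F \<otimes> G \<otimes> H) n x" .
qed (use assms in auto)

text \<open>The composite of tensors groups the four indices by stage, the tensor of composites
  groups them by factor. The two groupings differ by the middle indices, hence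
  \<open>sum_quad_swap\<close>.\<close>

lemma interchange:
  assumes "arr F" "arr G" "arr F'" "arr G'" "tgt F' = src F" "tgt G' = src G"
  shows "(F \<otimes> G) \<cdot> (F' \<otimes> G') = (F \<cdot> F') \<otimes> (G \<cdot> G')"
proof (rule mor_eqI)
  fix n x assume x: "x \<in> T B (src ((F \<cdot> F') \<otimes> (G \<cdot> G')))"
  let ?p = "src F" and ?q = "src G" and ?p' = "src F'" and ?q' = "src G'"
  note l = arr_lin[OF assms(1)] arr_lin[OF assms(2)] arr_lin'[OF assms(3) refl assms(5)[symmetric]]
    arr_lin'[OF assms(4) refl assms(6)[symmetric]]
  note l13 = lin_comp[OF l(3,1)] and l24 = lin_comp[OF l(4,2)]
  have "cf ((F \<otimes> G) \<cdot> (F' \<otimes> G')) n x =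
    (\<Sum>i\<le>n. \<Sum>a\<le>i. tm ?p ?q (cf F a) (cf G (i - a)) (\<Sum>b\<le>n - i. tm ?p' ?q' (cf F' b) (cf G' (n - i - b)) x))"
    by (simp add: cf_comp cf_ten)
  also have "\<dots> = (\<Sum>i\<le>n. \<Sum>a\<le>i. \<Sum>b\<le>n - i. tm ?p ?q (cf F a) (cf G (i - a)) (tm ?p' ?q' (cf F' b) (cf G' (n - i - b)) x))"
    using x by (intro sum.cong refl lin_sum[OF lin_tm[OF l(1,2) refl refl]] lin_in[OF lin_tm[OF l(3,4) refl refl]]) simp
  also have "\<dots> = (\<Sum>i\<le>n. \<Sum>a\<le>i. \<Sum>b\<le>n - i.
      tm ?p' ?q' (\<lambda>x. cf F a (cf F' b x)) (\<lambda>x. cf G (i - a) (cf G' (n - i - b) x)) x)"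
    by (simp add: tm_comp[OF l(3,4,1,2)])
  also have "\<dots> = (\<Sum>i\<le>n. \<Sum>a\<le>i. \<Sum>b\<le>n - i.
      tm ?p' ?q' (\<lambda>x. cf F a (cf F' (i - a) x)) (\<lambda>x. cf G b (cf G' (n - i - b) x)) x)"
    by (rule sum_quad_swap[of "\<lambda>a c b d. tm ?p' ?q' (\<lambda>x. cf F a (cf F' b x)) (\<lambda>x. cf G c (cf G' d x)) x"])
  also have "\<dots> = (\<Sum>i\<le>n. tm ?p' ?q' (\<lambda>x. \<Sum>a\<le>i. cf F a (cf F' (i - a) x))
      (\<lambda>x. \<Sum>b\<le>n - i. cf G b (cf G' (n - i - b) x)) x)"
    by (rule sum.cong[OF refl], subst tm_sum_left[OF l13 lin_summed[OF l24]], subst tm_sum_right[OF l13 l24]) (rule refl)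
  also have "\<dots> = cf ((F \<cdot> F') \<otimes> (G \<cdot> G')) n x"
    by (simp add: cf_ten cf_comp[abs_def])
  finally show "cf ((F \<otimes> G) \<cdot> (F' \<otimes> G')) n x = cf ((F \<cdot> F') \<otimes> (G \<cdot> G')) n x" .
qed (use assms in auto)

lemma sum_only_first:
  fixes h :: "nat \<Rightarrow> 'a::comm_monoid_add"
  assumes "\<And>i. 0 < i \<Longrightarrow> i \<le> n \<Longrightarrow> h i = 0"
  shows "(\<Sum>i\<le>n. h i) = h 0"
proof -
  have "(\<Sum>i\<le>n. h i) = (\<Sum>i\<in>{0}. h i)"
    by (rule sum.mono_neutral_right) (use assms in auto)
  then show ?thesis by simp
qed

lemma sum_only_last:
  fixes h :: "nat \<Rightarrow> 'a::comm_monoid_add"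
  assumes "\<And>i. i < n \<Longrightarrow> h i = 0"
  shows "(\<Sum>i\<le>n. h i) = h n"
proof -
  have "(\<Sum>i\<le>n. h i) = (\<Sum>i\<in>{n}. h i)"
    by (rule sum.mono_neutral_right) (use assms in auto)
  then show ?thesis by simp
qed

lemma cf_ord0_comp:
  assumes "arr F" "p = tgt F" "x \<in> T B (src F)"
  shows "cf (ord0 p q f \<cdot> F) n x = f (cf F n x)"
  unfolding cf_comp by (subst sum_only_first) (use assms in \<open>auto simp: cf_ord0 arr_in\<close>)

lemma cf_comp_ord0:
  assumes "arr F" "src F = q" "x \<in> T B p"
  shows "cf (F \<cdot> ord0 p q f) n x = cf F n (f x)"
  unfolding cf_comp by (subst sum_only_last) (use assms in \<open>auto simp: cf_ord0\<close>)

lemma comp_I [simp]: "arr F \<Longrightarrow> n = src F \<Longrightarrow> F \<cdot> I n = F"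
  by (rule mor_eqI) (auto simp: I_def cf_comp_ord0 hlin_id)

lemma I_comp [simp]: "arr F \<Longrightarrow> n = tgt F \<Longrightarrow> I n \<cdot> F = F"
  by (rule mor_eqI) (auto simp: I_def cf_ord0_comp hlin_id)

lemma tm_I: "tm p q (\<lambda>x. x) (\<lambda>x. x) = restrict0 (T B (p + q)) (\<lambda>x. x)"
  by (rule tm_eqI[where n' = "p + q", symmetric, OF _ _ lin_id(2) lin_id(2)])
   (auto simp: lin_restrict0 lin_id, auto simp: restrict0_def tprod_in[OF _ _ refl])

lemma tm_zero_left: "lin s q q' g \<Longrightarrow> tm p q (\<lambda>x. 0) g = (\<lambda>x. 0)"
  by (rule tm_eqI[symmetric, OF _ _ lin_zero_map(2)]) (auto intro: lin_zero_map)

lemma tm_zero_right: "lin s p p' f \<Longrightarrow> tm p q f (\<lambda>x. 0) = (\<lambda>x. 0)"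
  by (rule tm_eqI[symmetric, OF _ _ _ lin_zero_map(2)])
    (auto simp: lin_zero_map tprod_zero_right[OF lin_in])

lemma cf_ord0_zero: "cf (ord0 p q f) 0 = restrict0 (T B p) f"
  and cf_ord0_pos: "n > 0 \<Longrightarrow> cf (ord0 p q f) n = (\<lambda>x. 0)"
  by (auto simp: ord0_def)

lemma tm_restrict0: "tm p q (restrict0 (T B p) f) (restrict0 (T B q) g) = tm p q f g"
  by (rule tm_cong) (auto simp: restrict0_def)

lemma ten_ord0:
  assumes "hlin p p' 0 f" "hlin q q' 0 g"
  shows "ord0 p p' f \<otimes> ord0 q q' g = ord0 (p + q) (p' + q') (tm p q f g)"
proof (rule mor_eqI)
  fix n x assume "x \<in> T B (src (ord0 (p + q) (p' + q') (tm p q f g)))"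
  then have x: "x \<in> T B (p + q)" by simp
  have "cf (ord0 p p' f \<otimes> ord0 q q' g) n x = tm p q (cf (ord0 p p' f) 0) (cf (ord0 q q' g) n) x"
    unfolding cf_ten src_ord0
    by (subst sum_only_first) (use assms in \<open>auto simp: cf_ord0_pos tm_zero_left[OF arr_lin', OF arr_ord0]\<close>)
  also have "\<dots> = (if n = 0 then tm p q f g x else 0)"
    using assms by (auto simp: cf_ord0_zero cf_ord0_pos tm_restrict0 tm_zero_right[of p p'] lin_restrict0)
  finally show "cf (ord0 p p' f \<otimes> ord0 q q' g) n x = cf (ord0 (p + q) (p' + q') (tm p q f g)) n x"
    using x by (simp add: cf_ord0)
qed (use assms hlin_tm[OF assms refl refl] in auto)

lemma ord0_eqI:
  assumes "hlin p q 0 f" "hlin p q 0 g" "\<And>bs. length bs = p \<Longrightarrow> f (tens s bs) = g (tens s bs)"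
  shows "ord0 p q f = ord0 p q g"
proof (rule mor_eqI)
  fix n x assume "x \<in> T B (src (ord0 p q g))"
  then show "cf (ord0 p q f) n x = cf (ord0 p q g) n x"
    using lin_eqI[OF hlin_lin[OF assms(1)] hlin_lin[OF assms(2)] assms(3)] by (simp add: cf_ord0)
qed (use assms in auto)

lemma I_ten [simp]: "I p \<otimes> I q = I (p + q)"
  unfolding I_def ten_ord0[OF hlin_id(1) hlin_id(1)] tm_I
  by (rule ord0_eqI) (simp_all add: hlin_restrict0 hlin_id, simp add: restrict0_def)

lemma I0_ten [simp]:
  assumes "arr F" shows "I 0 \<otimes> F = F"
proof (rule mor_eqI)
  fix n x assume x: "x \<in> T B (src F)"
  have "cf (I 0 \<otimes> F) n x = tm 0 (src F) (cf (I 0) 0) (cf F n) x"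
    unfolding cf_ten src_I
    by (subst sum_only_first) (auto simp: I_def cf_ord0_pos tm_zero_left[OF arr_lin[OF assms]])
  also have "\<dots> = tm 0 (src F) (\<lambda>x. x) (cf F n) x"
    by (rule fun_cong[OF tm_cong]) (auto simp: cf_I)
  also have "\<dots> = cf F n x"
  proof -
    have "tm 0 (src F) (\<lambda>x. x) (cf F n) (tprod s (tens s []) x) = tprod s (tens s []) (cf F n x)"
      by (rule tm_tprod[OF lin_id(2) arr_lin[OF assms]]) (use x in auto)
    then show ?thesis
      using x arr_in[OF assms x refl] by (simp add: tprod_nil_left[of _ s "src F"] tprod_nil_left[of _ s "tgt F"])
  qed
  finally show "cf (I 0 \<otimes> F) n x = cf F n x" .
qed (use assms in auto)

lemma ten_I0 [simp]:
  assumes "arr F" shows "F \<otimes> I 0 = F"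
proof (rule mor_eqI)
  fix n x assume x: "x \<in> T B (src F)"
  have "cf (F \<otimes> I 0) n x = tm (src F) 0 (cf F n) (cf (I 0) 0) x"
    unfolding cf_ten src_I
    by (subst sum_only_last) (auto simp: I_def cf_ord0_pos tm_zero_right[OF arr_lin[OF assms]])
  also have "\<dots> = tm (src F) 0 (cf F n) (\<lambda>x. x) x"
    by (rule fun_cong[OF tm_cong]) (auto simp: cf_I)
  also have "\<dots> = cf F n x"
  proof -
    have "tm (src F) 0 (cf F n) (\<lambda>x. x) (tprod s x (tens s [])) = tprod s (cf F n x) (tens s [])"
      by (rule tm_tprod[OF arr_lin[OF assms] lin_id(2)]) (use x in auto)
    then show ?thesis
      using x arr_in[OF assms x refl] by (simp add: tprod_nil_right[of _ s "src F"] tprod_nil_right[of _ s "tgt F"])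
  qed
  finally show "cf (F \<otimes> I 0) n x = cf F n x" .
qed (use assms in auto)

lemma hlin_tlift:
  assumes m: "multilinear s tscale UNIV p F" and "\<And>bs. length bs = p \<Longrightarrow> F bs \<in> T B q"
    and "\<And>bs ns e. length bs = p \<Longrightarrow> length ns = p \<Longrightarrow> (\<And>i. i < p \<Longrightarrow> bs ! i \<in> grade B (ns ! i)) \<Longrightarrow>
      F bs \<in> tgrade B q UNIV (int (sum_list ns) + d)"
  shows "hlin p q d (\<lambda>x. tlift x F)"
proof (rule hlinI)
  show "lin s p q (\<lambda>x. tlift x F)" by (rule lin_tlift[OF assms(1,2)])
  fix bs ns e assume a: "length bs = p" "length ns = p" "\<And>i. i < p \<Longrightarrow> bs ! i \<in> grade B (ns ! i)"
    "int (sum_list ns) = e"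
  have "tlift (tens s bs) F = F bs" by (rule tlift_tens) (use m a in simp)
  then show "tlift (tens s bs) F \<in> tgrade B q UNIV (e + d)" using assms(3)[of bs ns] a by auto
qed

section \<open>The symmetry of the monoidal category\<close>

lemma multilinear_swap: "multilinear s tscale UNIV (p + q) (\<lambda>bs. tens s (drop p bs @ take p bs))"
proof (rule multilinearI)
  fix bs :: "'b list" and i x y c assume a: "length bs = p + q" "i < p + q"
  \<comment> \<open>The position to which the swap carries entry i.\<close>
  let ?j = "if i < p then i + q else i - p"
  have *: "drop p (bs[i := z]) @ take p (bs[i := z]) = (drop p bs @ take p bs)[?j := z]" for z
    using a by (auto simp: take_update_swap drop_update_swap list_update_beyond list_update_append)
  have l: "length (drop p bs @ take p bs) = p + q" "?j < p + q" using a by auto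
  show "tens s (drop p (bs[i := x + y]) @ take p (bs[i := x + y])) =
    tens s (drop p (bs[i := x]) @ take p (bs[i := x])) + tens s (drop p (bs[i := y]) @ take p (bs[i := y]))"
    unfolding * by (rule tens_update_add[OF l])
  show "tens s (drop p (bs[i := s c x]) @ take p (bs[i := s c x])) =
    tscale c (tens s (drop p (bs[i := x]) @ take p (bs[i := x])))"
    unfolding * by (rule tens_update_scale[OF l])
qed

lemma hlin_swap: "hlin (p + q) (q + p) 0 (\<lambda>x. tlift x (\<lambda>bs. tens s (drop p bs @ take p bs)))"
proof (rule hlin_tlift[OF multilinear_swap])
  fix bs :: "'b list" and ns assume a: "length bs = p + q" "length ns = p + q"
    "\<And>i. i < p + q \<Longrightarrow> bs ! i \<in> grade B (ns ! i)"
  have "sum_list (drop p ns @ take p ns) = sum_list (take p ns @ drop p ns)" by (simp only: sum_list_append add.commute)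
  then show "tens s (drop p bs @ take p bs) \<in> tgrade B (q + p) UNIV (int (sum_list ns) + 0)"
    by (intro tgrade_tens[of _ _ "drop p ns @ take p ns"]) (use a in \<open>auto simp: nth_append\<close>)
qed auto

lemma arr_swp [simp]: "arr (swp p q)"
  by (simp add: swp_def hlin_swap)

lemma swap_tprod:
  assumes x: "x \<in> T B p" and y: "y \<in> T B q"
  shows "tlift (tprod s x y) (\<lambda>bs. tens s (drop p bs @ take p bs)) = tprod s y x"
proof (rule lin_eqI[OF _ _ _ x, of "q + p" _ "q + p"])
  let ?S = "\<lambda>x. tlift x (\<lambda>bs. tens s (drop p bs @ take p bs))"
  note S = hlin_lin[OF hlin_swap[of p q]]
  show "lin s p (q + p) (\<lambda>x. ?S (tprod s x y))"
    by (rule lin_comp[OF lin_tprod_left[OF y refl] S])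
  show "lin s p (q + p) (\<lambda>x. tprod s y x)"
    by (rule lin_tprod_right[OF y refl])
  fix as :: "'b list" assume as: "length as = p"
  show "?S (tprod s (tens s as) y) = tprod s y (tens s as)"
  proof (rule lin_eqI[OF _ _ _ y, of "q + p" _ "q + p"])
    show "lin s q (q + p) (\<lambda>y. ?S (tprod s (tens s as) y))"
      by (rule lin_comp[OF lin_tprod_right[OF _ refl] S]) (simp add: as)
    show "lin s q (q + p) (\<lambda>y. tprod s y (tens s as))"
      by (rule lin_tprod_left[OF _ refl]) (simp add: as)
    fix bs :: "'b list" assume "length bs = q"
    then show "?S (tprod s (tens s as) (tens s bs)) = tprod s (tens s bs) (tens s as)"
      using as multilinear_swap[of p q] by (simp add: tlift_tens)
  qed
qed

lemma swp_natural:
  assumes F: "arr F" and G: "arr G"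
  shows "swp (tgt F) (tgt G) \<cdot> (F \<otimes> G) = (G \<otimes> F) \<cdot> swp (src F) (src G)"
proof (rule mor_eqI)
  fix n x assume "x \<in> T B (src ((G \<otimes> F) \<cdot> swp (src F) (src G)))"
  then have x: "x \<in> T B (src F + src G)" by simp
  let ?S = "\<lambda>p q x. tlift x (\<lambda>bs. tens s (drop p bs @ take p bs))"
  note S = hlin_lin[OF hlin_swap]
  note fg = lin_tm[OF arr_lin[OF F] arr_lin[OF G] refl refl] and gf = lin_tm[OF arr_lin[OF G] arr_lin[OF F] refl refl]
  have *: "?S (tgt F) (tgt G) (tm (src F) (src G) (cf F i) (cf G j) x) =
      tm (src G) (src F) (cf G j) (cf F i) (?S (src F) (src G) x)" for i j
    by (rule lin_eqI_tprod[OF lin_comp[OF fg S] lin_comp[OF S gf] refl _ x])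
      (simp add: swap_tprod[OF arr_in[OF F _ refl] arr_in[OF G _ refl]] swap_tprod tm_tprod[OF arr_lin[OF F] arr_lin[OF G]]
        tm_tprod[OF arr_lin[OF G] arr_lin[OF F]])
  have "cf (swp (tgt F) (tgt G) \<cdot> (F \<otimes> G)) n x = ?S (tgt F) (tgt G) (cf (F \<otimes> G) n x)"
    unfolding swp_def by (rule cf_ord0_comp) (use F G x in auto)
  also have "\<dots> = (\<Sum>i\<le>n. ?S (tgt F) (tgt G) (tm (src F) (src G) (cf F i) (cf G (n - i)) x))"
    unfolding cf_ten by (rule lin_sum[OF S]) (rule lin_in[OF fg x])
  also have "\<dots> = (\<Sum>i\<le>n. tm (src G) (src F) (cf G (n - i)) (cf F i) (?S (src F) (src G) x))"
    by (simp only: *)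
  \<comment> \<open>The swap exchanges the factors, so the Cauchy sum has to be run
    backwards.\<close>
  also have "\<dots> = (\<Sum>i\<le>n. tm (src G) (src F) (cf G i) (cf F (n - i)) (?S (src F) (src G) x))"
    by (rule sum.reindex_bij_witness[of _ "\<lambda>i. n - i" "\<lambda>i. n - i"]) auto
  also have "\<dots> = cf ((G \<otimes> F) \<cdot> swp (src F) (src G)) n x"
    unfolding swp_def by (subst cf_comp_ord0) (use F G x in \<open>auto simp: cf_ten\<close>)
  finally show "cf (swp (tgt F) (tgt G) \<cdot> (F \<otimes> G)) n x = cf ((G \<otimes> F) \<cdot> swp (src F) (src G)) n x" .
qed (use assms in auto)

section \<open>Congruence modulo powers of t and the leading difference of two series\<close>

definition eqv :: "nat \<Rightarrow> ('b, 'k) mor \<Rightarrow> ('b, 'k) mor \<Rightarrow> bool" where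
  "eqv n F G \<longleftrightarrow> src F = src G \<and> tgt F = tgt G \<and> (\<forall>i<n. cf F i = cf G i)"

definition dif :: "nat \<Rightarrow> ('b, 'k) mor \<Rightarrow> ('b, 'k) mor \<Rightarrow> ('b, 'k) tensor \<Rightarrow> ('b, 'k) tensor" where
  "dif n F G x = cf F n x - cf G n x"

lemma eqv_refl [simp]: "eqv n F F"
  by (simp add: eqv_def)

lemma eqv_sym: "eqv n F G \<Longrightarrow> eqv n G F"
  by (simp add: eqv_def)

lemma eqv_trans: "eqv n F G \<Longrightarrow> eqv n G H \<Longrightarrow> eqv n F H"
  by (simp add: eqv_def)

lemma eqv_cf0: "eqv n F G \<Longrightarrow> 0 < n \<Longrightarrow> cf F 0 = cf G 0"
  by (simp add: eqv_def)

lemma dif_refl [simp]: "dif n F F = (\<lambda>x. 0)"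
  by (simp add: dif_def fun_eq_iff)

lemma eqv_comp [intro]: "eqv n F F' \<Longrightarrow> eqv n G G' \<Longrightarrow> eqv n (F \<cdot> G) (F' \<cdot> G')"
  by (auto simp: eqv_def cf_comp[abs_def] intro!: sum.cong)

lemma eqv_ten [intro]: "eqv n F F' \<Longrightarrow> eqv n G G' \<Longrightarrow> eqv n (F \<otimes> G) (F' \<otimes> G')"
proof -
  assume a: "eqv n F F'" "eqv n G G'"
  have "cf (F \<otimes> G) i x = cf (F' \<otimes> G') i x" if "i < n" for i x
  proof -
    have "cf F j = cf F' j \<and> cf G (i - j) = cf G' (i - j)" if "j \<le> i" for j
      using a that \<open>i < n\<close> by (auto simp: eqv_def)
    then show ?thesis using a by (simp add: cf_ten eqv_def)
  qed
  then show ?thesis using a by (auto simp: eqv_def fun_eq_iff)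
qed

text \<open>For the difference of two Cauchy products whose factors agree below n, the summands with
  0 < i < n cancel, because both i and n - i lie below n. The two ends that remain are the terms of
  the Leibniz rule.\<close>

lemma sum_first_last:
  fixes h :: "nat \<Rightarrow> 'a::comm_monoid_add"
  assumes "0 < n" "\<And>i. 0 < i \<Longrightarrow> i < n \<Longrightarrow> h i = 0"
  shows "(\<Sum>i\<le>n. h i) = h 0 + h n"
proof -
  have "(\<Sum>i\<le>n. h i) = (\<Sum>i\<in>{0, n}. h i)"
    by (rule sum.mono_neutral_right) (use assms in auto)
  then show ?thesis using assms(1) by simp
qed

text \<open>Passing to the first coefficient in which two series may differ is a derivation.\<close>

lemma dif_comp:
  assumes a: "arr F" "arr F'" "arr G" "arr G'" "tgt G = src F" and e: "eqv n F F'" "eqv n G G'"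
    and n: "0 < n" and x: "x \<in> T B (src G)"
  shows "dif n (F \<cdot> G) (F' \<cdot> G') x = dif n F F' (cf G 0 x) + cf F 0 (dif n G G' x)"
proof -
  have "dif n (F \<cdot> G) (F' \<cdot> G') x = (\<Sum>i\<le>n. cf F i (cf G (n - i) x) - cf F' i (cf G' (n - i) x))"
    by (simp add: dif_def cf_comp sum_subtractf)
  also have "\<dots> = (cf F 0 (cf G n x) - cf F' 0 (cf G' n x)) + (cf F n (cf G 0 x) - cf F' n (cf G' 0 x))"
    by (subst sum_first_last[OF n]) (use e in \<open>auto simp: eqv_def\<close>)
  also have "cf F' 0 = cf F 0" using e n by (simp add: eqv_def)
  also have "cf G' 0 = cf G 0" using e n by (simp add: eqv_def)
  also have "cf F 0 (cf G n x) - cf F 0 (cf G' n x) = cf F 0 (dif n G G' x)"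
    unfolding dif_def by (rule lin_diff[OF arr_lin[OF a(1)], symmetric])
      (use a e x in \<open>auto simp: eqv_def intro!: arr_in\<close>)
  finally show ?thesis by (simp add: dif_def)
qed

lemma dif_ten:
  assumes a: "arr F" "arr F'" "arr G" "arr G'" and e: "eqv n F F'" "eqv n G G'" and n: "0 < n"
  shows "dif n (F \<otimes> G) (F' \<otimes> G') x =
    tm (src F) (src G) (dif n F F') (cf G 0) x + tm (src F) (src G) (cf F 0) (dif n G G') x"
proof -
  let ?tm = "tm (src F) (src G)"
  have [simp]: "src F' = src F" "src G' = src G" "tgt F' = tgt F" "tgt G' = tgt G" using e by (auto simp: eqv_def)
  note l = arr_lin[OF a(1)] arr_lin'[OF a(2), of "src F" "tgt F"] arr_lin[OF a(3)] arr_lin'[OF a(4), of "src G" "tgt G"]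
  have "dif n (F \<otimes> G) (F' \<otimes> G') x = (\<Sum>i\<le>n. ?tm (cf F i) (cf G (n - i)) x - ?tm (cf F' i) (cf G' (n - i)) x)"
    by (simp add: dif_def cf_ten sum_subtractf)
  also have "\<dots> = (?tm (cf F 0) (cf G n) x - ?tm (cf F' 0) (cf G' n) x) + (?tm (cf F n) (cf G 0) x - ?tm (cf F' n) (cf G' 0) x)"
    by (subst sum_first_last[OF n]) (use e in \<open>auto simp: eqv_def\<close>)
  also have "cf F' 0 = cf F 0" using e n by (simp add: eqv_def)
  also have "cf G' 0 = cf G 0" using e n by (simp add: eqv_def)
  also have "?tm (cf F 0) (cf G n) x - ?tm (cf F 0) (cf G' n) x = ?tm (cf F 0) (dif n G G') x"
    unfolding dif_def[abs_def] by (rule tm_minus_right[symmetric, OF l(1,3)]) (rule l(4), auto)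
  also have "?tm (cf F n) (cf G 0) x - ?tm (cf F' n) (cf G 0) x = ?tm (dif n F F') (cf G 0) x"
    unfolding dif_def[abs_def] by (rule tm_minus_left[symmetric, OF l(1) _ l(3)]) (rule l(2), auto)
  finally show ?thesis by (simp only: add.commute)
qed

lemma hlin_dif: "arr F \<Longrightarrow> arr G \<Longrightarrow> src F = src G \<Longrightarrow> tgt F = tgt G \<Longrightarrow> p = src G \<Longrightarrow> q = tgt G \<Longrightarrow>
    hlin p q (- int n) (dif n F G)"
  unfolding dif_def[abs_def] using arr_hlin[of F n] arr_hlin[of G n] by (intro hlin_minus) auto

end

text \<open>Arities are kept as the numeral 1 and not as \<open>Suc 0\<close>, so that the rules
  about \<open>I 1\<close> and sums of arities match.\<close>

declare One_nat_def [simp del]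

lemma length1_conv: "length xs = 1 \<longleftrightarrow> (\<exists>a. xs = [a])"
  and length2_conv: "length xs = 2 \<longleftrightarrow> (\<exists>a b. xs = [a, b])"
  and length3_conv: "length xs = 3 \<longleftrightarrow> (\<exists>a b c. xs = [a, b, c])"
  and length4_conv: "length xs = 4 \<longleftrightarrow> (\<exists>a b c d. xs = [a, b, c, d])"
  and length6_conv: "length xs = 6 \<longleftrightarrow> (\<exists>a b c d e f. xs = [a, b, c, d, e, f])"
  by (auto simp: eval_nat_numeral One_nat_def length_Suc_conv)

lemma take_drop_1 [simp]: "take 1 (x # xs) = [x]" "drop 1 (x # xs) = xs"
  by (simp_all add: One_nat_def)

lemma tlift_tens_at: "multilinear s tscale UNIV n F \<Longrightarrow> length bs = n \<Longrightarrow> tlift (tens s bs) F = F bs"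
  by (simp add: tlift_tens)

context graded_bialgebra
begin

text \<open>Composites are bracketed to the right, so \<open>interchange\<close> does not match in
  the middle of a chain; H is the rest of the chain.\<close>

lemma interchange':
  assumes "arr F" "arr G" "arr F'" "arr G'" "tgt F' = src F" "tgt G' = src G" "arr H" "tgt H = src F' + src G'"
  shows "(F \<otimes> G) \<cdot> (F' \<otimes> G') \<cdot> H = ((F \<cdot> F') \<otimes> (G \<cdot> G')) \<cdot> H"
  using assms by (simp add: interchange comp_assoc[symmetric] del: comp_assoc)

lemma cf0_comp: "cf (F \<cdot> G) 0 x = cf F 0 (cf G 0 x)"
  by (simp add: cf_comp)

lemma cf0_ten: "cf (F \<otimes> G) 0 = tm (src F) (src G) (cf F 0) (cf G 0)"
  by (rule ext) (simp add: cf_ten)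

lemma tm_tens: "lin s p p' f \<Longrightarrow> lin s q q' g \<Longrightarrow> length bs = p + q \<Longrightarrow>
    tm p q f g (tens s bs) = tprod s (f (tens s (take p bs))) (g (tens s (drop p bs)))"
  by (simp add: tm_def restrict0_def tmap_tens)

lemma cf0_ten_tens: "arr F \<Longrightarrow> arr G \<Longrightarrow> length bs = src F + src G \<Longrightarrow>
    cf (F \<otimes> G) 0 (tens s bs) = tprod s (cf F 0 (tens s (take (src F) bs))) (cf G 0 (tens s (drop (src F) bs)))"
  unfolding cf0_ten by (rule tm_tens[OF arr_lin arr_lin])

lemma cf0_I: "x \<in> T B p \<Longrightarrow> cf (I p) 0 x = x"
  by (simp add: cf_I)

lemma cf0_swp: "length bs = p + q \<Longrightarrow> cf (swp p q) 0 (tens s bs) = tens s (drop p bs @ take p bs)"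
  by (simp add: swp_def cf_ord0 tlift_tens multilinear_swap)

section \<open>Arrows that are constant in t\<close>

definition order0 where "order0 F \<longleftrightarrow> arr F \<and> (\<forall>n>0. cf F n = (\<lambda>x. 0))"

lemma order0_ord0: "hlin p q 0 f \<Longrightarrow> order0 (ord0 p q f)"
  by (simp add: order0_def cf_ord0_pos)

lemma order0_I [simp]: "order0 (I p)" and order0_swp [simp]: "order0 (swp p q)"
  by (simp_all add: order0_def I_def swp_def hlin_id hlin_swap cf_ord0_pos)

lemma order0_comp [simp]: "order0 F \<Longrightarrow> order0 G \<Longrightarrow> tgt G = src F \<Longrightarrow> order0 (F \<cdot> G)"
  unfolding order0_def
proof (intro conjI allI impI, simp, rule ext)
  fix n x assume a: "arr F \<and> (\<forall>n>0. cf F n = (\<lambda>x. 0))" "arr G \<and> (\<forall>n>0. cf G n = (\<lambda>x. 0))" "0 < (n::nat)"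
  have "cf F i (cf G (n - i) x) = 0" if "i \<le> n" for i
    using a that by (cases "i = 0") auto
  then show "cf (F \<cdot> G) n x = 0" by (simp add: cf_comp)
qed

lemma order0_ten [simp]: "order0 F \<Longrightarrow> order0 G \<Longrightarrow> order0 (F \<otimes> G)"
  unfolding order0_def
proof (intro conjI allI impI, simp, rule ext)
  fix n x assume a: "arr F \<and> (\<forall>n>0. cf F n = (\<lambda>x. 0))" "arr G \<and> (\<forall>n>0. cf G n = (\<lambda>x. 0))" "0 < (n::nat)"
  have "tm (src F) (src G) (cf F i) (cf G (n - i)) x = 0" if "i \<le> n" for i
    using a that by (cases "i = 0") (auto simp: tm_zero_left[OF arr_lin] tm_zero_right[OF arr_lin])
  then show "cf (F \<otimes> G) n x = 0" by (simp add: cf_ten)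
qed

text \<open>Identities between permutations, and the axioms of B itself, thereby become computations
  on pure tensors.\<close>

lemma order0_eqI:
  assumes "order0 F" "order0 G" "src F = src G" "tgt F = tgt G"
    and "\<And>bs. length bs = src F \<Longrightarrow> cf F 0 (tens s bs) = cf G 0 (tens s bs)"
  shows "F = G"
proof (rule mor_eqI)
  show a: "arr F" "arr G" using assms by (auto simp: order0_def)
  fix n x assume x: "x \<in> T B (src G)"
  show "cf F n x = cf G n x"
  proof (cases "n = 0")
    case True
    show ?thesis unfolding True
      by (rule lin_eqI[OF arr_lin[OF a(1)] arr_lin'[OF a(2) assms(3) refl] assms(5)]) (simp_all add: x assms(3))
  next
    case False
    then show ?thesis using assms(1,2) by (simp add: order0_def)
  qed
qed fact+

text \<open>Exchanges the second and third of four blocks of sizes p, q, r, t. With all sizes 1 it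
  is the flip in the compatibility axiom; larger blocks arise when it is moved past multiplications
  or comultiplications.\<close>

definition msw where "msw p q r t = I p \<otimes> swp q r \<otimes> I t"

lemma arr_msw [simp]: "arr (msw p q r t)" and order0_msw [simp]: "order0 (msw p q r t)"
  and src_msw [simp]: "src (msw p q r t) = p + (q + r + t)"
  and tgt_msw [simp]: "tgt (msw p q r t) = p + (r + q + t)"
  by (simp_all add: msw_def)

lemma msw_natural:
  assumes "arr F" "arr G" "arr H" "arr K"
  shows "msw (tgt F) (tgt G) (tgt H) (tgt K) \<cdot> (F \<otimes> G \<otimes> H \<otimes> K) =
    (F \<otimes> H \<otimes> G \<otimes> K) \<cdot> msw (src F) (src G) (src H) (src K)"
proof -
  have "msw (tgt F) (tgt G) (tgt H) (tgt K) \<cdot> (F \<otimes> (G \<otimes> H) \<otimes> K) =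
      F \<otimes> (swp (tgt G) (tgt H) \<cdot> (G \<otimes> H)) \<otimes> K"
    unfolding msw_def using assms by (simp add: interchange del: ten_assoc)
  also have "\<dots> = F \<otimes> ((H \<otimes> G) \<cdot> swp (src G) (src H)) \<otimes> K"
    using assms by (simp add: swp_natural)
  also have "\<dots> = (F \<otimes> (H \<otimes> G) \<otimes> K) \<cdot> msw (src F) (src G) (src H) (src K)"
    unfolding msw_def using assms by (simp add: interchange del: ten_assoc)
  finally show ?thesis using assms by simp
qed

text \<open>Arities are given by separate equations, so that the rule unifies with numerals such as
  those in \<open>ms\<close>.\<close>

lemma msw_natural_at:
  assumes "arr F" "arr G" "arr H" "arr K" "tgt F = p" "tgt G = q" "tgt H = r" "tgt K = t"
    "src F = p'" "src G = q'" "src H = r'" "src K = t'"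
  shows "msw p q r t \<cdot> (F \<otimes> G \<otimes> H \<otimes> K) = (F \<otimes> H \<otimes> G \<otimes> K) \<cdot> msw p' q' r' t'"
  using msw_natural[OF assms(1-4)] assms(5-) by simp

lemma swp_0 [simp]: "swp p 0 = I p" "swp 0 p = I p"
  by (rule order0_eqI; simp add: cf0_swp cf_I)+

abbreviation ms where "ms \<equiv> msw 1 1 1 1"

text \<open>\<open>sh6\<close> sorts three pairs into their three first legs followed by their three
  second legs; \<open>ush6\<close> is the inverse permutation and interleaves two triples. They
  govern the triple product on the tensor square and the factorwise product on the tensor
  cube.\<close>

definition sh6 where "sh6 = msw 2 2 1 1 \<cdot> (ms \<otimes> I 2)"
definition ush6 where "ush6 = (I 2 \<otimes> ms) \<cdot> msw 1 2 1 2"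

lemmas eval_tens = cf0_comp cf0_ten_tens cf0_I cf0_swp msw_def

lemma arr_sh6 [simp]: "arr sh6" "src sh6 = 6" "tgt sh6 = 6"
  and arr_ush6 [simp]: "arr ush6" "src ush6 = 6" "tgt ush6 = 6"
  by (simp_all add: sh6_def ush6_def)

lemma sh6_tens: "cf sh6 0 (tens s [a, b, c, d, e, f]) = tens s [a, c, e, b, d, f]"
  by (simp add: sh6_def eval_tens)

lemma ush6_tens: "cf ush6 0 (tens s [a, b, c, d, e, f]) = tens s [a, d, b, e, c, f]"
  by (simp add: ush6_def eval_tens)

text \<open>A second factorisation of the same permutation: the definition fits products nested to
  the left (\<open>mul2_assL\<close>), this one those nested to the right
  (\<open>mul2_assR\<close>). \<open>ush6_alt\<close> plays the same role for iterated
  comultiplications.\<close>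

lemma sh6_alt: "sh6 = msw 1 1 2 2 \<cdot> (I 2 \<otimes> ms)"
proof (rule order0_eqI)
  fix bs :: "'b list" assume "length bs = src sh6"
  then obtain a b c d e f where "bs = [a, b, c, d, e, f]" by (auto simp: length6_conv)
  then show "cf sh6 0 (tens s bs) = cf (msw 1 1 2 2 \<cdot> (I 2 \<otimes> ms)) 0 (tens s bs)"
    by (simp add: sh6_tens) (simp add: eval_tens)
qed (simp_all add: sh6_def)

lemma ush6_alt: "ush6 = (ms \<otimes> I 2) \<cdot> msw 2 1 2 1"
proof (rule order0_eqI)
  fix bs :: "'b list" assume "length bs = src ush6"
  then obtain a b c d e f where "bs = [a, b, c, d, e, f]" by (auto simp: length6_conv)
  then show "cf ush6 0 (tens s bs) = cf ((ms \<otimes> I 2) \<cdot> msw 2 1 2 1) 0 (tens s bs)"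
    by (simp add: ush6_tens) (simp add: eval_tens)
qed (simp_all add: ush6_def)

section \<open>Unit, counit and the operations of B as arrows\<close>

definition eta where "eta = ord0 0 1 (\<lambda>x. tlift x (\<lambda>bs. tens s [1]))"
definition ep where "ep = ord0 1 0 (eps B)"
definition mult0 where "mult0 = ord0 2 1 (mu B 1)"
definition comult0 where "comult0 = ord0 1 2 (delta B 1)"

lemma multilinear_1: "multilinear s tscale UNIV 1 (\<lambda>bs. f (hd bs))"
  if "\<And>x y. f (x + y) = f x + f y" "\<And>c x. f (s c x) = tscale c (f x)"
proof (rule multilinearI)
  fix bs :: "'b list" and i :: nat and x y c assume "length bs = 1" "i < 1"
  then obtain a where [simp]: "bs = [a]" "i = 0" by (auto simp: length1_conv)
  show "f (hd (bs[i := x + y])) = f (hd (bs[i := x])) + f (hd (bs[i := y]))"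
    "f (hd (bs[i := s c x])) = tscale c (f (hd (bs[i := x])))"
    using that by simp_all
qed

lemma counit_add: "counit B (x + y) = counit B x + counit B y"
  and counit_scale: "counit B (s c x) = c * counit B x"
  and comult_add: "comult B (x + y) = comult B x + comult B y"
  and comult_scale: "comult B (s c x) = tscale c (comult B x)"
proof -
  interpret c: Vector_Spaces.linear s "(*)" "counit B" by (rule counit_linear)
  interpret d: Vector_Spaces.linear s tscale "comult B" by (rule comult_linear)
  show "counit B (x + y) = counit B x + counit B y" "counit B (s c x) = c * counit B x"
    "comult B (x + y) = comult B x + comult B y" "comult B (s c x) = tscale c (comult B x)"
    by (simp_all add: c.add c.scale d.add d.scale)
qed

lemma tscale_plus: "tscale (a + b) x = tscale a x + tscale b x" 
  by (simp add: ts.scale_left_distrib)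

lemma multilinear_eps: "multilinear s tscale UNIV 1 (\<lambda>bs. tscale (counit B (hd bs)) (tens s []))"
  by (rule multilinear_1) (simp_all add: counit_add counit_scale tscale_plus)

lemma eps_tens [simp]: "eps B (tens s [a]) = tscale (counit B a) (tens s [])"
  unfolding eps_def by (subst tlift_tens_at[OF multilinear_eps]) (simp_all add: One_nat_def)

lemma hlin_eps: "hlin 1 0 0 (eps B)"
  unfolding eps_def[abs_def]
proof (rule hlin_tlift[OF multilinear_eps])
  fix bs ns assume a: "length bs = 1" "length ns = 1" "\<And>i. i < 1 \<Longrightarrow> bs ! i \<in> grade B (ns ! i)"
  then obtain b k where [simp]: "bs = [b]" "ns = [k]" by (auto simp: length1_conv)
  show "tscale (counit B (hd bs)) (tens s []) \<in> tgrade B 0 UNIV (int (sum_list ns) + 0)"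
  proof (cases "k = 0")
    case True
    then show ?thesis by (auto intro!: tgrade_scale tgrade_tens[of _ _ "[]"])
  next
    case False
    then show ?thesis using grade_counit[of b k] a(3)[of 0] by simp
  qed
qed auto

lemma mu1_aux: "multilinear s tscale UNIV 2 (\<lambda>bs. tens s (take 0 bs @ [bs ! 0 * bs ! 1] @ drop 2 bs))"
proof (rule multilinearI)
  fix bs :: "'b list" and i :: nat and x y c assume "length bs = 2" "i < 2"
  then obtain a b where [simp]: "bs = [a, b]" and i: "i = 0 \<or> i = 1" by (auto simp: length2_conv less_2_cases_iff One_nat_def)
  let ?F = "\<lambda>bs. tens s (take 0 bs @ [bs ! 0 * bs ! 1] @ drop 2 bs)"
  show "?F (bs[i := x + y]) = ?F (bs[i := x]) + ?F (bs[i := y])"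
    using i by (auto simp: distrib_left distrib_right tens1_add One_nat_def)
  show "?F (bs[i := s c x]) = tscale c (?F (bs[i := x]))"
    using i by (auto simp: mult_smult_left mult_smult_right tens1_scale One_nat_def)
qed

lemma mu1_tens [simp]: "mu B 1 (tens s [a, b]) = tens s [a * b]"
  using tlift_tens_at[OF mu1_aux, of "[a, b]"] by (simp add: mu_def)

lemma hlin_mu: "hlin 2 1 0 (mu B 1)"
proof -
  have "hlin 2 1 0 (\<lambda>x. tlift x (\<lambda>bs. tens s (take 0 bs @ [bs ! 0 * bs ! 1] @ drop 2 bs)))"
  proof (rule hlin_tlift[OF mu1_aux])
    fix bs ns assume a: "length bs = 2" "length ns = 2" "\<And>i. i < 2 \<Longrightarrow> bs ! i \<in> grade B (ns ! i)"
    then obtain b b' k k' where [simp]: "bs = [b, b']" "ns = [k, k']" by (auto simp: length2_conv)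
    show "tens s (take 0 bs @ [bs ! 0 * bs ! 1] @ drop 2 bs) \<in> tgrade B 1 UNIV (int (sum_list ns) + 0)"
      using a(3)[of 0] a(3)[of 1] by (intro tgrade_tens[of _ _ "[k + k']"]) (auto intro: grade_mult)
  qed auto
  then show ?thesis by (simp add: mu_def[abs_def])
qed

lemma hlin_delta_aux: "hlin 1 2 0 (\<lambda>x. tlift x (\<lambda>bs. comult B (hd bs)))"
proof (rule hlin_tlift)
  show "multilinear s tscale UNIV 1 (\<lambda>bs. comult B (hd bs))"
    by (rule multilinear_1) (simp_all add: comult_add comult_scale)
  fix bs ns assume a: "length bs = 1" "length ns = 1" "\<And>i. i < 1 \<Longrightarrow> bs ! i \<in> grade B (ns ! i)"
  then obtain b k where [simp]: "bs = [b]" "ns = [k]" by (auto simp: length1_conv)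
  show "comult B (hd bs) \<in> tgrade B 2 UNIV (int (sum_list ns) + 0)"
    using grade_comult[of b k] a(3)[of 0] by simp
qed (simp add: comult_in)

text \<open>F inherits multilinearity from g and \<open>tens\<close>, because it factors through
  them on lists of length n. This identifies an operation defined by a lift with a known linear map
  by checking pure tensors only.\<close>

lemma tlift_cong_tens:
  assumes "lin s n q g" "\<And>cs. length cs = n \<Longrightarrow> F cs = g (tens s cs)" "x \<in> T B n"
  shows "tlift x F = g x"
proof (rule lin_eqI[OF _ assms(1) _ assms(3)])
  have m: "multilinear s tscale UNIV n F"
    by (rule multilinearI)
      (simp_all add: assms(2) tens_update_add[of _ n] tens_update_scale[of _ n] lin_add[OF assms(1)] lin_scale[OF assms(1)])
  then show "lin s n q (\<lambda>x. tlift x F)"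
    by (rule lin_tlift) (simp add: assms(2) lin_in[OF assms(1)])
  show "\<And>bs. length bs = n \<Longrightarrow> tlift (tens s bs) F = g (tens s bs)"
    using m assms(2) by (simp add: tlift_tens)
qed

lemma delta1_tens [simp]: "delta B 1 (tens s [a]) = comult B a"
  and hlin_delta: "hlin 1 2 0 (delta B 1)"
proof -
  have t: "tlift (tens s [a]) (\<lambda>bs. comult B (hd bs)) = comult B a" for a
    by (subst tlift_tens_at[OF multilinear_1]) (simp_all add: comult_add comult_scale One_nat_def)
  \<comment> \<open>On a single factor \<open>delta\<close> multiplies \<open>comult\<close> on both
    sides by the tensor of the empty list, which is neutral.\<close>
  have e: "delta B 1 x = tlift x (\<lambda>bs. comult B (hd bs))" if "x \<in> T B 1" for x
    unfolding delta_def
    by (rule tlift_cong_tens[OF hlin_lin[OF hlin_delta_aux] _ that])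
      (auto simp: length1_conv t tprod_nil_left[OF comult_in] tprod_nil_right[OF comult_in])
  show "delta B 1 (tens s [a]) = comult B a" using e[of "tens s [a]"] t by simp
  have "restrict0 (T B 1) (delta B 1) = restrict0 (T B 1) (\<lambda>x. tlift x (\<lambda>bs. comult B (hd bs)))"
    using e by (auto simp: restrict0_def)
  then show "hlin 1 2 0 (delta B 1)" using hlin_delta_aux hlin_restrict0[of 1 2 0] by metis
qed

lemma hlin_eta: "hlin 0 1 0 (\<lambda>x. tlift x (\<lambda>bs. tens s [1]))"
  by (rule hlin_tlift) (auto simp: multilinear_def intro!: tgrade_tens[of _ _ "[0]"] grade_one)

lemma structure_maps [simp]:
  "arr eta" "src eta = 0" "tgt eta = 1" "arr ep" "src ep = 1" "tgt ep = 0"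
  "arr mult0" "src mult0 = 2" "tgt mult0 = 1" "arr comult0" "src comult0 = 1" "tgt comult0 = 2"
  by (simp_all add: eta_def ep_def mult0_def comult0_def hlin_eta hlin_eps hlin_mu hlin_delta)

lemma order0_structure_maps [simp]: "order0 eta" "order0 ep" "order0 mult0" "order0 comult0"
  by (simp_all add: eta_def ep_def mult0_def comult0_def order0_ord0 hlin_eta hlin_eps hlin_mu hlin_delta)

lemma structure_maps_tens:
  "cf eta 0 (tens s []) = tens s [1]"
  "cf ep 0 (tens s [a]) = tscale (counit B a) (tens s [])"
  "cf mult0 0 (tens s [a, b]) = tens s [a * b]"
  "cf comult0 0 (tens s [a]) = comult B a"
  by (simp_all add: eta_def ep_def mult0_def comult0_def cf_ord0 tlift_tens multilinear_def)

section \<open>Loops of diagrams\<close>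

text \<open>The two sides of the three axioms that may fail: \<open>assL\<close> and
  \<open>assR\<close>, \<open>coaL\<close> and \<open>coaR\<close>, and \<open>d \<cdot> m\<close>
  against \<open>cmp m d\<close>. Here \<open>mul2\<close> is the factorwise product on the tensor
  square, so \<open>cmp\<close> multiplies two coproducts.\<close>

definition mul2 where "mul2 m = (m \<otimes> m) \<cdot> ms"
definition assL where "assL m = m \<cdot> (m \<otimes> I 1)"
definition assR where "assR m = m \<cdot> (I 1 \<otimes> m)"
definition coaL where "coaL d = (d \<otimes> I 1) \<cdot> d"
definition coaR where "coaR d = (I 1 \<otimes> d) \<cdot> d"
definition cmp where "cmp m d = mul2 m \<cdot> (d \<otimes> d)"

definition shape where
  "shape m d \<longleftrightarrow> arr m \<and> src m = 2 \<and> tgt m = 1 \<and> arr d \<and> src d = 1 \<and> tgt d = 2"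

lemma ten_I2: "arr F \<Longrightarrow> F \<otimes> I 2 = (F \<otimes> I 1) \<otimes> I 1" and I2_ten: "arr F \<Longrightarrow> I 2 \<otimes> F = I 1 \<otimes> I 1 \<otimes> F"
proof -
  assume "arr F"
  then show "F \<otimes> I 2 = (F \<otimes> I 1) \<otimes> I 1" by simp
  have "I 1 \<otimes> I 1 \<otimes> F = (I 1 \<otimes> I 1) \<otimes> F" using \<open>arr F\<close> by (simp del: I_ten)
  then show "I 2 \<otimes> F = I 1 \<otimes> I 1 \<otimes> F" by simp
qed

context
  fixes m d
  assumes shape: "shape m d"
begin

lemma shapes [simp]: "arr m" "src m = 2" "tgt m = 1" "arr d" "src d = 1" "tgt d = 2"
  using shape by (auto simp: shape_def)

lemma composite_arr:
  "arr (mul2 m)" "arr (assL m)" "arr (assR m)" "arr (coaL d)" "arr (coaR d)" "arr (cmp m d)"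
  and composite_src: "src (mul2 m) = 4" "src (assL m) = 3" "src (assR m) = 3" "src (coaL d) = 1"
    "src (coaR d) = 1" "src (cmp m d) = 2"
  and composite_tgt: "tgt (mul2 m) = 2" "tgt (assL m) = 1" "tgt (assR m) = 1" "tgt (coaL d) = 3"
    "tgt (coaR d) = 3" "tgt (cmp m d) = 2"
  by (simp_all add: mul2_def assL_def assR_def coaL_def coaR_def cmp_def)

lemmas composites [simp] = composite_arr composite_src composite_tgt

text \<open>The five bracketings of four factors form a pentagon whose edges replace an
  \<open>assL\<close> by an \<open>assR\<close>. Each vertex ends two edges and so has two
  descriptions; the five lemmas identify them. They hold for every m of the right shape, by the
  interchange law.\<close>

lemma pentagon1: "assL m \<cdot> (m \<otimes> I 2) = m \<cdot> (assL m \<otimes> I 1)"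
  by (simp add: ten_I2 assL_def interchange del: ten_assoc I_ten)

lemma pentagon2: "assR m \<cdot> (m \<otimes> I 2) = assL m \<cdot> (I 2 \<otimes> m)"
  by (simp add: assL_def assR_def interchange)

lemma pentagon3: "m \<cdot> (assR m \<otimes> I 1) = assL m \<cdot> (I 1 \<otimes> m \<otimes> I 1)"
  by (simp add: assL_def assR_def interchange ten_assoc[symmetric] del: ten_assoc)

lemma pentagon4: "assR m \<cdot> (I 1 \<otimes> m \<otimes> I 1) = m \<cdot> (I 1 \<otimes> assL m)"
  by (simp add: assL_def assR_def interchange)

lemma pentagon5: "m \<cdot> (I 1 \<otimes> assR m) = assR m \<cdot> (I 2 \<otimes> m)"
  by (simp add: I2_ten assR_def interchange del: ten_assoc I_ten)

text \<open>The same pentagon with all arrows reversed; its edges join \<open>coaL\<close> and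
  \<open>coaR\<close>.\<close>

lemma copentagon1: "(d \<otimes> I 2) \<cdot> coaL d = (coaL d \<otimes> I 1) \<cdot> d"
  by (simp add: ten_I2 coaL_def interchange interchange' del: ten_assoc I_ten)

lemma copentagon2: "(d \<otimes> I 2) \<cdot> coaR d = (I 2 \<otimes> d) \<cdot> coaL d"
  by (simp add: coaL_def coaR_def interchange')

lemma copentagon3: "(I 1 \<otimes> d \<otimes> I 1) \<cdot> coaL d = (coaR d \<otimes> I 1) \<cdot> d"
  by (simp add: coaL_def coaR_def interchange' ten_assoc[symmetric] del: ten_assoc)

lemma copentagon4: "(I 1 \<otimes> d \<otimes> I 1) \<cdot> coaR d = (I 1 \<otimes> coaL d) \<cdot> d"
  by (simp add: coaL_def coaR_def interchange')

lemma copentagon5: "(I 2 \<otimes> d) \<cdot> coaR d = (I 1 \<otimes> coaR d) \<cdot> d"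
  by (simp add: I2_ten coaR_def interchange' del: ten_assoc I_ten)

text \<open>A triple product in the tensor square is formed in each factor separately once the six
  legs are sorted. Naturality moves the inner flip past the multiplications, so the identity is
  exact for every m.\<close>

lemma mul2_assL: "mul2 m \<cdot> (mul2 m \<otimes> I 2) = (assL m \<otimes> assL m) \<cdot> sh6"
proof -
  have "mul2 m \<otimes> I 2 = ((m \<otimes> m) \<otimes> I 2) \<cdot> (ms \<otimes> I 2)"
    by (simp add: mul2_def interchange del: ten_assoc)
  then have "mul2 m \<cdot> (mul2 m \<otimes> I 2) = (m \<otimes> m) \<cdot> (ms \<cdot> (m \<otimes> m \<otimes> I 1 \<otimes> I 1)) \<cdot> (ms \<otimes> I 2)"
    by (simp add: mul2_def)
  also have "ms \<cdot> (m \<otimes> m \<otimes> I 1 \<otimes> I 1) = (m \<otimes> I 1 \<otimes> m \<otimes> I 1) \<cdot> msw 2 2 1 1"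
    by (rule msw_natural_at) simp_all
  also have "(m \<otimes> m) \<cdot> ((m \<otimes> I 1 \<otimes> m \<otimes> I 1) \<cdot> msw 2 2 1 1) \<cdot> (ms \<otimes> I 2) =
      ((m \<otimes> m) \<cdot> ((m \<otimes> I 1) \<otimes> m \<otimes> I 1)) \<cdot> sh6"
    by (simp add: sh6_def)
  also have "(m \<otimes> m) \<cdot> ((m \<otimes> I 1) \<otimes> m \<otimes> I 1) = assL m \<otimes> assL m"
    by (simp add: interchange assL_def del: ten_assoc)
  finally show ?thesis .
qed

lemma mul2_assR: "mul2 m \<cdot> (I 2 \<otimes> mul2 m) = (assR m \<otimes> assR m) \<cdot> sh6"
proof -
  have "I 2 \<otimes> mul2 m = (I 2 \<otimes> m \<otimes> m) \<cdot> (I 2 \<otimes> ms)"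
    by (simp add: mul2_def interchange)
  then have "mul2 m \<cdot> (I 2 \<otimes> mul2 m) = (m \<otimes> m) \<cdot> (ms \<cdot> (I 1 \<otimes> I 1 \<otimes> m \<otimes> m)) \<cdot> (I 2 \<otimes> ms)"
    by (simp add: mul2_def I2_ten)
  also have "ms \<cdot> (I 1 \<otimes> I 1 \<otimes> m \<otimes> m) = (I 1 \<otimes> m \<otimes> I 1 \<otimes> m) \<cdot> msw 1 1 2 2"
    by (rule msw_natural_at) simp_all
  also have "(m \<otimes> m) \<cdot> ((I 1 \<otimes> m \<otimes> I 1 \<otimes> m) \<cdot> msw 1 1 2 2) \<cdot> (I 2 \<otimes> ms) =
      ((m \<otimes> m) \<cdot> ((I 1 \<otimes> m) \<otimes> I 1 \<otimes> m)) \<cdot> sh6"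
    by (simp add: sh6_alt)
  also have "(m \<otimes> m) \<cdot> ((I 1 \<otimes> m) \<otimes> I 1 \<otimes> m) = assR m \<otimes> assR m"
    by (simp add: interchange assR_def del: ten_assoc)
  finally show ?thesis .
qed

lemma mul2_cmpL: "mul2 m \<cdot> (cmp m d \<otimes> d) = (assL m \<otimes> assL m) \<cdot> sh6 \<cdot> (d \<otimes> d \<otimes> d)"
proof -
  have "cmp m d \<otimes> d = (mul2 m \<otimes> I 2) \<cdot> ((d \<otimes> d) \<otimes> d)"
    by (simp add: cmp_def interchange del: ten_assoc)
  then have "mul2 m \<cdot> (cmp m d \<otimes> d) = (mul2 m \<cdot> (mul2 m \<otimes> I 2)) \<cdot> (d \<otimes> d \<otimes> d)" by simp
  then show ?thesis by (simp add: mul2_assL)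
qed

lemma mul2_cmpR: "mul2 m \<cdot> (d \<otimes> cmp m d) = (assR m \<otimes> assR m) \<cdot> sh6 \<cdot> (d \<otimes> d \<otimes> d)"
proof -
  have "d \<otimes> cmp m d = (I 2 \<otimes> mul2 m) \<cdot> (d \<otimes> d \<otimes> d)"
    by (simp add: cmp_def interchange)
  then have "mul2 m \<cdot> (d \<otimes> cmp m d) = (mul2 m \<cdot> (I 2 \<otimes> mul2 m)) \<cdot> (d \<otimes> d \<otimes> d)" by simp
  then show ?thesis by (simp add: mul2_assR)
qed

lemma cmp_multL: "cmp m d \<cdot> (m \<otimes> I 1) = mul2 m \<cdot> ((d \<cdot> m) \<otimes> d)"
  by (simp add: cmp_def interchange)

lemma cmp_multR: "cmp m d \<cdot> (I 1 \<otimes> m) = mul2 m \<cdot> (d \<otimes> (d \<cdot> m))"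
  by (simp add: cmp_def interchange)

lemma comult_cmpR: "(I 1 \<otimes> d) \<cdot> cmp m d = (m \<otimes> (d \<cdot> m)) \<cdot> ms \<cdot> (d \<otimes> d)"
  by (simp add: cmp_def mul2_def interchange')

lemma comult_cmpL: "(d \<otimes> I 1) \<cdot> cmp m d = ((d \<cdot> m) \<otimes> m) \<cdot> ms \<cdot> (d \<otimes> d)"
  by (simp add: cmp_def mul2_def interchange')

text \<open>Dual to the triple products in the tensor square: the flip is moved past the
  comultiplications instead, and \<open>ush6\<close> pairs the legs of two threefold
  coproducts.\<close>

lemma cmp_coaR: "(m \<otimes> cmp m d) \<cdot> ms \<cdot> (d \<otimes> d) = (m \<otimes> m \<otimes> m) \<cdot> ush6 \<cdot> (coaR d \<otimes> coaR d)"
proof -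
  have 1: "m \<otimes> cmp m d = (m \<otimes> m \<otimes> m) \<cdot> (I 2 \<otimes> ms) \<cdot> (I 1 \<otimes> I 1 \<otimes> d \<otimes> d)"
    by (simp add: cmp_def mul2_def interchange interchange' I2_ten[symmetric] del: I_ten)
  have 2: "msw 1 2 1 2 \<cdot> (I 1 \<otimes> d \<otimes> I 1 \<otimes> d) = (I 1 \<otimes> I 1 \<otimes> d \<otimes> d) \<cdot> ms"
    by (rule msw_natural_at) simp_all
  have 3: "coaR d \<otimes> coaR d = ((I 1 \<otimes> d) \<otimes> I 1 \<otimes> d) \<cdot> (d \<otimes> d)"
    by (simp add: coaR_def interchange del: ten_assoc)
  have "(m \<otimes> cmp m d) \<cdot> ms \<cdot> (d \<otimes> d) =
      (m \<otimes> m \<otimes> m) \<cdot> (I 2 \<otimes> ms) \<cdot> ((I 1 \<otimes> I 1 \<otimes> d \<otimes> d) \<cdot> ms) \<cdot> (d \<otimes> d)"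
    unfolding 1 by simp
  also have "\<dots> = (m \<otimes> m \<otimes> m) \<cdot> ush6 \<cdot> (coaR d \<otimes> coaR d)"
    unfolding 2[symmetric] 3 by (simp add: ush6_def)
  finally show ?thesis .
qed

lemma cmp_coaL: "(cmp m d \<otimes> m) \<cdot> ms \<cdot> (d \<otimes> d) = (m \<otimes> m \<otimes> m) \<cdot> ush6 \<cdot> (coaL d \<otimes> coaL d)"
proof -
  have 1: "cmp m d \<otimes> m = (m \<otimes> m \<otimes> m) \<cdot> (ms \<otimes> I 2) \<cdot> (d \<otimes> d \<otimes> I 1 \<otimes> I 1)"
  proof -
    have "cmp m d \<otimes> m = ((m \<otimes> m) \<otimes> m) \<cdot> (ms \<otimes> I 2) \<cdot> ((d \<otimes> d) \<otimes> I 2)"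
      by (simp add: cmp_def mul2_def interchange interchange' del: ten_assoc)
    then show ?thesis by simp
  qed
  have 2: "msw 2 1 2 1 \<cdot> (d \<otimes> I 1 \<otimes> d \<otimes> I 1) = (d \<otimes> d \<otimes> I 1 \<otimes> I 1) \<cdot> ms"
    by (rule msw_natural_at) simp_all
  have 3: "coaL d \<otimes> coaL d = ((d \<otimes> I 1) \<otimes> d \<otimes> I 1) \<cdot> (d \<otimes> d)"
    by (simp add: coaL_def interchange del: ten_assoc)
  have "(cmp m d \<otimes> m) \<cdot> ms \<cdot> (d \<otimes> d) =
      (m \<otimes> m \<otimes> m) \<cdot> (ms \<otimes> I 2) \<cdot> ((d \<otimes> d \<otimes> I 1 \<otimes> I 1) \<cdot> ms) \<cdot> (d \<otimes> d)"
    unfolding 1 by simp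
  also have "\<dots> = (m \<otimes> m \<otimes> m) \<cdot> ush6 \<cdot> (coaL d \<otimes> coaL d)"
    unfolding 2[symmetric] 3 by (simp add: ush6_alt)
  finally show ?thesis .
qed

end

section \<open>Leading differences along closed loops\<close>

lemma dif_comp_left:
  assumes "arr F" "arr F'" "arr G" "tgt G = src F" "eqv n F F'" "0 < n" "x \<in> T B (src G)"
  shows "dif n (F \<cdot> G) (F' \<cdot> G) x = dif n F F' (cf G 0 x)"
  using dif_comp[OF assms(1,2,3,3,4,5) _ assms(6,7)] assms(1) by simp

lemma dif_comp_right:
  assumes "arr F" "arr G" "arr G'" "tgt G = src F" "eqv n G G'" "0 < n" "x \<in> T B (src G)"
  shows "dif n (F \<cdot> G) (F \<cdot> G') x = cf F 0 (dif n G G' x)"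
  using dif_comp[OF assms(1,1,2,3,4) _ assms(5,6,7)] by simp

lemma dif_ten_left:
  assumes "arr F" "arr F'" "arr G" "eqv n F F'" "0 < n"
  shows "dif n (F \<otimes> G) (F' \<otimes> G) = tm (src F) (src G) (dif n F F') (cf G 0)"
  by (rule ext, subst dif_ten[OF assms(1,2,3,3,4) _ assms(5)]) (simp_all add: tm_zero_right[OF arr_lin[OF assms(1)]])

lemma dif_ten_right:
  assumes "arr F" "arr G" "arr G'" "eqv n G G'" "0 < n"
  shows "dif n (F \<otimes> G) (F \<otimes> G') = tm (src F) (src G) (cf F 0) (dif n G G')"
  by (rule ext, subst dif_ten[OF assms(1,1,2,3) _ assms(4,5)]) (simp_all add: tm_zero_left[OF arr_lin[OF assms(2)]])

lemma dif_eqv_Suc: "eqv (Suc n) F G \<Longrightarrow> dif n F G x = 0"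
  by (simp add: dif_def eqv_def)

lemma eqv_Suc: "eqv (Suc n) F G \<Longrightarrow> eqv n F G"
  by (simp add: eqv_def)

lemma tm_cf_I_left: "tm p q (cf (I p) 0) g = tm p q (\<lambda>x. x) g"
  and tm_cf_I_right: "tm p q f (cf (I q) 0) = tm p q f (\<lambda>x. x)"
  by (rule tm_cong; simp add: cf_I)+

lemmas dif_simps = dif_comp_left dif_comp_right dif_ten_left dif_ten_right eqv_comp eqv_ten tm_cf_I_left tm_cf_I_right

context
  fixes m d and n :: nat
  assumes shape: "shape m d" and n [simp]: "0 < n"
begin

lemmas [simp] = shapes[OF shape] composites[OF shape]

text \<open>The next four lemmas express that the differences along a closed loop of diagrams add up to zero;
  they are the four components of the cocycle condition for the defects of the axioms.\<close>

lemma pentagon_dif: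
  assumes e [simp]: "eqv n (assL m) (assR m)" and x [simp]: "x \<in> T B 4"
  defines "a \<equiv> dif n (assL m) (assR m)"
  shows "a (cf (m \<otimes> I 2) 0 x) + a (cf (I 2 \<otimes> m) 0 x) =
    cf m 0 (tm 3 1 a (\<lambda>x. x) x) + a (cf (I 1 \<otimes> m \<otimes> I 1) 0 x) + cf m 0 (tm 1 3 (\<lambda>x. x) a x)"
proof -
  have "dif n (assL m \<cdot> (m \<otimes> I 2)) (assR m \<cdot> (m \<otimes> I 2)) x + dif n (assL m \<cdot> (I 2 \<otimes> m)) (assR m \<cdot> (I 2 \<otimes> m)) x =
    dif n (m \<cdot> (assL m \<otimes> I 1)) (m \<cdot> (assR m \<otimes> I 1)) x +
    dif n (assL m \<cdot> (I 1 \<otimes> m \<otimes> I 1)) (assR m \<cdot> (I 1 \<otimes> m \<otimes> I 1)) x +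
    dif n (m \<cdot> (I 1 \<otimes> assL m)) (m \<cdot> (I 1 \<otimes> assR m)) x"
    unfolding dif_def
    by (simp add: pentagon1[OF shape] pentagon2[OF shape] pentagon3[OF shape] pentagon4[OF shape]
      pentagon5[OF shape] algebra_simps)
  then show ?thesis by (simp add: dif_simps a_def)
qed

lemma copentagon_dif:
  assumes e [simp]: "eqv n (coaR d) (coaL d)" and x [simp]: "x \<in> T B 1"
  defines "a \<equiv> dif n (coaR d) (coaL d)"
  shows "cf (d \<otimes> I 2) 0 (a x) + cf (I 2 \<otimes> d) 0 (a x) =
    tm 1 1 a (\<lambda>x. x) (cf d 0 x) + cf (I 1 \<otimes> d \<otimes> I 1) 0 (a x) + tm 1 1 (\<lambda>x. x) a (cf d 0 x)"
proof -
  have "dif n ((d \<otimes> I 2) \<cdot> coaR d) ((d \<otimes> I 2) \<cdot> coaL d) x + dif n ((I 2 \<otimes> d) \<cdot> coaR d) ((I 2 \<otimes> d) \<cdot> coaL d) x =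
    dif n ((coaR d \<otimes> I 1) \<cdot> d) ((coaL d \<otimes> I 1) \<cdot> d) x +
    dif n ((I 1 \<otimes> d \<otimes> I 1) \<cdot> coaR d) ((I 1 \<otimes> d \<otimes> I 1) \<cdot> coaL d) x +
    dif n ((I 1 \<otimes> coaR d) \<cdot> d) ((I 1 \<otimes> coaL d) \<cdot> d) x"
    unfolding dif_def
    by (simp add: copentagon1[OF shape] copentagon2[OF shape] copentagon3[OF shape] copentagon4[OF shape]
      copentagon5[OF shape] algebra_simps)
  then show ?thesis by (simp add: dif_simps a_def)
qed

lemma mixed_mult_dif:
  assumes e [simp]: "eqv n (assL m) (assR m)" "eqv n (d \<cdot> m) (cmp m d)" and x [simp]: "x \<in> T B 3"
  defines "a \<equiv> dif n (assL m) (assR m)" and "c \<equiv> dif n (d \<cdot> m) (cmp m d)"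
  shows "c (cf (m \<otimes> I 1) 0 x) + cf (mul2 m) 0 (tm 2 1 c (cf d 0) x) +
      tm 3 3 a (cf (assR m) 0) (cf (sh6 \<cdot> (d \<otimes> d \<otimes> d)) 0 x) +
      tm 3 3 (cf (assL m) 0) a (cf (sh6 \<cdot> (d \<otimes> d \<otimes> d)) 0 x) =
    cf d 0 (a x) + c (cf (I 1 \<otimes> m) 0 x) + cf (mul2 m) 0 (tm 1 2 (cf d 0) c x)"
proof -
  let ?S = "sh6 \<cdot> (d \<otimes> d \<otimes> d)"
  \<comment> \<open>The two ways of splitting a product of three factors are joined by a loop.
    Passing from \<open>assL \<otimes> assL\<close> to \<open>assR \<otimes> assR\<close> takes two
    edges, through \<open>assL \<otimes> assR\<close>; this is why the associator appears once in
    each leg.\<close>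
  have "dif n ((d \<cdot> m) \<cdot> (m \<otimes> I 1)) (cmp m d \<cdot> (m \<otimes> I 1)) x +
      dif n (mul2 m \<cdot> ((d \<cdot> m) \<otimes> d)) (mul2 m \<cdot> (cmp m d \<otimes> d)) x +
      dif n ((assL m \<otimes> assR m) \<cdot> ?S) ((assR m \<otimes> assR m) \<cdot> ?S) x +
      dif n ((assL m \<otimes> assL m) \<cdot> ?S) ((assL m \<otimes> assR m) \<cdot> ?S) x =
    dif n (d \<cdot> assL m) (d \<cdot> assR m) x + dif n ((d \<cdot> m) \<cdot> (I 1 \<otimes> m)) (cmp m d \<cdot> (I 1 \<otimes> m)) x +
    dif n (mul2 m \<cdot> (d \<otimes> (d \<cdot> m))) (mul2 m \<cdot> (d \<otimes> cmp m d)) x"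
    unfolding dif_def
    by (simp add: cmp_multL[OF shape] cmp_multR[OF shape] mul2_cmpL[OF shape] mul2_cmpR[OF shape]
      assL_def[symmetric] assR_def[symmetric])
  then show ?thesis by (simp add: dif_simps a_def c_def del: comp_assoc)
qed

lemma mixed_comult_dif:
  assumes e [simp]: "eqv n (coaR d) (coaL d)" "eqv n (d \<cdot> m) (cmp m d)" and x [simp]: "x \<in> T B 2"
  defines "a \<equiv> dif n (coaR d) (coaL d)" and "c \<equiv> dif n (d \<cdot> m) (cmp m d)"
  shows "cf (I 1 \<otimes> d) 0 (c x) + tm 2 2 (cf m 0) c (cf (ms \<cdot> (d \<otimes> d)) 0 x) +
      cf ((m \<otimes> m \<otimes> m) \<cdot> ush6) 0 (tm 1 1 a (cf (coaL d) 0) x) +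
      cf ((m \<otimes> m \<otimes> m) \<cdot> ush6) 0 (tm 1 1 (cf (coaR d) 0) a x) =
    a (cf m 0 x) + cf (d \<otimes> I 1) 0 (c x) + tm 2 2 c (cf m 0) (cf (ms \<cdot> (d \<otimes> d)) 0 x)"
proof -
  let ?S = "ms \<cdot> (d \<otimes> d)" and ?W = "(m \<otimes> m \<otimes> m) \<cdot> ush6"
  \<comment> \<open>Here \<open>coaR \<otimes> coaR\<close> becomes
    \<open>coaL \<otimes> coaL\<close> through \<open>coaR \<otimes> coaL\<close>, one tensor factor
    per edge.\<close>
  have "dif n ((I 1 \<otimes> d) \<cdot> (d \<cdot> m)) ((I 1 \<otimes> d) \<cdot> cmp m d) x +
      dif n ((m \<otimes> (d \<cdot> m)) \<cdot> ?S) ((m \<otimes> cmp m d) \<cdot> ?S) x +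
      dif n (?W \<cdot> (coaR d \<otimes> coaL d)) (?W \<cdot> (coaL d \<otimes> coaL d)) x +
      dif n (?W \<cdot> (coaR d \<otimes> coaR d)) (?W \<cdot> (coaR d \<otimes> coaL d)) x =
    dif n (coaR d \<cdot> m) (coaL d \<cdot> m) x + dif n ((d \<otimes> I 1) \<cdot> (d \<cdot> m)) ((d \<otimes> I 1) \<cdot> cmp m d) x +
    dif n (((d \<cdot> m) \<otimes> m) \<cdot> ?S) ((cmp m d \<otimes> m) \<cdot> ?S) x"
    unfolding dif_def
    by (simp add: comult_cmpL[OF shape] comult_cmpR[OF shape] cmp_coaR[OF shape] cmp_coaL[OF shape])
      (simp add: coaL_def coaR_def)
  then show ?thesis by (simp add: dif_simps a_def c_def del: comp_assoc)
qed

end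

section \<open>Two structures that agree below t^n, and their comparison\<close>

context
  fixes m d m' d' and n :: nat
  assumes shape: "shape m d" and shape': "shape m' d'" and n [simp]: "0 < n"
begin

lemmas [simp] = shapes[OF shape] composites[OF shape] shapes[OF shape'] composites[OF shape']

context
  assumes e [simp]: "eqv n m' m" "eqv n d' d"
begin

lemma eqv_composites [simp]:
  "eqv n (mul2 m') (mul2 m)" "eqv n (assL m') (assL m)" "eqv n (assR m') (assR m)"
  "eqv n (coaL d') (coaL d)" "eqv n (coaR d') (coaR d)" "eqv n (cmp m' d') (cmp m d)"
  by (simp_all add: mul2_def assL_def assR_def coaL_def coaR_def cmp_def eqv_comp eqv_ten)

lemma cf0_change [simp]: "cf m' 0 = cf m 0" "cf d' 0 = cf d 0"
  using e by (auto simp: eqv_def)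

text \<open>The order of the two differences is exchanged: on each side of the axiom the new series
  is compared with the old one. These agree below n, so the Leibniz rule applies, and its four terms
  are, up to sign, those of the horizontal differential of \<mu>.\<close>

lemma dif_assoc_change:
  assumes [simp]: "x \<in> T B 3"
  defines "\<mu> \<equiv> dif n m' m"
  shows "dif n (assL m') (assR m') x = dif n (assL m) (assR m) x +
    (\<mu> (cf (m \<otimes> I 1) 0 x) + cf m 0 (tm 2 1 \<mu> (\<lambda>x. x) x)) -
    (\<mu> (cf (I 1 \<otimes> m) 0 x) + cf m 0 (tm 1 2 (\<lambda>x. x) \<mu> x))"
proof -
  have "dif n (assL m') (assR m') x - dif n (assL m) (assR m) x = dif n (assL m') (assL m) x - dif n (assR m') (assR m) x"
    by (simp add: dif_def)
  also have "\<dots> = (\<mu> (cf (m \<otimes> I 1) 0 x) + cf m 0 (tm 2 1 \<mu> (\<lambda>x. x) x)) -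
    (\<mu> (cf (I 1 \<otimes> m) 0 x) + cf m 0 (tm 1 2 (\<lambda>x. x) \<mu> x))"
    by (simp add: assL_def assR_def dif_comp dif_simps cf0_ten \<mu>_def)
  finally show ?thesis by (simp add: algebra_simps)
qed

text \<open>\<open>cmp\<close> contains each operation twice and contributes four Leibniz terms;
  \<open>d \<cdot> m\<close> contributes two more. The terms with \<mu> belong to the vertical
  differential of \<mu>, those with \<nu> to the horizontal differential of \<nu>.\<close>

lemma dif_mixed_change:
  assumes [simp]: "x \<in> T B 2"
  defines "\<mu> \<equiv> dif n m' m" and "\<nu> \<equiv> dif n d' d" and "y \<equiv> cf (ms \<cdot> (d \<otimes> d)) 0 x"
  shows "dif n (d' \<cdot> m') (cmp m' d') x = dif n (d \<cdot> m) (cmp m d) x +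
    (\<nu> (cf m 0 x) + cf d 0 (\<mu> x)) -
    (tm 2 2 \<mu> (cf m 0) y + tm 2 2 (cf m 0) \<mu> y +
     (cf (mul2 m) 0 (tm 1 1 \<nu> (cf d 0) x) + cf (mul2 m) 0 (tm 1 1 (cf d 0) \<nu> x)))"
proof -
  have "dif n (d' \<cdot> m') (cmp m' d') x - dif n (d \<cdot> m) (cmp m d) x =
      dif n (d' \<cdot> m') (d \<cdot> m) x - dif n (cmp m' d') (cmp m d) x"
    by (simp add: dif_def)
  also have "dif n (d' \<cdot> m') (d \<cdot> m) x = \<nu> (cf m 0 x) + cf d 0 (\<mu> x)"
    by (simp add: dif_comp \<mu>_def \<nu>_def)
  also have "dif n (cmp m' d') (cmp m d) x = dif n (mul2 m') (mul2 m) (cf (d \<otimes> d) 0 x) + cf (mul2 m) 0 (dif n (d' \<otimes> d') (d \<otimes> d) x)"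
    by (simp add: cmp_def dif_comp eqv_ten cf0_ten) (simp add: mul2_def cf0_comp cf0_ten)
  also have "dif n (mul2 m') (mul2 m) (cf (d \<otimes> d) 0 x) = tm 2 2 \<mu> (cf m 0) y + tm 2 2 (cf m 0) \<mu> y"
  proof -
    have [simp]: "cf (d \<otimes> d) 0 x \<in> T B 4" by (rule arr_in) simp_all
    show ?thesis by (simp add: mul2_def dif_comp_left eqv_ten dif_ten cf0_comp \<mu>_def y_def)
  qed
  also have "dif n (d' \<otimes> d') (d \<otimes> d) x = tm 1 1 \<nu> (cf d 0) x + tm 1 1 (cf d 0) \<nu> x"
    by (simp add: dif_ten \<nu>_def)
  also have "cf (mul2 m) 0 (tm 1 1 \<nu> (cf d 0) x + tm 1 1 (cf d 0) \<nu> x) =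
      cf (mul2 m) 0 (tm 1 1 \<nu> (cf d 0) x) + cf (mul2 m) 0 (tm 1 1 (cf d 0) \<nu> x)"
  proof (rule lin_add[OF arr_lin'])
    have l: "lin s 1 2 \<nu>" "lin s 1 2 (cf d 0)"
      by (simp_all add: \<nu>_def hlin_lin[OF hlin_dif] arr_lin')
    show "tm 1 1 \<nu> (cf d 0) x \<in> T B 4" "tm 1 1 (cf d 0) \<nu> x \<in> T B 4"
      by (rule lin_in[OF lin_tm[OF l, of 2 4]] lin_in[OF lin_tm[OF l(2,1), of 2 4]]; simp)+
  qed simp_all
  finally show ?thesis by (simp add: algebra_simps)
qed

lemma dif_coassoc_change:
  assumes [simp]: "x \<in> T B 1"
  defines "\<nu> \<equiv> dif n d' d"
  shows "dif n (coaR d') (coaL d') x = dif n (coaR d) (coaL d) x +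
    (tm 1 1 (\<lambda>x. x) \<nu> (cf d 0 x) + cf (I 1 \<otimes> d) 0 (\<nu> x)) -
    (tm 1 1 \<nu> (\<lambda>x. x) (cf d 0 x) + cf (d \<otimes> I 1) 0 (\<nu> x))"
proof -
  have "dif n (coaR d') (coaL d') x - dif n (coaR d) (coaL d) x = dif n (coaR d') (coaR d) x - dif n (coaL d') (coaL d) x"
    by (simp add: dif_def)
  also have "\<dots> = (tm 1 1 (\<lambda>x. x) \<nu> (cf d 0 x) + cf (I 1 \<otimes> d) 0 (\<nu> x)) -
    (tm 1 1 \<nu> (\<lambda>x. x) (cf d 0 x) + cf (d \<otimes> I 1) 0 (\<nu> x))"
    by (simp add: coaL_def coaR_def dif_comp dif_simps cf0_ten \<nu>_def)
  finally show ?thesis by (simp add: algebra_simps)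
qed

end

section \<open>Failure of a series to be a morphism between two structures\<close>

context
  fixes \<phi>
  assumes phi [simp]: "arr \<phi>" "src \<phi> = 1" "tgt \<phi> = 1"
begin

text \<open>The loop carries both bracketings of a triple product from m to m', moving \<phi> past
  one multiplication at a time. The two edges that apply associativity of m or m' vanish at t^n,
  because associativity is assumed modulo t^(n+1); what remains is the cocycle identity for
  \<mu>.\<close>

lemma twist_assoc:
  assumes [simp]: "eqv n (\<phi> \<cdot> m) (m' \<cdot> (\<phi> \<otimes> \<phi>))" and x [simp]: "x \<in> T B 3"
    and a: "eqv (Suc n) (assL m) (assR m)" "eqv (Suc n) (assL m') (assR m')"
  defines "\<mu> \<equiv> dif n (\<phi> \<cdot> m) (m' \<cdot> (\<phi> \<otimes> \<phi>))"
  shows "\<mu> (cf (m \<otimes> I 1) 0 x) + cf m' 0 (tm 2 1 \<mu> (cf \<phi> 0) x) =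
    \<mu> (cf (I 1 \<otimes> m) 0 x) + cf m' 0 (tm 1 2 (cf \<phi> 0) \<mu> x)"
proof -
  have 1: "(m' \<cdot> (\<phi> \<otimes> \<phi>)) \<cdot> (m \<otimes> I 1) = m' \<cdot> ((\<phi> \<cdot> m) \<otimes> \<phi>)"
    "(m' \<cdot> (\<phi> \<otimes> \<phi>)) \<cdot> (I 1 \<otimes> m) = m' \<cdot> (\<phi> \<otimes> (\<phi> \<cdot> m))"
    by (simp_all add: interchange)
  have 2: "m' \<cdot> ((m' \<cdot> (\<phi> \<otimes> \<phi>)) \<otimes> \<phi>) = assL m' \<cdot> ((\<phi> \<otimes> \<phi>) \<otimes> \<phi>)"
    by (simp add: assL_def interchange del: ten_assoc)
  have 3: "m' \<cdot> (\<phi> \<otimes> (m' \<cdot> (\<phi> \<otimes> \<phi>))) = assR m' \<cdot> (\<phi> \<otimes> \<phi> \<otimes> \<phi>)"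
    by (simp add: assR_def interchange)
  have "dif n ((\<phi> \<cdot> m) \<cdot> (m \<otimes> I 1)) ((m' \<cdot> (\<phi> \<otimes> \<phi>)) \<cdot> (m \<otimes> I 1)) x +
      dif n (m' \<cdot> ((\<phi> \<cdot> m) \<otimes> \<phi>)) (m' \<cdot> ((m' \<cdot> (\<phi> \<otimes> \<phi>)) \<otimes> \<phi>)) x +
      dif n (assL m' \<cdot> (\<phi> \<otimes> \<phi> \<otimes> \<phi>)) (assR m' \<cdot> (\<phi> \<otimes> \<phi> \<otimes> \<phi>)) x =
    dif n (\<phi> \<cdot> assL m) (\<phi> \<cdot> assR m) x +
      dif n ((\<phi> \<cdot> m) \<cdot> (I 1 \<otimes> m)) ((m' \<cdot> (\<phi> \<otimes> \<phi>)) \<cdot> (I 1 \<otimes> m)) x +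
      dif n (m' \<cdot> (\<phi> \<otimes> (\<phi> \<cdot> m))) (m' \<cdot> (\<phi> \<otimes> (m' \<cdot> (\<phi> \<otimes> \<phi>)))) x"
    unfolding dif_def 1 2 3 by (simp add: assL_def[of m] assR_def[of m])
  moreover have "dif n (assL m' \<cdot> (\<phi> \<otimes> \<phi> \<otimes> \<phi>)) (assR m' \<cdot> (\<phi> \<otimes> \<phi> \<otimes> \<phi>)) x = 0"
    "dif n (\<phi> \<cdot> assL m) (\<phi> \<cdot> assR m) x = 0"
    using a by (auto intro!: dif_eqv_Suc)
  ultimately show ?thesis by (simp add: dif_simps \<mu>_def del: comp_assoc)
qed

text \<open>Compatibility is carried from (m, d) to (m', d'). As \<open>cmp\<close> involves each
  operation twice, \<phi> passes one tensor factor per edge, which gives two terms with \<mu> and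
  two with \<nu>. The edges given by the axioms of the two structures contribute nothing at
  t^n.\<close>

lemma twist_mixed:
  assumes [simp]: "eqv n (\<phi> \<cdot> m) (m' \<cdot> (\<phi> \<otimes> \<phi>))" "eqv n ((\<phi> \<otimes> \<phi>) \<cdot> d) (d' \<cdot> \<phi>)" and x [simp]: "x \<in> T B 2"
    and a: "eqv (Suc n) (d \<cdot> m) (cmp m d)" "eqv (Suc n) (d' \<cdot> m') (cmp m' d')"
  defines "\<mu> \<equiv> dif n (\<phi> \<cdot> m) (m' \<cdot> (\<phi> \<otimes> \<phi>))" and "\<nu> \<equiv> dif n ((\<phi> \<otimes> \<phi>) \<cdot> d) (d' \<cdot> \<phi>)"
    and "y \<equiv> cf (ms \<cdot> (d \<otimes> d)) 0 x"
  shows "tm 2 2 \<mu> (cf (\<phi> \<cdot> m) 0) y + tm 2 2 (cf (m' \<cdot> (\<phi> \<otimes> \<phi>)) 0) \<mu> y +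
      cf (mul2 m') 0 (tm 1 1 \<nu> (cf ((\<phi> \<otimes> \<phi>) \<cdot> d) 0) x) + cf (mul2 m') 0 (tm 1 1 (cf (d' \<cdot> \<phi>) 0) \<nu> x) =
    \<nu> (cf m 0 x) + cf d' 0 (\<mu> x)"
proof -
  let ?tw = "m' \<cdot> (\<phi> \<otimes> \<phi>)" and ?ct = "(\<phi> \<otimes> \<phi>) \<cdot> d" and ?S = "ms \<cdot> (d \<otimes> d)"
  have 1: "(\<phi> \<otimes> \<phi>) \<cdot> cmp m d = ((\<phi> \<cdot> m) \<otimes> (\<phi> \<cdot> m)) \<cdot> ?S"
    by (simp add: cmp_def mul2_def interchange')
  have 2: "(?tw \<otimes> ?tw) \<cdot> ?S = mul2 m' \<cdot> (?ct \<otimes> ?ct)"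
  proof -
    have "(?tw \<otimes> ?tw) \<cdot> ?S = (m' \<otimes> m') \<cdot> ((\<phi> \<otimes> \<phi> \<otimes> \<phi> \<otimes> \<phi>) \<cdot> ms) \<cdot> (d \<otimes> d)"
    proof -
      have "?tw \<otimes> ?tw = (m' \<otimes> m') \<cdot> ((\<phi> \<otimes> \<phi>) \<otimes> \<phi> \<otimes> \<phi>)"
        by (simp add: interchange del: ten_assoc)
      then show ?thesis by simp
    qed
    also have "(\<phi> \<otimes> \<phi> \<otimes> \<phi> \<otimes> \<phi>) \<cdot> ms = ms \<cdot> (\<phi> \<otimes> \<phi> \<otimes> \<phi> \<otimes> \<phi>)"
      by (rule msw_natural_at[symmetric]) simp_all
    also have "(m' \<otimes> m') \<cdot> (ms \<cdot> (\<phi> \<otimes> \<phi> \<otimes> \<phi> \<otimes> \<phi>)) \<cdot> (d \<otimes> d) = mul2 m' \<cdot> ((\<phi> \<otimes> \<phi>) \<otimes> \<phi> \<otimes> \<phi>) \<cdot> (d \<otimes> d)"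
      by (simp add: mul2_def)
    also have "\<dots> = mul2 m' \<cdot> (?ct \<otimes> ?ct)"
      by (simp add: interchange del: ten_assoc)
    finally show ?thesis .
  qed
  have 3: "mul2 m' \<cdot> ((d' \<cdot> \<phi>) \<otimes> (d' \<cdot> \<phi>)) = cmp m' d' \<cdot> (\<phi> \<otimes> \<phi>)"
    by (simp add: cmp_def interchange)
  have "dif n ((\<phi> \<otimes> \<phi>) \<cdot> (d \<cdot> m)) ((\<phi> \<otimes> \<phi>) \<cdot> cmp m d) x +
      dif n (((\<phi> \<cdot> m) \<otimes> (\<phi> \<cdot> m)) \<cdot> ?S) ((?tw \<otimes> (\<phi> \<cdot> m)) \<cdot> ?S) x +
      dif n ((?tw \<otimes> (\<phi> \<cdot> m)) \<cdot> ?S) ((?tw \<otimes> ?tw) \<cdot> ?S) x +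
      dif n (mul2 m' \<cdot> (?ct \<otimes> ?ct)) (mul2 m' \<cdot> ((d' \<cdot> \<phi>) \<otimes> ?ct)) x +
      dif n (mul2 m' \<cdot> ((d' \<cdot> \<phi>) \<otimes> ?ct)) (mul2 m' \<cdot> ((d' \<cdot> \<phi>) \<otimes> (d' \<cdot> \<phi>))) x =
    dif n (?ct \<cdot> m) ((d' \<cdot> \<phi>) \<cdot> m) x + dif n (d' \<cdot> (\<phi> \<cdot> m)) (d' \<cdot> ?tw) x +
      dif n ((d' \<cdot> m') \<cdot> (\<phi> \<otimes> \<phi>)) (cmp m' d' \<cdot> (\<phi> \<otimes> \<phi>)) x"
    unfolding dif_def 1 2 3 by simp
  moreover have "dif n ((\<phi> \<otimes> \<phi>) \<cdot> (d \<cdot> m)) ((\<phi> \<otimes> \<phi>) \<cdot> cmp m d) x = 0"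
    "dif n ((d' \<cdot> m') \<cdot> (\<phi> \<otimes> \<phi>)) (cmp m' d' \<cdot> (\<phi> \<otimes> \<phi>)) x = 0"
    using a by (auto intro!: dif_eqv_Suc simp del: comp_assoc)
  ultimately show ?thesis by (simp add: dif_simps \<mu>_def \<nu>_def y_def del: comp_assoc)
qed

lemma twist_coassoc:
  assumes [simp]: "eqv n ((\<phi> \<otimes> \<phi>) \<cdot> d) (d' \<cdot> \<phi>)" and x [simp]: "x \<in> T B 1"
    and a: "eqv (Suc n) (coaR d) (coaL d)" "eqv (Suc n) (coaR d') (coaL d')"
  defines "\<nu> \<equiv> dif n ((\<phi> \<otimes> \<phi>) \<cdot> d) (d' \<cdot> \<phi>)"
  shows "tm 1 1 \<nu> (cf \<phi> 0) (cf d 0 x) + cf (d' \<otimes> I 1) 0 (\<nu> x) =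
    tm 1 1 (cf \<phi> 0) \<nu> (cf d 0 x) + cf (I 1 \<otimes> d') 0 (\<nu> x)"
proof -
  let ?ct = "(\<phi> \<otimes> \<phi>) \<cdot> d"
  have 1: "(?ct \<otimes> \<phi>) \<cdot> d = ((\<phi> \<otimes> \<phi>) \<otimes> \<phi>) \<cdot> coaL d"
    by (simp add: coaL_def interchange' del: ten_assoc)
  have 2: "(\<phi> \<otimes> ?ct) \<cdot> d = (\<phi> \<otimes> \<phi> \<otimes> \<phi>) \<cdot> coaR d"
    by (simp add: coaR_def interchange')
  have 3: "((d' \<cdot> \<phi>) \<otimes> \<phi>) \<cdot> d = (d' \<otimes> I 1) \<cdot> ?ct" "(\<phi> \<otimes> (d' \<cdot> \<phi>)) \<cdot> d = (I 1 \<otimes> d') \<cdot> ?ct"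
    by (simp_all add: interchange')
  have "dif n ((?ct \<otimes> \<phi>) \<cdot> d) (((d' \<cdot> \<phi>) \<otimes> \<phi>) \<cdot> d) x +
      dif n ((d' \<otimes> I 1) \<cdot> ?ct) ((d' \<otimes> I 1) \<cdot> (d' \<cdot> \<phi>)) x +
      dif n ((\<phi> \<otimes> \<phi> \<otimes> \<phi>) \<cdot> coaR d) ((\<phi> \<otimes> \<phi> \<otimes> \<phi>) \<cdot> coaL d) x =
    dif n ((\<phi> \<otimes> ?ct) \<cdot> d) ((\<phi> \<otimes> (d' \<cdot> \<phi>)) \<cdot> d) x +
      dif n ((I 1 \<otimes> d') \<cdot> ?ct) ((I 1 \<otimes> d') \<cdot> (d' \<cdot> \<phi>)) x +
      dif n (coaR d' \<cdot> \<phi>) (coaL d' \<cdot> \<phi>) x"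
    unfolding dif_def 1 2 3 by (simp add: coaL_def[of d'] coaR_def[of d'])
  moreover have "dif n ((\<phi> \<otimes> \<phi> \<otimes> \<phi>) \<cdot> coaR d) ((\<phi> \<otimes> \<phi> \<otimes> \<phi>) \<cdot> coaL d) x = 0"
    "dif n (coaR d' \<cdot> \<phi>) (coaL d' \<cdot> \<phi>) x = 0"
    using a by (auto intro!: dif_eqv_Suc)
  ultimately show ?thesis by (simp add: dif_simps \<nu>_def del: comp_assoc)
qed

text \<open>In \<open>m' \<cdot> (\<psi> \<otimes> \<psi>)\<close> the series occurs twice and in
  \<open>\<psi> \<cdot> m\<close> once. The Leibniz rule yields three terms, which are those of the
  horizontal differential of f when the t^0 coefficients are those of B; dually for the
  comultiplication.\<close>

lemma twist_change:
  assumes [simp]: "arr \<psi>" "src \<psi> = 1" "tgt \<psi> = 1" "eqv n \<psi> \<phi>"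
  defines "f \<equiv> dif n \<psi> \<phi>"
  shows "x \<in> T B 2 \<Longrightarrow> dif n (\<psi> \<cdot> m) (m' \<cdot> (\<psi> \<otimes> \<psi>)) x = dif n (\<phi> \<cdot> m) (m' \<cdot> (\<phi> \<otimes> \<phi>)) x +
      f (cf m 0 x) - cf m' 0 (tm 1 1 f (cf \<phi> 0) x + tm 1 1 (cf \<phi> 0) f x)" (is "_ \<Longrightarrow> ?A")
    and "x \<in> T B 1 \<Longrightarrow> dif n ((\<psi> \<otimes> \<psi>) \<cdot> d) (d' \<cdot> \<psi>) x = dif n ((\<phi> \<otimes> \<phi>) \<cdot> d) (d' \<cdot> \<phi>) x +
      (tm 1 1 f (cf \<phi> 0) (cf d 0 x) + tm 1 1 (cf \<phi> 0) f (cf d 0 x)) - cf d' 0 (f x)" (is "_ \<Longrightarrow> ?B")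
proof -
  have [simp]: "cf \<psi> 0 = cf \<phi> 0" using assms(4) n by (rule eqv_cf0)
  have t: "dif n (\<psi> \<otimes> \<psi>) (\<phi> \<otimes> \<phi>) y = tm 1 1 f (cf \<phi> 0) y + tm 1 1 (cf \<phi> 0) f y" for y
    by (simp add: dif_ten f_def)
  {
    assume [simp]: "x \<in> T B 2"
    have "dif n (\<psi> \<cdot> m) (m' \<cdot> (\<psi> \<otimes> \<psi>)) x - dif n (\<phi> \<cdot> m) (m' \<cdot> (\<phi> \<otimes> \<phi>)) x =
        dif n (\<psi> \<cdot> m) (\<phi> \<cdot> m) x - dif n (m' \<cdot> (\<psi> \<otimes> \<psi>)) (m' \<cdot> (\<phi> \<otimes> \<phi>)) x"
      by (simp add: dif_def)
    also have "\<dots> = f (cf m 0 x) - cf m' 0 (tm 1 1 f (cf \<phi> 0) x + tm 1 1 (cf \<phi> 0) f x)"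
      by (simp add: dif_comp_left dif_comp_right eqv_ten t f_def)
    finally show ?A by (simp add: algebra_simps)
  }
  {
    assume [simp]: "x \<in> T B 1"
    have "dif n ((\<psi> \<otimes> \<psi>) \<cdot> d) (d' \<cdot> \<psi>) x - dif n ((\<phi> \<otimes> \<phi>) \<cdot> d) (d' \<cdot> \<phi>) x =
        dif n ((\<psi> \<otimes> \<psi>) \<cdot> d) ((\<phi> \<otimes> \<phi>) \<cdot> d) x - dif n (d' \<cdot> \<psi>) (d' \<cdot> \<phi>) x"
      by (simp add: dif_def)
    also have "\<dots> = (tm 1 1 f (cf \<phi> 0) (cf d 0 x) + tm 1 1 (cf \<phi> 0) f (cf d 0 x)) - cf d' 0 (f x)"
      by (simp add: dif_comp_left dif_comp_right eqv_ten t f_def)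
    finally show ?B by (simp add: algebra_simps)
  }
qed

end

end

section \<open>The differentials of the bicomplex\<close>

lemma shape0: "shape mult0 comult0"
  by (simp add: shape_def)

lemmas [simp] = composites[OF shape0]

lemma order0_composites [simp]:
  "order0 (mul2 mult0)" "order0 (assL mult0)" "order0 (assR mult0)" "order0 (coaL comult0)" "order0 (coaR comult0)"
  by (simp_all add: mul2_def assL_def assR_def coaL_def coaR_def)

abbreviation W where "W \<equiv> (mult0 \<otimes> mult0 \<otimes> mult0) \<cdot> ush6"

lemma tm_tmap: "x \<in> T B (p + q) \<Longrightarrow> tmap s p f g x = tm p q f g x"
  by (simp add: tm_def restrict0_def)

lemma tm_tmap_at: "x \<in> T B n \<Longrightarrow> n = p + q \<Longrightarrow> tmap s p f g x = tm p q f g x"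
  by (simp add: tm_tmap)

lemma lin_cf0: "arr F \<Longrightarrow> src F = p \<Longrightarrow> tgt F = q \<Longrightarrow> lin s p q (cf F 0)"
  using arr_lin by blast

lemmas eval_simps = structure_maps_tens tprod_nil_left[OF comult_in] tprod_nil_right[OF comult_in]
  tprod_nil_left[OF tprod_in[OF comult_in tens_in[OF refl] refl]]

text \<open>Hat degrees up to three involve cochains with at most three arguments, whose
  differentials have at most four; these are all the instances of \<open>mu\<close> that
  occur.\<close>

lemma mu_eq:
  "x \<in> T B 2 \<Longrightarrow> mu B 1 x = cf mult0 0 x"
  "x \<in> T B 3 \<Longrightarrow> mu B 1 x = cf (mult0 \<otimes> I 1) 0 x"
  "x \<in> T B 3 \<Longrightarrow> mu B 2 x = cf (I 1 \<otimes> mult0) 0 x"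
  "x \<in> T B 4 \<Longrightarrow> mu B 1 x = cf (mult0 \<otimes> I 2) 0 x"
  "x \<in> T B 4 \<Longrightarrow> mu B 2 x = cf (I 1 \<otimes> mult0 \<otimes> I 1) 0 x"
  "x \<in> T B 4 \<Longrightarrow> mu B 3 x = cf (I 2 \<otimes> mult0) 0 x"
  unfolding mu_def
  by (rule tlift_cong_tens[OF lin_cf0]; (simp; fail)?;
    auto simp: length2_conv length3_conv length4_conv eval_tens eval_simps)+

lemma delta_eq:
  "x \<in> T B 1 \<Longrightarrow> delta B 1 x = cf comult0 0 x"
  "x \<in> T B 2 \<Longrightarrow> delta B 1 x = cf (comult0 \<otimes> I 1) 0 x"
  "x \<in> T B 2 \<Longrightarrow> delta B 2 x = cf (I 1 \<otimes> comult0) 0 x"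
  "x \<in> T B 3 \<Longrightarrow> delta B 1 x = cf (comult0 \<otimes> I 2) 0 x"
  "x \<in> T B 3 \<Longrightarrow> delta B 2 x = cf (I 1 \<otimes> comult0 \<otimes> I 1) 0 x"
  "x \<in> T B 3 \<Longrightarrow> delta B 3 x = cf (I 2 \<otimes> comult0) 0 x"
  unfolding delta_def
  by (rule tlift_cong_tens[OF lin_cf0]; (simp; fail)?;
    auto simp: length1_conv length2_conv length3_conv eval_tens eval_simps)+

lemma tmult_eq:
  assumes g: "lin s (p + p) q g" "\<And>as bs. length as = p \<Longrightarrow> length bs = p \<Longrightarrow> tens s (map2 (*) as bs) = g (tens s (as @ bs))"
    and x: "x \<in> T B p" and y: "y \<in> T B p"
  shows "tmult B x y = g (tprod s x y)"
  unfolding tmult_def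
proof (rule tlift_cong_tens[OF lin_comp[OF lin_tprod_left[OF y refl] g(1)] _ x])
  fix as :: "'b list" assume as: "length as = p"
  show "tlift y (\<lambda>bs. tens s (map2 (*) as bs)) = g (tprod s (tens s as) y)"
    by (rule tlift_cong_tens[OF lin_comp[OF lin_tprod_right[OF _ refl] g(1)] _ y]) (simp_all add: as g(2))
qed

lemma tmult_1: "x \<in> T B 1 \<Longrightarrow> y \<in> T B 1 \<Longrightarrow> tmult B x y = cf mult0 0 (tprod s x y)"
  by (rule tmult_eq[OF lin_cf0]) (auto simp: length1_conv eval_simps)

lemma tmult_2: "x \<in> T B 2 \<Longrightarrow> y \<in> T B 2 \<Longrightarrow> tmult B x y = cf (mul2 mult0) 0 (tprod s x y)"
  by (rule tmult_eq[OF lin_cf0]) (auto simp: length2_conv mul2_def eval_tens eval_simps)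

lemma W_tens: "cf W 0 (tens s [a, b, c, d, e, f]) = tens s [a * d, b * e, c * f]"
  by (simp add: cf0_comp ush6_tens) (simp add: eval_tens eval_simps)

lemma tmult_3: "x \<in> T B 3 \<Longrightarrow> y \<in> T B 3 \<Longrightarrow> tmult B x y = cf W 0 (tprod s x y)"
  by (rule tmult_eq[OF lin_cf0]) (auto simp: length3_conv W_tens)

text \<open>\<open>copow\<close> always applies the comultiplication to the first factor, hence the
  left nested \<open>coaL\<close>.\<close>

lemma copow_eq:
  "copow B 1 a = tens s [a]"
  "copow B 2 a = cf comult0 0 (tens s [a])"
  "copow B 3 a = cf (coaL comult0) 0 (tens s [a])"
  by (simp_all add: eval_nat_numeral One_nat_def)
    (simp_all add: One_nat_def[symmetric] numeral_2_eq_2[symmetric] eval_simps coaL_def cf0_comp delta_eq comult_in)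

lemma lam_eq:
  "x \<in> T B 2 \<Longrightarrow> lam B 1 x = cf mult0 0 x"
  "x \<in> T B 3 \<Longrightarrow> lam B 2 x = cf (mul2 mult0) 0 (tm 1 2 (cf comult0 0) (\<lambda>x. x) x)"
  "x \<in> T B 4 \<Longrightarrow> lam B 3 x = cf W 0 (tm 1 3 (cf (coaL comult0) 0) (\<lambda>x. x) x)"
proof -
  show "x \<in> T B 2 \<Longrightarrow> lam B 1 x = cf mult0 0 x"
    unfolding lam_def by (rule tlift_cong_tens[OF lin_cf0]) (auto simp: length2_conv copow_eq tmult_1)
  show "x \<in> T B 3 \<Longrightarrow> lam B 2 x = cf (mul2 mult0) 0 (tm 1 2 (cf comult0 0) (\<lambda>x. x) x)"
    unfolding lam_def
    by (rule tlift_cong_tens[OF lin_comp[OF lin_tm[OF lin_cf0 lin_id(2)] lin_cf0]])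
      (auto simp: length3_conv copow_eq tmult_2 tm_tens[OF lin_cf0 lin_id(2)] arr_in)
  show "x \<in> T B 4 \<Longrightarrow> lam B 3 x = cf W 0 (tm 1 3 (cf (coaL comult0) 0) (\<lambda>x. x) x)"
    unfolding lam_def
    by (rule tlift_cong_tens[OF lin_comp[OF lin_tm[OF lin_cf0 lin_id(2)] lin_cf0]])
      (auto simp: length4_conv copow_eq tmult_3 tm_tens[OF lin_cf0 lin_id(2)] arr_in)
qed

lemma rho_eq:
  "x \<in> T B 2 \<Longrightarrow> rho B 1 x = cf mult0 0 x"
  "x \<in> T B 3 \<Longrightarrow> rho B 2 x = cf (mul2 mult0) 0 (tm 2 1 (\<lambda>x. x) (cf comult0 0) x)"
  "x \<in> T B 4 \<Longrightarrow> rho B 3 x = cf W 0 (tm 3 1 (\<lambda>x. x) (cf (coaL comult0) 0) x)"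
proof -
  show "x \<in> T B 2 \<Longrightarrow> rho B 1 x = cf mult0 0 x"
    unfolding rho_def by (rule tlift_cong_tens[OF lin_cf0]) (auto simp: length2_conv copow_eq tmult_1)
  show "x \<in> T B 3 \<Longrightarrow> rho B 2 x = cf (mul2 mult0) 0 (tm 2 1 (\<lambda>x. x) (cf comult0 0) x)"
    unfolding rho_def
    by (rule tlift_cong_tens[OF lin_comp[OF lin_tm[OF lin_id(2) lin_cf0] lin_cf0]])
      (auto simp: length3_conv copow_eq tmult_2 tm_tens[OF lin_id(2) lin_cf0] arr_in)
  show "x \<in> T B 4 \<Longrightarrow> rho B 3 x = cf W 0 (tm 3 1 (\<lambda>x. x) (cf (coaL comult0) 0) x)"
    unfolding rho_def
    by (rule tlift_cong_tens[OF lin_comp[OF lin_tm[OF lin_id(2) lin_cf0] lin_cf0]])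
      (auto simp: length4_conv copow_eq tmult_3 tm_tens[OF lin_id(2) lin_cf0] arr_in)
qed

lemma comult_all_eq:
  "comult_all B [a] = cf comult0 0 (tens s [a])"
  "comult_all B [a, b] = cf (comult0 \<otimes> comult0) 0 (tens s [a, b])"
  "comult_all B [a, b, c] = cf (comult0 \<otimes> comult0 \<otimes> comult0) 0 (tens s [a, b, c])"
  by (simp_all add: comult_all_def eval_tens eval_simps)

lemma legs_2: "leg1 2 [a, b, c, d] = [a, c]" "leg2 2 [a, b, c, d] = [b, d]"
  and legs_1: "leg1 1 [a, b] = [a]" "leg2 1 [a, b] = [b]"
  and legs_3: "leg1 3 [a, b, c, d, e, f] = [a, c, e]" "leg2 3 [a, b, c, d, e, f] = [b, d, f]"
  by (simp_all add: leg1_def leg2_def upt_rec eval_nat_numeral One_nat_def)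

lemma sigma_aux:
  assumes g: "lin s (2 * q) r g" and e: "\<And>cs. length cs = 2 * q \<Longrightarrow> F cs = g (tens s cs)"
    and h: "lin s q (2 * q) h" "\<And>bs. length bs = q \<Longrightarrow> comult_all B bs = h (tens s bs)" and x: "x \<in> T B q"
  shows "tlift x (\<lambda>bs. tlift (comult_all B bs) F) = g (h x)"
proof (rule tlift_cong_tens[OF lin_comp[OF h(1) g] _ x])
  fix bs :: "'b list" assume bs: "length bs = q"
  show "tlift (comult_all B bs) F = g (h (tens s bs))"
    unfolding h(2)[OF bs] by (rule tlift_cong_tens[OF g e]) (use lin_in[OF h(1)] bs in auto)
qed

text \<open>\<open>prod_list\<close> multiplies the legs from the right and ends in 1; associativity
  of B brings this to the form \<open>assL mult0\<close> in which the loops supply it.\<close>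

lemma sigma_eq:
  "x \<in> T B 1 \<Longrightarrow> sigma B 1 x = cf comult0 0 x"
  "x \<in> T B 2 \<Longrightarrow> sigma B 2 x = tm 2 2 (cf mult0 0) (\<lambda>x. x) (cf (ms \<cdot> (comult0 \<otimes> comult0)) 0 x)"
  "x \<in> T B 3 \<Longrightarrow> sigma B 3 x = tm 3 3 (cf (assL mult0) 0) (\<lambda>x. x) (cf (sh6 \<cdot> (comult0 \<otimes> comult0 \<otimes> comult0)) 0 x)"
proof -
  show "x \<in> T B 1 \<Longrightarrow> sigma B 1 x = cf comult0 0 x"
    unfolding sigma_def
    by (rule sigma_aux[OF lin_id(2) _ lin_cf0, simplified]) (auto simp: length1_conv length2_conv legs_1 comult_all_eq)
  show "x \<in> T B 2 \<Longrightarrow> sigma B 2 x = tm 2 2 (cf mult0 0) (\<lambda>x. x) (cf (ms \<cdot> (comult0 \<otimes> comult0)) 0 x)"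
    unfolding sigma_def cf0_comp
    by (rule sigma_aux[OF lin_comp[OF lin_cf0 lin_tm[OF lin_cf0 lin_id(2)]] _ lin_cf0])
      (auto simp: length2_conv length4_conv legs_2 comult_all_eq eval_tens eval_simps tm_tens[OF lin_cf0 lin_id(2)])
  show "x \<in> T B 3 \<Longrightarrow> sigma B 3 x = tm 3 3 (cf (assL mult0) 0) (\<lambda>x. x) (cf (sh6 \<cdot> (comult0 \<otimes> comult0 \<otimes> comult0)) 0 x)"
    unfolding sigma_def cf0_comp
    by (rule sigma_aux[OF lin_comp[OF lin_cf0 lin_tm[OF lin_cf0 lin_id(2)]] _ lin_cf0])
      (auto simp: length3_conv length6_conv legs_3 comult_all_eq sh6_tens tm_tens[OF lin_cf0 lin_id(2)],
       auto simp: assL_def eval_tens eval_simps mult.assoc)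
qed

lemma tau_eq:
  "x \<in> T B 1 \<Longrightarrow> tau B 1 x = cf comult0 0 x"
  "x \<in> T B 2 \<Longrightarrow> tau B 2 x = tm 2 2 (\<lambda>x. x) (cf mult0 0) (cf (ms \<cdot> (comult0 \<otimes> comult0)) 0 x)"
  "x \<in> T B 3 \<Longrightarrow> tau B 3 x = tm 3 3 (\<lambda>x. x) (cf (assL mult0) 0) (cf (sh6 \<cdot> (comult0 \<otimes> comult0 \<otimes> comult0)) 0 x)"
proof -
  show "x \<in> T B 1 \<Longrightarrow> tau B 1 x = cf comult0 0 x"
    unfolding tau_def
    by (rule sigma_aux[OF lin_id(2) _ lin_cf0, simplified]) (auto simp: length1_conv length2_conv legs_1 comult_all_eq)
  show "x \<in> T B 2 \<Longrightarrow> tau B 2 x = tm 2 2 (\<lambda>x. x) (cf mult0 0) (cf (ms \<cdot> (comult0 \<otimes> comult0)) 0 x)"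
    unfolding tau_def cf0_comp
    by (rule sigma_aux[OF lin_comp[OF lin_cf0 lin_tm[OF lin_id(2) lin_cf0]] _ lin_cf0])
      (auto simp: length2_conv length4_conv legs_2 comult_all_eq eval_tens eval_simps tm_tens[OF lin_id(2) lin_cf0])
  show "x \<in> T B 3 \<Longrightarrow> tau B 3 x = tm 3 3 (\<lambda>x. x) (cf (assL mult0) 0) (cf (sh6 \<cdot> (comult0 \<otimes> comult0 \<otimes> comult0)) 0 x)"
    unfolding tau_def cf0_comp
    by (rule sigma_aux[OF lin_comp[OF lin_cf0 lin_tm[OF lin_id(2) lin_cf0]] _ lin_cf0])
      (auto simp: length3_conv length6_conv legs_3 comult_all_eq sh6_tens tm_tens[OF lin_id(2) lin_cf0],
       auto simp: assL_def eval_tens eval_simps mult.assoc)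
qed

text \<open>A tensor product of maps may be applied one factor at a time, in either order. This
  merges the coproduct hidden in \<open>lam\<close> and \<open>rho\<close>, or the product in
  \<open>sigma\<close> and \<open>tau\<close>, with the cochain f.\<close>

lemma tm_slides:
  assumes g: "lin s a a' g" and f: "lin s q p f"
  shows "tm a p g (\<lambda>x. x) (tm a q (\<lambda>x. x) f x) = tm a q g f x"
    and "tm p a (\<lambda>x. x) g (tm q a f (\<lambda>x. x) x) = tm q a f g x"
    and "tm a' q (\<lambda>x. x) f (tm a q g (\<lambda>x. x) x) = tm a q g f x"
    and "tm q a' f (\<lambda>x. x) (tm q a (\<lambda>x. x) g x) = tm q a f g x"
  using tm_comp[OF lin_id(2) f g lin_id(2)] tm_comp[OF f lin_id(2) lin_id(2) g]
    tm_comp[OF g lin_id(2) lin_id(2) f] tm_comp[OF lin_id(2) g f lin_id(2)] by blast+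

lemma sum_Icc_small:
  fixes h :: "nat \<Rightarrow> ('b, 'k) tensor"
  shows "(\<Sum>i=1..1. h i) = h 1" "(\<Sum>i=1..2. h i) = h 1 + h 2" "(\<Sum>i=1..3. h i) = h 1 + h 2 + h 3"
  by (simp_all add: numeral_2_eq_2 numeral_3_eq_3 One_nat_def)

lemma id_tm: "tm p q id f = tm p q (\<lambda>x. x) f" "tm p q f id = tm p q f (\<lambda>x. x)"
  by (simp_all add: id_def)

lemma dh_unfold:
  assumes "x \<in> T B (q + 1)"
  shows "dh B p q f x = lam B p (tm 1 q (\<lambda>x. x) f x) + (\<Sum>i=1..q. tscale ((-1) ^ i) (f (mu B i x)))
    + tscale ((-1) ^ (q + 1)) (rho B p (tm q 1 f (\<lambda>x. x) x))"
  using assms by (simp add: dh_def restrict0_def tm_tmap tm_tmap_at[of x "q + 1" 1 q] id_tm)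

lemma dc_unfold:
  assumes "x \<in> T B q" "sigma B q x \<in> T B (1 + q)" "tau B q x \<in> T B (q + 1)"
  shows "dc B p q f x = tm 1 q (\<lambda>x. x) f (sigma B q x) + (\<Sum>j=1..p. tscale ((-1) ^ j) (delta B j (f x)))
    + tscale ((-1) ^ (p + 1)) (tm q 1 f (\<lambda>x. x) (tau B q x))"
  using assms by (simp add: dc_def restrict0_def tm_tmap id_tm)

lemma tm_in: "lin s p p' f \<Longrightarrow> lin s q q' g \<Longrightarrow> x \<in> T B (p + q) \<Longrightarrow> n = p' + q' \<Longrightarrow> tm p q f g x \<in> T B n"
  using lin_in[OF lin_tm] by blast

section \<open>Expanded differentials in the bidegrees that occur\<close>

lemma dh_1_1:
  assumes f: "lin s 1 1 f" and x: "x \<in> T B 2"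
  shows "dh B 1 1 f x = cf mult0 0 (tm 1 1 (\<lambda>x. x) f x) - f (cf mult0 0 x) + cf mult0 0 (tm 1 1 f (\<lambda>x. x) x)"
proof -
  have t: "tm 1 1 (\<lambda>x. x) f x \<in> T B 2" "tm 1 1 f (\<lambda>x. x) x \<in> T B 2"
    by (rule tm_in[OF lin_id(2) f] tm_in[OF f lin_id(2)]; simp add: x)+
  have "dh B 1 1 f x = lam B 1 (tm 1 1 (\<lambda>x. x) f x) + (\<Sum>i=1..1. tscale ((-1) ^ i) (f (mu B i x)))
    + tscale ((-1) ^ (1 + 1)) (rho B 1 (tm 1 1 f (\<lambda>x. x) x))"
    by (rule dh_unfold) (simp add: x)
  then show ?thesis
    by (simp add: lam_eq(1)[OF t(1)] rho_eq(1)[OF t(2)] sum_Icc_small mu_eq(1)[OF x])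
qed

lemma dh_1_2:
  assumes f: "lin s 2 1 f" and x: "x \<in> T B 3"
  shows "dh B 1 2 f x = cf mult0 0 (tm 1 2 (\<lambda>x. x) f x) - f (cf (mult0 \<otimes> I 1) 0 x) + f (cf (I 1 \<otimes> mult0) 0 x) - cf mult0 0 (tm 2 1 f (\<lambda>x. x) x)"
proof -
  have t: "tm 1 2 (\<lambda>x. x) f x \<in> T B 2" "tm 2 1 f (\<lambda>x. x) x \<in> T B 2"
    by (rule tm_in[OF lin_id(2) f] tm_in[OF f lin_id(2)]; simp add: x)+
  have "dh B 1 2 f x = lam B 1 (tm 1 2 (\<lambda>x. x) f x) + (\<Sum>i=1..2. tscale ((-1) ^ i) (f (mu B i x)))
    + tscale ((-1) ^ (2 + 1)) (rho B 1 (tm 2 1 f (\<lambda>x. x) x))"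
    by (rule dh_unfold) (simp add: x)
  then show ?thesis
    by (simp add: lam_eq(1)[OF t(1)] rho_eq(1)[OF t(2)] sum_Icc_small mu_eq(2,3)[OF x])
qed

lemma dh_1_3:
  assumes f: "lin s 3 1 f" and x: "x \<in> T B 4"
  shows "dh B 1 3 f x = cf mult0 0 (tm 1 3 (\<lambda>x. x) f x) - f (cf (mult0 \<otimes> I 2) 0 x) + f (cf (I 1 \<otimes> mult0 \<otimes> I 1) 0 x) - f (cf (I 2 \<otimes> mult0) 0 x) + cf mult0 0 (tm 3 1 f (\<lambda>x. x) x)"
proof -
  have t: "tm 1 3 (\<lambda>x. x) f x \<in> T B 2" "tm 3 1 f (\<lambda>x. x) x \<in> T B 2"
    by (rule tm_in[OF lin_id(2) f] tm_in[OF f lin_id(2)]; simp add: x)+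
  have "dh B 1 3 f x = lam B 1 (tm 1 3 (\<lambda>x. x) f x) + (\<Sum>i=1..3. tscale ((-1) ^ i) (f (mu B i x)))
    + tscale ((-1) ^ (3 + 1)) (rho B 1 (tm 3 1 f (\<lambda>x. x) x))"
    by (rule dh_unfold) (simp add: x)
  then show ?thesis
    by (simp add: lam_eq(1)[OF t(1)] rho_eq(1)[OF t(2)] sum_Icc_small mu_eq(4,5,6)[OF x])
qed

lemma dh_2_1:
  assumes f: "lin s 1 2 f" and x: "x \<in> T B 2"
  shows "dh B 2 1 f x = cf (mul2 mult0) 0 (tm 1 1 (cf comult0 0) f x) - f (cf mult0 0 x) + cf (mul2 mult0) 0 (tm 1 1 f (cf comult0 0) x)"
proof -
  have t: "tm 1 1 (\<lambda>x. x) f x \<in> T B 3" "tm 1 1 f (\<lambda>x. x) x \<in> T B 3"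
    by (rule tm_in[OF lin_id(2) f] tm_in[OF f lin_id(2)]; simp add: x)+
  have "dh B 2 1 f x = lam B 2 (tm 1 1 (\<lambda>x. x) f x) + (\<Sum>i=1..1. tscale ((-1) ^ i) (f (mu B i x)))
    + tscale ((-1) ^ (1 + 1)) (rho B 2 (tm 1 1 f (\<lambda>x. x) x))"
    by (rule dh_unfold) (simp add: x)
  then show ?thesis
    by (simp add: lam_eq(2)[OF t(1)] rho_eq(2)[OF t(2)] sum_Icc_small mu_eq(1)[OF x] tm_slides[OF lin_cf0[of comult0 1 2] f])
qed

lemma dh_2_2:
  assumes f: "lin s 2 2 f" and x: "x \<in> T B 3"
  shows "dh B 2 2 f x = cf (mul2 mult0) 0 (tm 1 2 (cf comult0 0) f x) - f (cf (mult0 \<otimes> I 1) 0 x) + f (cf (I 1 \<otimes> mult0) 0 x) - cf (mul2 mult0) 0 (tm 2 1 f (cf comult0 0) x)"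
proof -
  have t: "tm 1 2 (\<lambda>x. x) f x \<in> T B 3" "tm 2 1 f (\<lambda>x. x) x \<in> T B 3"
    by (rule tm_in[OF lin_id(2) f] tm_in[OF f lin_id(2)]; simp add: x)+
  have "dh B 2 2 f x = lam B 2 (tm 1 2 (\<lambda>x. x) f x) + (\<Sum>i=1..2. tscale ((-1) ^ i) (f (mu B i x)))
    + tscale ((-1) ^ (2 + 1)) (rho B 2 (tm 2 1 f (\<lambda>x. x) x))"
    by (rule dh_unfold) (simp add: x)
  then show ?thesis
    by (simp add: lam_eq(2)[OF t(1)] rho_eq(2)[OF t(2)] sum_Icc_small mu_eq(2,3)[OF x] tm_slides[OF lin_cf0[of comult0 1 2] f])
qed

lemma dh_3_1:
  assumes f: "lin s 1 3 f" and x: "x \<in> T B 2"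
  shows "dh B 3 1 f x = cf W 0 (tm 1 1 (cf (coaL comult0) 0) f x) - f (cf mult0 0 x) + cf W 0 (tm 1 1 f (cf (coaL comult0) 0) x)"
proof -
  have t: "tm 1 1 (\<lambda>x. x) f x \<in> T B 4" "tm 1 1 f (\<lambda>x. x) x \<in> T B 4"
    by (rule tm_in[OF lin_id(2) f] tm_in[OF f lin_id(2)]; simp add: x)+
  have "dh B 3 1 f x = lam B 3 (tm 1 1 (\<lambda>x. x) f x) + (\<Sum>i=1..1. tscale ((-1) ^ i) (f (mu B i x)))
    + tscale ((-1) ^ (1 + 1)) (rho B 3 (tm 1 1 f (\<lambda>x. x) x))"
    by (rule dh_unfold) (simp add: x)
  then show ?thesis
    by (simp add: lam_eq(3)[OF t(1)] rho_eq(3)[OF t(2)] sum_Icc_small mu_eq(1)[OF x] tm_slides[OF lin_cf0[of "coaL comult0" 1 3] f])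
qed

lemma dc_1_1:
  assumes f: "lin s 1 1 f" and x: "x \<in> T B 1"
  shows "dc B 1 1 f x = tm 1 1 (\<lambda>x. x) f (cf comult0 0 x) - cf comult0 0 (f x) + tm 1 1 f (\<lambda>x. x) (cf comult0 0 x)"
proof -
  have st: "sigma B 1 x \<in> T B (1 + 1)" "tau B 1 x \<in> T B (1 + 1)"
    using lin_in[OF lin_cf0[of comult0 1 2] x] by (simp_all add: sigma_eq(1)[OF x] tau_eq(1)[OF x])
  show ?thesis
    unfolding dc_unfold[OF x st]
    by (simp add: sigma_eq(1)[OF x] tau_eq(1)[OF x] sum_Icc_small delta_eq(1)[OF lin_in[OF f x]])
qed

lemma dc_1_2:
  assumes f: "lin s 2 1 f" and x: "x \<in> T B 2"
  shows "dc B 1 2 f x = tm 2 2 (cf mult0 0) f (cf (ms \<cdot> (comult0 \<otimes> comult0)) 0 x) - cf comult0 0 (f x) + tm 2 2 f (cf mult0 0) (cf (ms \<cdot> (comult0 \<otimes> comult0)) 0 x)"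
proof -
  have y: "cf (ms \<cdot> (comult0 \<otimes> comult0)) 0 x \<in> T B 4"
    by (rule arr_in) (simp_all add: x)
  have st: "sigma B 2 x \<in> T B (1 + 2)" "tau B 2 x \<in> T B (2 + 1)"
    unfolding sigma_eq(2)[OF x] tau_eq(2)[OF x]
    by (rule tm_in[OF lin_cf0[of _ 2 1] lin_id(2)] tm_in[OF lin_id(2) lin_cf0[of _ 2 1]]; simp add: y)+
  show ?thesis
    unfolding dc_unfold[OF x st]
    by (simp add: sigma_eq(2)[OF x] tau_eq(2)[OF x] sum_Icc_small delta_eq(1)[OF lin_in[OF f x]] tm_slides[OF lin_cf0[of mult0 2 1] f])
qed

lemma dc_1_3:
  assumes f: "lin s 3 1 f" and x: "x \<in> T B 3"
  shows "dc B 1 3 f x = tm 3 3 (cf (assL mult0) 0) f (cf (sh6 \<cdot> (comult0 \<otimes> comult0 \<otimes> comult0)) 0 x) - cf comult0 0 (f x) + tm 3 3 f (cf (assL mult0) 0) (cf (sh6 \<cdot> (comult0 \<otimes> comult0 \<otimes> comult0)) 0 x)"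
proof -
  have y: "cf (sh6 \<cdot> (comult0 \<otimes> comult0 \<otimes> comult0)) 0 x \<in> T B 6"
    by (rule arr_in) (simp_all add: x)
  have st: "sigma B 3 x \<in> T B (1 + 3)" "tau B 3 x \<in> T B (3 + 1)"
    unfolding sigma_eq(3)[OF x] tau_eq(3)[OF x]
    by (rule tm_in[OF lin_cf0[of _ 3 1] lin_id(2)] tm_in[OF lin_id(2) lin_cf0[of _ 3 1]]; simp add: y)+
  show ?thesis
    unfolding dc_unfold[OF x st]
    by (simp add: sigma_eq(3)[OF x] tau_eq(3)[OF x] sum_Icc_small delta_eq(1)[OF lin_in[OF f x]] tm_slides[OF lin_cf0[of "assL mult0" 3 1] f])
qed

lemma dc_2_1:
  assumes f: "lin s 1 2 f" and x: "x \<in> T B 1"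
  shows "dc B 2 1 f x = tm 1 1 (\<lambda>x. x) f (cf comult0 0 x) - cf (comult0 \<otimes> I 1) 0 (f x) + cf (I 1 \<otimes> comult0) 0 (f x) - tm 1 1 f (\<lambda>x. x) (cf comult0 0 x)"
proof -
  have st: "sigma B 1 x \<in> T B (1 + 1)" "tau B 1 x \<in> T B (1 + 1)"
    using lin_in[OF lin_cf0[of comult0 1 2] x] by (simp_all add: sigma_eq(1)[OF x] tau_eq(1)[OF x])
  show ?thesis
    unfolding dc_unfold[OF x st]
    by (simp add: sigma_eq(1)[OF x] tau_eq(1)[OF x] sum_Icc_small delta_eq(2,3)[OF lin_in[OF f x]])
qed

lemma dc_2_2:
  assumes f: "lin s 2 2 f" and x: "x \<in> T B 2"
  shows "dc B 2 2 f x = tm 2 2 (cf mult0 0) f (cf (ms \<cdot> (comult0 \<otimes> comult0)) 0 x) - cf (comult0 \<otimes> I 1) 0 (f x) + cf (I 1 \<otimes> comult0) 0 (f x) - tm 2 2 f (cf mult0 0) (cf (ms \<cdot> (comult0 \<otimes> comult0)) 0 x)"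
proof -
  have y: "cf (ms \<cdot> (comult0 \<otimes> comult0)) 0 x \<in> T B 4"
    by (rule arr_in) (simp_all add: x)
  have st: "sigma B 2 x \<in> T B (1 + 2)" "tau B 2 x \<in> T B (2 + 1)"
    unfolding sigma_eq(2)[OF x] tau_eq(2)[OF x]
    by (rule tm_in[OF lin_cf0[of _ 2 1] lin_id(2)] tm_in[OF lin_id(2) lin_cf0[of _ 2 1]]; simp add: y)+
  show ?thesis
    unfolding dc_unfold[OF x st]
    by (simp add: sigma_eq(2)[OF x] tau_eq(2)[OF x] sum_Icc_small delta_eq(2,3)[OF lin_in[OF f x]] tm_slides[OF lin_cf0[of mult0 2 1] f])
qed

lemma dc_3_1:
  assumes f: "lin s 1 3 f" and x: "x \<in> T B 1"
  shows "dc B 3 1 f x = tm 1 1 (\<lambda>x. x) f (cf comult0 0 x) - cf (comult0 \<otimes> I 2) 0 (f x) + cf (I 1 \<otimes> comult0 \<otimes> I 1) 0 (f x) - cf (I 2 \<otimes> comult0) 0 (f x) + tm 1 1 f (\<lambda>x. x) (cf comult0 0 x)"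
proof -
  have st: "sigma B 1 x \<in> T B (1 + 1)" "tau B 1 x \<in> T B (1 + 1)"
    using lin_in[OF lin_cf0[of comult0 1 2] x] by (simp_all add: sigma_eq(1)[OF x] tau_eq(1)[OF x])
  show ?thesis
    unfolding dc_unfold[OF x st]
    by (simp add: sigma_eq(1)[OF x] tau_eq(1)[OF x] sum_Icc_small delta_eq(4,5,6)[OF lin_in[OF f x]])
qed

lemma cf_comp_order0: "order0 G \<Longrightarrow> arr F \<Longrightarrow> cf (F \<cdot> G) n x = cf F n (cf G 0 x)"
  unfolding cf_comp by (subst sum_only_last) (auto simp: order0_def)

lemma cf_order0_comp: "order0 F \<Longrightarrow> cf (F \<cdot> G) n x = cf F 0 (cf G n x)"
  unfolding cf_comp by (subst sum_only_first) (auto simp: order0_def)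

section \<open>Normalised cochains\<close>

text \<open>Vanishing on tensors with a factor 1 and having an image killed by \<open>\<epsilon>\<close> in every factor
  characterises the image of the embedding in the definition of \<^const>\<open>D\<close>.\<close>

definition normal where
  "normal p q d f \<longleftrightarrow> hlin q p d f \<and> (\<forall>x. x \<notin> T B q \<longrightarrow> f x = 0) \<and>
    (\<forall>i<q. \<forall>z\<in>T B (q - 1). f (cf (I i \<otimes> eta \<otimes> I (q - 1 - i)) 0 z) = 0) \<and>
    (\<forall>i<p. \<forall>x\<in>T B q. cf (I i \<otimes> ep \<otimes> I (p - 1 - i)) 0 (f x) = 0)"

lemma normalI:
  assumes "hlin q p d f" "\<And>x. x \<notin> T B q \<Longrightarrow> f x = 0"
    and "\<And>i z. i < q \<Longrightarrow> z \<in> T B (q - 1) \<Longrightarrow> f (cf (I i \<otimes> eta \<otimes> I (q - 1 - i)) 0 z) = 0"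
    and "\<And>i x. i < p \<Longrightarrow> x \<in> T B q \<Longrightarrow> cf (I i \<otimes> ep \<otimes> I (p - 1 - i)) 0 (f x) = 0"
  shows "normal p q d f"
  using assms by (auto simp: normal_def)

lemma normal_hlin: "normal p q d f \<Longrightarrow> hlin q p d f"
  by (simp add: normal_def)

lemma normal_lin: "normal p q d f \<Longrightarrow> lin s q p f"
  by (rule hlin_lin[OF normal_hlin])

lemma eta_slot: "length bs = n \<Longrightarrow> i < n \<Longrightarrow> n' = n - 1 - i \<Longrightarrow>
   cf (I i \<otimes> eta \<otimes> I n') 0 (tens s (take i bs @ drop (Suc i) bs)) = tens s (bs[i := 1])"
  by (simp add: cf0_ten_tens cf0_I structure_maps_tens min_def upd_conv_take_nth_drop)

lemma ep_slot: "length bs = n \<Longrightarrow> i < n \<Longrightarrow> n' = n - 1 - i \<Longrightarrow>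
   cf (I i \<otimes> ep \<otimes> I n') 0 (tens s bs) = tscale (counit B (bs ! i)) (tens s (take i bs @ drop (Suc i) bs))"
proof -
  assume a: "length bs = n" "i < n" "n' = n - 1 - i"
  then have "drop i bs = bs ! i # drop (Suc i) bs" by (intro Cons_nth_drop_Suc[symmetric]) simp
  then show ?thesis using a
    by (simp add: cf0_ten_tens cf0_I structure_maps_tens tprod_scale_left
      tprod_scale_right[OF tens_in[OF refl] tens_in[OF refl]])
qed

lemma lin_ep_slot: "i < n \<Longrightarrow> lin s n (n - 1) (cf (I i \<otimes> ep \<otimes> I (n - 1 - i)) 0)"
  and lin_eta_slot: "i < n \<Longrightarrow> lin s (n - 1) n (cf (I i \<otimes> eta \<otimes> I (n - 1 - i)) 0)"
  by (rule lin_cf0; simp)+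

text \<open>Applies the projection onto Ker \<epsilon> to factor i. As the identity minus \<epsilon>
  followed by insertion of 1, it is invisible to a map that vanishes on tensors with a factor 1, and
  it fixes tensors killed by \<epsilon> in that factor.\<close>

definition slot where
  "slot n i x = x - cf (I i \<otimes> eta \<otimes> I (n - 1 - i)) 0 (cf (I i \<otimes> ep \<otimes> I (n - 1 - i)) 0 x)"

lemma tens_update_diff:
  "length bs = n \<Longrightarrow> i < n \<Longrightarrow> tens s (bs[i := x - y]) = tens s (bs[i := x]) - tens s (bs[i := y])"
  using tens_update_add[of bs n i s "x - y" y] by simp

lemma slot_tens:
  assumes "length bs = n" "i < n"
  shows "slot n i (tens s bs) = tens s (bs[i := proj_aug B (bs ! i)])"
proof -
  let ?n' = "n - 1 - i"
  have "cf (I i \<otimes> eta \<otimes> I ?n') 0 (tscale c (tens s (take i bs @ drop (Suc i) bs))) = tscale c (tens s (bs[i := 1]))" for c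
    using assms eta_slot[OF assms refl] by (subst lin_scale[OF lin_eta_slot]) simp_all
  then show ?thesis
    unfolding slot_def ep_slot[OF assms refl] proj_aug_def
    using assms by (simp add: tens_update_diff tens_update_scale)
qed

lemma lin_slot: "i < n \<Longrightarrow> lin s n n (slot n i)"
  unfolding slot_def[abs_def] by (rule lin_minus[OF lin_id(2) lin_comp[OF lin_ep_slot lin_eta_slot]])

primrec slots where
  "slots n 0 x = x"
| "slots n (Suc i) x = slots n i (slot n i x)"

lemma lin_slots: "i \<le> n \<Longrightarrow> lin s n n (slots n i)"
proof (induction i)
  case 0
  have "slots n 0 = (\<lambda>x. x)" by (rule ext) simp
  then show ?case using lin_id(2) by simp
next
  case (Suc i)
  have "slots n (Suc i) = (\<lambda>x. slots n i (slot n i x))" by (rule ext) simp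
  then show ?case using lin_comp[OF lin_slot[of i n] Suc.IH] Suc.prems by simp
qed

lemma slots_tens:
  "i \<le> n \<Longrightarrow> length bs = n \<Longrightarrow> slots n i (tens s bs) = tens s (map (proj_aug B) (take i bs) @ drop i bs)"
proof (induction i arbitrary: bs)
  case (Suc i)
  have "drop i bs = bs ! i # drop (Suc i) bs" using Suc by (intro Cons_nth_drop_Suc[symmetric]) simp
  moreover have "take (Suc i) bs = take i bs @ [bs ! i]" using Suc by (simp add: take_Suc_conv_app_nth)
  ultimately show ?case using Suc by (simp add: slot_tens upd_conv_take_nth_drop min_def One_nat_def)
qed simp

definition prj where "prj x = tlift x (\<lambda>bs. tens s (map (proj_aug B) bs))"

lemma prj_slots: "x \<in> T B n \<Longrightarrow> prj x = slots n n x"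
  unfolding prj_def by (rule tlift_cong_tens[OF lin_slots]) (auto simp: slots_tens)

lemma prj_tens: "prj (tens s bs) = tens s (map (proj_aug B) bs)"
  using prj_slots[of "tens s bs" "length bs"] by (simp add: slots_tens)

lemma prj_add: "prj (x + y) = prj x + prj y" and prj_scale: "prj (tscale c x) = tscale c (prj x)"
  and prj_zero: "prj 0 = 0"
  by (simp_all add: prj_def tlift_add tlift_scale)

lemma counit_diff: "counit B (x - y) = counit B x - counit B y"
  using counit_add[of "x - y" y] by simp

lemma proj_aug_in: "proj_aug B b \<in> aug B"
  by (simp add: proj_aug_def aug_def counit_diff counit_scale counit_one)

lemma smult_zero: "s c 0 = 0"
proof -
  interpret V: vector_space s by (rule vector_space)
  show ?thesis by simp
qed

lemma proj_aug_one: "proj_aug B 1 = 0"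
proof -
  interpret V: vector_space s by (rule vector_space)
  show ?thesis by (simp add: proj_aug_def counit_one)
qed

lemma proj_aug_grade: "b \<in> grade B k \<Longrightarrow> proj_aug B b \<in> grade B k"
proof -
  interpret V: vector_space s by (rule vector_space)
  assume b: "b \<in> grade B k"
  show ?thesis
  proof (cases "k = 0")
    case True
    then show ?thesis using b grade_one V.subspace_diff[OF grade_subspace] V.subspace_scale[OF grade_subspace]
      by (simp add: proj_aug_def)
  next
    case False
    then show ?thesis using b grade_counit by (simp add: proj_aug_def)
  qed
qed

lemma prj_in_aug: "x \<in> T B n \<Longrightarrow> prj x \<in> tpow s n (aug B)"
  by (induction rule: tpow_induct) (auto simp: prj_tens prj_add prj_scale prj_zero proj_aug_in intro!: tens_in_tpow)

lemma prj_tgrade: "x \<in> tgrade B n UNIV e \<Longrightarrow> prj x \<in> tgrade B n (aug B) e"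
proof (induction rule: tgrade_induct)
  case (tens bs ns)
  then show ?case
    by (auto simp: prj_tens proj_aug_in proj_aug_grade intro!: tgrade_tens[of _ _ ns])
qed (auto simp: prj_add prj_scale prj_zero intro: tgrade_add tgrade_scale)

lemma tpow_aug_T: "x \<in> tpow s n (aug B) \<Longrightarrow> x \<in> T B n"
  by (induction rule: tpow_induct) auto

text \<open>The projection is applied one factor at a time. Its correction term has a factor 1,
  where f vanishes; on a value of f the correction contains \<epsilon> of a factor, which is
  zero.\<close>

lemma normal_slots:
  assumes "normal p q d f" "x \<in> T B q"
  shows "f (prj x) = f x" "prj (f x) = f x"
proof -
  note f = normal_lin[OF assms(1)]
  have "f (slots q i x) = f x" if "i \<le> q" "x \<in> T B q" for i x
    using that
  proof (induction i arbitrary: x)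
    case (Suc i)
    let ?E = "cf (I i \<otimes> eta \<otimes> I (q - 1 - i)) 0" and ?P = "cf (I i \<otimes> ep \<otimes> I (q - 1 - i)) 0"
    have P: "?P x \<in> T B (q - 1)" using lin_in[OF lin_ep_slot[of i q]] Suc.prems by simp
    have E: "?E (?P x) \<in> T B q" using lin_in[OF lin_eta_slot[of i q] P] Suc.prems by simp
    have "f (?E (?P x)) = 0" using assms(1) Suc P by (auto simp: normal_def)
    then have "f (slot q i x) = f x"
      unfolding slot_def using Suc E by (simp add: lin_diff[OF f])
    then show ?case using Suc lin_in[OF lin_slot[of i q]] by auto
  qed simp
  then show "f (prj x) = f x" using assms(2) by (simp add: prj_slots)
  have "slots p i (f x) = f x" if "i \<le> p" for i
    using that
  proof (induction i)
    case (Suc i)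
    then have "slot p i (f x) = f x" using assms by (auto simp: slot_def normal_def)
    then show ?case using Suc by simp
  qed simp
  then show "prj (f x) = f x" using lin_in[OF f assms(2)] by (simp add: prj_slots)
qed

lemma tpow_aug_ep:
  assumes "y \<in> tpow s p (aug B)" "i < p"
  shows "cf (I i \<otimes> ep \<otimes> I (p - 1 - i)) 0 y = 0"
  using assms(1)
proof (induction rule: tpow_induct)
  case (tens bs)
  then have "bs ! i \<in> aug B" using assms(2) by (auto dest: nth_mem)
  then show ?case unfolding ep_slot[OF tens(1) assms(2) refl] by (simp add: aug_def)
next
  case (add x y)
  then show ?case using lin_add[OF lin_ep_slot[OF assms(2)] tpow_aug_T tpow_aug_T] by simp
next
  case (scale c x)
  then show ?case using lin_scale[OF lin_ep_slot[OF assms(2)] tpow_aug_T] by simp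
qed simp

text \<open>The embedding is inverted by restriction to tensors over Ker \<epsilon>: a normal map
  stays the same if argument and value are projected. Conversely, an embedded map vanishes on
  factors 1 because the projection does, and its values lie over Ker \<epsilon>.\<close>

lemma D_iff_normal: "f \<in> D B p q d \<longleftrightarrow> normal p q d f"
proof
  assume f: "normal p q d f"
  let ?g = "restrict0 (tpow s q (aug B)) f"
  note fl = normal_lin[OF f]
  have "?g \<in> Hom_aug B p q d"
    unfolding Hom_aug_def Hom_def
  proof (safe, goal_cases)
    case (3 _ x)
    then show ?case
      using prj_in_aug[OF lin_in[OF fl]] normal_slots(2)[OF f] by (metis restrict0_def tpow_aug_T)
  next
    case (5 n _ x)
    have "f x \<in> tgrade B p UNIV (n + d)"
      using hlin_grade[OF normal_hlin[OF f] tgrade_mono[OF 5] refl] .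
    then have "prj (f x) \<in> tgrade B p (aug B) (n + d)" by (rule prj_tgrade)
    moreover have "x \<in> tpow s q (aug B)" using tgrade_in_tpow[OF 5] .
    ultimately show ?case using normal_slots(2)[OF f] by (simp add: restrict0_def tpow_aug_T)
  qed (simp_all add: restrict0_def lin_add[OF fl] lin_scale[OF fl] tpow_aug_T)
  moreover have "f = restrict0 (T B q) (\<lambda>x. ?g (prj x))"
  proof
    fix x show "f x = restrict0 (T B q) (\<lambda>x. ?g (prj x)) x"
      using f normal_slots(1)[OF f] prj_in_aug[of x q] by (auto simp: restrict0_def normal_def)
  qed
  ultimately show "f \<in> D B p q d"
    unfolding D_def prj_def by blast
next
  assume "f \<in> D B p q d"
  then obtain g where g: "g \<in> Hom (tpow s q (aug B)) (tpow s p (aug B))"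
    "\<And>n x. x \<in> tgrade B q (aug B) n \<Longrightarrow> g x \<in> tgrade B p (aug B) (n + d)"
    and f: "f = restrict0 (T B q) (\<lambda>x. g (prj x))"
    unfolding D_def Hom_aug_def prj_def by blast
  have ga: "g (x + y) = g x + g y" if "x \<in> tpow s q (aug B)" "y \<in> tpow s q (aug B)" for x y
    using g(1) that by (simp add: Hom_def)
  have gs: "g (tscale c x) = tscale c (g x)" if "x \<in> tpow s q (aug B)" for c x
    using g(1) that by (simp add: Hom_def)
  have gi: "g x \<in> tpow s p (aug B)" if "x \<in> tpow s q (aug B)" for x
    using g(1) that by (auto simp: Hom_def)
  have fl: "lin s q p (\<lambda>x. g (prj x))"
    by (rule linI) (simp_all add: prj_add prj_scale ga gs prj_in_aug tpow_aug_T[OF gi[OF prj_in_aug]])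
  have "hlin q p d (\<lambda>x. g (prj x))"
    unfolding hlin_def using fl by (auto intro!: tgrade_mono[OF g(2)] prj_tgrade)
  show "normal p q d f"
    unfolding f
  proof (rule normalI)
    show "hlin q p d (restrict0 (T B q) (\<lambda>x. g (prj x)))" by (simp add: hlin_restrict0) fact
    fix i z assume i: "i < q" and z: "z \<in> T B (q - 1)"
    let ?E = "cf (I i \<otimes> eta \<otimes> I (q - 1 - i)) 0"
    have E: "lin s (q - 1) q ?E" by (rule lin_eta_slot[OF i])
    have "g (prj (?E z)) = 0"
    proof (rule lin_eqI[OF lin_comp[OF E fl] lin_zero_map(2) _ z])
      fix cs :: "'b list" assume cs: "length cs = q - 1"
      \<comment> \<open>The list with a 1 reinserted at position i, so that \<open>eta_slot\<close>
        describes the insertion.\<close>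
      let ?bs = "take i cs @ 1 # drop i cs"
      have l: "length (take i cs) = i" using cs i by simp
      have "length ?bs = q" using cs i by simp
      moreover have "take i ?bs @ drop (Suc i) ?bs = cs"
        using l by (simp add: take_append drop_append Suc_diff_le)
      ultimately have "?E (tens s cs) = tens s (?bs[i := 1])"
        using eta_slot[of ?bs q i, OF _ i refl] by simp
      then have "prj (?E (tens s cs)) = tens s (map (proj_aug B) (?bs[i := 1]))" by (simp add: prj_tens)
      \<comment> \<open>The projected entry is zero; written as \<open>s 0 0\<close> it lets
        linearity in this entry extract the scalar 0.\<close>
      also have "\<dots> = tens s ((map (proj_aug B) ?bs)[i := s 0 0])"
        by (simp add: map_update proj_aug_one smult_zero)
      also have "\<dots> = tscale 0 (tens s ((map (proj_aug B) ?bs)[i := 0]))"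
        by (rule tens_update_scale[OF refl]) (use cs i in auto)
      also have "\<dots> = 0" by simp
      finally show "g (prj (?E (tens s cs))) = 0" using lin_zero[OF fl] by (simp add: prj_zero)
    qed
    then show "restrict0 (T B q) (\<lambda>x. g (prj x)) (?E z) = 0" by (simp add: restrict0_def)
  next
    fix i x assume "i < p" "x \<in> T B q"
    then show "cf (I i \<otimes> ep \<otimes> I (p - 1 - i)) 0 (restrict0 (T B q) (\<lambda>x. g (prj x)) x) = 0"
      using tpow_aug_ep[OF gi[OF prj_in_aug] \<open>i < p\<close>] by (simp add: restrict0_def)
  qed (simp add: restrict0_def)
qed

section \<open>Cochains of hat degree one, two and three\<close>

definition c1 :: "(('b, 'k) tensor \<Rightarrow> ('b, 'k) tensor) \<Rightarrow> ('b, 'k) cochain" where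
  "c1 f = (\<lambda>p q. if p = 1 \<and> q = 1 then f else 0)"

definition c2 :: "(('b, 'k) tensor \<Rightarrow> ('b, 'k) tensor) \<Rightarrow> (('b, 'k) tensor \<Rightarrow> ('b, 'k) tensor) \<Rightarrow> ('b, 'k) cochain" where
  "c2 f g = (\<lambda>p q. if p = 1 \<and> q = 2 then f else if p = 2 \<and> q = 1 then g else 0)"

definition c3 :: "(('b, 'k) tensor \<Rightarrow> ('b, 'k) tensor) \<Rightarrow> (('b, 'k) tensor \<Rightarrow> ('b, 'k) tensor)
    \<Rightarrow> (('b, 'k) tensor \<Rightarrow> ('b, 'k) tensor) \<Rightarrow> ('b, 'k) cochain" where
  "c3 a c e = (\<lambda>p q. if p = 1 \<and> q = 3 then a else if p = 2 \<and> q = 2 then c else if p = 3 \<and> q = 1 then e else 0)"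

lemma c2_eq_iff: "c2 f g = c2 f' g' \<longleftrightarrow> f = f' \<and> g = g'"
proof
  assume a: "c2 f g = c2 f' g'"
  show "f = f' \<and> g = g'"
    using fun_cong[OF fun_cong[OF a, of 1], of 2] fun_cong[OF fun_cong[OF a, of 2], of 1] by (simp add: c2_def)
qed simp

lemma c3_eq_iff: "c3 a c e = c3 a' c' e' \<longleftrightarrow> a = a' \<and> c = c' \<and> e = e'"
proof
  assume a: "c3 a c e = c3 a' c' e'"
  show "a = a' \<and> c = c' \<and> e = e'"
    using fun_cong[OF fun_cong[OF a, of 1], of 3] fun_cong[OF fun_cong[OF a, of 2], of 2]
      fun_cong[OF fun_cong[OF a, of 3], of 1] by (simp add: c3_def)
qed simp

lemma c2_diff: "c2 f g - c2 f' g' = c2 (\<lambda>x. f x - f' x) (\<lambda>x. g x - g' x)"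
  by (intro ext) (simp add: c2_def fun_apply_simps)

lemma c3_diff: "c3 a c e - c3 a' c' e' = c3 (\<lambda>x. a x - a' x) (\<lambda>x. c x - c' x) (\<lambda>x. e x - e' x)"
  by (intro ext) (simp add: c3_def fun_apply_simps)

lemma c3_zero: "c3 (\<lambda>x. 0) (\<lambda>x. 0) (\<lambda>x. 0) = 0"
  by (intro ext) (simp add: c3_def fun_apply_simps)

lemma c2_zero: "c2 (\<lambda>x. 0) (\<lambda>x. 0) = 0"
  by (intro ext) (simp add: c2_def fun_apply_simps)

lemma Dhat_1: "c \<in> Dhat B 1 d \<longleftrightarrow> (\<exists>f. normal 1 1 d f \<and> c = c1 f)"
proof
  assume c: "c \<in> Dhat B 1 d"
  have *: "(if 1 \<le> p \<and> 1 \<le> q \<and> p + q = 1 + 1 then c p q \<in> D B p q d else c p q = 0)" for p q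
    using c by (simp add: Dhat_def)
  have "c = c1 (c 1 1)"
    using * by (intro ext) (force simp: c1_def split: if_splits)
  moreover have "normal 1 1 d (c 1 1)" using *[of 1 1] by (simp add: D_iff_normal)
  ultimately show "\<exists>f. normal 1 1 d f \<and> c = c1 f" by blast
next
  assume "\<exists>f. normal 1 1 d f \<and> c = c1 f"
  then obtain f where f: "normal 1 1 d f" "c = c1 f" by blast
  have "if 1 \<le> p \<and> 1 \<le> q \<and> p + q = 1 + 1 then c p q \<in> D B p q d else c p q = 0" for p q
  proof (cases "p = 1 \<and> q = 1")
    case False
    then have "\<not> (1 \<le> p \<and> 1 \<le> q \<and> p + q = 1 + 1)" by auto
    then show ?thesis using f False by (auto simp: c1_def)
  qed (use f in \<open>auto simp: c1_def D_iff_normal\<close>)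
  then show "c \<in> Dhat B 1 d" by (simp add: Dhat_def)
qed

lemma pq3: "1 \<le> p \<and> 1 \<le> q \<and> p + q = (3::nat) \<longleftrightarrow> p = 1 \<and> q = 2 \<or> p = 2 \<and> q = 1" 
  and pq4: "1 \<le> p \<and> 1 \<le> q \<and> p + q = (4::nat) \<longleftrightarrow> p = 1 \<and> q = 3 \<or> p = 2 \<and> q = 2 \<or> p = 3 \<and> q = 1"
  and pq5: "1 \<le> p \<and> 1 \<le> q \<and> p + q = (5::nat) \<longleftrightarrow>
    p = 1 \<and> q = 4 \<or> p = 2 \<and> q = 3 \<or> p = 3 \<and> q = 2 \<or> p = 4 \<and> q = 1"
  by auto

lemma Dhat_2: "c \<in> Dhat B 2 d \<longleftrightarrow> (\<exists>f g. normal 1 2 d f \<and> normal 2 1 d g \<and> c = c2 f g)"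
proof
  assume c: "c \<in> Dhat B 2 d"
  have *: "(if p = 1 \<and> q = 2 \<or> p = 2 \<and> q = 1 then normal p q d (c p q) else c p q = 0)" for p q
    using c pq3 unfolding Dhat_def by (auto simp: D_iff_normal split: if_splits)
  have "c = c2 (c 1 2) (c 2 1)"
    using * by (intro ext) (force simp: c2_def split: if_splits)
  moreover have "normal 1 2 d (c 1 2)" "normal 2 1 d (c 2 1)" using *[of 1 2] *[of 2 1] by simp_all
  ultimately show "\<exists>f g. normal 1 2 d f \<and> normal 2 1 d g \<and> c = c2 f g" by blast
next
  assume "\<exists>f g. normal 1 2 d f \<and> normal 2 1 d g \<and> c = c2 f g"
  then obtain f g where f: "normal 1 2 d f" "normal 2 1 d g" "c = c2 f g" by blast
  have "if 1 \<le> p \<and> 1 \<le> q \<and> p + q = 2 + 1 then c p q \<in> D B p q d else c p q = 0" for p q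
    using pq3[of p q] f by (auto simp: c2_def D_iff_normal)
  then show "c \<in> Dhat B 2 d" by (simp add: Dhat_def)
qed

lemma c3_Dhat:
  assumes "normal 1 3 d a" "normal 2 2 d c" "normal 3 1 d e"
  shows "c3 a c e \<in> Dhat B 3 d"
  using assms by (auto simp: Dhat_def c3_def D_iff_normal)

lemma bd_c1: "bd B 1 (c1 f) = c2 (dh B 1 1 f) (\<lambda>x. - dc B 1 1 f x)"
proof (rule ext, rule ext, rule ext)
  fix p q x
  show "bd B 1 (c1 f) p q x = c2 (dh B 1 1 f) (\<lambda>x. - dc B 1 1 f x) p q x"
    using pq3[of p q] by (auto simp: bd_def c2_def c1_def fun_apply_simps One_nat_def)
qed

lemma bd_c2: "bd B 2 (c2 f g) = c3 (dh B 1 2 f) (\<lambda>x. dh B 2 1 g x + dc B 1 2 f x) (\<lambda>x. - dc B 2 1 g x)"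
proof (rule ext, rule ext, rule ext)
  fix p q x
  show "bd B 2 (c2 f g) p q x = c3 (dh B 1 2 f) (\<lambda>x. dh B 2 1 g x + dc B 1 2 f x) (\<lambda>x. - dc B 2 1 g x) p q x"
    using pq4[of p q] by (auto simp: bd_def c2_def c3_def fun_apply_simps One_nat_def)
qed

text \<open>The sign (-1)^q makes the component at (2, 3) a difference and the one at (3, 2) a sum,
  hence the different shapes of the second and third hypothesis.\<close>

lemma bd_c3:
  assumes "\<And>x. dh B 1 3 a x = 0" "\<And>x. dh B 2 2 c x = dc B 1 3 a x" "\<And>x. dh B 3 1 e x + dc B 2 2 c x = 0"
    "\<And>x. dc B 3 1 e x = 0"
  shows "bd B 3 (c3 a c e) = 0"
proof (rule ext, rule ext, rule ext)
  fix p q x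
  show "bd B 3 (c3 a c e) p q x = 0 p q x"
    using pq5[of p q] assms by (auto simp: bd_def c3_def fun_apply_simps One_nat_def)
qed

lemma dh_outside: "x \<notin> T B (q + 1) \<Longrightarrow> dh B p q f x = 0"
  and dc_outside: "x \<notin> T B q \<Longrightarrow> dc B p q f x = 0"
  by (simp_all add: dh_def dc_def restrict0_def)

section \<open>The undeformed bialgebra satisfies the axioms as identities of series\<close>

lemma base_assoc: "assL mult0 = assR mult0"
proof (rule order0_eqI)
  fix bs :: "'b list" assume "length bs = src (assL mult0)"
  then obtain a b c where "bs = [a, b, c]" by (auto simp: length3_conv)
  then show "cf (assL mult0) 0 (tens s bs) = cf (assR mult0) 0 (tens s bs)"
    by (simp add: assL_def assR_def eval_tens eval_simps mult.assoc)
qed simp_all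

lemma base_coassoc: "coaR comult0 = coaL comult0"
proof (rule order0_eqI)
  fix bs :: "'b list" assume "length bs = src (coaR comult0)"
  then obtain a where [simp]: "bs = [a]" by (auto simp: length1_conv)
  have "tm 1 1 (cf comult0 0) (\<lambda>x. x) (comult B a) = tmap s 1 (delta B 1) id (comult B a)"
    by (subst tm_cong[of 1 "cf comult0 0" "delta B 1" 1 "\<lambda>x. x" id]) (simp_all add: delta_eq tm_tmap_at[OF comult_in, of 1 1])
  moreover have "tm 1 1 (\<lambda>x. x) (cf comult0 0) (comult B a) = tmap s 1 id (delta B 1) (comult B a)"
    by (subst tm_cong[of 1 "\<lambda>x. x" id 1 "cf comult0 0" "delta B 1"]) (simp_all add: delta_eq tm_tmap_at[OF comult_in, of 1 1])
  ultimately show "cf (coaR comult0) 0 (tens s bs) = cf (coaL comult0) 0 (tens s bs)"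
    by (simp add: coaL_def coaR_def cf0_comp cf0_ten tm_cf_I_left tm_cf_I_right eval_simps coassoc)
qed simp_all

lemma order0_cmp0 [simp]: "order0 (cmp mult0 comult0)"
  by (simp add: cmp_def)

lemma base_compat: "comult0 \<cdot> mult0 = cmp mult0 comult0"
proof (rule order0_eqI)
  fix bs :: "'b list" assume "length bs = src (comult0 \<cdot> mult0)"
  then obtain a b where [simp]: "bs = [a, b]" by (auto simp: length2_conv)
  show "cf (comult0 \<cdot> mult0) 0 (tens s bs) = cf (cmp mult0 comult0) 0 (tens s bs)"
    by (simp add: cmp_def cf0_comp cf0_ten_tens eval_simps comult_mult tmult_2[OF comult_in comult_in])
qed simp_all

section \<open>Defects of the axioms\<close>

text \<open>The part of the structure of a bialgebra that involves identity and counit holds on the nose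
  for the series of a deformation; the remaining axioms hold up to some power of \<open>t\<close>.\<close>

definition unital where
  "unital m d \<longleftrightarrow> shape m d \<and> eqv 1 m mult0 \<and> eqv 1 d comult0 \<and>
    m \<cdot> (eta \<otimes> I 1) = I 1 \<and> m \<cdot> (I 1 \<otimes> eta) = I 1 \<and> (ep \<otimes> I 1) \<cdot> d = I 1 \<and> (I 1 \<otimes> ep) \<cdot> d = I 1 \<and>
    d \<cdot> eta = eta \<otimes> eta \<and> ep \<cdot> m = ep \<otimes> ep"

definition axs where
  "axs n m d \<longleftrightarrow> eqv n (assL m) (assR m) \<and> eqv n (d \<cdot> m) (cmp m d) \<and> eqv n (coaR d) (coaL d)"

text \<open>Associativity is measured as left minus right bracketing, coassociativity as right minus
  left. This orientation matches the signs of \<open>bd\<close>, so that all three components change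
  by the boundary with the same sign, and it is the one in \<open>obstruction\<close>.\<close>

definition defects where
  "defects n m d = c3 (dif n (assL m) (assR m)) (dif n (d \<cdot> m) (cmp m d)) (dif n (coaR d) (coaL d))"

lemma dif_zero_iff: "dif n F G = (\<lambda>x. 0) \<longleftrightarrow> cf F n = cf G n"
proof
  assume "dif n F G = (\<lambda>x. 0)"
  then have "cf F n x - cf G n x = 0" for x unfolding dif_def by (rule fun_cong)
  then show "cf F n = cf G n" by (intro ext[where f = "cf F n"]) simp
qed (simp add: dif_def[abs_def])

lemma eqv_Suc_iff:
  "eqv (Suc n) F G \<longleftrightarrow> eqv n F G \<and> dif n F G = (\<lambda>x. 0)"
  by (auto simp: eqv_def dif_zero_iff less_Suc_eq)

lemma axs_Suc: "axs (Suc n) m d \<longleftrightarrow> axs n m d \<and> defects n m d = 0"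
  unfolding axs_def defects_def eqv_Suc_iff c3_zero[symmetric] c3_eq_iff by blast

lemma unital_base: "unital mult0 comult0"
proof -
  have "mult0 \<cdot> (eta \<otimes> I 1) = I 1" "mult0 \<cdot> (I 1 \<otimes> eta) = I 1"
    by (rule order0_eqI; auto simp: length1_conv eval_tens eval_simps)+
  moreover have "(ep \<otimes> I 1) \<cdot> comult0 = I 1"
  proof (rule order0_eqI)
    fix bs :: "'b list" assume "length bs = src ((ep \<otimes> I 1) \<cdot> comult0)"
    then obtain a where [simp]: "bs = [a]" by (auto simp: length1_conv)
    have "tm 1 1 (cf ep 0) (\<lambda>x. x) (comult B a) = tmap s 1 (eps B) id (comult B a)"
      by (subst tm_cong[of 1 "cf ep 0" "eps B" 1 "\<lambda>x. x" id]) (simp_all add: ep_def cf_ord0 tm_tmap_at[OF comult_in, of 1 1])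
    then show "cf ((ep \<otimes> I 1) \<cdot> comult0) 0 (tens s bs) = cf (I 1) 0 (tens s bs)"
      by (simp add: cf0_comp cf0_ten tm_cf_I_left tm_cf_I_right eval_simps counit_left cf_I)
  qed simp_all
  moreover have "(I 1 \<otimes> ep) \<cdot> comult0 = I 1"
  proof (rule order0_eqI)
    fix bs :: "'b list" assume "length bs = src ((I 1 \<otimes> ep) \<cdot> comult0)"
    then obtain a where [simp]: "bs = [a]" by (auto simp: length1_conv)
    have "tm 1 1 (\<lambda>x. x) (cf ep 0) (comult B a) = tmap s 1 id (eps B) (comult B a)"
      by (subst tm_cong[of 1 "\<lambda>x. x" id 1 "cf ep 0" "eps B"]) (simp_all add: ep_def cf_ord0 tm_tmap_at[OF comult_in, of 1 1])
    then show "cf ((I 1 \<otimes> ep) \<cdot> comult0) 0 (tens s bs) = cf (I 1) 0 (tens s bs)"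
      by (simp add: cf0_comp cf0_ten tm_cf_I_left tm_cf_I_right eval_simps counit_right cf_I)
  qed simp_all
  moreover have "comult0 \<cdot> eta = eta \<otimes> eta"
    by (rule order0_eqI) (auto simp: eval_tens eval_simps comult_one)
  moreover have "ep \<cdot> mult0 = ep \<otimes> ep"
    by (rule order0_eqI) (auto simp: length2_conv eval_tens eval_simps counit_mult tprod_scale_left
      tprod_scale_right[OF tens_in[OF refl] tens_in[OF refl]])
  ultimately show ?thesis by (simp add: unital_def shape0)
qed

lemma axs_base: "axs n mult0 comult0"
  by (simp add: axs_def base_assoc base_coassoc base_compat)

lemma defects_base: "defects n mult0 comult0 = 0"
  using axs_base[of "Suc n"] by (simp add: axs_Suc)

lemma dif_comp_order0:
  assumes "order0 U" "arr F" "arr G"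
  shows "dif n F G (cf U 0 z) = dif n (F \<cdot> U) (G \<cdot> U) z"
  using assms by (simp add: dif_def cf_comp_order0)

lemma order0_comp_dif:
  assumes "order0 V" "arr F" "arr G" "src F = src G" "tgt F = tgt G" "src V = tgt G" "x \<in> T B (src G)"
  shows "cf V 0 (dif n F G x) = dif n (V \<cdot> F) (V \<cdot> G) x"
proof -
  have "lin s (src V) (tgt V) (cf V 0)" using assms(1) by (intro arr_lin) (simp add: order0_def)
  then show ?thesis using assms by (simp add: dif_def cf_order0_comp lin_diff arr_in)
qed

text \<open>Inserting 1 and applying \<epsilon> are arrows constant in t, so they act on the
  coefficient of t^n alone. Equality of the composites as series therefore annihilates the
  difference of these coefficients.\<close>

lemma normal_dif:
  assumes "arr F" "arr G" "src F = q" "src G = q" "tgt F = p" "tgt G = p"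
    and "\<And>i. i < q \<Longrightarrow> F \<cdot> (I i \<otimes> eta \<otimes> I (q - 1 - i)) = G \<cdot> (I i \<otimes> eta \<otimes> I (q - 1 - i))"
    and "\<And>i. i < p \<Longrightarrow> (I i \<otimes> ep \<otimes> I (p - 1 - i)) \<cdot> F = (I i \<otimes> ep \<otimes> I (p - 1 - i)) \<cdot> G"
  shows "normal p q (- int n) (dif n F G)"
proof (rule normalI)
  show "hlin q p (- int n) (dif n F G)" using assms by (intro hlin_dif) auto
  show "x \<notin> T B q \<Longrightarrow> dif n F G x = 0" for x using assms by (simp add: dif_def arr_outside)
  show "dif n F G (cf (I i \<otimes> eta \<otimes> I (q - 1 - i)) 0 z) = 0" if "i < q" for i z
    by (subst dif_comp_order0) (use assms(1-6) assms(7)[OF that] in simp_all)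
  show "cf (I i \<otimes> ep \<otimes> I (p - 1 - i)) 0 (dif n F G x) = 0" if "i < p" "x \<in> T B q" for i x
    by (subst order0_comp_dif) (use that assms(1-6) assms(8)[OF that(1)] in simp_all)
qed

lemma less3: "i < (3::nat) \<longleftrightarrow> i = 0 \<or> i = 1 \<or> i = 2" and less2: "i < (2::nat) \<longleftrightarrow> i = 0 \<or> i = 1"
  and less1: "i < (1::nat) \<longleftrightarrow> i = 0"
  by auto

section \<open>Defects are normalised cochains\<close>

context
  fixes m d
  assumes u: "unital m d"
begin

lemma u_shape: "shape m d" and u_unit [simp]: "m \<cdot> (eta \<otimes> I 1) = I 1" "m \<cdot> (I 1 \<otimes> eta) = I 1"
  and u_counit [simp]: "(ep \<otimes> I 1) \<cdot> d = I 1" "(I 1 \<otimes> ep) \<cdot> d = I 1" "d \<cdot> eta = eta \<otimes> eta" "ep \<cdot> m = ep \<otimes> ep"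
  and u_eqv: "eqv 1 m mult0" "eqv 1 d comult0"
  using u by (auto simp: unital_def)

lemmas [simp] = shapes[OF u_shape] composites[OF u_shape]

text \<open>An arrow from or to the ground field has arity 0 on one side, so the interchange law
  with \<open>I 0\<close> slides it past m or d.\<close>

lemma unit_square:
  "arr F \<Longrightarrow> src F = 0 \<Longrightarrow> F \<otimes> m = (F \<otimes> I 1) \<cdot> m" "arr F \<Longrightarrow> src F = 0 \<Longrightarrow> m \<otimes> F = (I 1 \<otimes> F) \<cdot> m"
  "arr F \<Longrightarrow> src F = 0 \<Longrightarrow> F \<otimes> d = (F \<otimes> I 2) \<cdot> d" "arr F \<Longrightarrow> src F = 0 \<Longrightarrow> d \<otimes> F = (I 2 \<otimes> F) \<cdot> d"
  "arr F \<Longrightarrow> tgt F = 0 \<Longrightarrow> F \<otimes> m = m \<cdot> (F \<otimes> I 2)" "arr F \<Longrightarrow> tgt F = 0 \<Longrightarrow> m \<otimes> F = m \<cdot> (I 2 \<otimes> F)"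
  "arr F \<Longrightarrow> tgt F = 0 \<Longrightarrow> F \<otimes> d = d \<cdot> (F \<otimes> I 1)" "arr F \<Longrightarrow> tgt F = 0 \<Longrightarrow> d \<otimes> F = d \<cdot> (I 1 \<otimes> F)"
  using interchange[of F "I 1" "I 0" m] interchange[of "I 1" F m "I 0"] interchange[of F "I 2" "I 0" d]
    interchange[of "I 2" F d "I 0"] interchange[of "I 0" m F "I 2"] interchange[of m "I 0" "I 2" F]
    interchange[of "I 0" d F "I 1"] interchange[of d "I 0" "I 1" F] by simp_all

lemma ass_unit:
  "assL m \<cdot> (eta \<otimes> I 2) = m" "assR m \<cdot> (eta \<otimes> I 2) = m"
  "assL m \<cdot> (I 1 \<otimes> eta \<otimes> I 1) = m" "assR m \<cdot> (I 1 \<otimes> eta \<otimes> I 1) = m"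
  "assL m \<cdot> (I 2 \<otimes> eta) = m" "assR m \<cdot> (I 2 \<otimes> eta) = m"
proof -
  have "assL m \<cdot> ((eta \<otimes> I 1) \<otimes> I 1) = m" "assL m \<cdot> ((I 1 \<otimes> eta) \<otimes> I 1) = m"
    by (simp_all add: assL_def interchange del: ten_assoc)
  then show "assL m \<cdot> (eta \<otimes> I 2) = m" "assL m \<cdot> (I 1 \<otimes> eta \<otimes> I 1) = m" by simp_all
  have "assR m \<cdot> (I 1 \<otimes> I 1 \<otimes> eta) = m"
    by (simp add: assR_def interchange del: I_ten)  simp
  then show "assR m \<cdot> (I 2 \<otimes> eta) = m" by (simp add: I2_ten)
  show "assR m \<cdot> (I 1 \<otimes> eta \<otimes> I 1) = m" by (simp add: assR_def interchange)
  show "assL m \<cdot> (I 2 \<otimes> eta) = m" "assR m \<cdot> (eta \<otimes> I 2) = m"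
  proof -
    have "assL m \<cdot> (I 2 \<otimes> eta) = (m \<cdot> (I 1 \<otimes> eta)) \<cdot> m" "assR m \<cdot> (eta \<otimes> I 2) = (m \<cdot> (eta \<otimes> I 1)) \<cdot> m"
      by (simp_all add: assL_def assR_def interchange unit_square del: u_unit)
    then show "assL m \<cdot> (I 2 \<otimes> eta) = m" "assR m \<cdot> (eta \<otimes> I 2) = m" by simp_all
  qed
qed

lemma ass_counit: "ep \<cdot> assL m = ep \<cdot> assR m"
proof -
  have "ep \<cdot> assL m = (ep \<cdot> m) \<cdot> (m \<otimes> I 1)" "ep \<cdot> assR m = (ep \<cdot> m) \<cdot> (I 1 \<otimes> m)"
    by (simp_all add: assL_def assR_def del: u_counit)
  then show ?thesis by (simp add: interchange)
qed

lemma cmp_unit: "cmp m d \<cdot> (eta \<otimes> I 1) = d" "cmp m d \<cdot> (I 1 \<otimes> eta) = d"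
proof -
  \<comment> \<open>\<open>1 \<otimes> 1\<close> is a left unit of the tensor square: moving the
    flip past the two units leaves the flip of blocks of size 0, which is an identity.\<close>
  have "mul2 m \<cdot> (eta \<otimes> eta \<otimes> I 2) = I 2"
  proof -
    have "ms \<cdot> (eta \<otimes> eta \<otimes> I 1 \<otimes> I 1) = (eta \<otimes> I 1 \<otimes> eta \<otimes> I 1) \<cdot> msw 0 0 1 1"
      by (rule msw_natural_at) simp_all
    then have "mul2 m \<cdot> (eta \<otimes> eta \<otimes> I 2) = (m \<otimes> m) \<cdot> ((eta \<otimes> I 1) \<otimes> eta \<otimes> I 1) \<cdot> msw 0 0 1 1"
      by (simp add: mul2_def)
    then show ?thesis by (simp add: interchange interchange' msw_def del: ten_assoc)
  qed
  then have "mul2 m \<cdot> ((eta \<otimes> eta) \<otimes> I 2) \<cdot> d = d"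
    by (simp add: comp_assoc[symmetric] del: comp_assoc)
  then have "mul2 m \<cdot> ((eta \<otimes> eta) \<otimes> d) = d" by (simp add: unit_square del: ten_assoc)
  then show "cmp m d \<cdot> (eta \<otimes> I 1) = d" by (simp add: cmp_def interchange del: ten_assoc)
  have "mul2 m \<cdot> (I 2 \<otimes> eta \<otimes> eta) = I 2"
  proof -
    have "ms \<cdot> (I 1 \<otimes> I 1 \<otimes> eta \<otimes> eta) = (I 1 \<otimes> eta \<otimes> I 1 \<otimes> eta) \<cdot> msw 1 1 0 0"
      by (rule msw_natural_at) simp_all
    then have "mul2 m \<cdot> (I 2 \<otimes> eta \<otimes> eta) = (m \<otimes> m) \<cdot> ((I 1 \<otimes> eta) \<otimes> I 1 \<otimes> eta) \<cdot> msw 1 1 0 0"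
      by (simp add: mul2_def I2_ten)
    then show ?thesis by (simp add: interchange interchange' msw_def del: ten_assoc)
  qed
  then have "mul2 m \<cdot> (I 2 \<otimes> eta \<otimes> eta) \<cdot> d = d"
    by (simp add: comp_assoc[symmetric] del: comp_assoc)
  then have "mul2 m \<cdot> (d \<otimes> eta \<otimes> eta) = d" by (simp add: unit_square)
  then show "cmp m d \<cdot> (I 1 \<otimes> eta) = d" by (simp add: cmp_def interchange)
qed

lemma mult_unit: "(d \<cdot> m) \<cdot> (eta \<otimes> I 1) = d" "(d \<cdot> m) \<cdot> (I 1 \<otimes> eta) = d"
  "(ep \<otimes> I 1) \<cdot> d \<cdot> m = m" "(I 1 \<otimes> ep) \<cdot> d \<cdot> m = m"
proof -
  show "(d \<cdot> m) \<cdot> (eta \<otimes> I 1) = d" "(d \<cdot> m) \<cdot> (I 1 \<otimes> eta) = d" by simp_all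
  show "(ep \<otimes> I 1) \<cdot> d \<cdot> m = m" "(I 1 \<otimes> ep) \<cdot> d \<cdot> m = m"
    by (subst comp_assoc[symmetric]; simp)+
qed

lemma cmp_counit: "(ep \<otimes> I 1) \<cdot> cmp m d = m" "(I 1 \<otimes> ep) \<cdot> cmp m d = m"
proof -
  have "(ep \<otimes> I 1) \<cdot> cmp m d = ((ep \<otimes> ep) \<otimes> m) \<cdot> ms \<cdot> (d \<otimes> d)"
    by (simp add: cmp_def mul2_def interchange' del: ten_assoc)
  also have "(ep \<otimes> ep) \<otimes> m = m \<cdot> (ep \<otimes> ep \<otimes> I 1 \<otimes> I 1)"
    by (subst unit_square) simp_all
  also have "(m \<cdot> (ep \<otimes> ep \<otimes> I 1 \<otimes> I 1)) \<cdot> ms \<cdot> (d \<otimes> d) = m \<cdot> ((ep \<otimes> ep \<otimes> I 1 \<otimes> I 1) \<cdot> ms) \<cdot> (d \<otimes> d)"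
    by simp
  also have "(ep \<otimes> ep \<otimes> I 1 \<otimes> I 1) \<cdot> ms = msw 0 1 0 1 \<cdot> (ep \<otimes> I 1 \<otimes> ep \<otimes> I 1)"
    by (rule msw_natural_at[symmetric]) simp_all
  also have "m \<cdot> (msw 0 1 0 1 \<cdot> (ep \<otimes> I 1 \<otimes> ep \<otimes> I 1)) \<cdot> (d \<otimes> d) = m \<cdot> ((ep \<otimes> I 1) \<otimes> ep \<otimes> I 1) \<cdot> (d \<otimes> d)"
    by (simp add: msw_def)
  also have "\<dots> = m" by (simp add: interchange del: ten_assoc)
  finally show "(ep \<otimes> I 1) \<cdot> cmp m d = m" .
  have "(I 1 \<otimes> ep) \<cdot> cmp m d = (m \<otimes> ep \<otimes> ep) \<cdot> ms \<cdot> (d \<otimes> d)"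
    by (simp add: cmp_def mul2_def interchange')
  also have "m \<otimes> ep \<otimes> ep = m \<cdot> (I 1 \<otimes> I 1 \<otimes> ep \<otimes> ep)"
    using unit_square(6)[of "ep \<otimes> ep"] by (simp add: I2_ten)
  also have "(m \<cdot> (I 1 \<otimes> I 1 \<otimes> ep \<otimes> ep)) \<cdot> ms \<cdot> (d \<otimes> d) = m \<cdot> ((I 1 \<otimes> I 1 \<otimes> ep \<otimes> ep) \<cdot> ms) \<cdot> (d \<otimes> d)"
    by simp
  also have "(I 1 \<otimes> I 1 \<otimes> ep \<otimes> ep) \<cdot> ms = msw 1 0 1 0 \<cdot> (I 1 \<otimes> ep \<otimes> I 1 \<otimes> ep)"
    by (rule msw_natural_at[symmetric]) simp_all
  also have "m \<cdot> (msw 1 0 1 0 \<cdot> (I 1 \<otimes> ep \<otimes> I 1 \<otimes> ep)) \<cdot> (d \<otimes> d) = m \<cdot> ((I 1 \<otimes> ep) \<otimes> I 1 \<otimes> ep) \<cdot> (d \<otimes> d)"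
    by (simp add: msw_def)
  also have "\<dots> = m" by (simp add: interchange del: ten_assoc)
  finally show "(I 1 \<otimes> ep) \<cdot> cmp m d = m" .
qed

lemma coa_unit: "coaR d \<cdot> eta = coaL d \<cdot> eta"
  by (simp add: coaR_def coaL_def interchange)

lemma coa_counit:
  "(ep \<otimes> I 2) \<cdot> coaR d = d" "(ep \<otimes> I 2) \<cdot> coaL d = d"
  "(I 1 \<otimes> ep \<otimes> I 1) \<cdot> coaR d = d" "(I 1 \<otimes> ep \<otimes> I 1) \<cdot> coaL d = d"
  "(I 2 \<otimes> ep) \<cdot> coaR d = d" "(I 2 \<otimes> ep) \<cdot> coaL d = d"
proof -
  have "((ep \<otimes> I 1) \<otimes> I 1) \<cdot> coaL d = d" "((I 1 \<otimes> ep) \<otimes> I 1) \<cdot> coaL d = d"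
    by (simp_all add: coaL_def interchange' del: ten_assoc)
  then show "(ep \<otimes> I 2) \<cdot> coaL d = d" "(I 1 \<otimes> ep \<otimes> I 1) \<cdot> coaL d = d" by simp_all
  have "(I 1 \<otimes> I 1 \<otimes> ep) \<cdot> coaR d = d"
    by (simp add: coaR_def interchange' del: I_ten) simp
  then show "(I 2 \<otimes> ep) \<cdot> coaR d = d" by (simp add: I2_ten)
  show "(I 1 \<otimes> ep \<otimes> I 1) \<cdot> coaR d = d" by (simp add: coaR_def interchange')
  show "(I 2 \<otimes> ep) \<cdot> coaL d = d" "(ep \<otimes> I 2) \<cdot> coaR d = d"
    by (simp_all add: coaL_def coaR_def interchange' unit_square)
qed

text \<open>Insertion of 1 in a slot of \<open>assL\<close> and \<open>assR\<close> collapses both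
  to m, and in \<open>d \<cdot> m\<close> and \<open>cmp m d\<close> to d. Applying \<epsilon> works
  dually, and the remaining cases agree as well, so \<open>normal_dif\<close> applies to each
  component.\<close>

lemma defects_Dhat: "defects n m d \<in> Dhat B 3 (- int n)"
  unfolding defects_def
proof (rule c3_Dhat; rule normal_dif)
  show "i < 3 \<Longrightarrow> assL m \<cdot> (I i \<otimes> eta \<otimes> I (3 - 1 - i)) = assR m \<cdot> (I i \<otimes> eta \<otimes> I (3 - 1 - i))" for i
    unfolding less3 by (elim disjE) (simp_all add: ass_unit One_nat_def[symmetric])
  show "i < 1 \<Longrightarrow> (I i \<otimes> ep \<otimes> I (1 - 1 - i)) \<cdot> assL m = (I i \<otimes> ep \<otimes> I (1 - 1 - i)) \<cdot> assR m" for i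
    unfolding less1 by (simp add: ass_counit)
  show "i < 2 \<Longrightarrow> (d \<cdot> m) \<cdot> (I i \<otimes> eta \<otimes> I (2 - 1 - i)) = cmp m d \<cdot> (I i \<otimes> eta \<otimes> I (2 - 1 - i))" for i
    unfolding less2 by (elim disjE) (simp_all add: cmp_unit mult_unit One_nat_def[symmetric])
  show "i < 2 \<Longrightarrow> (I i \<otimes> ep \<otimes> I (2 - 1 - i)) \<cdot> (d \<cdot> m) = (I i \<otimes> ep \<otimes> I (2 - 1 - i)) \<cdot> cmp m d" for i
    unfolding less2 by (elim disjE) (simp_all add: cmp_counit mult_unit One_nat_def[symmetric])
  show "i < 1 \<Longrightarrow> coaR d \<cdot> (I i \<otimes> eta \<otimes> I (1 - 1 - i)) = coaL d \<cdot> (I i \<otimes> eta \<otimes> I (1 - 1 - i))" for i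
    unfolding less1 by (simp add: coa_unit)
  show "i < 3 \<Longrightarrow> (I i \<otimes> ep \<otimes> I (3 - 1 - i)) \<cdot> coaR d = (I i \<otimes> ep \<otimes> I (3 - 1 - i)) \<cdot> coaL d" for i
    unfolding less3 by (elim disjE) (simp_all add: coa_counit One_nat_def[symmetric])
qed simp_all

end

end

text \<open>Sign bookkeeping between the loop identities, which equate sums of differences, and the
  expanded differentials: the first three items serve \<open>defects_cocycle\<close>, the others
  \<open>tdefects_cocycle\<close>.\<close>

lemma group_rearrange:
  fixes a b c d e f g :: "'a::ab_group_add"
  shows "b + d = e + c + a \<Longrightarrow> a - b + c - d + e = 0"
    and "b + d + g + e = f + c + a \<Longrightarrow> a - b + c - d = e - f + g"
    and "a + b + c + d = e + f + g \<Longrightarrow> d - e + c + (b - f + a - g) = 0"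
    and "a + b = c + d \<Longrightarrow> d - a + c - b = 0"
    and "a + b + c + d = e + f \<Longrightarrow> d - e + c + (b - f + a) = 0"
    and "a + b = c + d \<Longrightarrow> c - b + d - a = 0"
proof -
  show "a - b + c - d + e = 0" if "b + d = e + c + a"
    using arg_cong[OF that, of "\<lambda>z. a - b + c - d + e + z - (b + d)"] by (simp add: algebra_simps)
  show "a - b + c - d = e - f + g" if "b + d + g + e = f + c + a"
    using arg_cong[OF that, of "\<lambda>z. z - b - d - f"] by (simp add: algebra_simps)
  show "d - e + c + (b - f + a - g) = 0" if "a + b + c + d = e + f + g"
    using arg_cong[OF that, of "\<lambda>z. z - e - f - g"] by (simp add: algebra_simps)
  show "d - a + c - b = 0" if "a + b = c + d"
    using arg_cong[OF that, of "\<lambda>z. z - a - b"] by (simp add: algebra_simps)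
  show "d - e + c + (b - f + a) = 0" if "a + b + c + d = e + f"
    using arg_cong[OF that, of "\<lambda>z. z - e - f"] by (simp add: algebra_simps)
  show "c - b + d - a = 0" if "a + b = c + d"
    using arg_cong[OF that, of "\<lambda>z. z - a - b"] by (simp add: algebra_simps)
qed

context graded_bialgebra
begin

text \<open>Loop identities for a deformation involve only t^0 coefficients besides the differences,
  and these come from B. The right nested composites are brought to left nested form, as in the
  expanded differentials, by associativity and coassociativity of B.\<close>

lemma u_cf0:
  assumes u: "unital m d"
  shows "cf m 0 = cf mult0 0" "cf d 0 = cf comult0 0" "cf (mul2 m) 0 = cf (mul2 mult0) 0"
    "cf (assL m) 0 = cf (assL mult0) 0" "cf (assR m) 0 = cf (assL mult0) 0"
    "cf (coaL d) 0 = cf (coaL comult0) 0" "cf (coaR d) 0 = cf (coaL comult0) 0"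
    "cf (m \<otimes> I 1) 0 = cf (mult0 \<otimes> I 1) 0" "cf (I 1 \<otimes> m) 0 = cf (I 1 \<otimes> mult0) 0"
    "cf (m \<otimes> I 2) 0 = cf (mult0 \<otimes> I 2) 0" "cf (I 2 \<otimes> m) 0 = cf (I 2 \<otimes> mult0) 0"
    "cf (I 1 \<otimes> m \<otimes> I 1) 0 = cf (I 1 \<otimes> mult0 \<otimes> I 1) 0"
    "cf (d \<otimes> I 1) 0 = cf (comult0 \<otimes> I 1) 0" "cf (I 1 \<otimes> d) 0 = cf (I 1 \<otimes> comult0) 0"
    "cf (d \<otimes> I 2) 0 = cf (comult0 \<otimes> I 2) 0" "cf (I 2 \<otimes> d) 0 = cf (I 2 \<otimes> comult0) 0"
    "cf (I 1 \<otimes> d \<otimes> I 1) 0 = cf (I 1 \<otimes> comult0 \<otimes> I 1) 0"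
    "cf (ms \<cdot> (d \<otimes> d)) 0 = cf (ms \<cdot> (comult0 \<otimes> comult0)) 0"
    "cf (sh6 \<cdot> (d \<otimes> d \<otimes> d)) 0 = cf (sh6 \<cdot> (comult0 \<otimes> comult0 \<otimes> comult0)) 0"
    "cf ((m \<otimes> m \<otimes> m) \<cdot> ush6) 0 = cf W 0"
proof -
  note e = eqv_comp eqv_ten u_eqv[OF u] and z = eqv_cf0[OF _ zero_less_one]
  show "cf (assR m) 0 = cf (assL mult0) 0" unfolding base_assoc by (rule z) (simp add: assR_def e)
  show "cf (coaR d) 0 = cf (coaL comult0) 0" unfolding base_coassoc[symmetric] by (rule z) (simp add: coaR_def e)
qed (rule eqv_cf0[OF _ zero_less_one]; simp add: mul2_def assL_def coaL_def eqv_comp eqv_ten u_eqv[OF u])+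

lemma dif_outside: "arr F \<Longrightarrow> arr G \<Longrightarrow> src F = src G \<Longrightarrow> x \<notin> T B (src G) \<Longrightarrow> dif n F G x = 0"
  by (simp add: dif_def arr_outside)

text \<open>The boundary of a 3-cochain has four components, one per loop: the pentagon at (1, 4),
  the splitting of a triple product at (2, 3), the threefold coproduct of a product at (3, 2) and
  the reversed pentagon at (4, 1).\<close>

theorem defects_cocycle:
  assumes u: "unital m d" and ax: "axs n m d" and n: "0 < n"
  shows "defects n m d \<in> cocycles B 3 (- int n)"
proof -
  note [simp] = shapes[OF u_shape[OF u]] composites[OF u_shape[OF u]]
  define a where "a = dif n (assL m) (assR m)"
  define c where "c = dif n (d \<cdot> m) (cmp m d)"
  define e where "e = dif n (coaR d) (coaL d)"
  have lin: "lin s 3 1 a" "lin s 2 2 c" "lin s 1 3 e"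
    by (simp_all add: a_def c_def e_def hlin_lin[OF hlin_dif])
  note eqs = ax[unfolded axs_def, THEN conjunct1] ax[unfolded axs_def, THEN conjunct2, THEN conjunct1]
    ax[unfolded axs_def, THEN conjunct2, THEN conjunct2]
  have "bd B 3 (c3 a c e) = 0"
  proof (rule bd_c3)
    fix x
    show "dh B 1 3 a x = 0"
    proof (cases "x \<in> T B 4")
      case True
      show ?thesis unfolding dh_1_3[OF lin(1) True]
        using pentagon_dif[OF u_shape[OF u] n eqs(1) True] unfolding u_cf0[OF u] a_def
        by (rule group_rearrange(1))
    qed (simp add: dh_outside)
    show "dh B 2 2 c x = dc B 1 3 a x"
    proof (cases "x \<in> T B 3")
      case True
      show ?thesis unfolding dh_2_2[OF lin(2) True] dc_1_3[OF lin(1) True]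
        using mixed_mult_dif[OF u_shape[OF u] n eqs(1,2) True] unfolding u_cf0[OF u] a_def c_def
        by (rule group_rearrange(2))
    qed (simp add: dh_outside dc_outside)
    show "dh B 3 1 e x + dc B 2 2 c x = 0"
    proof (cases "x \<in> T B 2")
      case True
      show ?thesis unfolding dh_3_1[OF lin(3) True] dc_2_2[OF lin(2) True]
        using mixed_comult_dif[OF u_shape[OF u] n eqs(3,2) True] unfolding u_cf0[OF u] e_def c_def
        by (rule group_rearrange(3))
    qed (simp add: dh_outside dc_outside)
    show "dc B 3 1 e x = 0"
    proof (cases "x \<in> T B 1")
      case True
      show ?thesis unfolding dc_3_1[OF lin(3) True]
        using copentagon_dif[OF u_shape[OF u] n eqs(3) True] unfolding u_cf0[OF u] e_def
        by (rule group_rearrange(1))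
    qed (simp add: dc_outside)
  qed
  then show ?thesis
    using defects_Dhat[OF u, of n] by (simp add: cocycles_def defects_def a_def c_def e_def)
qed

lemma normal_dif_unital:
  assumes u: "unital m d" and u': "unital m' d'"
  shows "normal 1 2 (- int n) (dif n m' m)" "normal 2 1 (- int n) (dif n d' d)"
proof -
  note [simp] = shapes[OF u_shape[OF u]] shapes[OF u_shape[OF u']] u_unit[OF u] u_counit[OF u] u_unit[OF u'] u_counit[OF u']
  show "normal 1 2 (- int n) (dif n m' m)"
  proof (rule normal_dif)
    show "i < 2 \<Longrightarrow> m' \<cdot> (I i \<otimes> eta \<otimes> I (2 - 1 - i)) = m \<cdot> (I i \<otimes> eta \<otimes> I (2 - 1 - i))" for i
      unfolding less2 by (elim disjE) (simp_all add: One_nat_def[symmetric])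
    show "i < 1 \<Longrightarrow> (I i \<otimes> ep \<otimes> I (1 - 1 - i)) \<cdot> m' = (I i \<otimes> ep \<otimes> I (1 - 1 - i)) \<cdot> m" for i
      unfolding less1 by simp
  qed simp_all
  show "normal 2 1 (- int n) (dif n d' d)"
  proof (rule normal_dif)
    show "i < 2 \<Longrightarrow> (I i \<otimes> ep \<otimes> I (2 - 1 - i)) \<cdot> d' = (I i \<otimes> ep \<otimes> I (2 - 1 - i)) \<cdot> d" for i
      unfolding less2 by (elim disjE) (simp_all add: One_nat_def[symmetric])
    show "i < 1 \<Longrightarrow> d' \<cdot> (I i \<otimes> eta \<otimes> I (1 - 1 - i)) = d \<cdot> (I i \<otimes> eta \<otimes> I (1 - 1 - i))" for i
      unfolding less1 by simp
  qed simp_all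
qed

text \<open>The three Leibniz formulas for a change of the structure are read in terms of B, whose
  operations are the t^0 coefficients of every unital pair; their terms are then those of the
  boundary.\<close>

theorem defects_change:
  assumes u: "unital m d" and u': "unital m' d'" and e: "eqv n m' m" "eqv n d' d" and n: "0 < n"
  shows "defects n m' d' = defects n m d - bd B 2 (c2 (dif n m' m) (dif n d' d))"
proof -
  note [simp] = shapes[OF u_shape[OF u]] composites[OF u_shape[OF u]] shapes[OF u_shape[OF u']] composites[OF u_shape[OF u']]
  define \<mu> where "\<mu> = dif n m' m"
  define \<nu> where "\<nu> = dif n d' d"
  have lin: "lin s 2 1 \<mu>" "lin s 1 2 \<nu>"
    by (simp_all add: \<mu>_def \<nu>_def hlin_lin[OF hlin_dif])
  note sh = u_shape[OF u] u_shape[OF u'] n e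
  have 1: "dif n (assL m') (assR m') x = dif n (assL m) (assR m) x - dh B 1 2 \<mu> x" for x
  proof (cases "x \<in> T B 3")
    case True
    show ?thesis
      unfolding dif_assoc_change[OF sh True] u_cf0[OF u] dh_1_2[OF lin(1) True] \<mu>_def[symmetric]
      by (simp add: algebra_simps)
  qed (simp add: dh_outside dif_outside)
  have 2: "dif n (d' \<cdot> m') (cmp m' d') x = dif n (d \<cdot> m) (cmp m d) x - (dh B 2 1 \<nu> x + dc B 1 2 \<mu> x)" for x
  proof (cases "x \<in> T B 2")
    case True
    show ?thesis
      unfolding dif_mixed_change[OF sh True] u_cf0[OF u] dh_2_1[OF lin(2) True] dc_1_2[OF lin(1) True]
        \<mu>_def[symmetric] \<nu>_def[symmetric]
      by (simp add: algebra_simps)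
  qed (simp add: dh_outside dc_outside dif_outside)
  have 3: "dif n (coaR d') (coaL d') x = dif n (coaR d) (coaL d) x - (- dc B 2 1 \<nu> x)" for x
  proof (cases "x \<in> T B 1")
    case True
    show ?thesis
      unfolding dif_coassoc_change[OF sh True] u_cf0[OF u] dc_2_1[OF lin(2) True] \<nu>_def[symmetric]
      by (simp add: algebra_simps)
  qed (simp add: dc_outside dif_outside)
  have f: "dif n (assL m') (assR m') = (\<lambda>x. dif n (assL m) (assR m) x - dh B 1 2 \<mu> x)"
    "dif n (d' \<cdot> m') (cmp m' d') = (\<lambda>x. dif n (d \<cdot> m) (cmp m d) x - (dh B 2 1 \<nu> x + dc B 1 2 \<mu> x))"
    "dif n (coaR d') (coaL d') = (\<lambda>x. dif n (coaR d) (coaL d) x - (- dc B 2 1 \<nu> x))"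
    by (rule ext, rule 1 2 3)+
  show ?thesis
    unfolding defects_def f bd_c2 c3_diff \<mu>_def[symmetric] \<nu>_def[symmetric] ..
qed

section \<open>Series that may become isomorphisms, and their defects\<close>

definition twist where
  "twist \<phi> \<longleftrightarrow> arr \<phi> \<and> src \<phi> = 1 \<and> tgt \<phi> = 1 \<and> eqv 1 \<phi> (I 1) \<and> \<phi> \<cdot> eta = eta \<and> ep \<cdot> \<phi> = ep"

definition tdefects where
  "tdefects n \<phi> m d m' d' = c2 (dif n (\<phi> \<cdot> m) (m' \<cdot> (\<phi> \<otimes> \<phi>))) (dif n ((\<phi> \<otimes> \<phi>) \<cdot> d) (d' \<cdot> \<phi>))"

definition taxs where
  "taxs n \<phi> m d m' d' \<longleftrightarrow> eqv n (\<phi> \<cdot> m) (m' \<cdot> (\<phi> \<otimes> \<phi>)) \<and> eqv n ((\<phi> \<otimes> \<phi>) \<cdot> d) (d' \<cdot> \<phi>)"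

lemma taxs_Suc: "taxs (Suc n) \<phi> m d m' d' \<longleftrightarrow> taxs n \<phi> m d m' d' \<and> tdefects n \<phi> m d m' d' = 0"
  unfolding taxs_def tdefects_def eqv_Suc_iff c2_zero[symmetric] c2_eq_iff by blast

context
  fixes m d m' d' \<phi>
  assumes u: "unital m d" and u': "unital m' d'" and tw: "twist \<phi>"
begin

lemma tw_simps [simp]: "arr \<phi>" "src \<phi> = 1" "tgt \<phi> = 1" "\<phi> \<cdot> eta = eta" "ep \<cdot> \<phi> = ep"
  and tw_eqv: "eqv 1 \<phi> (I 1)"
  using tw by (auto simp: twist_def)

lemmas [simp] = shapes[OF u_shape[OF u]] composites[OF u_shape[OF u]] shapes[OF u_shape[OF u']]
  composites[OF u_shape[OF u']] u_unit[OF u] u_counit[OF u] u_unit[OF u'] u_counit[OF u']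

lemma tw_cf0: "cf \<phi> 0 = cf (I 1) 0" "cf (\<phi> \<cdot> m) 0 = cf mult0 0" "cf (m' \<cdot> (\<phi> \<otimes> \<phi>)) 0 = cf mult0 0"
  "cf ((\<phi> \<otimes> \<phi>) \<cdot> d) 0 = cf comult0 0" "cf (d' \<cdot> \<phi>) 0 = cf comult0 0"
proof -
  note e = eqv_cf0[OF _ zero_less_one]
  show "cf \<phi> 0 = cf (I 1) 0" by (rule e[OF tw_eqv])
  show "cf (\<phi> \<cdot> m) 0 = cf mult0 0" using e[OF eqv_comp[OF tw_eqv u_eqv(1)[OF u]]] by simp
  show "cf (m' \<cdot> (\<phi> \<otimes> \<phi>)) 0 = cf mult0 0"
    using e[OF eqv_comp[OF u_eqv(1)[OF u'] eqv_ten[OF tw_eqv tw_eqv]]] by simp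
  show "cf ((\<phi> \<otimes> \<phi>) \<cdot> d) 0 = cf comult0 0"
    using e[OF eqv_comp[OF eqv_ten[OF tw_eqv tw_eqv] u_eqv(2)[OF u]]] by simp
  show "cf (d' \<cdot> \<phi>) 0 = cf comult0 0" using e[OF eqv_comp[OF u_eqv(2)[OF u'] tw_eqv]] by simp
qed

lemma taxs_1: "taxs 1 \<phi> m d m' d'"
  using tw_cf0 by (auto simp: taxs_def eqv_def)

lemma unit_twist: "eta \<otimes> \<phi> = (eta \<otimes> I 1) \<cdot> \<phi>" "\<phi> \<otimes> eta = (I 1 \<otimes> eta) \<cdot> \<phi>"
  "ep \<otimes> \<phi> = \<phi> \<cdot> (ep \<otimes> I 1)" "\<phi> \<otimes> ep = \<phi> \<cdot> (I 1 \<otimes> ep)"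
  using interchange[of eta "I 1" "I 0" \<phi>] interchange[of "I 1" eta \<phi> "I 0"]
    interchange[of "I 0" \<phi> ep "I 1"] interchange[of \<phi> "I 0" "I 1" ep] by simp_all

lemma tdefects_Dhat: "tdefects n \<phi> m d m' d' \<in> Dhat B 2 (- int n)"
proof -
  have 1: "(m' \<cdot> (\<phi> \<otimes> \<phi>)) \<cdot> (eta \<otimes> I 1) = \<phi>" "(m' \<cdot> (\<phi> \<otimes> \<phi>)) \<cdot> (I 1 \<otimes> eta) = \<phi>"
  proof -
    have "(m' \<cdot> (\<phi> \<otimes> \<phi>)) \<cdot> (eta \<otimes> I 1) = (m' \<cdot> (eta \<otimes> I 1)) \<cdot> \<phi>"
      "(m' \<cdot> (\<phi> \<otimes> \<phi>)) \<cdot> (I 1 \<otimes> eta) = (m' \<cdot> (I 1 \<otimes> eta)) \<cdot> \<phi>"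
      by (simp_all add: interchange unit_twist del: u_unit[OF u'])
    then show "(m' \<cdot> (\<phi> \<otimes> \<phi>)) \<cdot> (eta \<otimes> I 1) = \<phi>" "(m' \<cdot> (\<phi> \<otimes> \<phi>)) \<cdot> (I 1 \<otimes> eta) = \<phi>" by simp_all
  qed
  have 2: "ep \<cdot> \<phi> \<cdot> m = ep \<otimes> ep" "ep \<cdot> m' \<cdot> (\<phi> \<otimes> \<phi>) = ep \<otimes> ep"
  proof -
    show "ep \<cdot> \<phi> \<cdot> m = ep \<otimes> ep" by (subst comp_assoc[symmetric]; simp)
    have "ep \<cdot> m' \<cdot> (\<phi> \<otimes> \<phi>) = (ep \<otimes> ep) \<cdot> (\<phi> \<otimes> \<phi>)" by (subst comp_assoc[symmetric]; simp)
    then show "ep \<cdot> m' \<cdot> (\<phi> \<otimes> \<phi>) = ep \<otimes> ep" by (simp add: interchange)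
  qed
  have 3: "(ep \<otimes> I 1) \<cdot> (\<phi> \<otimes> \<phi>) \<cdot> d = \<phi>" "(I 1 \<otimes> ep) \<cdot> (\<phi> \<otimes> \<phi>) \<cdot> d = \<phi>"
    "(ep \<otimes> I 1) \<cdot> d' \<cdot> \<phi> = \<phi>" "(I 1 \<otimes> ep) \<cdot> d' \<cdot> \<phi> = \<phi>"
  proof -
    show "(ep \<otimes> I 1) \<cdot> (\<phi> \<otimes> \<phi>) \<cdot> d = \<phi>" "(I 1 \<otimes> ep) \<cdot> (\<phi> \<otimes> \<phi>) \<cdot> d = \<phi>"
      by (simp_all add: interchange' unit_twist)
    show "(ep \<otimes> I 1) \<cdot> d' \<cdot> \<phi> = \<phi>" "(I 1 \<otimes> ep) \<cdot> d' \<cdot> \<phi> = \<phi>"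
      by (subst comp_assoc[symmetric]; simp)+
  qed
  have 4: "((\<phi> \<otimes> \<phi>) \<cdot> d) \<cdot> eta = (d' \<cdot> \<phi>) \<cdot> eta" by (simp add: interchange)
  have "normal 1 2 (- int n) (dif n (\<phi> \<cdot> m) (m' \<cdot> (\<phi> \<otimes> \<phi>)))"
  proof (rule normal_dif)
    show "i < 2 \<Longrightarrow> (\<phi> \<cdot> m) \<cdot> (I i \<otimes> eta \<otimes> I (2 - 1 - i)) = (m' \<cdot> (\<phi> \<otimes> \<phi>)) \<cdot> (I i \<otimes> eta \<otimes> I (2 - 1 - i))" for i
      unfolding less2 using 1 by (elim disjE) (simp_all add: One_nat_def[symmetric])
    show "i < 1 \<Longrightarrow> (I i \<otimes> ep \<otimes> I (1 - 1 - i)) \<cdot> (\<phi> \<cdot> m) = (I i \<otimes> ep \<otimes> I (1 - 1 - i)) \<cdot> (m' \<cdot> (\<phi> \<otimes> \<phi>))" for i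
      unfolding less1 using 2 by simp
  qed simp_all
  moreover have "normal 2 1 (- int n) (dif n ((\<phi> \<otimes> \<phi>) \<cdot> d) (d' \<cdot> \<phi>))"
  proof (rule normal_dif)
    show "i < 2 \<Longrightarrow> (I i \<otimes> ep \<otimes> I (2 - 1 - i)) \<cdot> ((\<phi> \<otimes> \<phi>) \<cdot> d) = (I i \<otimes> ep \<otimes> I (2 - 1 - i)) \<cdot> (d' \<cdot> \<phi>)" for i
      unfolding less2 using 3 by (elim disjE) (simp_all add: One_nat_def[symmetric])
    show "i < 1 \<Longrightarrow> ((\<phi> \<otimes> \<phi>) \<cdot> d) \<cdot> (I i \<otimes> eta \<otimes> I (1 - 1 - i)) = (d' \<cdot> \<phi>) \<cdot> (I i \<otimes> eta \<otimes> I (1 - 1 - i))" for i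
      unfolding less1 using 4 by simp
  qed simp_all
  ultimately show ?thesis by (auto simp: Dhat_2 tdefects_def)
qed

text \<open>Both structures satisfy the axioms at t^n as well, whereas \<phi> is a morphism only
  below t^n. Since \<phi> is the identity at t^0, the three twisted loops become the components of
  the boundary at (1, 3), (2, 2) and (3, 1).\<close>

theorem tdefects_cocycle:
  assumes ax: "axs (Suc n) m d" "axs (Suc n) m' d'" and t: "taxs n \<phi> m d m' d'" and n: "0 < n"
  shows "tdefects n \<phi> m d m' d' \<in> cocycles B 2 (- int n)"
proof -
  define \<mu> where "\<mu> = dif n (\<phi> \<cdot> m) (m' \<cdot> (\<phi> \<otimes> \<phi>))"
  define \<nu> where "\<nu> = dif n ((\<phi> \<otimes> \<phi>) \<cdot> d) (d' \<cdot> \<phi>)"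
  have lin: "lin s 2 1 \<mu>" "lin s 1 2 \<nu>"
    by (simp_all add: \<mu>_def \<nu>_def hlin_lin[OF hlin_dif])
  note sh = u_shape[OF u] u_shape[OF u'] n tw_simps(1-3)
  note te = t[unfolded taxs_def, THEN conjunct1] t[unfolded taxs_def, THEN conjunct2]
  have 1: "dh B 1 2 \<mu> x = 0" for x
  proof (cases "x \<in> T B 3")
    case True
    have "\<mu> (cf (m \<otimes> I 1) 0 x) + cf m' 0 (tm 2 1 \<mu> (cf \<phi> 0) x) =
        \<mu> (cf (I 1 \<otimes> m) 0 x) + cf m' 0 (tm 1 2 (cf \<phi> 0) \<mu> x)"
      unfolding \<mu>_def by (rule twist_assoc[OF sh te(1) True]) (use ax in \<open>auto simp: axs_def\<close>)
    then show ?thesis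
      unfolding dh_1_2[OF lin(1) True] u_cf0[OF u] u_cf0[OF u'] tw_cf0 tm_cf_I_left tm_cf_I_right
      by (rule group_rearrange(4))
  qed (simp add: dh_outside)
  have 2: "dh B 2 1 \<nu> x + dc B 1 2 \<mu> x = 0" for x
  proof (cases "x \<in> T B 2")
    case True
    have "tm 2 2 \<mu> (cf (\<phi> \<cdot> m) 0) (cf (ms \<cdot> (d \<otimes> d)) 0 x) + tm 2 2 (cf (m' \<cdot> (\<phi> \<otimes> \<phi>)) 0) \<mu> (cf (ms \<cdot> (d \<otimes> d)) 0 x) +
      cf (mul2 m') 0 (tm 1 1 \<nu> (cf ((\<phi> \<otimes> \<phi>) \<cdot> d) 0) x) + cf (mul2 m') 0 (tm 1 1 (cf (d' \<cdot> \<phi>) 0) \<nu> x) =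
      \<nu> (cf m 0 x) + cf d' 0 (\<mu> x)"
      unfolding \<mu>_def \<nu>_def by (rule twist_mixed[OF sh te True]) (use ax in \<open>auto simp: axs_def\<close>)
    then show ?thesis
      unfolding dh_2_1[OF lin(2) True] dc_1_2[OF lin(1) True] tw_cf0 u_cf0[OF u] u_cf0[OF u']
      by (rule group_rearrange(5))
  qed (simp add: dh_outside dc_outside)
  have 3: "dc B 2 1 \<nu> x = 0" for x
  proof (cases "x \<in> T B 1")
    case True
    have "tm 1 1 \<nu> (cf \<phi> 0) (cf d 0 x) + cf (d' \<otimes> I 1) 0 (\<nu> x) =
      tm 1 1 (cf \<phi> 0) \<nu> (cf d 0 x) + cf (I 1 \<otimes> d') 0 (\<nu> x)"
      unfolding \<nu>_def by (rule twist_coassoc[OF sh te(2) True]) (use ax in \<open>auto simp: axs_def\<close>)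
    then show ?thesis
      unfolding dc_2_1[OF lin(2) True] u_cf0[OF u] u_cf0[OF u'] tw_cf0 tm_cf_I_left tm_cf_I_right
      by (rule group_rearrange(6))
  qed (simp add: dc_outside)
  have f: "dh B 1 2 \<mu> = (\<lambda>x. 0)" "dc B 2 1 \<nu> = (\<lambda>x. 0)"
    by (rule ext, rule 1 3)+
  have "bd B 2 (tdefects n \<phi> m d m' d') = 0"
    unfolding tdefects_def bd_c2 \<mu>_def[symmetric] \<nu>_def[symmetric] f 2 by (simp add: c3_zero)
  then show ?thesis using tdefects_Dhat by (simp add: cocycles_def)
qed

theorem tdefects_change:
  assumes tw': "twist \<psi>" and e: "eqv n \<psi> \<phi>" and n: "0 < n"
  shows "tdefects n \<psi> m d m' d' = tdefects n \<phi> m d m' d' - bd B 1 (c1 (dif n \<psi> \<phi>))"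
proof -
  have psi [simp]: "arr \<psi>" "src \<psi> = 1" "tgt \<psi> = 1" using tw' by (auto simp: twist_def)
  define f where "f = dif n \<psi> \<phi>"
  have lin: "lin s 1 1 f" by (simp add: f_def hlin_lin[OF hlin_dif])
  note sh = u_shape[OF u] u_shape[OF u'] n tw_simps(1-3) psi e
  have 1: "dif n (\<psi> \<cdot> m) (m' \<cdot> (\<psi> \<otimes> \<psi>)) x = dif n (\<phi> \<cdot> m) (m' \<cdot> (\<phi> \<otimes> \<phi>)) x - dh B 1 1 f x" for x
  proof (cases "x \<in> T B 2")
    case True
    have "cf mult0 0 (tm 1 1 f (\<lambda>x. x) x + tm 1 1 (\<lambda>x. x) f x) =
      cf mult0 0 (tm 1 1 f (\<lambda>x. x) x) + cf mult0 0 (tm 1 1 (\<lambda>x. x) f x)"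
      by (rule lin_add[OF lin_cf0]) (use True in \<open>auto intro!: tm_in[OF lin lin_id(2)] tm_in[OF lin_id(2) lin]\<close>)
    then show ?thesis
      unfolding twist_change(1)[OF sh True] dh_1_1[OF lin True] f_def[symmetric] u_cf0[OF u] u_cf0[OF u']
        tw_cf0 tm_cf_I_left tm_cf_I_right
      by (simp add: algebra_simps)
  qed (simp add: dh_outside dif_outside)
  have 2: "dif n ((\<psi> \<otimes> \<psi>) \<cdot> d) (d' \<cdot> \<psi>) x = dif n ((\<phi> \<otimes> \<phi>) \<cdot> d) (d' \<cdot> \<phi>) x - (- dc B 1 1 f x)" for x
  proof (cases "x \<in> T B 1")
    case True
    show ?thesis
      unfolding twist_change(2)[OF sh True] dc_1_1[OF lin True] f_def[symmetric] u_cf0[OF u] u_cf0[OF u']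
        tw_cf0 tm_cf_I_left tm_cf_I_right
      by (simp add: algebra_simps)
  qed (simp add: dc_outside dif_outside)
  have g: "dif n (\<psi> \<cdot> m) (m' \<cdot> (\<psi> \<otimes> \<psi>)) = (\<lambda>x. dif n (\<phi> \<cdot> m) (m' \<cdot> (\<phi> \<otimes> \<phi>)) x - dh B 1 1 f x)"
    "dif n ((\<psi> \<otimes> \<psi>) \<cdot> d) (d' \<cdot> \<psi>) = (\<lambda>x. dif n ((\<phi> \<otimes> \<phi>) \<cdot> d) (d' \<cdot> \<phi>) x - (- dc B 1 1 f x))"
    by (rule ext, rule 1 2)+
  show ?thesis unfolding tdefects_def g bd_c1 c2_diff f_def[symmetric] ..
qed

end

end

section \<open>Deformations as power series\<close>

lemma sum_triangle_swap:
  fixes h :: "nat \<Rightarrow> nat \<Rightarrow> 'a::comm_monoid_add"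
  shows "(\<Sum>i\<le>n. \<Sum>j\<le>n - i. h i j) = (\<Sum>j\<le>n. \<Sum>i\<le>n - j. h i j)"
proof -
  have "(\<Sum>i\<le>n. \<Sum>j\<le>n - i. h i j) = (\<Sum>(i, j)\<in>Sigma {..n} (\<lambda>i. {..n - i}). h i j)"
    by (rule sum.Sigma) auto
  also have "\<dots> = (\<Sum>(j, i)\<in>Sigma {..n} (\<lambda>i. {..n - i}). h i j)"
    by (rule sum.reindex_bij_witness[of _ "\<lambda>(i, j). (j, i)" "\<lambda>(i, j). (j, i)"]) auto
  also have "\<dots> = (\<Sum>j\<le>n. \<Sum>i\<le>n - j. h i j)"
    by (rule sum.Sigma[symmetric]) auto
  finally show ?thesis .
qed

lemma enat_le_diff: "enat n \<le> l \<Longrightarrow> enat (n - i) \<le> l"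
  by (meson diff_le_self enat_ord_simps(1) order_trans)

lemma enat_le_mono: "enat n \<le> l \<Longrightarrow> i \<le> n \<Longrightarrow> enat i \<le> l"
  by (meson enat_ord_simps(1) order_trans)

lemma zero_enat_le [simp]: "enat 0 \<le> l"
  by (simp add: zero_enat_def[symmetric])

lemma tpolyD: "X \<in> tpoly l V \<Longrightarrow> X n \<in> V" "X \<in> tpoly l V \<Longrightarrow> \<not> enat n \<le> l \<Longrightarrow> X n = 0"
  "X \<in> tpoly l V \<Longrightarrow> finite {n. X n \<noteq> 0}"
  by (auto simp: tpoly_def)

lemma const_in_tpoly: "0 \<in> V \<Longrightarrow> const x \<in> tpoly l V \<longleftrightarrow> x \<in> V"
  by (auto simp: tpoly_def const_def)

lemma poly_zero_apply: "(0 :: nat \<Rightarrow> ('b, 'k::field) tensor) n = 0"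
  and poly_plus_apply: "(X + Y :: nat \<Rightarrow> ('b, 'k::field) tensor) n = X n + Y n"
  by (rule zero_fun_apply plus_fun_apply)+

context graded_bialgebra
begin

definition act :: "enat \<Rightarrow> ('b, 'k) mor \<Rightarrow> (nat \<Rightarrow> ('b, 'k) tensor) \<Rightarrow> nat \<Rightarrow> ('b, 'k) tensor" where
  "act l F X = (\<lambda>n. if enat n \<le> l then \<Sum>i\<le>n. cf F i (X (n - i)) else 0)"

definition oper :: "enat \<Rightarrow> ('b, 'k) mor \<Rightarrow> ('b, 'k) tlinmap" where
  "oper l F = restrict0 (tpoly l (T B (src F))) (act l F)"

definition ser :: "nat \<Rightarrow> nat \<Rightarrow> ('b, 'k) tlinmap \<Rightarrow> ('b, 'k) mor" where
  "ser p q F = Mor p q (tcoeff F)"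

text \<open>A linear map over the ring truncated at t^(l+1) determines the coefficients up to l
  only. With the others normalised to zero, \<open>ser\<close> and \<open>oper\<close> are inverse
  to each other; for l = \<infinity> the condition is empty.\<close>

definition van :: "enat \<Rightarrow> ('b, 'k) mor \<Rightarrow> bool" where
  "van l F \<longleftrightarrow> (\<forall>n. \<not> enat n \<le> l \<longrightarrow> cf F n = (\<lambda>x. 0))"

definition eql :: "enat \<Rightarrow> ('b, 'k) mor \<Rightarrow> ('b, 'k) mor \<Rightarrow> bool" where
  "eql l F G \<longleftrightarrow> src F = src G \<and> tgt F = tgt G \<and> (\<forall>n. enat n \<le> l \<longrightarrow> cf F n = cf G n)"

lemma ser_simps [simp]: "src (ser p q F) = p" "tgt (ser p q F) = q" "cf (ser p q F) = tcoeff F"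
  by (simp_all add: ser_def)

lemma act_const:
  assumes "arr F" shows "act l F (const x) n = (if enat n \<le> l then cf F n x else 0)"
proof -
  have "(\<Sum>i\<le>n. cf F i (const x (n - i))) = cf F n x"
    by (subst sum_only_last) (use assms in \<open>auto simp: const_def\<close>)
  then show ?thesis by (simp add: act_def)
qed

lemma arr_finite_support:
  assumes F: "arr F" and x: "x \<in> T B (src F)"
  shows "\<exists>N. \<forall>i\<ge>N. cf F i x = 0"
  using x
proof (induction rule: T_homogeneous_induct)
  case (homogeneous y e)
  \<comment> \<open>The value has degree e - i, which is negative from here on, also when e itself
    is negative.\<close>
  have "cf F i y = 0" if "i \<ge> nat (e + 1)" for i
    by (rule tgrade_negative[OF hlin_grade[OF arr_hlin[OF F] homogeneous refl]]) (use that in linarith)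
  then show ?case by blast
next
  case (add x y)
  then obtain N M where "\<forall>i\<ge>N. cf F i x = 0" "\<forall>i\<ge>M. cf F i y = 0" by blast
  then have "\<forall>i\<ge>max N M. cf F i (x + y) = 0" using add by (simp add: lin_add[OF arr_lin[OF F]])
  then show ?case by blast
qed

text \<open>Each of the finitely many non-zero coefficients of X meets only finitely many non-zero
  values of the coefficients of F, so the product has finite support even though F may be an
  infinite series.\<close>

lemma act_tpoly:
  assumes F: "arr F" and X: "X \<in> tpoly l (T B (src F))" and q: "q = tgt F"
  shows "act l F X \<in> tpoly l (T B q)"
proof -
  have "\<forall>j. \<exists>N. \<forall>i\<ge>N. cf F i (X j) = 0" using arr_finite_support[OF F tpolyD(1)[OF X]] by blast
  then obtain N where N: "\<And>j i. i \<ge> N j \<Longrightarrow> cf F i (X j) = 0" by metis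
  let ?J = "{j. X j \<noteq> 0}"
  have "{n. act l F X n \<noteq> 0} \<subseteq> (\<lambda>(j, i). j + i) ` (Sigma ?J (\<lambda>j. {..<N j}))"
  proof
    fix n assume "n \<in> {n. act l F X n \<noteq> 0}"
    then have "(\<Sum>i\<le>n. cf F i (X (n - i))) \<noteq> 0" by (auto simp: act_def split: if_splits)
    then obtain i where i: "i \<le> n" "cf F i (X (n - i)) \<noteq> 0" by (metis (no_types, lifting) atMost_iff sum.neutral)
    then have "X (n - i) \<noteq> 0" "i < N (n - i)" using F N[of "n - i" i] by (auto simp: not_le[symmetric])
    then show "n \<in> (\<lambda>(j, i). j + i) ` (Sigma ?J (\<lambda>j. {..<N j}))"
      using i by (intro image_eqI[of _ _ "(n - i, i)"]) auto
  qed
  moreover have "finite ((\<lambda>(j, i). j + i) ` (Sigma ?J (\<lambda>j. {..<N j})))"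
    using tpolyD(3)[OF X] by auto
  ultimately have "finite {n. act l F X n \<noteq> 0}" by (rule finite_subset)
  moreover have "act l F X n \<in> T B q" for n
    using arr_in[OF F tpolyD(1)[OF X] q] by (auto simp: act_def intro!: tpow_sum)
  ultimately show ?thesis by (auto simp: tpoly_def act_def split: if_splits)
qed

lemma act_comp:
  assumes F: "arr F" and G: "arr G" and t: "tgt G = src F" and X: "X \<in> tpoly l (T B (src G))"
  shows "act l (F \<cdot> G) X = act l F (act l G X)"
proof (rule ext)
  fix n show "act l (F \<cdot> G) X n = act l F (act l G X) n"
  proof (cases "enat n \<le> l")
    case True
    have "act l F (act l G X) n = (\<Sum>i\<le>n. cf F i (\<Sum>j\<le>n - i. cf G j (X (n - i - j))))"
      using True by (simp add: act_def enat_le_diff)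
    also have "\<dots> = (\<Sum>i\<le>n. \<Sum>j\<le>n - i. cf F i (cf G j (X (n - i - j))))"
      by (intro sum.cong refl lin_sum[OF arr_lin[OF F]] arr_in[OF G tpolyD(1)[OF X]]) (simp add: t)
    also have "\<dots> = (\<Sum>i\<le>n. \<Sum>j\<le>i. cf F j (cf G (i - j) (X (n - i))))"
      by (rule sum_triangle[of "\<lambda>i j k. cf F i (cf G j (X k))", symmetric])
    also have "\<dots> = act l (F \<cdot> G) X n"
      using True by (simp add: act_def cf_comp)
    finally show ?thesis ..
  qed (simp add: act_def)
qed

lemma act_order0:
  assumes "order0 F"
  shows "act l F X n = (if enat n \<le> l then cf F 0 (X n) else 0)"
  unfolding act_def by (subst sum_only_first) (use assms in \<open>auto simp: order0_def\<close>)

lemma act_I: "X \<in> tpoly l (T B p) \<Longrightarrow> act l (I p) X = X"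
  by (rule ext) (auto simp: act_order0 cf_I tpolyD)

lemma act_eq_iff:
  assumes "arr F" "arr G" "src F = p" "src G = p" "tgt F = tgt G"
  shows "(\<forall>X\<in>tpoly l (T B p). act l F X = act l G X) \<longleftrightarrow> eql l F G"
proof
  assume a: "\<forall>X\<in>tpoly l (T B p). act l F X = act l G X"
  have "cf F n x = cf G n x" if n: "enat n \<le> l" for n x
  proof (cases "x \<in> T B p")
    case True
    then have "act l F (const x) = act l G (const x)" using a by (simp add: const_in_tpoly)
    from fun_cong[OF this, of n] n assms show ?thesis by (simp add: act_const)
  qed (use assms in \<open>simp add: arr_outside\<close>)
  then have "\<And>n. enat n \<le> l \<Longrightarrow> cf F n = cf G n" by (intro ext[where f = "cf F _"])
  then show "eql l F G" using assms by (simp add: eql_def)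
next
  assume a: "eql l F G"
  have "act l F X = act l G X" for X
  proof (rule ext)
    fix n show "act l F X n = act l G X n"
      using a by (auto simp: act_def eql_def enat_le_mono intro!: sum.cong)
  qed
  then show "\<forall>X\<in>tpoly l (T B p). act l F X = act l G X" by blast
qed

text \<open>A constant polynomial of degree e has an image of degree e, and t has degree 1, so the
  coefficient of t^n lies in degree e - n. Linearity over the field is linearity over constant
  polynomials.\<close>

lemma ser_arr:
  assumes F: "F \<in> tHom B l p q"
  shows "arr (ser p q F)" "van l (ser p q F)"
proof -
  have add: "F (X + Y) = F X + F Y" if "X \<in> tpoly l (T B p)" "Y \<in> tpoly l (T B p)" for X Y
    using F that by (simp add: tHom_def)
  have scl: "F (tact l c X) = tact l c (F X)" if "c \<in> tpoly l UNIV" "X \<in> tpoly l (T B p)" for X c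
    using F that by (simp add: tHom_def)
  have img: "F X \<in> tpoly l (T B q)" if "X \<in> tpoly l (T B p)" for X
    using F that by (auto simp: tHom_def)
  have grd: "F X \<in> tpoly_grade B l q e" if "X \<in> tpoly_grade B l p e" for X e
    using F that unfolding tHom_def by blast
  have out: "F X = 0" if "X \<notin> tpoly l (T B p)" for X
    using F that by (simp add: tHom_def)
  have c: "const x \<in> tpoly l (T B p)" if "x \<in> T B p" for x using that by (simp add: const_in_tpoly)
  have o: "tcoeff F n x = 0" if "x \<notin> T B p" for n x
    using out[of "const x"] that by (simp add: tcoeff_def const_in_tpoly poly_zero_apply)
  have l: "lin s p q (tcoeff F n)" for n
  proof (rule linI)
    fix x y assume x: "x \<in> T B p" and y: "y \<in> T B p"
    show "tcoeff F n x \<in> T B q" using tpolyD(1)[OF img[OF c[OF x]]] by (simp add: tcoeff_def)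
    have "const (x + y) = const x + const y" by (rule ext) (simp add: const_def poly_plus_apply)
    then show "tcoeff F n (x + y) = tcoeff F n x + tcoeff F n y"
      using add[OF c[OF x] c[OF y]] by (simp add: tcoeff_def poly_plus_apply)
  next
    fix k :: 'k and x assume x: "x \<in> T B p"
    have k: "const k \<in> tpoly l UNIV" by (simp add: const_in_tpoly)
    have t: "tact l (const k) X = (\<lambda>n. tscale k (X n))" if "X \<in> tpoly l V" for X V
    proof (rule ext)
      fix n
      have "(\<Sum>i\<le>n. tscale (const k i) (X (n - i))) = tscale k (X n)"
        by (subst sum_only_first) (auto simp: const_def)
      then show "tact l (const k) X n = tscale k (X n)" using tpolyD(2)[OF that] by (simp add: tact_def)
    qed
    have "const (tscale k x) = tact l (const k) (const x)"
      unfolding t[OF c[OF x]] by (rule ext) (simp add: const_def)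
    then have "F (const (tscale k x)) = tact l (const k) (F (const x))" using scl[OF k c[OF x]] by simp
    then show "tcoeff F n (tscale k x) = tscale k (tcoeff F n x)" by (simp add: tcoeff_def t[OF img[OF c[OF x]]])
  qed
  have "hlin p q (- int n) (tcoeff F n)" for n
    unfolding hlin_def
  proof (intro conjI allI ballI l)
    fix e x assume x: "x \<in> tgrade B p UNIV e"
    then have "const x \<in> tpoly_grade B l p e" using c[OF tgrade_T[OF x]] by (auto simp: tpoly_grade_def const_def)
    from grd[OF this] show "tcoeff F n x \<in> tgrade B q UNIV (e + - int n)" by (simp add: tpoly_grade_def tcoeff_def)
  qed
  then show "arr (ser p q F)" using o by (simp add: arr_def)
  have "tcoeff F n x = 0" if "\<not> enat n \<le> l" for n x
    using o[of x n] tpolyD(2)[OF img[OF c] that] by (cases "x \<in> T B p") (auto simp: tcoeff_def)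
  then show "van l (ser p q F)" by (simp add: van_def) (auto intro: ext)
qed

text \<open>X is a finite sum of monomials, each a power of t times a constant, and F commutes with
  multiplication by powers of t. So F is determined by its values on constants, which
  \<open>tcoeff\<close> records.\<close>

lemma tHom_act:
  assumes F: "F \<in> tHom B l p q" and X: "X \<in> tpoly l (T B p)"
  shows "F X = act l (ser p q F) X"
proof -
  have add: "F (X + Y) = F X + F Y" if "X \<in> tpoly l (T B p)" "Y \<in> tpoly l (T B p)" for X Y
    using F that by (simp add: tHom_def)
  have scl: "F (tact l c X) = tact l c (F X)" if "c \<in> tpoly l UNIV" "X \<in> tpoly l (T B p)" for X c
    using F that by (simp add: tHom_def)
  note s = ser_arr[OF F]
  \<comment> \<open>\<open>?t j\<close> is the power t^j and \<open>?Y j\<close> the monomial of X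
    in degree j.\<close>
  let ?t = "\<lambda>j n. if n = j then 1 else 0 :: 'k"
  let ?Y = "\<lambda>j. (\<lambda>n. if n = j then X j else 0)"
  have t: "?t j \<in> tpoly l UNIV" if "enat j \<le> l" for j using that by (auto simp: tpoly_def)
  have Y: "?Y j \<in> tpoly l (T B p)" for j
    using tpolyD(1)[OF X, of j] tpolyD(2)[OF X, of j] by (auto simp: tpoly_def)
  have c: "const (X j) \<in> tpoly l (T B p)" for j using tpolyD(1)[OF X] by (simp add: const_in_tpoly)
  have tt: "tact l (?t j) Z n = (if enat n \<le> l \<and> j \<le> n then Z (n - j) else 0)" for j Z n
  proof -
    have "(\<Sum>i\<le>n. tscale (?t j i) (Z (n - i))) = (\<Sum>i\<le>n. if i = j then Z (n - j) else 0)"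
      by (rule sum.cong) auto
    then show ?thesis by (simp add: tact_def)
  qed
  have FY: "F (?Y j) n = (if enat n \<le> l \<and> j \<le> n then tcoeff F (n - j) (X j) else 0)" for j n
  proof (cases "enat j \<le> l")
    case True
    have "?Y j = tact l (?t j) (const (X j))"
    proof (rule ext)
      fix i show "?Y j i = tact l (?t j) (const (X j)) i"
        unfolding tt using True by (auto simp: const_def)
    qed
    then show ?thesis using scl[OF t[OF True] c] by (simp add: tt tcoeff_def)
  next
    case False
    then have z: "X j = 0" by (rule tpolyD(2)[OF X])
    have zz: "(\<lambda>n. if n = j then X j else 0) = 0" by (rule ext) (simp add: z poly_zero_apply)
    have "0 \<in> tpoly l (T B p)" by (auto simp: tpoly_def poly_zero_apply)
    from add[OF this this] have "F 0 = 0" by simp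
    then have "F (?Y j) n = 0" unfolding zz by (simp add: poly_zero_apply)
    moreover have "tcoeff F (n - j) (X j) = 0" using arr_zero[OF s(1), of "n - j"] z by simp
    ultimately show ?thesis by simp
  qed
  have fin: "(\<Sum>j\<in>J. ?Y j) \<in> tpoly l (T B p) \<and> F (\<Sum>j\<in>J. ?Y j) = (\<Sum>j\<in>J. F (?Y j))" if "finite J" for J
    using that
  proof (induction J)
    case empty
    have "0 \<in> tpoly l (T B p)" by (auto simp: tpoly_def poly_zero_apply)
    with add[OF this this] show ?case by simp
  next
    case (insert j J)
    have "?Y j + (\<Sum>j\<in>J. ?Y j) \<in> tpoly l (T B p)"
    proof -
      have "{n. (?Y j + (\<Sum>j\<in>J. ?Y j)) n \<noteq> 0} \<subseteq> {n. ?Y j n \<noteq> 0} \<union> {n. (\<Sum>j\<in>J. ?Y j) n \<noteq> 0}"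
        by (auto simp: poly_plus_apply)
      then have "finite {n. (?Y j + (\<Sum>j\<in>J. ?Y j)) n \<noteq> 0}"
        using tpolyD(3)[OF Y] tpolyD(3)[OF insert.IH[THEN conjunct1]] by (meson finite_Un finite_subset)
      moreover have "(?Y j + (\<Sum>j\<in>J. ?Y j)) n \<in> T B p" for n
        using tpolyD(1)[OF Y] tpolyD(1)[OF insert.IH[THEN conjunct1]] unfolding poly_plus_apply by (rule tpow_add)
      moreover have "(?Y j + (\<Sum>j\<in>J. ?Y j)) n = 0" if "\<not> enat n \<le> l" for n
        using tpolyD(2)[OF Y that] tpolyD(2)[OF insert.IH[THEN conjunct1] that] unfolding poly_plus_apply by simp
      ultimately show ?thesis by (auto simp: tpoly_def)
    qed
    then show ?case using insert add[OF Y insert.IH[THEN conjunct1], of j] by simp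
  qed
  have ap: "(\<Sum>j\<in>J. Z j) n = (\<Sum>j\<in>J. Z j n)" for Z :: "nat \<Rightarrow> nat \<Rightarrow> ('b, 'k) tensor" and J n
    by (induction J rule: infinite_finite_induct) (auto simp: poly_plus_apply poly_zero_apply)
  let ?J = "{j. X j \<noteq> 0}"
  have J: "finite ?J" by (rule tpolyD(3)[OF X])
  have "X = (\<Sum>j\<in>?J. ?Y j)"
  proof (rule ext)
    fix n show "X n = (\<Sum>j\<in>?J. ?Y j) n" unfolding ap using J by (simp add: if_distrib sum.delta)
  qed
  then have FX: "F X = (\<Sum>j\<in>?J. F (?Y j))" using fin[OF J] by metis
  show ?thesis
  proof (rule ext)
    fix n
    have "F X n = (\<Sum>j\<in>?J. if enat n \<le> l \<and> j \<le> n then tcoeff F (n - j) (X j) else 0)"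
      unfolding FX ap FY ..
    also have "\<dots> = act l (ser p q F) X n"
    proof (cases "enat n \<le> l")
      case True
      have "(\<Sum>j\<in>?J. if j \<le> n then tcoeff F (n - j) (X j) else 0) = (\<Sum>j\<le>n. tcoeff F (n - j) (X j))"
        by (rule sum.mono_neutral_cong) (use J arr_zero[OF s(1)] in auto)
      also have "\<dots> = (\<Sum>i\<le>n. tcoeff F i (X (n - i)))"
        by (rule sum.reindex_bij_witness[of _ "\<lambda>i. n - i" "\<lambda>i. n - i"]) auto
      finally show ?thesis using True by (simp add: act_def)
    qed (simp add: act_def)
    finally show "F X n = act l (ser p q F) X n" .
  qed
qed

lemma oper_act: "X \<in> tpoly l (T B (src F)) \<Longrightarrow> oper l F X = act l F X"
  by (simp add: oper_def restrict0_def)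

lemma oper_tHom:
  assumes F: "arr F" "src F = p" "tgt F = q"
  shows "oper l F \<in> tHom B l p q"
  unfolding tHom_def
proof (safe, goal_cases)
  case (1 X Y)
  have "X + Y \<in> tpoly l (T B p)"
  proof -
    have "{n. (X + Y) n \<noteq> 0} \<subseteq> {n. X n \<noteq> 0} \<union> {n. Y n \<noteq> 0}" by (auto simp: poly_plus_apply)
    then have "finite {n. (X + Y) n \<noteq> 0}" using tpolyD(3)[OF 1(1)] tpolyD(3)[OF 1(2)] by (meson finite_Un finite_subset)
    then show ?thesis using tpolyD(1,2)[OF 1(1)] tpolyD(1,2)[OF 1(2)] by (auto simp: tpoly_def poly_plus_apply)
  qed
  moreover have "act l F (X + Y) = act l F X + act l F Y"
    using tpolyD(1)[OF 1(1)] tpolyD(1)[OF 1(2)] F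
    by (intro ext[where f = "act l F (X + Y)"]) (simp add: act_def poly_plus_apply lin_add[OF arr_lin[OF F(1)]] sum.distrib)
  ultimately show ?case using 1 F by (simp add: oper_act)
next
  case (2 c X)
  have cX: "tact l c X \<in> tpoly l (T B p)"
  proof -
    have "{n. tact l c X n \<noteq> 0} \<subseteq> (\<lambda>(i, j). i + j) ` ({i. c i \<noteq> 0} \<times> {j. X j \<noteq> 0})"
    proof
      fix n assume "n \<in> {n. tact l c X n \<noteq> 0}"
      then have "(\<Sum>i\<le>n. tscale (c i) (X (n - i))) \<noteq> 0" by (auto simp: tact_def split: if_splits)
      then obtain i where i: "i \<le> n" "tscale (c i) (X (n - i)) \<noteq> 0" by (metis (no_types, lifting) atMost_iff sum.neutral)
      then show "n \<in> (\<lambda>(i, j). i + j) ` ({i. c i \<noteq> 0} \<times> {j. X j \<noteq> 0})"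
        by (intro image_eqI[of _ _ "(i, n - i)"]) auto
    qed
    then have "finite {n. tact l c X n \<noteq> 0}"
      by (rule finite_subset) (use tpolyD(3)[OF 2(1)] tpolyD(3)[OF 2(2)] in auto)
    then show ?thesis using tpolyD(1)[OF 2(2)] by (auto simp: tpoly_def tact_def intro!: tpow_sum split: if_splits)
  qed
  have "act l F (tact l c X) = tact l c (act l F X)"
  proof (rule ext)
    fix n show "act l F (tact l c X) n = tact l c (act l F X) n"
    proof (cases "enat n \<le> l")
      case True
      have X: "X j \<in> T B (src F)" for j using tpolyD(1)[OF 2(2)] F by simp
      have "act l F (tact l c X) n = (\<Sum>i\<le>n. cf F i (\<Sum>j\<le>n - i. tscale (c j) (X (n - i - j))))"
        using True by (simp add: act_def tact_def enat_le_diff)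
      also have "\<dots> = (\<Sum>i\<le>n. \<Sum>j\<le>n - i. tscale (c j) (cf F i (X (n - i - j))))"
        by (intro sum.cong refl) (subst lin_sum[OF arr_lin[OF F(1)]], auto simp: X lin_scale[OF arr_lin[OF F(1)]])
      also have "\<dots> = (\<Sum>j\<le>n. \<Sum>i\<le>n - j. tscale (c j) (cf F i (X (n - i - j))))"
        by (rule sum_triangle_swap)
      also have "\<dots> = tact l c (act l F X) n"
        using True by (simp add: act_def tact_def enat_le_diff ts.scale_sum_right diff_diff_left add.commute)
      finally show ?thesis .
    qed (simp add: act_def tact_def)
  qed
  then show ?case using cX 2 F by (simp add: oper_act)
next
  case (3 _ X)
  then show ?case using act_tpoly[OF F(1)] F by (simp add: oper_act)
next
  case (4 d _ X)
  then have X: "X \<in> tpoly l (T B (src F))" "\<And>j. X j \<in> tgrade B p UNIV (d - int j)" using F by (auto simp: tpoly_grade_def)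
  have "act l F X n \<in> tgrade B q UNIV (d - int n)" for n
  proof (cases "enat n \<le> l")
    case True
    have "cf F i (X (n - i)) \<in> tgrade B q UNIV (d - int n)" if "i \<le> n" for i
      by (rule hlin_grade[OF _ X(2)[of "n - i"]]) (use arr_hlin[OF F(1), of i] F that in auto)
    then show ?thesis using True by (auto simp: act_def intro!: tgrade_sum)
  qed (simp add: act_def)
  then show ?case using act_tpoly[OF F(1) X(1)] F X by (simp add: oper_act tpoly_grade_def)
next
  case (5 X)
  then show ?case using F by (auto simp: oper_def restrict0_def zero_fun_def)
qed

lemma ser_oper:
  assumes F: "arr F" "src F = p" "tgt F = q" and v: "van l F"
  shows "ser p q (oper l F) = F"
proof -
  have "tcoeff (oper l F) n x = cf F n x" for n x
  proof (cases "x \<in> T B p")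
    case True
    then show ?thesis using F v by (simp add: tcoeff_def oper_act const_in_tpoly act_const van_def)
  next
    case False
    then show ?thesis using F by (simp add: tcoeff_def oper_def restrict0_def const_in_tpoly arr_outside poly_zero_apply)
  qed
  then have "tcoeff (oper l F) = cf F" by (intro ext[where f = "tcoeff _"] ext[where f = "tcoeff _ _"])
  then show ?thesis using F by (intro mor.expand) simp
qed

lemma oper_ser:
  assumes F: "F \<in> tHom B l p q"
  shows "oper l (ser p q F) = F"
proof (rule ext)
  fix X show "oper l (ser p q F) X = F X"
    using tHom_act[OF F, of X] F by (cases "X \<in> tpoly l (T B p)") (auto simp: oper_def restrict0_def tHom_def)
qed

text \<open>Agreement on polynomials only: maps such as \<open>id\<close> and
  \<open>eps_t B\<close>, which occur in the axioms, do not vanish elsewhere and so are not of the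
  form \<open>oper l F\<close>.\<close>

definition rep where "rep l f F \<longleftrightarrow> arr F \<and> (\<forall>X\<in>tpoly l (T B (src F)). f X = act l F X)"

lemma rep_tHom: "F \<in> tHom B l p q \<Longrightarrow> rep l F (ser p q F)"
  using tHom_act ser_arr by (simp add: rep_def)

lemma rep_oper: "arr F \<Longrightarrow> rep l (oper l F) F"
  by (simp add: rep_def oper_act)

lemma rep_id: "rep l id (I p)"
  by (simp add: rep_def act_I)

lemma rep_eps: "rep l (eps_t B) ep"
proof -
  have "eps_t B X = act l ep X" if "X \<in> tpoly l (T B 1)" for X
  proof (rule ext)
    fix n show "eps_t B X n = act l ep X n"
      using tpolyD(1,2)[OF that, of n] lin_zero[OF hlin_lin[OF hlin_eps]]
      by (auto simp: eps_t_def act_order0 ep_def cf_ord0 hlin_eps order0_ord0)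
  qed
  then show ?thesis by (simp add: rep_def)
qed

lemma rep_tcoeff: "rep l f F \<Longrightarrow> enat i \<le> l \<Longrightarrow> y \<in> T B (src F) \<Longrightarrow> tcoeff f i y = cf F i y"
  by (simp add: rep_def tcoeff_def const_in_tpoly act_const)

lemma tmap_t_act:
  assumes f: "rep l f F" and g: "rep l g G" and p: "p = src F" and X: "X \<in> tpoly l (T B (src F + src G))"
  shows "tmap_t B l p f g X = act l (F \<otimes> G) X"
proof (rule ext)
  fix n show "tmap_t B l p f g X n = act l (F \<otimes> G) X n"
  proof (cases "enat n \<le> l")
    case True
    have "tmap s p (tcoeff f i) (tcoeff g j) (X k) = tm (src F) (src G) (cf F i) (cf G j) (X k)"
      if "i \<le> n" "j \<le> n" for i j k
    proof -
      have "tm (src F) (src G) (cf F i) (cf G j) = tm (src F) (src G) (tcoeff f i) (tcoeff g j)"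
        by (rule tm_cong) (use f g True that enat_le_mono in \<open>auto simp: rep_tcoeff\<close>)
      then show ?thesis using tpolyD(1)[OF X] p by (simp add: tm_tmap)
    qed
    then have "tmap_t B l p f g X n = (\<Sum>i\<le>n. \<Sum>j\<le>n - i. tm (src F) (src G) (cf F i) (cf G j) (X (n - i - j)))"
      using True by (simp add: tmap_t_def)
    also have "\<dots> = (\<Sum>i\<le>n. \<Sum>j\<le>i. tm (src F) (src G) (cf F j) (cf G (i - j)) (X (n - i)))"
      by (rule sum_triangle[of "\<lambda>i j k. tm (src F) (src G) (cf F i) (cf G j) (X k)", symmetric])
    also have "\<dots> = act l (F \<otimes> G) X n" using True by (simp add: act_def cf_ten)
    finally show ?thesis .
  qed (simp add: tmap_t_def act_def)
qed

lemma eql_refl [simp]: "eql l F F"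
  by (simp add: eql_def)

lemma van_eqlD:
  assumes "eql l F G" "van l F" "van l G"
  shows "F = G"
proof (rule mor.expand, intro conjI)
  show "cf F = cf G"
  proof (rule ext[where f = "cf F"])
    fix n show "cf F n = cf G n"
      using assms by (cases "enat n \<le> l") (simp_all add: eql_def van_def)
  qed
qed (use assms in \<open>simp_all add: eql_def\<close>)

lemma van_order0: "order0 F \<Longrightarrow> van l F"
  unfolding van_def
proof (intro allI impI)
  fix n assume "order0 F" "\<not> enat n \<le> l"
  then show "cf F n = (\<lambda>x. 0)" by (cases "n = 0") (simp_all add: order0_def)
qed

lemma van_comp_order0:
  assumes "van l F" "arr F" "order0 G" shows "van l (F \<cdot> G)" "van l (G \<cdot> F)"
proof -
  have "cf (F \<cdot> G) n = (\<lambda>x. 0)" "cf (G \<cdot> F) n = (\<lambda>x. 0)" if "\<not> enat n \<le> l" for n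
  proof -
    have "arr G" using assms by (simp add: order0_def)
    then show "cf (F \<cdot> G) n = (\<lambda>x. 0)" "cf (G \<cdot> F) n = (\<lambda>x. 0)"
      using assms that by (auto simp: cf_comp_order0 cf_order0_comp van_def intro: ext[where f = "cf (F \<cdot> G) n"] ext[where f = "cf (G \<cdot> F) n"])
  qed
  then show "van l (F \<cdot> G)" "van l (G \<cdot> F)" by (simp_all add: van_def)
qed

lemma mid_swap_tens: "mid_swap B x = cf ms 0 x" if "x \<in> T B 4"
  unfolding mid_swap_def
  by (rule tlift_cong_tens[OF lin_cf0 _ that]) (auto simp: length4_conv eval_tens)

lemma one_t_tpoly: "one_t B \<in> tpoly l (T B 1)"
  by (simp add: one_t_def const_in_tpoly One_nat_def)

lemma one_t_act: "one_t B = act l eta (const (tens s []))"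
proof (rule ext)
  fix n
  have "act l eta (const (tens s [])) n = (if enat n \<le> l then cf eta n (tens s []) else 0)"
    by (simp add: act_const)
  moreover have "cf eta n (tens s []) = (if n = 0 then tens s [1] else 0)"
    using order0_structure_maps(1) by (auto simp: order0_def structure_maps_tens)
  ultimately show "one_t B n = act l eta (const (tens s [])) n"
    by (auto simp: one_t_def const_def)
qed

lemma unit_act:
  assumes X: "X \<in> tpoly l (T B 1)"
  shows "tprod_t B l (one_t B) X = act l (eta \<otimes> I 1) X" "tprod_t B l X (one_t B) = act l (I 1 \<otimes> eta) X"
proof -
  have x: "X n \<in> T B 1" for n by (rule tpolyD(1)[OF X])
  have e: "arr (eta \<otimes> I 1)" "arr (I 1 \<otimes> eta)" by simp_all
  have t: "cf (eta \<otimes> I 1) 0 y = tprod s (tens s [1]) y" "cf (I 1 \<otimes> eta) 0 y = tprod s y (tens s [1])" if "y \<in> T B 1" for y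
  proof -
    have "tm 0 1 (cf eta 0) (cf (I 1) 0) (tprod s (tens s []) y) = tprod s (cf eta 0 (tens s [])) (cf (I 1) 0 y)"
      by (rule tm_tprod[OF lin_cf0 lin_cf0]) (simp_all add: that)
    then show "cf (eta \<otimes> I 1) 0 y = tprod s (tens s [1]) y"
      using that by (simp add: cf0_ten structure_maps_tens cf0_I tprod_nil_left[of y s 1])
    have "tm 1 0 (cf (I 1) 0) (cf eta 0) (tprod s y (tens s [])) = tprod s (cf (I 1) 0 y) (cf eta 0 (tens s []))"
      by (rule tm_tprod[OF lin_cf0 lin_cf0]) (simp_all add: that)
    then show "cf (I 1 \<otimes> eta) 0 y = tprod s y (tens s [1])"
      using that by (simp add: cf0_ten structure_maps_tens cf0_I tprod_nil_right[of y s 1])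
  qed
  have 1: "(\<Sum>i\<le>n. tprod s (one_t B i) (X (n - i))) = tprod s (tens s [1]) (X n)" for n
    by (subst sum_only_first) (auto simp: one_t_def const_def)
  have 2: "(\<Sum>i\<le>n. tprod s (X i) (one_t B (n - i))) = tprod s (X n) (tens s [1])" for n
    by (subst sum_only_last) (auto simp: one_t_def const_def tprod_zero_right[OF x])
  show "tprod_t B l (one_t B) X = act l (eta \<otimes> I 1) X"
    by (rule ext) (simp add: tprod_t_def 1 act_order0 t x)
  show "tprod_t B l X (one_t B) = act l (I 1 \<otimes> eta) X"
    by (rule ext) (simp add: tprod_t_def 2 act_order0 t x)
qed

text \<open>The tensor power of order 0 is spanned by \<open>tens s []\<close>, so one value
  determines an arrow out of it. This translates axioms about the element 1 into equations between
  arrows.\<close>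

lemma act_scalar_iff:
  assumes "arr F" "arr G" "src F = 0" "src G = 0" "tgt F = tgt G"
  shows "act l F (const (tens s [])) = act l G (const (tens s [])) \<longleftrightarrow> eql l F G"
proof
  assume a: "act l F (const (tens s [])) = act l G (const (tens s []))"
  have "cf F n = cf G n" if n: "enat n \<le> l" for n
  proof (rule ext[where f = "cf F n"])
    fix x show "cf F n x = cf G n x"
    proof (cases "x \<in> T B 0")
      case True
      show ?thesis
      proof (rule lin_eqI[OF _ _ _ True])
        show "lin s 0 (tgt F) (cf F n)" "lin s 0 (tgt F) (cf G n)"
          using assms by (simp_all add: arr_lin')
        fix bs :: "'b list" assume "length bs = 0"
        then show "cf F n (tens s bs) = cf G n (tens s bs)"
          using fun_cong[OF a, of n] n assms by (simp add: act_const)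
      qed
    qed (use assms in \<open>simp add: arr_outside\<close>)
  qed
  then show "eql l F G" using assms by (simp add: eql_def)
next
  assume "eql l F G"
  then show "act l F (const (tens s [])) = act l G (const (tens s []))"
    using assms by (intro ext[where f = "act l F _"]) (auto simp: act_const eql_def)
qed

lemma eps_one: "eps_t B (one_t B) = const (tens s [])"
proof (rule ext)
  fix n show "eps_t B (one_t B) n = const (tens s []) n"
    using lin_zero[OF hlin_lin[OF hlin_eps]] by (auto simp: eps_t_def one_t_def const_def counit_one)
qed

section \<open>The axioms of a deformation as equations between series\<close>

lemma act_diagrams:
  assumes m: "rep l m M" and \<Delta>: "rep l \<Delta> D'" and sh: "shape M D'"
  shows "X \<in> tpoly l (T B 3) \<Longrightarrow> m (tmap_t B l 2 m id X) = act l (assL M) X"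
    and "X \<in> tpoly l (T B 3) \<Longrightarrow> m (tmap_t B l 1 id m X) = act l (assR M) X"
    and "X \<in> tpoly l (T B 1) \<Longrightarrow> m (tprod_t B l (one_t B) X) = act l (M \<cdot> (eta \<otimes> I 1)) X"
    and "X \<in> tpoly l (T B 1) \<Longrightarrow> m (tprod_t B l X (one_t B)) = act l (M \<cdot> (I 1 \<otimes> eta)) X"
    and "X \<in> tpoly l (T B 1) \<Longrightarrow> tmap_t B l 1 \<Delta> id (\<Delta> X) = act l (coaL D') X"
    and "X \<in> tpoly l (T B 1) \<Longrightarrow> tmap_t B l 1 id \<Delta> (\<Delta> X) = act l (coaR D') X"
    and "X \<in> tpoly l (T B 1) \<Longrightarrow> tmap_t B l 1 (eps_t B) id (\<Delta> X) = act l ((ep \<otimes> I 1) \<cdot> D') X"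
    and "X \<in> tpoly l (T B 1) \<Longrightarrow> tmap_t B l 1 id (eps_t B) (\<Delta> X) = act l ((I 1 \<otimes> ep) \<cdot> D') X"
    and "X \<in> tpoly l (T B 2) \<Longrightarrow> \<Delta> (m X) = act l (D' \<cdot> M) X"
    and "X \<in> tpoly l (T B 2) \<Longrightarrow> tmap_t B l 2 m m (\<lambda>n. mid_swap B (tmap_t B l 1 \<Delta> \<Delta> X n)) = act l (cmp M D') X"
    and "\<Delta> (one_t B) = act l (D' \<cdot> eta) (const (tens s []))"
    and "tprod_t B l (one_t B) (one_t B) = act l (eta \<otimes> eta) (const (tens s []))"
    and "X \<in> tpoly l (T B 2) \<Longrightarrow> eps_t B (m X) = act l (ep \<cdot> M) X"
    and "X \<in> tpoly l (T B 2) \<Longrightarrow> tmap_t B l 1 (eps_t B) (eps_t B) X = act l (ep \<otimes> ep) X"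
proof -
  note [simp] = shapes[OF sh]
  have mX: "m X = act l M X" if "X \<in> tpoly l (T B 2)" for X using m that by (simp add: rep_def)
  have dX: "\<Delta> X = act l D' X" if "X \<in> tpoly l (T B 1)" for X using \<Delta> that by (simp add: rep_def)
  have eX: "eps_t B X = act l ep X" if "X \<in> tpoly l (T B 1)" for X using rep_eps that by (simp add: rep_def)
  note tp = act_tpoly
  show "m (tmap_t B l 2 m id X) = act l (assL M) X" "m (tmap_t B l 1 id m X) = act l (assR M) X" if "X \<in> tpoly l (T B 3)"
    using that by (simp_all add: tmap_t_act[OF m rep_id[of l 1]] tmap_t_act[OF rep_id[of l 1] m] mX act_tpoly
      assL_def assR_def act_comp)
  show "m (tprod_t B l (one_t B) X) = act l (M \<cdot> (eta \<otimes> I 1)) X" "m (tprod_t B l X (one_t B)) = act l (M \<cdot> (I 1 \<otimes> eta)) X"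
    if "X \<in> tpoly l (T B 1)"
    using that by (simp_all add: unit_act mX act_tpoly act_comp)
  show "tmap_t B l 1 \<Delta> id (\<Delta> X) = act l (coaL D') X" "tmap_t B l 1 id \<Delta> (\<Delta> X) = act l (coaR D') X"
    "tmap_t B l 1 (eps_t B) id (\<Delta> X) = act l ((ep \<otimes> I 1) \<cdot> D') X"
    "tmap_t B l 1 id (eps_t B) (\<Delta> X) = act l ((I 1 \<otimes> ep) \<cdot> D') X"
    if "X \<in> tpoly l (T B 1)"
    using that by (simp_all add: dX act_tpoly tmap_t_act[OF \<Delta> rep_id[of l 1]] tmap_t_act[OF rep_id[of l 1] \<Delta>]
      tmap_t_act[OF rep_eps rep_id[of l 1]] tmap_t_act[OF rep_id[of l 1] rep_eps] coaL_def coaR_def act_comp)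
  show "\<Delta> (m X) = act l (D' \<cdot> M) X" if "X \<in> tpoly l (T B 2)"
    using that by (simp add: mX dX act_tpoly act_comp)
  show "tmap_t B l 2 m m (\<lambda>n. mid_swap B (tmap_t B l 1 \<Delta> \<Delta> X n)) = act l (cmp M D') X" if X: "X \<in> tpoly l (T B 2)"
  proof -
    have 1: "tmap_t B l 1 \<Delta> \<Delta> X = act l (D' \<otimes> D') X" using X by (simp add: tmap_t_act[OF \<Delta> \<Delta>])
    have 2: "act l (D' \<otimes> D') X \<in> tpoly l (T B 4)" using X by (simp add: act_tpoly)
    have 3: "(\<lambda>n. mid_swap B (act l (D' \<otimes> D') X n)) = act l ms (act l (D' \<otimes> D') X)"
    proof (rule ext)
      fix n
      show "mid_swap B (act l (D' \<otimes> D') X n) = act l ms (act l (D' \<otimes> D') X) n"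
        using tpolyD(1,2)[OF 2, of n] arr_zero[of ms 0] by (simp add: mid_swap_tens act_order0)
    qed
    show ?thesis
      unfolding 1 3 using 2 X by (simp add: tmap_t_act[OF m m] act_tpoly cmp_def mul2_def act_comp)
  qed
  have c: "const (tens s []) \<in> tpoly l (T B 0)" by (simp add: const_in_tpoly)
  show "\<Delta> (one_t B) = act l (D' \<cdot> eta) (const (tens s []))"
    using c by (simp add: dX[OF one_t_tpoly] act_comp one_t_act[of l, symmetric])
  have "eta \<otimes> eta = (eta \<otimes> I 1) \<cdot> eta" using interchange[of eta "I 1" "I 0" eta] by simp
  then show "tprod_t B l (one_t B) (one_t B) = act l (eta \<otimes> eta) (const (tens s []))"
    using c by (simp add: unit_act[OF one_t_tpoly] act_comp one_t_act[of l, symmetric])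
  show "eps_t B (m X) = act l (ep \<cdot> M) X" "tmap_t B l 1 (eps_t B) (eps_t B) X = act l (ep \<otimes> ep) X" if "X \<in> tpoly l (T B 2)"
    using that by (simp_all add: mX eX act_tpoly act_comp tmap_t_act[OF rep_eps rep_eps])
qed

lemma act_I_iff:
  assumes "arr F" "src F = p" "tgt F = p"
  shows "(\<forall>X\<in>tpoly l (T B p). act l F X = X) \<longleftrightarrow> eql l F (I p)"
  using act_eq_iff[of F "I p" p l] assms by (simp add: act_I)

lemma bialgebra_t_iff:
  assumes m: "rep l m M" and \<Delta>: "rep l \<Delta> D'" and sh: "shape M D'"
  shows "bialgebra_t B l m \<Delta> \<longleftrightarrow> eql l (assL M) (assR M) \<and> eql l (M \<cdot> (eta \<otimes> I 1)) (I 1) \<and> eql l (M \<cdot> (I 1 \<otimes> eta)) (I 1) \<and>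
    eql l (coaL D') (coaR D') \<and> eql l ((ep \<otimes> I 1) \<cdot> D') (I 1) \<and> eql l ((I 1 \<otimes> ep) \<cdot> D') (I 1) \<and>
    eql l (D' \<cdot> M) (cmp M D') \<and> eql l (D' \<cdot> eta) (eta \<otimes> eta) \<and> eql l (ep \<cdot> M) (ep \<otimes> ep)"
proof -
  note [simp] = shapes[OF sh] composites[OF sh]
  have e: "(\<forall>X\<in>tpoly l (T B 3). act l (assL M) X = act l (assR M) X) \<longleftrightarrow> eql l (assL M) (assR M)"
    "(\<forall>X\<in>tpoly l (T B 1). act l (M \<cdot> (eta \<otimes> I 1)) X = X) \<longleftrightarrow> eql l (M \<cdot> (eta \<otimes> I 1)) (I 1)"
    "(\<forall>X\<in>tpoly l (T B 1). act l (M \<cdot> (I 1 \<otimes> eta)) X = X) \<longleftrightarrow> eql l (M \<cdot> (I 1 \<otimes> eta)) (I 1)"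
    "(\<forall>X\<in>tpoly l (T B 1). act l (coaL D') X = act l (coaR D') X) \<longleftrightarrow> eql l (coaL D') (coaR D')"
    "(\<forall>X\<in>tpoly l (T B 1). act l ((ep \<otimes> I 1) \<cdot> D') X = X) \<longleftrightarrow> eql l ((ep \<otimes> I 1) \<cdot> D') (I 1)"
    "(\<forall>X\<in>tpoly l (T B 1). act l ((I 1 \<otimes> ep) \<cdot> D') X = X) \<longleftrightarrow> eql l ((I 1 \<otimes> ep) \<cdot> D') (I 1)"
    "(\<forall>X\<in>tpoly l (T B 2). act l (D' \<cdot> M) X = act l (cmp M D') X) \<longleftrightarrow> eql l (D' \<cdot> M) (cmp M D')"
    "act l (D' \<cdot> eta) (const (tens s [])) = act l (eta \<otimes> eta) (const (tens s [])) \<longleftrightarrow> eql l (D' \<cdot> eta) (eta \<otimes> eta)"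
    "(\<forall>X\<in>tpoly l (T B 2). act l (ep \<cdot> M) X = act l (ep \<otimes> ep) X) \<longleftrightarrow> eql l (ep \<cdot> M) (ep \<otimes> ep)"
    by (rule act_eq_iff act_I_iff act_scalar_iff; simp)+
  show ?thesis
    unfolding bialgebra_t_def ball_conj_distrib e[symmetric]
    by (simp add: act_diagrams[OF assms] eps_one cong: ball_cong)
qed

definition defm where
  "defm l m d \<longleftrightarrow> unital m d \<and> van l m \<and> van l d \<and>
    eql l (assL m) (assR m) \<and> eql l (d \<cdot> m) (cmp m d) \<and> eql l (coaR d) (coaL d)"

lemma eql_sym: "eql l F G \<Longrightarrow> eql l G F"
  by (simp add: eql_def)

lemma act_at_0: "act l F X 0 = cf F 0 (X 0)"
  by (simp add: act_def)

text \<open>Each of these equations has a single deformed operation, composed with constant arrows,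
  so both sides vanish above l and agreement up to l is equality. The other axioms multiply deformed
  coefficients and may fail above l.\<close>

lemma unital_of_eql:
  assumes sh: "shape M D'" and v: "van l M" "van l D'" and c: "cf M 0 = cf mult0 0" "cf D' 0 = cf comult0 0"
    and e: "eql l (M \<cdot> (eta \<otimes> I 1)) (I 1)" "eql l (M \<cdot> (I 1 \<otimes> eta)) (I 1)" "eql l ((ep \<otimes> I 1) \<cdot> D') (I 1)"
      "eql l ((I 1 \<otimes> ep) \<cdot> D') (I 1)" "eql l (D' \<cdot> eta) (eta \<otimes> eta)" "eql l (ep \<cdot> M) (ep \<otimes> ep)"
  shows "unital M D'"
proof -
  note [simp] = shapes[OF sh]
  note vM = van_comp_order0[OF v(1) shapes(1)[OF sh]] and vD = van_comp_order0[OF v(2) shapes(4)[OF sh]]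
  have "M \<cdot> (eta \<otimes> I 1) = I 1" by (rule van_eqlD[OF e(1) vM(1) van_order0]) simp_all
  moreover have "M \<cdot> (I 1 \<otimes> eta) = I 1" by (rule van_eqlD[OF e(2) vM(1) van_order0]) simp_all
  moreover have "(ep \<otimes> I 1) \<cdot> D' = I 1" by (rule van_eqlD[OF e(3) vD(2) van_order0]) simp_all
  moreover have "(I 1 \<otimes> ep) \<cdot> D' = I 1" by (rule van_eqlD[OF e(4) vD(2) van_order0]) simp_all
  moreover have "D' \<cdot> eta = eta \<otimes> eta" by (rule van_eqlD[OF e(5) vD(1) van_order0]) simp_all
  moreover have "ep \<cdot> M = ep \<otimes> ep" by (rule van_eqlD[OF e(6) vM(2) van_order0]) simp_all
  moreover have "eqv 1 M mult0" "eqv 1 D' comult0" using c by (simp_all add: eqv_def)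
  ultimately show ?thesis unfolding unital_def using sh by blast
qed

lemma deformations_parts:
  assumes a: "(m, \<Delta>) \<in> deformations B l"
  shows "m \<in> tHom B l 2 1" "\<Delta> \<in> tHom B l 1 2" "bialgebra_t B l m \<Delta>"
    "X \<in> tpoly l (T B 2) \<Longrightarrow> m X 0 = mu B 1 (X 0)" "X \<in> tpoly l (T B 1) \<Longrightarrow> \<Delta> X 0 = delta B 1 (X 0)"
  using a unfolding deformations_def mem_Collect_eq prod.case by blast+

lemma deformations_cf0:
  assumes a: "(m, \<Delta>) \<in> deformations B l"
  shows "cf (ser 2 1 m) 0 = cf mult0 0" "cf (ser 1 2 \<Delta>) 0 = cf comult0 0"
proof -
  note p = deformations_parts[OF a]
  show "cf (ser 2 1 m) 0 = cf mult0 0"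
  proof (rule ext[where f = "cf (ser 2 1 m) 0"])
    fix x show "cf (ser 2 1 m) 0 x = cf mult0 0 x"
    proof (cases "x \<in> T B 2")
      case True
      then have "m (const x) 0 = mu B 1 (const x 0)" by (intro p(4)) (simp add: const_in_tpoly)
      then show ?thesis using True by (simp add: tcoeff_def mult0_def cf_ord0) (simp add: const_def)
    next
      case False
      then show ?thesis
        using arr_outside[OF ser_arr(1)[OF p(1)], of x 0] arr_outside[of mult0 x 0] by simp
    qed
  qed
  show "cf (ser 1 2 \<Delta>) 0 = cf comult0 0"
  proof (rule ext[where f = "cf (ser 1 2 \<Delta>) 0"])
    fix x show "cf (ser 1 2 \<Delta>) 0 x = cf comult0 0 x"
    proof (cases "x \<in> T B 1")
      case True
      then have "\<Delta> (const x) 0 = delta B 1 (const x 0)" by (intro p(5)) (simp add: const_in_tpoly)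
      then show ?thesis using True by (simp add: tcoeff_def comult0_def cf_ord0) (simp add: const_def)
    next
      case False
      then show ?thesis
        using arr_outside[OF ser_arr(1)[OF p(2)], of x 0] arr_outside[of comult0 x 0] by simp
    qed
  qed
qed

lemma deformations_defm:
  assumes a: "(m, \<Delta>) \<in> deformations B l"
  shows "defm l (ser 2 1 m) (ser 1 2 \<Delta>)"
proof -
  note p = deformations_parts[OF a]
  have sh: "shape (ser 2 1 m) (ser 1 2 \<Delta>)"
    unfolding shape_def ser_simps using ser_arr(1)[OF p(1)] ser_arr(1)[OF p(2)] by blast
  note v = ser_arr(2)[OF p(1)] ser_arr(2)[OF p(2)]
  note eqs = iffD1[OF bialgebra_t_iff[OF rep_tHom[OF p(1)] rep_tHom[OF p(2)] sh] p(3)]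
  have "unital (ser 2 1 m) (ser 1 2 \<Delta>)"
    using eqs by (elim conjE) (rule unital_of_eql[OF sh v deformations_cf0[OF a]]; assumption)
  then show ?thesis unfolding defm_def using v eqs eql_sym by blast
qed

lemma deformations_iff:
  "(m, \<Delta>) \<in> deformations B l \<longleftrightarrow> (\<exists>M D'. defm l M D' \<and> m = oper l M \<and> \<Delta> = oper l D')"
proof
  assume a: "(m, \<Delta>) \<in> deformations B l"
  have "m = oper l (ser 2 1 m)" "\<Delta> = oper l (ser 1 2 \<Delta>)"
    using oper_ser deformations_parts(1,2)[OF a] by simp_all
  then show "\<exists>M D'. defm l M D' \<and> m = oper l M \<and> \<Delta> = oper l D'" using deformations_defm[OF a] by blast
next
  assume "\<exists>M D'. defm l M D' \<and> m = oper l M \<and> \<Delta> = oper l D'"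
  then obtain M D' where df: "defm l M D'" and e: "m = oper l M" "\<Delta> = oper l D'" by blast
  then have u: "unital M D'" by (simp add: defm_def)
  note sh = u_shape[OF u]
  note [simp] = shapes[OF sh]
  have "bialgebra_t B l (oper l M) (oper l D')"
    unfolding bialgebra_t_iff[OF rep_oper[OF shapes(1)[OF sh]] rep_oper[OF shapes(4)[OF sh]] sh]
    using df eql_sym u_unit[OF u] u_counit[OF u] by (simp add: defm_def)
  moreover have "oper l M X 0 = mu B 1 (X 0)" if "X \<in> tpoly l (T B 2)" for X
    using that tpolyD(1)[OF that, of 0] by (simp add: oper_act act_at_0 u_cf0(1)[OF u] mu_eq(1))
  moreover have "oper l D' X 0 = delta B 1 (X 0)" if "X \<in> tpoly l (T B 1)" for X
    using that tpolyD(1)[OF that, of 0] by (simp add: oper_act act_at_0 u_cf0(2)[OF u] delta_eq(1))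
  ultimately show "(m, \<Delta>) \<in> deformations B l"
    unfolding e deformations_def by (simp add: oper_tHom)
qed

end

text \<open>Coefficients of the left inverse of a series with constant coefficient the identity.\<close>

fun linv :: "(nat \<Rightarrow> 'a \<Rightarrow> 'a) \<Rightarrow> nat \<Rightarrow> 'a \<Rightarrow> 'a::ab_group_add" where
  "linv c 0 x = c 0 x"
| "linv c (Suc n) x = - (\<Sum>i\<le>n. linv c i (c (Suc n - i) x))"

context graded_bialgebra
begin

lemma left_inverse:
  assumes F: "arr F" "src F = p" "tgt F = p" "cf F 0 = cf (I p) 0"
  obtains G where "arr G" "src G = p" "tgt G = p" "cf G 0 = cf (I p) 0" "G \<cdot> F = I p"
proof -
  let ?g = "linv (cf F)"
  have h: "hlin p p (- int n) (?g n) \<and> (\<forall>x. x \<notin> T B p \<longrightarrow> ?g n x = 0)" for n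
  proof (induction n rule: less_induct)
    case (less n)
    show ?case
    proof (cases n)
      case 0
      have "?g 0 = cf F 0" by (rule ext[where f = "?g 0"]) simp
      then show ?thesis
        using arr_hlin[OF F(1), of 0] arr_outside[OF F(1), of _ 0] unfolding F(2,3) 0 by simp
    next
      case (Suc k)
      have e: "?g (Suc k) = (\<lambda>x. 0 - (\<Sum>i\<le>k. ?g i (cf F (Suc k - i) x)))"
        by (rule ext[where f = "?g (Suc k)"]) simp
      have "hlin p p (- int n) (\<lambda>x. ?g i (cf F (Suc k - i) x))" if "i \<le> k" for i
        by (rule hlin_comp[of p p "- int (Suc k - i)" "cf F (Suc k - i)" p "- int i" "?g i"])
          (use arr_hlin[OF F(1), of "Suc k - i"] F less[of i] that Suc in auto)
      then have "hlin p p (- int (Suc k)) (?g (Suc k))"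
        unfolding e Suc by (intro hlin_minus hlin_zero hlin_summed) auto
      moreover have "?g (Suc k) x = 0" if "x \<notin> T B p" for x
      proof -
        have "?g i 0 = 0" if "i \<le> k" for i using less[of i] that Suc lin_zero[OF hlin_lin] by auto
        then show ?thesis using that F arr_outside[OF F(1), of x] by simp
      qed
      ultimately show ?thesis unfolding Suc by blast
    qed
  qed
  let ?G = "Mor p p ?g"
  have G: "arr ?G" using h by (simp add: arr_def)
  have 0: "cf ?G 0 = cf (I p) 0" using F(4) by (intro ext[where f = "cf ?G 0"]) simp
  have "?G \<cdot> F = I p"
  proof (rule mor_eqI)
    fix n x assume "x \<in> T B (src (I p))"
    then have x: "x \<in> T B p" by simp
    show "cf (?G \<cdot> F) n x = cf (I p) n x"
    proof (cases n)
      case 0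
      then show ?thesis using F(4) x by (simp add: cf_comp cf0_I)
    next
      case (Suc k)
      have "cf (?G \<cdot> F) n x = (\<Sum>i\<le>k. ?g i (cf F (Suc k - i) x)) + ?g (Suc k) (cf F 0 x)"
        using Suc by (simp add: cf_comp)
      also have "cf F 0 x = x" using F(4) x by (simp add: cf0_I)
      finally show ?thesis using Suc by (simp add: cf_I)
    qed
  qed (use F G in auto)
  then show thesis using that[OF G _ _ 0] by simp
qed

text \<open>A left inverse again has the identity as constant coefficient and so has a left inverse
  H of its own. Associativity gives H = F; hence the first left inverse is two-sided.\<close>

lemma bij_oper:
  assumes F: "arr F" "src F = p" "tgt F = p" "cf F 0 = cf (I p) 0"
  shows "bij_betw (oper l F) (tpoly l (T B p)) (tpoly l (T B p))"
proof -
  obtain G where G: "arr G" "src G = p" "tgt G = p" "cf G 0 = cf (I p) 0" "G \<cdot> F = I p"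
    using left_inverse[OF F] .
  obtain H where H: "arr H" "src H = p" "tgt H = p" "cf H 0 = cf (I p) 0" "H \<cdot> G = I p"
    using left_inverse[OF G(1-4)] .
  have "H = H \<cdot> G \<cdot> F" using G H by simp
  also have "\<dots> = (H \<cdot> G) \<cdot> F" by (rule comp_assoc[symmetric]) (use F G H in simp_all)
  also have "\<dots> = F" using F H by simp
  finally have FG: "F \<cdot> G = I p" using H by simp
  show ?thesis
  proof (rule bij_betw_byWitness[where f' = "act l G"])
    show "oper l F ` tpoly l (T B p) \<subseteq> tpoly l (T B p)"
      using F by (auto simp: oper_act act_tpoly)
    show "act l G ` tpoly l (T B p) \<subseteq> tpoly l (T B p)"
      using G by (auto simp: act_tpoly)
    show "\<forall>X\<in>tpoly l (T B p). act l G (oper l F X) = X"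
      using act_comp[of G F _ l] F G by (auto simp: oper_act act_I)
    show "\<forall>X\<in>tpoly l (T B p). oper l F (act l G X) = X"
      using act_comp[of F G _ l] F G FG by (auto simp: oper_act act_I act_tpoly)
  qed
qed

section \<open>Isomorphisms of deformations as series\<close>

lemma iso_oper:
  assumes u: "unital M D'" and u': "unital M' D''" and tw: "twist F"
    and e: "eql l (F \<cdot> M) (M' \<cdot> (F \<otimes> F))" "eql l ((F \<otimes> F) \<cdot> D') (D'' \<cdot> F)"
  shows "deformation_iso B l (oper l M, oper l D') (oper l M', oper l D'') (oper l F)"
proof -
  have F [simp]: "arr F" "src F = 1" "tgt F = 1" "F \<cdot> eta = eta" "ep \<cdot> F = ep" and F0: "cf F 0 = cf (I 1) 0"
    using tw by (auto simp: twist_def eqv_def)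
  note [simp] = shapes[OF u_shape[OF u]] shapes[OF u_shape[OF u']]
  have c: "const (tens s []) \<in> tpoly l (T B 0)" by (simp add: const_in_tpoly)
  have 1: "oper l F (oper l M X) = oper l M' (tmap_t B l 1 (oper l F) (oper l F) X)" if X: "X \<in> tpoly l (T B 2)" for X
  proof -
    have "oper l F (oper l M X) = act l (F \<cdot> M) X" using X by (simp add: oper_act act_tpoly act_comp)
    also have "\<dots> = act l (M' \<cdot> (F \<otimes> F)) X"
      using e(1) act_eq_iff[of "F \<cdot> M" "M' \<cdot> (F \<otimes> F)" 2 l] X by simp
    finally show ?thesis using X by (simp add: tmap_t_act[OF rep_oper rep_oper] oper_act act_tpoly act_comp)
  qed
  have 2: "tmap_t B l 1 (oper l F) (oper l F) (oper l D' X) = oper l D'' (oper l F X)" if X: "X \<in> tpoly l (T B 1)" for X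
  proof -
    have "tmap_t B l 1 (oper l F) (oper l F) (oper l D' X) = act l ((F \<otimes> F) \<cdot> D') X"
      using X by (simp add: tmap_t_act[OF rep_oper rep_oper] oper_act act_tpoly act_comp)
    also have "\<dots> = act l (D'' \<cdot> F) X"
      using e(2) act_eq_iff[of "(F \<otimes> F) \<cdot> D'" "D'' \<cdot> F" 1 l] X by simp
    finally show ?thesis using X by (simp add: oper_act act_tpoly act_comp)
  qed
  have 3: "oper l F (one_t B) = one_t B"
    using c act_comp[of F eta "const (tens s [])" l] by (simp add: oper_act one_t_tpoly one_t_act[of l, symmetric])
  have 4: "eps_t B (oper l F X) = eps_t B X" if X: "X \<in> tpoly l (T B 1)" for X
    using X act_comp[of ep F X l] rep_eps[of l] act_tpoly[of F X l 1] by (simp add: rep_def oper_act)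
  have 5: "oper l F X 0 = X 0" if X: "X \<in> tpoly l (T B 1)" for X
    using X tpolyD(1)[OF X, of 0] by (simp add: oper_act act_at_0 F0 cf0_I)
  show ?thesis
    unfolding deformation_iso_def using 1 2 3 4 5 bij_oper[OF F(1-3) F0] oper_tHom[OF F(1-3)] by simp
qed

text \<open>F consists of the coefficients of \<phi>. It vanishes above l, and unit and counit are
  constant in t, so \<phi> preserving them up to l becomes an exact equation, as
  \<open>twist\<close> requires.\<close>

lemma iso_series:
  assumes u: "unital M D'" and u': "unital M' D''"
    and iso: "deformation_iso B l (oper l M, oper l D') (oper l M', oper l D'') \<phi>"
  obtains F where "twist F" "van l F" "eql l (F \<cdot> M) (M' \<cdot> (F \<otimes> F))" "eql l ((F \<otimes> F) \<cdot> D') (D'' \<cdot> F)"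
proof -
  let ?F = "ser 1 1 \<phi>"
  have h: "\<phi> \<in> tHom B l 1 1" using iso by (simp add: deformation_iso_def)
  note r = rep_tHom[OF h]
  have F [simp]: "arr ?F" and v: "van l ?F" using ser_arr[OF h] by auto
  note [simp] = shapes[OF u_shape[OF u]] shapes[OF u_shape[OF u']]
  have p: "\<phi> X = act l ?F X" if "X \<in> tpoly l (T B 1)" for X using tHom_act[OF h that] .
  have c: "const (tens s []) \<in> tpoly l (T B 0)" by (simp add: const_in_tpoly)
  have "\<forall>X\<in>tpoly l (T B 2). act l (?F \<cdot> M) X = act l (M' \<cdot> (?F \<otimes> ?F)) X"
  proof
    fix X assume X: "X \<in> tpoly l (T B 2)"
    then have "\<phi> (oper l M X) = oper l M' (tmap_t B l 1 \<phi> \<phi> X)" using iso by (simp add: deformation_iso_def)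
    then show "act l (?F \<cdot> M) X = act l (M' \<cdot> (?F \<otimes> ?F)) X"
      using X by (simp add: p tmap_t_act[OF r r] oper_act act_tpoly act_comp del: ser_simps(3))
  qed
  then have 1: "eql l (?F \<cdot> M) (M' \<cdot> (?F \<otimes> ?F))" by (subst (asm) act_eq_iff) simp_all
  have "\<forall>X\<in>tpoly l (T B 1). act l ((?F \<otimes> ?F) \<cdot> D') X = act l (D'' \<cdot> ?F) X"
  proof
    fix X assume X: "X \<in> tpoly l (T B 1)"
    then have "tmap_t B l 1 \<phi> \<phi> (oper l D' X) = oper l D'' (\<phi> X)" using iso by (simp add: deformation_iso_def)
    then show "act l ((?F \<otimes> ?F) \<cdot> D') X = act l (D'' \<cdot> ?F) X"
      using X by (simp add: p tmap_t_act[OF r r] oper_act act_tpoly act_comp)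
  qed
  then have 2: "eql l ((?F \<otimes> ?F) \<cdot> D') (D'' \<cdot> ?F)" by (subst (asm) act_eq_iff) simp_all
  have "act l (?F \<cdot> eta) (const (tens s [])) = act l eta (const (tens s []))"
  proof -
    have "act l ?F (act l eta (const (tens s []))) = act l eta (const (tens s []))"
      using iso p[OF one_t_tpoly] unfolding one_t_act[of l, symmetric] by (simp add: deformation_iso_def)
    then show ?thesis using c by (simp add: act_comp)
  qed
  then have "eql l (?F \<cdot> eta) eta" by (subst (asm) act_scalar_iff) simp_all
  then have 3: "?F \<cdot> eta = eta"
    by (rule van_eqlD) (use van_comp_order0(1)[OF v F] van_order0 in simp_all)
  have "\<forall>X\<in>tpoly l (T B 1). act l (ep \<cdot> ?F) X = act l ep X"
  proof
    fix X assume X: "X \<in> tpoly l (T B 1)"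
    then have "eps_t B (\<phi> X) = eps_t B X" using iso by (simp add: deformation_iso_def)
    then show "act l (ep \<cdot> ?F) X = act l ep X"
      using X rep_eps[of l] act_tpoly[of ?F X l 1] by (simp add: p act_comp rep_def)
  qed
  then have "eql l (ep \<cdot> ?F) ep" by (subst (asm) act_eq_iff) simp_all
  then have 4: "ep \<cdot> ?F = ep"
    by (rule van_eqlD) (use van_comp_order0(2)[OF v F] van_order0 in simp_all)
  have "cf ?F 0 x = cf (I 1) 0 x" for x
  proof (cases "x \<in> T B 1")
    case True
    then have "\<phi> (const x) 0 = const x 0" using iso by (simp add: deformation_iso_def const_in_tpoly)
    then show ?thesis using True by (simp add: tcoeff_def cf0_I) (simp add: const_def)
  qed (use arr_outside[OF F] in \<open>simp add: cf_I\<close>)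
  then have "cf ?F 0 = cf (I 1) 0" by (intro ext[where f = "cf ?F 0"])
  then have "twist ?F" using 3 4 by (simp add: twist_def eqv_def)
  then show thesis using that v 1 2 by blast
qed

end

section \<open>Extensions and obstructions\<close>

text \<open>R is the relation pulled back from S along h, so it inherits from S whatever makes the
  classes correspond; in particular isomorphism is handled through cohomology alone. The bijection
  is the map induced by h.\<close>

lemma quotient_bij:
  assumes S: "equiv C S" and h: "\<And>x. x \<in> A \<Longrightarrow> h x \<in> C" and onto: "\<And>c. c \<in> C \<Longrightarrow> \<exists>x\<in>A. h x = c"
    and R: "R = {(x, y). x \<in> A \<and> y \<in> A \<and> (h x, h y) \<in> S}"
  shows "\<exists>\<Phi>. bij_betw \<Phi> (A // R) (C // S) \<and> (\<forall>x\<in>A. \<Phi> (R `` {x}) = S `` {h x})"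
proof -
  define \<Phi> where "\<Phi> = (\<lambda>X. \<Union>x\<in>X. S `` {h x})"
  have \<Phi>: "\<Phi> (R `` {x}) = S `` {h x}" if x: "x \<in> A" for x
  proof -
    have "x \<in> R `` {x}" using x h equiv_class_self[OF S h[OF x]] by (auto simp: R)
    moreover have "S `` {h y} = S `` {h x}" if "y \<in> R `` {x}" for y
      using that equiv_class_eq[OF S] by (auto simp: R)
    ultimately show ?thesis unfolding \<Phi>_def by blast
  qed
  have "inj_on \<Phi> (A // R)"
  proof (rule inj_onI)
    fix X Y assume "X \<in> A // R" "Y \<in> A // R" and e: "\<Phi> X = \<Phi> Y"
    then obtain x y where x: "x \<in> A" "X = R `` {x}" and y: "y \<in> A" "Y = R `` {y}"
      by (auto elim!: quotientE)
    have "S `` {h x} = S `` {h y}" using e \<Phi> x y by simp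
    then have "(h x, z) \<in> S \<longleftrightarrow> (h y, z) \<in> S" for z by blast
    then show "X = Y" using x y by (auto simp: R)
  qed
  moreover have "\<Phi> ` (A // R) = C // S"
  proof
    show "\<Phi> ` (A // R) \<subseteq> C // S"
    proof
      fix Z assume "Z \<in> \<Phi> ` (A // R)"
      then obtain x where "x \<in> A" "Z = \<Phi> (R `` {x})" by (auto elim: quotientE)
      then show "Z \<in> C // S" using \<Phi> quotientI[OF h] by simp
    qed
    show "C // S \<subseteq> \<Phi> ` (A // R)"
    proof
      fix Z assume "Z \<in> C // S"
      then obtain c where c: "c \<in> C" "Z = S `` {c}" by (auto elim: quotientE)
      then obtain x where "x \<in> A" "h x = c" using onto by blast
      then show "Z \<in> \<Phi> ` (A // R)" using \<Phi> c by (metis image_eqI quotientI)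
    qed
  qed
  ultimately show ?thesis using \<Phi> by (auto simp: bij_betw_def)
qed

lemma sum_inner:
  fixes h :: "nat \<Rightarrow> 'a::comm_monoid_add"
  assumes "h 0 = 0" "h (Suc l) = 0"
  shows "(\<Sum>i\<le>Suc l. h i) = (\<Sum>i=1..l. h i)"
proof (rule sum.mono_neutral_right)
  show "\<forall>i\<in>{..Suc l} - {1..l}. h i = 0"
  proof
    fix i assume "i \<in> {..Suc l} - {1..l}"
    then have "i = 0 \<or> i = Suc l" by auto
    then show "h i = 0" using assms by blast
  qed
qed auto

context graded_bialgebra
begin

section \<open>Changing a single coefficient\<close>

definition addc where
  "addc F n f = Mor (src F) (tgt F) (\<lambda>k x. if k = n then cf F n x + f x else cf F k x)"

lemma addc_simps [simp]: "src (addc F n f) = src F" "tgt (addc F n f) = tgt F"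
  by (simp_all add: addc_def)

lemma cf_addc: "cf (addc F n f) k x = (if k = n then cf F n x + f x else cf F k x)"
  by (simp add: addc_def)

lemma arr_addc:
  assumes F: "arr F" and f: "hlin (src F) (tgt F) (- int n) f" "\<And>x. x \<notin> T B (src F) \<Longrightarrow> f x = 0"
  shows "arr (addc F n f)"
  unfolding arr_def
proof (intro allI conjI impI)
  fix k
  have "hlin (src F) (tgt F) (- int k) (cf (addc F n f) k)"
  proof (cases "k = n")
    case True
    have "cf (addc F n f) k = (\<lambda>x. cf F n x + f x)" using True by (simp add: addc_def)
    then show ?thesis using hlin_plus[OF arr_hlin[OF F, of n] f(1)] True by simp
  next
    case False
    have "cf (addc F n f) k = cf F k" using False by (simp add: addc_def)
    then show ?thesis using arr_hlin[OF F, of k] by simp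
  qed
  then show "hlin (src (addc F n f)) (tgt (addc F n f)) (- int k) (cf (addc F n f) k)" by simp
next
  fix k x assume "x \<notin> T B (src (addc F n f))"
  then show "cf (addc F n f) k x = 0" using f(2) arr_outside[OF F] by (simp add: cf_addc)
qed

lemma eqv_addc: "k \<le> n \<Longrightarrow> eqv k (addc F n f) F"
  by (auto simp: eqv_def addc_def)

lemma dif_addc: "dif n (addc F n f) F = f"
  by (rule ext[where f = "dif n _ _"]) (simp add: dif_def cf_addc)

lemma dif_addc_addc: "dif n (addc F n f) (addc F n g) = (\<lambda>x. f x - g x)"
  by (rule ext[where f = "dif n _ _"]) (simp add: dif_def cf_addc)

lemma addc_comp:
  assumes F: "arr F" "arr (addc F n f)" and U: "order0 U" "tgt U = src F"
    and f: "\<And>z. z \<in> T B (src U) \<Longrightarrow> f (cf U 0 z) = 0"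
  shows "addc F n f \<cdot> U = F \<cdot> U"
proof (rule mor_eqI)
  have [simp]: "arr U" using U by (simp add: order0_def)
  show "arr (addc F n f \<cdot> U)" "arr (F \<cdot> U)" using F U by simp_all
  fix k x assume "x \<in> T B (src (F \<cdot> U))"
  then show "cf (addc F n f \<cdot> U) k x = cf (F \<cdot> U) k x"
    using F U f by (simp add: cf_comp_order0 cf_addc)
qed simp_all

lemma comp_addc:
  assumes F: "arr F" "arr (addc F n f)" and V: "order0 V" "src V = tgt F" and fl: "lin s (src F) (tgt F) f"
    and f: "\<And>x. x \<in> T B (src F) \<Longrightarrow> cf V 0 (f x) = 0"
  shows "V \<cdot> addc F n f = V \<cdot> F"
proof (rule mor_eqI)
  have [simp]: "arr V" using V by (simp add: order0_def)
  show "arr (V \<cdot> addc F n f)" "arr (V \<cdot> F)" using F V by simp_all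
  fix k x assume "x \<in> T B (src (V \<cdot> F))"
  then have x: "x \<in> T B (src F)" by simp
  have "cf V 0 (cf F n x + f x) = cf V 0 (cf F n x) + cf V 0 (f x)"
    by (rule lin_add[OF arr_lin]) (use V x arr_in[OF F(1) x refl] lin_in[OF fl x] in simp_all)
  then show "cf (V \<cdot> addc F n f) k x = cf (V \<cdot> F) k x"
    using V f[OF x] by (simp add: cf_order0_comp cf_addc)
qed simp_all

lemma normal_outside: "normal p q d f \<Longrightarrow> x \<notin> T B q \<Longrightarrow> f x = 0"
  by (simp add: normal_def)

lemma normal_eta: "normal p q d f \<Longrightarrow> i < q \<Longrightarrow> z \<in> T B (q - 1) \<Longrightarrow> f (cf (I i \<otimes> eta \<otimes> I (q - 1 - i)) 0 z) = 0"
  and normal_ep: "normal p q d f \<Longrightarrow> i < p \<Longrightarrow> x \<in> T B q \<Longrightarrow> cf (I i \<otimes> ep \<otimes> I (p - 1 - i)) 0 (f x) = 0"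
  unfolding normal_def by blast+

text \<open>The unit and counit axioms survive because f and g are normal: the added terms vanish as
  soon as 1 is inserted or \<epsilon> applied. As n > 0, the constant coefficients stay those of
  B.\<close>

lemma unital_addc:
  assumes u: "unital m d" and f: "normal 1 2 (- int n) f" and g: "normal 2 1 (- int n) g" and n: "0 < n"
  shows "unital (addc m n f) (addc d n g)"
proof -
  note [simp] = shapes[OF u_shape[OF u]]
  note hf = normal_hlin[OF f] normal_outside[OF f] and hg = normal_hlin[OF g] normal_outside[OF g]
  have a [simp]: "arr (addc m n f)" "arr (addc d n g)" by (rule arr_addc; use hf hg in simp)+
  note fe = normal_eta[OF f, of 0, simplified] normal_eta[OF f, of 1, simplified] normal_ep[OF f, of 0, simplified]
  note ge = normal_eta[OF g, of 0, simplified] normal_ep[OF g, of 0, simplified] normal_ep[OF g, of 1, simplified]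
  have "addc m n f \<cdot> (eta \<otimes> I 1) = m \<cdot> (eta \<otimes> I 1)" "addc m n f \<cdot> (I 1 \<otimes> eta) = m \<cdot> (I 1 \<otimes> eta)"
    "addc d n g \<cdot> eta = d \<cdot> eta"
    by (rule addc_comp; use fe ge in \<open>simp add: One_nat_def[symmetric]\<close>)+
  moreover have "ep \<cdot> addc m n f = ep \<cdot> m" "(ep \<otimes> I 1) \<cdot> addc d n g = (ep \<otimes> I 1) \<cdot> d"
    "(I 1 \<otimes> ep) \<cdot> addc d n g = (I 1 \<otimes> ep) \<cdot> d"
    by (rule comp_addc; use fe ge normal_lin[OF f] normal_lin[OF g] in \<open>simp add: One_nat_def[symmetric]\<close>)+
  moreover have "eqv 1 (addc m n f) mult0" "eqv 1 (addc d n g) comult0"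
    using eqv_trans[OF eqv_addc u_eqv(1)[OF u]] eqv_trans[OF eqv_addc u_eqv(2)[OF u]] n by simp_all
  moreover have "shape (addc m n f) (addc d n g)" by (simp add: shape_def)
  ultimately show ?thesis using u_unit[OF u] u_counit[OF u] unfolding unital_def by simp
qed

lemma twist_I: "twist (I 1)"
  by (simp add: twist_def)

lemma twist_addc:
  assumes t: "twist \<phi>" and f: "normal 1 1 (- int n) f" and n: "0 < n"
  shows "twist (addc \<phi> n f)"
proof -
  have [simp]: "arr \<phi>" "src \<phi> = 1" "tgt \<phi> = 1" "\<phi> \<cdot> eta = eta" "ep \<cdot> \<phi> = ep" and e: "eqv 1 \<phi> (I 1)"
    using t by (auto simp: twist_def)
  have a [simp]: "arr (addc \<phi> n f)" by (rule arr_addc) (use normal_hlin[OF f] normal_outside[OF f] in simp_all)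
  note fe = normal_eta[OF f, of 0, simplified] normal_ep[OF f, of 0, simplified]
  have "addc \<phi> n f \<cdot> eta = \<phi> \<cdot> eta" by (rule addc_comp) (use fe in simp_all)
  moreover have "ep \<cdot> addc \<phi> n f = ep \<cdot> \<phi>" by (rule comp_addc) (use fe normal_lin[OF f] in simp_all)
  moreover have "eqv 1 (addc \<phi> n f) (I 1)" using eqv_trans[OF eqv_addc e] n by simp
  ultimately show ?thesis by (simp add: twist_def)
qed

lemma normal_zero: "normal p q d (\<lambda>x. 0)"
proof (rule normalI)
  fix i x show "i < p \<Longrightarrow> cf (I i \<otimes> ep \<otimes> I (p - 1 - i)) 0 0 = 0"
    using lin_zero[OF lin_ep_slot] by blast
qed (simp_all add: hlin_zero)

section \<open>Coboundaries and cohomology classes in hat degrees two and three\<close>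

lemma c2_in_Dhat: "normal 1 2 d f \<Longrightarrow> normal 2 1 d g \<Longrightarrow> c2 f g \<in> Dhat B 2 d"
  by (auto simp: Dhat_2)

lemma c1_in_Dhat: "normal 1 1 d f \<Longrightarrow> c1 f \<in> Dhat B 1 d"
  by (auto simp: Dhat_1)

lemma coboundaries_3: "coboundaries B 3 d = bd B 2 ` Dhat B 2 d"
  and coboundaries_2: "coboundaries B 2 d = bd B 1 ` Dhat B 1 d"
  by (simp_all add: coboundaries_def One_nat_def)

lemma cocycles_3_zero: "0 < n \<Longrightarrow> 0 \<in> cocycles B 3 (- int n)"
  using defects_cocycle[OF unital_base axs_base, of n] by (simp add: defects_base)

text \<open>The trivial deformation has no defects, so changing it at t^n realises every coboundary,
  up to sign, as a defect.\<close>

lemma defects_addc_base: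
  assumes "normal 1 2 (- int n) f" "normal 2 1 (- int n) g" "0 < n"
  shows "defects n (addc mult0 n f) (addc comult0 n g) = - bd B 2 (c2 f g)"
  using defects_change[OF unital_base unital_addc[OF unital_base assms] eqv_addc eqv_addc assms(3)]
  by (simp add: dif_addc defects_base)

text \<open>Additivity of the boundary is read off from deformations: two changes of the trivial
  structure at t^n differ by a change by f - f' and g - g', and \<open>defects_change\<close>
  compares their defects.\<close>

lemma coboundaries_3_diff:
  assumes "a \<in> coboundaries B 3 (- int n)" "b \<in> coboundaries B 3 (- int n)" "0 < n"
  shows "a - b \<in> coboundaries B 3 (- int n)"
proof -
  obtain f g where a: "a = bd B 2 (c2 f g)" and fg: "normal 1 2 (- int n) f" "normal 2 1 (- int n) g"
    using assms(1) by (auto simp: coboundaries_3 Dhat_2)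
  obtain f' g' where b: "b = bd B 2 (c2 f' g')" and fg': "normal 1 2 (- int n) f'" "normal 2 1 (- int n) g'"
    using assms(2) by (auto simp: coboundaries_3 Dhat_2)
  note u = unital_addc[OF unital_base fg assms(3)] and u' = unital_addc[OF unital_base fg' assms(3)]
  note e = eqv_addc[OF order_refl]
  have "defects n (addc mult0 n f) (addc comult0 n g) = defects n (addc mult0 n f') (addc comult0 n g') -
      bd B 2 (c2 (\<lambda>x. f x - f' x) (\<lambda>x. g x - g' x))"
    using defects_change[OF u' u eqv_trans[OF e eqv_sym[OF e]] eqv_trans[OF e eqv_sym[OF e]] assms(3)]
    by (simp add: dif_addc_addc)
  then have "a - b = bd B 2 (c2 (\<lambda>x. f x - f' x) (\<lambda>x. g x - g' x))"
    unfolding defects_addc_base[OF fg assms(3)] defects_addc_base[OF fg' assms(3)] a b by (simp add: algebra_simps)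
  moreover have "normal 1 2 (- int n) (\<lambda>x. f x - f' x)" "normal 2 1 (- int n) (\<lambda>x. g x - g' x)"
    using normal_dif_unital[OF u' u, of n] by (simp_all add: dif_addc_addc)
  ultimately show ?thesis by (auto simp: coboundaries_3 intro!: imageI c2_in_Dhat)
qed

lemma coboundaries_3_zero: "0 < n \<Longrightarrow> 0 \<in> coboundaries B 3 (- int n)"
  using coboundaries_3_diff[of "bd B 2 (c2 (\<lambda>x. 0) (\<lambda>x. 0))" n "bd B 2 (c2 (\<lambda>x. 0) (\<lambda>x. 0))"]
  by (simp add: coboundaries_3 imageI c2_in_Dhat normal_zero)

lemma tdefects_base: "tdefects n (I 1) m d m' d' = c2 (dif n m m') (dif n d d')"
  if "unital m d" "unital m' d'"
  using shapes[OF u_shape[OF that(1)]] shapes[OF u_shape[OF that(2)]] by (simp add: tdefects_def)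

lemma cocycles_2_zero: "0 < n \<Longrightarrow> 0 \<in> cocycles B 2 (- int n)"
  using tdefects_cocycle[OF unital_base unital_base twist_I axs_base axs_base, of n]
  by (simp add: tdefects_base[OF unital_base unital_base] c2_zero taxs_def)

lemma tdefects_addc_base:
  assumes "normal 1 1 (- int n) f" "0 < n"
  shows "tdefects n (addc (I 1) n f) mult0 comult0 mult0 comult0 = - bd B 1 (c1 f)"
  using tdefects_change[OF unital_base unital_base twist_I twist_addc[OF twist_I assms] eqv_addc assms(2)]
  by (simp add: dif_addc tdefects_base[OF unital_base unital_base] c2_zero)

text \<open>The same argument one degree lower, with changes of the identity series instead of
  changes of the trivial deformation.\<close>

lemma coboundaries_2_diff:
  assumes "a \<in> coboundaries B 2 (- int n)" "b \<in> coboundaries B 2 (- int n)" "0 < n"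
  shows "a - b \<in> coboundaries B 2 (- int n)"
proof -
  obtain f where a: "a = bd B 1 (c1 f)" and f: "normal 1 1 (- int n) f"
    using assms(1) by (auto simp: coboundaries_2 Dhat_1)
  obtain f' where b: "b = bd B 1 (c1 f')" and f': "normal 1 1 (- int n) f'"
    using assms(2) by (auto simp: coboundaries_2 Dhat_1)
  note t = twist_addc[OF twist_I f assms(3)] and t' = twist_addc[OF twist_I f' assms(3)]
  note e = eqv_addc[OF order_refl]
  have "tdefects n (addc (I 1) n f) mult0 comult0 mult0 comult0 =
      tdefects n (addc (I 1) n f') mult0 comult0 mult0 comult0 - bd B 1 (c1 (\<lambda>x. f x - f' x))"
    using tdefects_change[OF unital_base unital_base t' t eqv_trans[OF e eqv_sym[OF e]] assms(3)]
    by (simp add: dif_addc_addc)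
  then have "a - b = bd B 1 (c1 (\<lambda>x. f x - f' x))"
    unfolding tdefects_addc_base[OF f assms(3)] tdefects_addc_base[OF f' assms(3)] a b by (simp add: algebra_simps)
  moreover have "normal 1 1 (- int n) (dif n (addc (I 1) n f) (addc (I 1) n f'))"
    by (rule normal_dif) (use t t' in \<open>simp_all add: twist_def less1\<close>)
  ultimately show ?thesis by (auto simp: coboundaries_2 dif_addc_addc intro!: imageI c1_in_Dhat)
qed

lemma coboundaries_2_zero: "0 < n \<Longrightarrow> 0 \<in> coboundaries B 2 (- int n)"
  using coboundaries_2_diff[of "bd B 1 (c1 (\<lambda>x. 0))" n "bd B 1 (c1 (\<lambda>x. 0))"]
  by (simp add: coboundaries_2 imageI c1_in_Dhat normal_zero)

lemma equiv_cohomologous: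
  assumes z: "0 \<in> coboundaries B k e"
    and m: "\<And>a b. a \<in> coboundaries B k e \<Longrightarrow> b \<in> coboundaries B k e \<Longrightarrow> a - b \<in> coboundaries B k e"
  shows "equiv (cocycles B k e) (cohomologous B k e)"
proof (rule equivI)
  show "cohomologous B k e \<subseteq> cocycles B k e \<times> cocycles B k e" by (auto simp: cohomologous_def)
  show "refl_on (cocycles B k e) (cohomologous B k e)"
    using z by (auto simp: refl_on_def cohomologous_def)
  show "sym (cohomologous B k e)"
  proof (rule symI)
    fix a b assume "(a, b) \<in> cohomologous B k e"
    moreover have "b - a = 0 - (a - b)" by simp
    ultimately show "(b, a) \<in> cohomologous B k e" using m[OF z, of "a - b"] by (simp add: cohomologous_def)
  qed
  show "trans (cohomologous B k e)"
  proof (rule transI)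
    fix a b c assume "(a, b) \<in> cohomologous B k e" "(b, c) \<in> cohomologous B k e"
    moreover have "a - c = (a - b) - (0 - (b - c))" by simp
    ultimately show "(a, c) \<in> cohomologous B k e" using m[of "a - b" "0 - (b - c)"] m[OF z, of "b - c"]
      by (simp add: cohomologous_def)
  qed
qed

lemma hclass_zero_iff:
  assumes eq: "equiv (cocycles B k e) (cohomologous B k e)" and z: "0 \<in> cocycles B k e" and a: "a \<in> cocycles B k e"
  shows "hclass B k e a = hclass B k e 0 \<longleftrightarrow> a \<in> coboundaries B k e"
  unfolding hclass_def eq_equiv_class_iff[OF eq a z] using a z by (simp add: cohomologous_def)

lemma hat_h_vanishesD:
  assumes v: "hat_h_vanishes B k e" and eq: "equiv (cocycles B k e) (cohomologous B k e)"
    and z: "0 \<in> cocycles B k e" and a: "a \<in> cocycles B k e"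
  shows "a \<in> coboundaries B k e"
proof -
  have "hclass B k e a \<in> hat_h B k e" using a by (simp add: hclass_def hat_h_def quotientI)
  then have "hclass B k e a = hclass B k e 0" using v by (simp add: hat_h_vanishes_def)
  then show ?thesis using hclass_zero_iff[OF eq z a] by simp
qed

lemma equiv_2: "0 < n \<Longrightarrow> equiv (cocycles B 2 (- int n)) (cohomologous B 2 (- int n))"
  by (intro equiv_cohomologous coboundaries_2_zero coboundaries_2_diff)

lemma equiv_3: "0 < n \<Longrightarrow> equiv (cocycles B 3 (- int n)) (cohomologous B 3 (- int n))"
  by (intro equiv_cohomologous coboundaries_3_zero coboundaries_3_diff)

section \<open>Deformations of finite level and their obstructions\<close>

lemma eql_enat: "eql (enat l) F G \<longleftrightarrow> eqv (Suc l) F G"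
  by (auto simp: eql_def eqv_def)

lemma eql_infinity: "eql \<infinity> F G \<longleftrightarrow> (\<forall>n. eqv n F G)"
  by (auto simp: eql_def eqv_def)

text \<open>Level l includes the coefficient of t^l, so the axioms hold modulo t^(l+1) and the first
  possible defect sits at \<open>Suc l\<close>.\<close>

lemma defm_enat: "defm (enat l) m d \<longleftrightarrow> unital m d \<and> van (enat l) m \<and> van (enat l) d \<and> axs (Suc l) m d"
  by (auto simp: defm_def axs_def eql_enat)

lemma defm_infinity: "defm \<infinity> m d \<longleftrightarrow> unital m d \<and> (\<forall>n. axs n m d)"
  by (auto simp: defm_def axs_def eql_infinity van_def)

lemma tcoeff_oper: "unital m d \<Longrightarrow> van l m \<Longrightarrow> tcoeff (oper l m) = cf m"
  "unital m d \<Longrightarrow> van l d \<Longrightarrow> tcoeff (oper l d) = cf d"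
  using ser_oper[of m 2 1 l] ser_oper[of d 1 2 l] shapes[OF u_shape, of m d] ser_simps(3) by metis+

lemma cf_ten_I: "arr F \<Longrightarrow> cf (F \<otimes> I q) k x = tm (src F) q (cf F k) (\<lambda>x. x) x"
  "arr F \<Longrightarrow> cf (I q \<otimes> F) k x = tm q (src F) (\<lambda>x. x) (cf F k) x"
proof -
  assume F: "arr F"
  have z: "cf (I q) j = (\<lambda>x. 0)" if "0 < j" for j using order0_I[of q] that by (simp add: order0_def)
  have "cf (F \<otimes> I q) k x = tm (src F) q (cf F k) (cf (I q) 0) x"
    unfolding cf_ten by (subst sum_only_last) (auto simp: z tm_zero_right[OF arr_lin[OF F]])
  then show "cf (F \<otimes> I q) k x = tm (src F) q (cf F k) (\<lambda>x. x) x" by (simp add: tm_cf_I_right)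
  have "cf (I q \<otimes> F) k x = tm q (src F) (cf (I q) 0) (cf F k) x"
    unfolding cf_ten by (subst sum_only_first) (auto simp: z tm_zero_left[OF arr_lin[OF F]])
  then show "cf (I q \<otimes> F) k x = tm q (src F) (\<lambda>x. x) (cf F k) x" by (simp add: tm_cf_I_left)
qed

lemma obstruction_c3: "obstruction B l (m, \<Delta>) = c3
  (restrict0 (T B 3) (\<lambda>x. \<Sum>i=1..l. tcoeff m i (tmap s 2 (tcoeff m (l + 1 - i)) id x) - tcoeff m i (tmap s 1 id (tcoeff m (l + 1 - i)) x)))
  (restrict0 (T B 2) (\<lambda>x. (\<Sum>i=1..l. tcoeff \<Delta> i (tcoeff m (l + 1 - i) x))
        - (\<Sum>(i, j, k, r) \<in> {(i, j, k, r). i \<le> l \<and> j \<le> l \<and> k \<le> l \<and> r \<le> l \<and> i + j + k + r = l + 1}.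
             tmap s 2 (tcoeff m i) (tcoeff m j) (mid_swap B (tmap s 1 (tcoeff \<Delta> k) (tcoeff \<Delta> r) x)))))
  (restrict0 (T B 1) (\<lambda>x. \<Sum>i=1..l. tmap s 1 id (tcoeff \<Delta> i) (tcoeff \<Delta> (l + 1 - i) x) - tmap s 1 (tcoeff \<Delta> i) id (tcoeff \<Delta> (l + 1 - i) x)))"
  unfolding obstruction_def Let_def c3_def fst_conv snd_conv ..

lemma quad_index_finite: "finite {(a, b, c, d). a + b + c + d = (n::nat)}"
  by (rule finite_subset[of _ "{..n} \<times> {..n} \<times> {..n} \<times> {..n}"]) auto

text \<open>M and N are continued by zero above l, so in the coefficient of t^(l+1) all terms with
  an operation at index l + 1 disappear. What is left are the terms listed in
  \<open>obstruction\<close>.\<close>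

theorem obstruction_defects:
  assumes df: "defm (enat l) M N"
  shows "obstruction B l (oper (enat l) M, oper (enat l) N) = defects (Suc l) M N"
proof -
  have u: "unital M N" and v: "van (enat l) M" "van (enat l) N" using df by (simp_all add: defm_enat)
  note [simp] = shapes[OF u_shape[OF u]] composites[OF u_shape[OF u]]
  have z: "cf M k = (\<lambda>x. 0)" "cf N k = (\<lambda>x. 0)" if "l < k" for k using v that by (simp_all add: van_def)
  have t: "tcoeff (oper (enat l) M) = cf M" "tcoeff (oper (enat l) N) = cf N"
    using tcoeff_oper[OF u] v by simp_all
  have lin0: "cf M k 0 = 0" "cf N k 0 = 0" for k by (rule lin_zero[OF arr_lin], simp)+
  have lM: "lin s 2 1 (cf M k)" and lN: "lin s 1 2 (cf N k)" for k by (simp_all add: arr_lin')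
  note li = lin_id(2)
  have z0: "tm 2 1 (\<lambda>x. 0) (\<lambda>x. x) x = 0" "tm 1 2 (\<lambda>x. x) (\<lambda>x. 0) x = 0" "tm 1 1 (\<lambda>x. 0) (\<lambda>x. x) x = 0" "tm 1 1 (\<lambda>x. x) (\<lambda>x. 0) x = 0" for x
    by (rule fun_cong[OF tm_zero_left[OF li]] fun_cong[OF tm_zero_right[OF li]])+
  show ?thesis
    unfolding obstruction_c3 t defects_def c3_eq_iff Suc_eq_plus1[symmetric]
  proof (intro conjI)
    let ?a = "restrict0 (T B 3) (\<lambda>x. \<Sum>i = 1..l. cf M i (tmap s 2 (cf M (Suc l - i)) id x) - cf M i (tmap s 1 id (cf M (Suc l - i)) x))"
    show "?a = dif (Suc l) (assL M) (assR M)"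
    proof (rule ext[where f = ?a])
      fix x
      show "?a x = dif (Suc l) (assL M) (assR M) x"
      proof (cases "x \<in> T B 3")
        case True
        have "cf (assL M) (Suc l) x = (\<Sum>i=1..l. cf M i (tm 2 1 (cf M (Suc l - i)) (\<lambda>x. x) x))"
          "cf (assR M) (Suc l) x = (\<Sum>i=1..l. cf M i (tm 1 2 (\<lambda>x. x) (cf M (Suc l - i)) x))"
          unfolding assL_def assR_def cf_comp
          by (subst sum_inner; simp add: cf_ten_I z z0 lin0)+
        then show ?thesis using True
          by (simp add: restrict0_def dif_def sum_subtractf tm_tmap_at[of x 3] id_tm)
      qed (simp add: dif_outside restrict0_def)
    qed
    let ?e = "restrict0 (T B 1) (\<lambda>x. \<Sum>i = 1..l. tmap s 1 id (cf N i) (cf N (Suc l - i) x) - tmap s 1 (cf N i) id (cf N (Suc l - i) x))"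
    show "?e = dif (Suc l) (coaR N) (coaL N)"
    proof (rule ext[where f = ?e])
      fix x
      show "?e x = dif (Suc l) (coaR N) (coaL N) x"
      proof (cases "x \<in> T B 1")
        case True
        have "cf (coaL N) (Suc l) x = (\<Sum>i=1..l. tm 1 1 (cf N i) (\<lambda>x. x) (cf N (Suc l - i) x))"
          "cf (coaR N) (Suc l) x = (\<Sum>i=1..l. tm 1 1 (\<lambda>x. x) (cf N i) (cf N (Suc l - i) x))"
          unfolding coaL_def coaR_def cf_comp
          by (subst sum_inner; simp add: cf_ten_I z z0 lin_zero[OF lin_tm[OF lN li refl refl]] lin_zero[OF lin_tm[OF li lN refl refl]])+
        moreover have "cf N k x \<in> T B 2" for k using lin_in[OF lN True] .
        ultimately show ?thesis using True
          by (simp add: restrict0_def dif_def sum_subtractf tm_tmap_at[of _ 2 1 1] id_tm)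
      qed (simp add: dif_outside restrict0_def)
    qed
    let ?h = "\<lambda>x a b c d. tm 2 2 (cf M a) (cf M b) (cf ms 0 (tm 1 1 (cf N c) (cf N d) x))"
    let ?S = "{(i, j, k, r). i \<le> l \<and> j \<le> l \<and> k \<le> l \<and> r \<le> l \<and> i + j + k + r = Suc l}"
    let ?c = "restrict0 (T B 2) (\<lambda>x. (\<Sum>i = 1..l. cf N i (cf M (Suc l - i) x)) - (\<Sum>(i, j, k, r)\<in>?S. tmap s 2 (cf M i) (cf M j) (mid_swap B (tmap s 1 (cf N k) (cf N r) x))))"
    show "?c = dif (Suc l) (N \<cdot> M) (cmp M N)"
    proof (rule ext[where f = ?c])
      fix x
      show "?c x = dif (Suc l) (N \<cdot> M) (cmp M N) x"
      proof (cases "x \<in> T B 2")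
        case True
        have 1: "cf (N \<cdot> M) (Suc l) x = (\<Sum>i=1..l. cf N i (cf M (Suc l - i) x))"
          unfolding cf_comp by (subst sum_inner) (simp_all add: z lin0)
        have y: "tm 1 1 (cf N c) (cf N d) x \<in> T B 4" for c d using tm_in[OF lN lN, of x 4] True by simp
        have y': "cf ms 0 (tm 1 1 (cf N c) (cf N d) x) \<in> T B 4" for c d
          by (rule lin_in[OF arr_lin' y]) simp_all
        have ml: "cf (mul2 M) i w = (\<Sum>a\<le>i. tm 2 2 (cf M a) (cf M (i - a)) (cf ms 0 w))" for i w
          unfolding mul2_def by (subst cf_comp_order0) (simp_all add: cf_ten)
        have "cf (cmp M N) (Suc l) x = (\<Sum>i\<le>Suc l. \<Sum>b\<le>Suc l - i. cf (mul2 M) i (tm 1 1 (cf N b) (cf N (Suc l - i - b)) x))"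
          unfolding cmp_def cf_comp
          by (simp add: cf_ten lin_sum[OF arr_lin'[of "mul2 M" 4 2]] y)
        also have "\<dots> = (\<Sum>i\<le>Suc l. \<Sum>a\<le>i. \<Sum>b\<le>Suc l - i. ?h x a (i - a) b (Suc l - i - b))"
          unfolding ml by (rule sum.cong[OF refl]) (rule sum.swap)
        also have "\<dots> = (\<Sum>(a, b, c, d)\<in>{(a, b, c, d). a + b + c + d = Suc l}. ?h x a b c d)"
          by (rule sum_quad)
        \<comment> \<open>If one of the four indices exceeds l, the corresponding coefficient is
          zero, and linearity makes the whole term zero.\<close>
        also have "\<dots> = (\<Sum>(a, b, c, d)\<in>?S. ?h x a b c d)"
        proof (rule sum.mono_neutral_right[OF quad_index_finite])
          have "?h x a b c d = 0" if "l < a \<or> l < b \<or> l < c \<or> l < d" for a b c d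
            using that
            by (auto simp: z tm_zero_left[OF lM] tm_zero_right[OF lM] tm_zero_left[OF lN] tm_zero_right[OF lN]
                lin_zero[OF arr_lin'[of ms 4 4]] lin_zero[OF lin_tm[OF lM lM refl refl]])
          then show "\<forall>i\<in>{(a, b, c, d). a + b + c + d = Suc l} - ?S. (case i of (a, b, c, d) \<Rightarrow> ?h x a b c d) = 0"
            by (auto simp: not_le)
        qed auto
        finally show ?thesis using True y y' 1
          by (simp add: restrict0_def dif_def tm_tmap_at[of _ 2 1 1] tm_tmap_at[of _ 4 2 2] mid_swap_tens)
      qed (simp add: dif_outside restrict0_def)
    qed
  qed
qed

lemma deformationsE:
  assumes "\<xi> \<in> deformations B l"
  obtains M N where "defm l M N" "\<xi> = (oper l M, oper l N)"
  using assms deformations_iff[of "fst \<xi>" "snd \<xi>" l] by (metis prod.collapse)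

lemma deformationsI: "defm l M N \<Longrightarrow> (oper l M, oper l N) \<in> deformations B l"
  unfolding deformations_iff by blast

lemma extends_iff:
  assumes df: "defm (enat l) M N" and df': "defm (enat l') M' N'"
  shows "extends B l (oper (enat l') M', oper (enat l') N') (oper (enat l) M, oper (enat l) N) \<longleftrightarrow>
    eqv (Suc l) M' M \<and> eqv (Suc l) N' N"
proof -
  have u: "unital M N" and v: "van (enat l) M" "van (enat l) N" using df by (simp_all add: defm_enat)
  have u': "unital M' N'" and v': "van (enat l') M'" "van (enat l') N'" using df' by (simp_all add: defm_enat)
  note [simp] = shapes[OF u_shape[OF u]] shapes[OF u_shape[OF u']]
  have t: "tcoeff (oper (enat l) M) = cf M" "tcoeff (oper (enat l) N) = cf N"
    using tcoeff_oper[OF u] v by simp_all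
  have t': "tcoeff (oper (enat l') M') = cf M'" "tcoeff (oper (enat l') N') = cf N'"
    using tcoeff_oper[OF u'] v' by simp_all
  have e: "cf F k = cf G k \<longleftrightarrow> (\<forall>x\<in>T B (src F). cf F k x = cf G k x)" if "arr F" "arr G" "src F = src G" for F G k
  proof
    assume a: "\<forall>x\<in>T B (src F). cf F k x = cf G k x"
    show "cf F k = cf G k"
    proof (rule ext[where f = "cf F k"])
      fix x show "cf F k x = cf G k x"
        using a that by (cases "x \<in> T B (src F)") (simp_all add: arr_outside)
    qed
  qed simp
  have eM: "cf M' k = cf M k \<longleftrightarrow> (\<forall>x\<in>T B 2. cf M' k x = cf M k x)"
    and eN: "cf N' k = cf N k \<longleftrightarrow> (\<forall>x\<in>T B 1. cf N' k x = cf N k x)" for k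
    using e[of M' M k] e[of N' N k] by simp_all
  show ?thesis unfolding extends_def eqv_def fst_conv snd_conv t t' eM eN
    by (auto simp: less_Suc_eq_le)
qed

lemma van_addc: "van (enat l) F \<Longrightarrow> n \<le> Suc l \<Longrightarrow> van (enat (Suc l)) (addc F n f)"
  unfolding van_def
proof (intro allI impI)
  fix k assume a: "\<forall>n. \<not> enat n \<le> enat l \<longrightarrow> cf F n = (\<lambda>x. 0)" "n \<le> Suc l" "\<not> enat k \<le> enat (Suc l)"
  then have "cf F k = (\<lambda>x. 0)" "k \<noteq> n" by auto
  then show "cf (addc F n f) k = (\<lambda>x. 0)"
    by (intro ext[where f = "cf (addc F n f) k"]) (simp add: cf_addc)
qed

lemma axs_cong:
  assumes e: "eqv n m' m" "eqv n d' d" and ax: "axs n m d"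
  shows "axs n m' d'"
proof -
  note c = eqv_comp eqv_ten eqv_refl e
  have "eqv n (assL m') (assL m)" "eqv n (assR m') (assR m)" "eqv n (d' \<cdot> m') (d \<cdot> m)"
    "eqv n (cmp m' d') (cmp m d)" "eqv n (coaR d') (coaR d)" "eqv n (coaL d') (coaL d)"
    unfolding assL_def assR_def cmp_def mul2_def coaR_def coaL_def by (intro c)+
  then show ?thesis using ax unfolding axs_def by (metis eqv_trans eqv_sym)
qed

theorem obstruction_cocycle:
  assumes "\<xi> \<in> deformations B (enat l)"
  shows "obstruction B l \<xi> \<in> cocycles B 3 (- int (Suc l))"
proof -
  obtain M N where df: "defm (enat l) M N" and \<xi>: "\<xi> = (oper (enat l) M, oper (enat l) N)"
    using assms by (rule deformationsE)
  then show ?thesis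
    unfolding \<xi> obstruction_defects[OF df] by (intro defects_cocycle) (simp_all add: defm_enat)
qed

text \<open>Continued by zero, the deformation has the obstruction as defect at t^(l+1). New
  coefficients there subtract their boundary, so they give an extension exactly if this boundary is
  the obstruction; conversely the new coefficients of an extension are such a cochain.\<close>

theorem extension_iff:
  assumes "\<xi> \<in> deformations B (enat l)"
  shows "obstruction B l \<xi> \<in> coboundaries B 3 (- int (Suc l)) \<longleftrightarrow>
    (\<exists>\<xi>'\<in>deformations B (enat (Suc l)). extends B l \<xi>' \<xi>)"
proof -
  obtain M N where df: "defm (enat l) M N" and \<xi>: "\<xi> = (oper (enat l) M, oper (enat l) N)"
    using assms by (rule deformationsE)
  have u: "unital M N" and v: "van (enat l) M" "van (enat l) N" and ax: "axs (Suc l) M N"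
    using df by (simp_all add: defm_enat)
  show ?thesis
    unfolding \<xi> obstruction_defects[OF df]
  proof
    assume "defects (Suc l) M N \<in> coboundaries B 3 (- int (Suc l))"
    then obtain f g where fg: "normal 1 2 (- int (Suc l)) f" "normal 2 1 (- int (Suc l)) g"
      and b: "defects (Suc l) M N = bd B 2 (c2 f g)"
      by (auto simp: coboundaries_3 Dhat_2)
    let ?M = "addc M (Suc l) f" and ?N = "addc N (Suc l) g"
    have u': "unital ?M ?N" by (rule unital_addc[OF u fg]) simp
    have e: "eqv (Suc l) ?M M" "eqv (Suc l) ?N N" by (simp_all add: eqv_addc)
    have "defects (Suc l) ?M ?N = 0"
      using defects_change[OF u u' e] b by (simp add: dif_addc)
    moreover have "axs (Suc l) ?M ?N" using ax axs_cong[OF e] by blast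
    ultimately have df': "defm (enat (Suc l)) ?M ?N"
      using u' v by (simp add: defm_enat axs_Suc van_addc)
    show "\<exists>\<xi>'\<in>deformations B (enat (Suc l)). extends B l \<xi>' (oper (enat l) M, oper (enat l) N)"
      using deformationsI[OF df'] extends_iff[OF df df'] e by blast
  next
    assume "\<exists>\<xi>'\<in>deformations B (enat (Suc l)). extends B l \<xi>' (oper (enat l) M, oper (enat l) N)"
    then obtain \<xi>' where d': "\<xi>' \<in> deformations B (enat (Suc l))" and ex: "extends B l \<xi>' (oper (enat l) M, oper (enat l) N)" by blast
    obtain M' N' where df': "defm (enat (Suc l)) M' N'" and \<xi>': "\<xi>' = (oper (enat (Suc l)) M', oper (enat (Suc l)) N')"
      using d' by (rule deformationsE)
    have u': "unital M' N'" and ax': "defects (Suc l) M' N' = 0" using df' by (simp_all add: defm_enat axs_Suc)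
    have e: "eqv (Suc l) M' M" "eqv (Suc l) N' N" using ex extends_iff[OF df df'] \<xi>' by simp_all
    have "defects (Suc l) M N = bd B 2 (c2 (dif (Suc l) M' M) (dif (Suc l) N' N))"
      using defects_change[OF u u' e] ax' by simp
    then show "defects (Suc l) M N \<in> coboundaries B 3 (- int (Suc l))"
      using normal_dif_unital[OF u u', of "Suc l"] by (simp add: coboundaries_3 imageI c2_in_Dhat)
  qed
qed

lemma normal_dif_twist: "twist \<phi> \<Longrightarrow> twist \<psi> \<Longrightarrow> normal 1 1 (- int n) (dif n \<phi> \<psi>)"
  by (rule normal_dif) (simp_all add: twist_def less1)

section \<open>First order deformations and rigidity\<close>

lemma axs_2: "axs 2 m d \<longleftrightarrow> axs 1 m d \<and> defects 1 m d = 0"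
  using axs_Suc[of 1] by simp

lemma infinitesimal_c2:
  assumes df: "defm (enat 1) M N"
  shows "infinitesimal (oper (enat 1) M, oper (enat 1) N) = c2 (dif 1 M mult0) (dif 1 N comult0)"
proof -
  have u: "unital M N" and v: "van (enat 1) M" "van (enat 1) N" using df by (simp_all add: defm_enat)
  have "cf mult0 1 = (\<lambda>x. 0)" "cf comult0 1 = (\<lambda>x. 0)"
    using order0_structure_maps by (auto simp: order0_def)
  then have e: "dif 1 M mult0 = cf M 1" "dif 1 N comult0 = cf N 1"
    by (auto simp: dif_def)
  show ?thesis
    unfolding infinitesimal_def c2_def fst_conv snd_conv e tcoeff_oper(1)[OF u v(1)] tcoeff_oper(2)[OF u v(2)] ..
qed

text \<open>Seen as a change of the trivial deformation at t^1, a deformation has minus the boundary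
  of its infinitesimal as defect, and at first order this defect is zero.\<close>

lemma infinitesimal_cocycle:
  assumes "\<xi> \<in> deformations B (enat 1)"
  shows "infinitesimal \<xi> \<in> cocycles B 2 (- int 1)"
proof -
  obtain M N where df: "defm (enat 1) M N" and \<xi>: "\<xi> = (oper (enat 1) M, oper (enat 1) N)"
    using assms by (rule deformationsE)
  have u: "unital M N" and ax: "defects 1 M N = 0" using df by (simp_all add: defm_enat axs_2)
  have "bd B 2 (c2 (dif 1 M mult0) (dif 1 N comult0)) = 0"
    using defects_change[OF unital_base u u_eqv[OF u]] ax by (simp add: defects_base)
  then show ?thesis
    using normal_dif_unital[OF unital_base u, of 1]
    by (simp add: \<xi> infinitesimal_c2[OF df] cocycles_def c2_in_Dhat)
qed

text \<open>A cocycle is added to the trivial deformation at t^1; its boundary is zero, so no defect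
  arises there.\<close>

lemma infinitesimal_surj:
  assumes "c \<in> cocycles B 2 (- int 1)"
  shows "\<exists>\<xi>\<in>deformations B (enat 1). infinitesimal \<xi> = c"
proof -
  obtain f g where fg: "normal 1 2 (- int 1) f" "normal 2 1 (- int 1) g" and c: "c = c2 f g" and b: "bd B 2 c = 0"
    using assms by (auto simp: cocycles_def Dhat_2)
  let ?M = "addc mult0 1 f" and ?N = "addc comult0 1 g"
  have u: "unital ?M ?N" by (rule unital_addc[OF unital_base fg]) simp
  have "van (enat (Suc 0)) ?M" "van (enat (Suc 0)) ?N"
    by (rule van_addc; simp add: van_order0 order0_structure_maps One_nat_def)+
  moreover have e: "eqv 1 ?M mult0" "eqv 1 ?N comult0" by (simp_all add: eqv_addc)
  moreover have "defects 1 ?M ?N = 0" using defects_addc_base[OF fg] b c by simp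
  ultimately have df: "defm (enat 1) ?M ?N"
    using u axs_cong[OF e axs_base] by (simp add: defm_enat axs_2 One_nat_def[symmetric])
  show ?thesis
    using deformationsI[OF df] infinitesimal_c2[OF df] c by (auto simp: dif_addc)
qed

text \<open>The identity series fails to be an isomorphism by the difference of the infinitesimals.
  Any other candidate differs from it at t^1 by a normal f and fails by this difference minus the
  boundary of f.\<close>

lemma iso_infinitesimal:
  assumes "\<xi> \<in> deformations B (enat 1)" "\<xi>' \<in> deformations B (enat 1)"
  shows "(\<exists>\<phi>. deformation_iso B (enat 1) \<xi> \<xi>' \<phi>) \<longleftrightarrow> infinitesimal \<xi> - infinitesimal \<xi>' \<in> coboundaries B 2 (- int 1)"
proof -
  obtain M N where df: "defm (enat 1) M N" and \<xi>: "\<xi> = (oper (enat 1) M, oper (enat 1) N)"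
    using assms(1) by (rule deformationsE)
  obtain M' N' where df': "defm (enat 1) M' N'" and \<xi>': "\<xi>' = (oper (enat 1) M', oper (enat 1) N')"
    using assms(2) by (rule deformationsE)
  have u: "unital M N" and u': "unital M' N'" using df df' by (simp_all add: defm_enat)
  have d: "infinitesimal \<xi> - infinitesimal \<xi>' = tdefects 1 (I 1) M N M' N'"
    unfolding \<xi> \<xi>' infinitesimal_c2[OF df] infinitesimal_c2[OF df'] tdefects_base[OF u u'] c2_diff
    by (simp add: dif_def[abs_def])
  have t: "taxs 2 F M N M' N' \<longleftrightarrow> infinitesimal \<xi> - infinitesimal \<xi>' = bd B 1 (c1 (dif 1 F (I 1)))" if F: "twist F" for F
  proof -
    have "eqv 1 F (I 1)" using F by (simp add: twist_def)
    then have "tdefects 1 F M N M' N' = tdefects 1 (I 1) M N M' N' - bd B 1 (c1 (dif 1 F (I 1)))"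
      using tdefects_change[OF u u' twist_I F] by simp
    moreover have "taxs (Suc 1) F M N M' N' \<longleftrightarrow> tdefects 1 F M N M' N' = 0"
      using taxs_Suc[of 1] taxs_1[OF u u' F] by simp
    moreover have "Suc 1 = 2" by simp
    ultimately show ?thesis unfolding d by simp
  qed
  have e: "eql (enat 1) F G \<longleftrightarrow> eqv 2 F G" for F G :: "('b, 'k) mor"
    using eql_enat[of 1] by (simp add: numeral_2_eq_2 One_nat_def)
  show ?thesis
  proof
    assume "\<exists>\<phi>. deformation_iso B (enat 1) \<xi> \<xi>' \<phi>"
    then obtain F where F: "twist F" and "taxs 2 F M N M' N'"
      unfolding \<xi> \<xi>' taxs_def e[symmetric] using iso_series[OF u u'] by metis
    then show "infinitesimal \<xi> - infinitesimal \<xi>' \<in> coboundaries B 2 (- int 1)"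
      using t[OF F] normal_dif_twist[OF F twist_I, of 1] by (simp add: coboundaries_2 imageI c1_in_Dhat)
  next
    assume "infinitesimal \<xi> - infinitesimal \<xi>' \<in> coboundaries B 2 (- int 1)"
    then obtain f where f: "normal 1 1 (- int 1) f" and b: "infinitesimal \<xi> - infinitesimal \<xi>' = bd B 1 (c1 f)"
      by (auto simp: coboundaries_2 Dhat_1)
    have F: "twist (addc (I 1) 1 f)" by (rule twist_addc[OF twist_I f]) simp
    then have "taxs 2 (addc (I 1) 1 f) M N M' N'" using t[OF F] b by (simp add: dif_addc)
    then show "\<exists>\<phi>. deformation_iso B (enat 1) \<xi> \<xi>' \<phi>"
      unfolding \<xi> \<xi>' taxs_def e[symmetric] using iso_oper[OF u u' F] by blast
  qed
qed

text \<open>The infinitesimal maps first order deformations onto the cocycles, and isomorphism is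
  the pullback of being cohomologous, so \<open>quotient_bij\<close> yields the bijection.\<close>

theorem first_order_classification:
  "\<exists>\<Phi>. bij_betw \<Phi> (iso_deformations B (enat 1)) (hat_h B 2 (- int 1)) \<and>
    (\<forall>\<xi>\<in>deformations B (enat 1). \<Phi> (iso_rel B (enat 1) `` {\<xi>}) = hclass B 2 (- int 1) (infinitesimal \<xi>))"
  unfolding iso_deformations_def hat_h_def hclass_def
proof (rule quotient_bij)
  show "equiv (cocycles B 2 (- int 1)) (cohomologous B 2 (- int 1))" by (rule equiv_2) simp
  show "iso_rel B (enat 1) = {(\<xi>, \<xi>'). \<xi> \<in> deformations B (enat 1) \<and> \<xi>' \<in> deformations B (enat 1) \<and>
    (infinitesimal \<xi>, infinitesimal \<xi>') \<in> cohomologous B 2 (- int 1)}"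
    unfolding iso_rel_def cohomologous_def
    using iso_infinitesimal infinitesimal_cocycle by blast
qed (use infinitesimal_cocycle infinitesimal_surj in blast)+

section \<open>Isomorphisms to all orders and rigidity\<close>

lemma taxs_cong:
  assumes e: "eqv n \<psi> \<phi>" and t: "taxs n \<phi> m d m' d'"
  shows "taxs n \<psi> m d m' d'"
proof -
  have "eqv n (\<psi> \<cdot> m) (\<phi> \<cdot> m)" "eqv n (m' \<cdot> (\<psi> \<otimes> \<psi>)) (m' \<cdot> (\<phi> \<otimes> \<phi>))"
    "eqv n ((\<psi> \<otimes> \<psi>) \<cdot> d) ((\<phi> \<otimes> \<phi>) \<cdot> d)" "eqv n (d' \<cdot> \<psi>) (d' \<cdot> \<phi>)"
    by (intro eqv_comp eqv_ten eqv_refl e)+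
  then show ?thesis using t unfolding taxs_def by (metis eqv_trans eqv_sym)
qed

text \<open>A morphism modulo t^(n+1) fails at t^(n+1) by a 2-cocycle. As this is the boundary of
  some f, adding f at that power removes the failure and leaves the lower coefficients alone, so the
  corrections converge.\<close>

lemma infinite_iso:
  assumes van: "\<And>n. 0 < n \<Longrightarrow> hat_h_vanishes B 2 (- int n)"
    and df: "defm \<infinity> m d" and df': "defm \<infinity> m' d'"
  shows "\<exists>\<phi>. deformation_iso B \<infinity> (oper \<infinity> m, oper \<infinity> d) (oper \<infinity> m', oper \<infinity> d') \<phi>"
proof -
  have u: "unital m d" and u': "unital m' d'" and ax: "axs n m d" "axs n m' d'" for n
    using df df' by (simp_all add: defm_infinity)
  have step: "\<exists>\<psi>. (twist \<psi> \<and> taxs (Suc (Suc n)) \<psi> m d m' d') \<and> eqv (Suc n) \<psi> \<phi>"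
    if \<phi>: "twist \<phi> \<and> taxs (Suc n) \<phi> m d m' d'" for n \<phi>
  proof -
    have "tdefects (Suc n) \<phi> m d m' d' \<in> cocycles B 2 (- int (Suc n))"
      using tdefects_cocycle[OF u u' _ ax _ zero_less_Suc] \<phi> by blast
    then have "tdefects (Suc n) \<phi> m d m' d' \<in> coboundaries B 2 (- int (Suc n))"
      using hat_h_vanishesD[OF van equiv_2 cocycles_2_zero] by blast
    then obtain f where f: "normal 1 1 (- int (Suc n)) f" and b: "tdefects (Suc n) \<phi> m d m' d' = bd B 1 (c1 f)"
      by (auto simp: coboundaries_2 Dhat_1)
    let ?\<psi> = "addc \<phi> (Suc n) f"
    have \<psi>: "twist ?\<psi>" using twist_addc[OF _ f] \<phi> by simp
    have e: "eqv (Suc n) ?\<psi> \<phi>" by (simp add: eqv_addc)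
    have "tdefects (Suc n) ?\<psi> m d m' d' = 0"
      using tdefects_change[OF u u' _ \<psi> e] \<phi> b by (simp add: dif_addc)
    moreover have "taxs (Suc n) ?\<psi> m d m' d'" using taxs_cong[OF e] \<phi> by blast
    ultimately show ?thesis using \<psi> e taxs_Suc by blast
  qed
  have start: "twist (I 1) \<and> taxs (Suc 0) (I 1) m d m' d'"
    using taxs_1[OF u u' twist_I] twist_I by (simp add: One_nat_def)
  \<comment> \<open>Each correction depends on a choice of f for the previous series, so the
    sequence comes from dependent choice.\<close>
  obtain \<phi> where \<phi>: "\<And>n. twist (\<phi> n)" "\<And>n. taxs (Suc n) (\<phi> n) m d m' d'" and e: "\<And>n. eqv (Suc n) (\<phi> (Suc n)) (\<phi> n)"
    using dependent_nat_choice[where P = "\<lambda>n \<phi>. twist \<phi> \<and> taxs (Suc n) \<phi> m d m' d'" and Q = "\<lambda>n \<phi> \<psi>. eqv (Suc n) \<psi> \<phi>"]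
      start step by metis
  have s: "arr (\<phi> n)" "src (\<phi> n) = 1" "tgt (\<phi> n) = 1" "\<phi> n \<cdot> eta = eta" "ep \<cdot> \<phi> n = ep" "eqv 1 (\<phi> n) (I 1)" for n
    using \<phi>(1)[of n] by (simp_all add: twist_def)
  \<comment> \<open>The diagonal is the limit: from stage k on, the coefficient of t^k is no longer
    changed.\<close>
  define F where "F = Mor 1 1 (\<lambda>k. cf (\<phi> k) k)"
  have F [simp]: "src F = 1" "tgt F = 1" "cf F k = cf (\<phi> k) k" for k by (simp_all add: F_def)
  have stable: "cf (\<phi> (n + j)) n = cf (\<phi> n) n" for n j
  proof (induction j)
    case (Suc j)
    have "cf (\<phi> (Suc (n + j))) n = cf (\<phi> (n + j)) n" using e[of "n + j"] by (simp add: eqv_def)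
    then show ?case using Suc by simp
  qed simp
  have eF: "eqv (Suc n) F (\<phi> n)" for n
    unfolding eqv_def using s stable by (auto simp: less_Suc_eq_le dest!: le_Suc_ex)
  have aF [simp]: "arr F"
    unfolding arr_def using s arr_hlin[OF s(1)] arr_outside[OF s(1)] by simp
  have all: "F' = G'" if "\<And>n. eqv (Suc n) F' G'" for F' G' :: "('b, 'k) mor"
    using that by (intro mor.expand) (auto simp: eqv_def)
  have tx: "taxs (Suc n) F m d m' d'" for n using taxs_cong[OF eF \<phi>(2)] .
  have "F \<cdot> eta = eta"
  proof (rule all)
    fix n show "eqv (Suc n) (F \<cdot> eta) eta" using eqv_comp[OF eF[of n] eqv_refl[of _ eta]] s by simp
  qed
  moreover have "ep \<cdot> F = ep"
  proof (rule all)
    fix n show "eqv (Suc n) (ep \<cdot> F) ep" using eqv_comp[OF eqv_refl[of _ ep] eF[of n]] s by simp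
  qed
  moreover have "eqv 1 F (I 1)" using eqv_trans[OF _ s(6)] eF[of 0] by (simp add: One_nat_def)
  ultimately have tF: "twist F" by (simp add: twist_def)
  have "eqv n (F \<cdot> m) (m' \<cdot> (F \<otimes> F))" "eqv n ((F \<otimes> F) \<cdot> d) (d' \<cdot> F)" for n
    using tx[of n] eqv_Suc unfolding taxs_def by blast+
  then have "eql \<infinity> (F \<cdot> m) (m' \<cdot> (F \<otimes> F))" "eql \<infinity> ((F \<otimes> F) \<cdot> d) (d' \<cdot> F)"
    by (simp_all add: eql_infinity)
  then show ?thesis using iso_oper[OF u u' tF] by blast
qed

theorem rigidity:
  assumes "\<And>n. 0 < n \<Longrightarrow> hat_h_vanishes B 2 (- int n)"
  shows "graded_rigid B"
proof -
  have all: "iso_rel B \<infinity> = deformations B \<infinity> \<times> deformations B \<infinity>"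
  proof (intro equalityI subsetI)
    fix p assume "p \<in> deformations B \<infinity> \<times> deformations B \<infinity>"
    then show "p \<in> iso_rel B \<infinity>"
      unfolding iso_rel_def using infinite_iso[OF assms] by (auto elim!: deformationsE intro: deformationsI)
  qed (auto simp: iso_rel_def)
  \<comment> \<open>The trivial deformation makes the set non-empty; otherwise the quotient by the
    full relation would be empty instead of a single class.\<close>
  have "defm \<infinity> mult0 comult0" by (simp add: defm_infinity unital_base axs_base)
  then have "deformations B \<infinity> \<noteq> {}" using deformationsI by blast
  then have "deformations B \<infinity> // iso_rel B \<infinity> = {deformations B \<infinity>}"
    unfolding all quotient_def by auto
  then show ?thesis unfolding graded_rigid_def iso_deformations_def by blast
qed

end

theorem theorem3p3:
  fixes B :: "('k::field, 'b::ring_1) bialg"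
  assumes "graded_bialgebra B"
  shows "(\<exists>\<Phi>. bij_betw \<Phi> (iso_deformations B 1) (hat_h B 2 (-1)) \<and>
            (\<forall>\<xi>\<in>deformations B 1. \<Phi> (iso_rel B 1 `` {\<xi>}) = hclass B 2 (-1) (infinitesimal \<xi>)))
    \<and> ((\<forall>l::nat. l \<ge> 1 \<longrightarrow> hat_h_vanishes B 2 (- int l)) \<longrightarrow> graded_rigid B)
    \<and> (\<forall>l::nat. l \<ge> 1 \<longrightarrow>
         (\<forall>\<xi>\<in>deformations B (enat l).
            obstruction B l \<xi> \<in> cocycles B 3 (- int l - 1) \<and>
            (hclass B 3 (- int l - 1) (obstruction B l \<xi>) = hclass B 3 (- int l - 1) 0 \<longleftrightarrow>
               (\<exists>\<xi>'\<in>deformations B (enat (l + 1)). extends B l \<xi>' \<xi>))) \<and>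
         (hat_h_vanishes B 3 (- int l - 1) \<longrightarrow>
            (\<forall>\<xi>\<in>deformations B (enat l). \<exists>\<xi>'\<in>deformations B (enat (l + 1)). extends B l \<xi>' \<xi>)))"
proof -
  interpret graded_bialgebra B by fact
  have d: "- int l - 1 = - int (Suc l)" "l + 1 = Suc l" for l by simp_all
  note zero = cocycles_3_zero[OF zero_less_Suc] and eq = equiv_3[OF zero_less_Suc]
  have 1: "\<exists>\<Phi>. bij_betw \<Phi> (iso_deformations B 1) (hat_h B 2 (-1)) \<and>
            (\<forall>\<xi>\<in>deformations B 1. \<Phi> (iso_rel B 1 `` {\<xi>}) = hclass B 2 (-1) (infinitesimal \<xi>))"
    using first_order_classification unfolding one_enat_def of_nat_1 .
  have 2: "(\<forall>l::nat. l \<ge> 1 \<longrightarrow> hat_h_vanishes B 2 (- int l)) \<longrightarrow> graded_rigid B"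
    using rigidity by (simp add: Suc_le_eq One_nat_def)
  have 3: "obstruction B l \<xi> \<in> cocycles B 3 (- int l - 1) \<and>
            (hclass B 3 (- int l - 1) (obstruction B l \<xi>) = hclass B 3 (- int l - 1) 0 \<longleftrightarrow>
               (\<exists>\<xi>'\<in>deformations B (enat (l + 1)). extends B l \<xi>' \<xi>))"
    if "\<xi> \<in> deformations B (enat l)" for l \<xi>
    unfolding d hclass_zero_iff[OF eq zero obstruction_cocycle[OF that]] extension_iff[OF that]
    using obstruction_cocycle[OF that] by simp
  have 4: "\<exists>\<xi>'\<in>deformations B (enat (l + 1)). extends B l \<xi>' \<xi>"
    if "hat_h_vanishes B 3 (- int l - 1)" "\<xi> \<in> deformations B (enat l)" for l \<xi>
    using hat_h_vanishesD[OF that(1)[unfolded d] eq zero obstruction_cocycle[OF that(2)]]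
    unfolding d extension_iff[OF that(2)] .
  show ?thesis using 1 2 3 4 by blast
qed

end
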